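(* Assume $N\ge 1$, $\beta>0$, and for $i=1,2$: $\mu_i>0$, $r_i>1$, $2<p_i<2+\frac4N$; assume also $r_1+r_2<2+\frac4N$. Then for any $a_1>0$ and $a_2>0$, all minimizing sequences for $m(a_1,a_2)$ are precompact in $H^1(\mathbb{R}^N)\times H^1(\mathbb{R}^N)$ after a suitable translation. That is, if $\{(u_1^n,u_2^n)\}\subset S(a_1,a_2)$ satisfies $J(u_1^n,u_2^n)\to m(a_1,a_2)$ as $n\to\infty$, then there exists a sequence $\{y_n\}\subset\mathbb{R}^N$ such that $\{(u_1^n(\cdot-y_n),u_2^n(\cdot-y_n))\}$ is relatively compact in $H^1(\mathbb{R}^N)\times H^1(\mathbb{R}^N)$ (strong topology).
   Context: Functions are complex-valued. $H^1(\mathbb{R}^N)$ is the usual Sobolev space with norm $\|u\|^2=\int_{\mathbb{R}^N}|\nabla u|^2+|u|^2\,dx$, and $\|\cdot\|_2$ is the $L^2(\mathbb{R}^N)$ norm. For $(u_1,u_2)\in H^1(\mathbb{R}^N)\times H^1(\mathbb{R}^N)$ define $$J(u_1,u_2):=\frac12\int_{\mathbb{R}^N}|\nabla u_1|^2+|\nabla u_2|^2\,dx-\int_{\mathbb{R}^N}\frac{\mu_1}{p_1}|u_1|^{p_1}+\frac{\mu_2}{p_2}|u_2|^{p_2}+\beta|u_1|^{r_1}|u_2|^{r_2}\,dx,$$ and set $$S(a_1,a_2):=\{(u_1,u_2)\in H^1(\mathbb{R}^N)\times H^1(\mathbb{R}^N):\|u_1\|_2^2=a_1,\ \|u_2\|_2^2=a_2\},\qquad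 m(a_1,a_2):=\inf_{(u_1,u_2)\in S(a_1,a_2)}J(u_1,u_2).$$ *)

theory Defs
  imports "HOL-Analysis.Analysis"
begin

text \<open>
  $\mathbb{R}^N$ is an arbitrary type \<open>'a::euclidean_space\<close> with \<open>N = DIM('a)\<close>, which is at least 1.
  Functions on it are not identified when they agree almost everywhere: elements of the Lebesgue
  and Sobolev spaces are Borel representatives (every class of Lebesgue measurable functions has
  one), and the norms below are seminorms on representatives.
\<close>

primrec C_k :: "nat \<Rightarrow> ('a::euclidean_space \<Rightarrow> real) \<Rightarrow> bool" where
  "C_k 0 f \<longleftrightarrow> continuous_on UNIV f"
| "C_k (Suc k) f \<longleftrightarrow> (\<forall>x. f differentiable (at x)) \<and>
     (\<forall>i\<in>Basis. C_k k (\<lambda>x. frechet_derivative f (at x) i))"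

definition test_functions :: "('a::euclidean_space \<Rightarrow> real) set" where
  "test_functions = {\<phi>. (\<forall>k. C_k k \<phi>) \<and> compact (closure {x. \<phi> x \<noteq> 0})}"

definition L2 :: "('a::euclidean_space \<Rightarrow> complex) set" where
  "L2 = {u. u \<in> borel_measurable borel \<and> integrable lborel (\<lambda>x. (cmod (u x))\<^sup>2)}"

definition L2_norm :: "('a::euclidean_space \<Rightarrow> complex) \<Rightarrow> real" where
  "L2_norm u = sqrt (LINT x|lborel. (cmod (u x))\<^sup>2)"

text \<open>
  Testing against real-valued functions is the same as testing against complex-valued ones, by
  linearity. The definition is only used for \<open>u\<close> and \<open>g\<close> in \<^const>\<open>L2\<close>, where both integrands
  are integrable.
\<close>

definition has_weak_partial ::
    "'a::euclidean_space \<Rightarrow> ('a \<Rightarrow> complex) \<Rightarrow> ('a \<Rightarrow> complex) \<Rightarrow> bool" where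
  "has_weak_partial i u g \<longleftrightarrow>
     (\<forall>\<phi>\<in>test_functions.
        (LINT x|lborel. frechet_derivative \<phi> (at x) i *\<^sub>R u x) = - (LINT x|lborel. \<phi> x *\<^sub>R g x))"

definition H1 :: "('a::euclidean_space \<Rightarrow> complex) set" where
  "H1 = {u \<in> L2. \<forall>i\<in>Basis. \<exists>g\<in>L2. has_weak_partial i u g}"

text \<open>A weak partial derivative is unique up to null sets, so the choice does not affect integrals.\<close>

definition weak_partial :: "'a::euclidean_space \<Rightarrow> ('a \<Rightarrow> complex) \<Rightarrow> 'a \<Rightarrow> complex" where
  "weak_partial i u = (SOME g. g \<in> L2 \<and> has_weak_partial i u g)"

definition grad_sq :: "('a::euclidean_space \<Rightarrow> complex) \<Rightarrow> 'a \<Rightarrow> real" where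
  "grad_sq u x = (\<Sum>i\<in>Basis. (cmod (weak_partial i u x))\<^sup>2)"

definition H1_norm :: "('a::euclidean_space \<Rightarrow> complex) \<Rightarrow> real" where
  "H1_norm u = sqrt (LINT x|lborel. grad_sq u x + (cmod (u x))\<^sup>2)"

text \<open>
  The strong topology of $H^1$, on representatives. A set is compact in it iff its image in the
  space of almost-everywhere classes is compact.
\<close>

definition H1_topology :: "('a::euclidean_space \<Rightarrow> complex) topology" where
  "H1_topology = topology (\<lambda>U. U \<subseteq> H1 \<and>
     (\<forall>u\<in>U. \<exists>e>0. \<forall>v\<in>H1. H1_norm (\<lambda>x. v x - u x) < e \<longrightarrow> v \<in> U))"

lemma openin_H1_topology:
  "openin H1_topology U \<longleftrightarrow> U \<subseteq> H1 \<and>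
     (\<forall>u\<in>U. \<exists>e>0. \<forall>v\<in>H1. H1_norm (\<lambda>x. v x - u x) < e \<longrightarrow> v \<in> U)"
proof -
  have "istopology (\<lambda>U. U \<subseteq> H1 \<and>
     (\<forall>u\<in>U. \<exists>e>0. \<forall>v\<in>H1. H1_norm (\<lambda>x. v x - u x) < e \<longrightarrow> v \<in> U))" (is "istopology ?L")
    unfolding istopology_def
  proof (intro conjI allI impI)
    fix S T assume S: "?L S" and T: "?L T"
    show "S \<inter> T \<subseteq> H1" using S by blast
    show "\<forall>u\<in>S \<inter> T. \<exists>e>0. \<forall>v\<in>H1. H1_norm (\<lambda>x. v x - u x) < e \<longrightarrow> v \<in> S \<inter> T"
    proof
      fix u assume u: "u \<in> S \<inter> T"
      obtain d where d: "d > 0" "\<forall>v\<in>H1. H1_norm (\<lambda>x. v x - u x) < d \<longrightarrow> v \<in> S"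
        using S u by blast
      obtain e where e: "e > 0" "\<forall>v\<in>H1. H1_norm (\<lambda>x. v x - u x) < e \<longrightarrow> v \<in> T"
        using T u by blast
      show "\<exists>e>0. \<forall>v\<in>H1. H1_norm (\<lambda>x. v x - u x) < e \<longrightarrow> v \<in> S \<inter> T"
        using d e by (intro exI[of _ "min d e"]) auto
    qed
  next
    fix K assume "\<forall>S\<in>K. ?L S"
    then show "\<Union>K \<subseteq> H1"
      and "\<forall>u\<in>\<Union>K. \<exists>e>0. \<forall>v\<in>H1. H1_norm (\<lambda>x. v x - u x) < e \<longrightarrow> v \<in> \<Union>K"
      by (blast, meson Union_iff)
  qed
  then show ?thesis
    unfolding H1_topology_def by (subst topology_inverse') auto
qed

lemma topspace_H1_topology: "topspace H1_topology = H1"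
proof
  show "topspace H1_topology \<subseteq> H1"
    using openin_topspace[of H1_topology] unfolding openin_H1_topology by blast
  have "openin H1_topology H1"
    unfolding openin_H1_topology using zero_less_one by blast
  then show "H1 \<subseteq> topspace H1_topology"
    by (rule openin_subset)
qed

definition relatively_compact_in :: "'b topology \<Rightarrow> 'b set \<Rightarrow> bool" where
  "relatively_compact_in X A \<longleftrightarrow> A \<subseteq> topspace X \<and> compactin X (X closure_of A)"

text \<open>
  The functional $J$, the constraint set $S(a_1,a_2)$ and the infimum $m(a_1,a_2)$. The infimum is
  taken in the extended reals, so that it does not presuppose a lower bound; its first argument
  fixes the type of the underlying space.
\<close>

definition energy :: "real \<Rightarrow> real \<Rightarrow> real \<Rightarrow> real \<Rightarrow> real \<Rightarrow> real \<Rightarrow> real \<Rightarrow>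
    ('a::euclidean_space \<Rightarrow> complex) \<Rightarrow> ('a \<Rightarrow> complex) \<Rightarrow> real" where
  "energy \<mu>1 \<mu>2 p1 p2 r1 r2 \<beta> u1 u2 =
     1/2 * (LINT x|lborel. grad_sq u1 x + grad_sq u2 x)
     - (LINT x|lborel. \<mu>1 / p1 * cmod (u1 x) powr p1 + \<mu>2 / p2 * cmod (u2 x) powr p2
          + \<beta> * cmod (u1 x) powr r1 * cmod (u2 x) powr r2)"

definition mass_constraint :: "real \<Rightarrow> real \<Rightarrow> (('a::euclidean_space \<Rightarrow> complex) \<times> ('a \<Rightarrow> complex)) set" where
  "mass_constraint a1 a2 = {(u1, u2). u1 \<in> H1 \<and> u2 \<in> H1 \<and> (L2_norm u1)\<^sup>2 = a1 \<and> (L2_norm u2)\<^sup>2 = a2}"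

definition min_energy :: "'a::euclidean_space itself \<Rightarrow> real \<Rightarrow> real \<Rightarrow> real \<Rightarrow> real \<Rightarrow> real \<Rightarrow> real \<Rightarrow> real \<Rightarrow>
    real \<Rightarrow> real \<Rightarrow> ereal" where
  "min_energy _ \<mu>1 \<mu>2 p1 p2 r1 r2 \<beta> a1 a2 =
     (INF (u1, u2) \<in> (mass_constraint a1 a2 :: (('a \<Rightarrow> complex) \<times> ('a \<Rightarrow> complex)) set).
        ereal (energy \<mu>1 \<mu>2 p1 p2 r1 r2 \<beta> u1 u2))"

end

theory Submission
  imports Defs "HOL-Library.Diagonal_Subsequence"
begin

text \<open>
  Concentration-compactness. The energy is negative at its minimum, since spreading a profile out makes
  the mass-subcritical potential dominate; so the mass of an almost minimiser cannot vanish and, after a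
  translation, stays above a fixed amount in the unit ball. Suppose some mass also stays far away. Cutting
  along an annulus splits the pair into two pieces at almost no cost. Instead of comparing infima at
  different masses, the outer piece is moved back so that it overlaps the inner one, and the two are
  replaced by the root of the sum of the squares of their moduli: masses are unchanged, the kinetic energy
  does not increase, and the potential energy increases by a definite amount, because it is strictly
  superadditive in squared moduli. This contradicts almost minimality, so the translated sequence is tight,
  hence precompact in \<^const>\<open>L2\<close>. The parallelogram law, applied to midpoints of almost minimisers,
  upgrades this to \<^const>\<open>H1\<close>.
\<close>

section \<open>Square-integrable functions\<close>

text \<open>The obstacle is dichotomy for a pair: the mass may split into pieces of which one
  carries only the first component and the other only the second, and a comparison of infima would
  have to handle such degenerate mass pairs separately. For overlapping moduli there is always a
  gain: a pure power gains where the pieces share a component, the coupling with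
  \<open>\<beta> > 0\<close> gains where they do not, and \<open>r1 + r2 > 2\<close> keeps the
  coupling superadditive in squared moduli. Gradients enter through the estimate that the mass of
  u(x + h) - u(x) is at most K |h|^2. It characterises \<open>H1\<close> and passes through every
  operation that does not increase increments, so moduli, cutoffs and glued profiles are all treated
  by one pointwise inequality. Two situations leave mass to spare: a vanishing outer piece, and the
  midpoint of two almost minimisers, whose masses can drop. In both, the missing mass is refilled by
  a wide tent of negative energy, which exists because \<open>p1\<close> and \<open>p2\<close> lie
  below 2 + 4/N.\<close>

definition mass :: "('a::euclidean_space \<Rightarrow> complex) \<Rightarrow> real" where
  "mass u = (LINT x|lborel. (cmod (u x))\<^sup>2)"

lemma L2_norm_mass: "L2_norm u = sqrt (mass u)"
  by (simp add: L2_norm_def mass_def)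

lemma mass_nonneg [simp]: "0 \<le> mass u"
  unfolding mass_def by simp

lemma L2_norm_nonneg [simp]: "0 \<le> L2_norm u"
  by (simp add: L2_norm_mass)

lemma L2_norm_sq: "(L2_norm u)\<^sup>2 = mass u"
  by (simp add: L2_norm_mass)

lemma L2_measurable [measurable_dest]: "u \<in> L2 \<Longrightarrow> u \<in> borel_measurable borel"
  by (simp add: L2_def)

lemma L2_integrable: "u \<in> L2 \<Longrightarrow> integrable lborel (\<lambda>x. (cmod (u x))\<^sup>2)"
  by (simp add: L2_def)

lemma L2_dominated:
  assumes "u \<in> L2" and [measurable]: "v \<in> borel_measurable borel"
    and "\<And>x. cmod (v x) \<le> C * cmod (u x)"
  shows "v \<in> L2"
proof -
  have "integrable lborel (\<lambda>x. C\<^sup>2 * (cmod (u x))\<^sup>2)"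
    using L2_integrable[OF assms(1)] by simp
  then have "integrable lborel (\<lambda>x. (cmod (v x))\<^sup>2)"
  proof (rule Bochner_Integration.integrable_bound)
    show "AE x in lborel. norm ((cmod (v x))\<^sup>2) \<le> norm (C\<^sup>2 * (cmod (u x))\<^sup>2)"
      using assms(3) by (intro AE_I2) (simp add: power_mult_distrib[symmetric] power_mono)
  qed simp
  then show ?thesis by (simp add: L2_def assms(2))
qed

lemma sq_norm_add_le: "(norm (a + b))\<^sup>2 \<le> 2 * (norm a)\<^sup>2 + 2 * (norm (b::'b::real_normed_vector))\<^sup>2"
proof -
  have "(norm (a + b))\<^sup>2 \<le> (norm a + norm b)\<^sup>2"
    by (intro power_mono norm_triangle_ineq) simp
  also have "\<dots> \<le> 2 * (norm a)\<^sup>2 + 2 * (norm b)\<^sup>2"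
    using sum_squares_bound[of "norm a" "norm b"] by (simp add: power2_sum)
  finally show ?thesis .
qed

lemma L2_add:
  assumes "u \<in> L2" "v \<in> L2" shows "(\<lambda>x. u x + v x) \<in> L2"
proof -
  have [measurable]: "u \<in> borel_measurable borel" "v \<in> borel_measurable borel"
    using assms by (simp_all add: L2_def)
  have "integrable lborel (\<lambda>x. 2 * (cmod (u x))\<^sup>2 + 2 * (cmod (v x))\<^sup>2)"
    using assms[THEN L2_integrable] by simp
  then have "integrable lborel (\<lambda>x. (cmod (u x + v x))\<^sup>2)"
  proof (rule Bochner_Integration.integrable_bound)
    show "AE x in lborel. norm ((cmod (u x + v x))\<^sup>2) \<le> norm (2 * (cmod (u x))\<^sup>2 + 2 * (cmod (v x))\<^sup>2)"
      using sq_norm_add_le by (intro AE_I2) auto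
  qed simp
  then show ?thesis by (simp add: L2_def)
qed

lemma L2_cmult: "u \<in> L2 \<Longrightarrow> (\<lambda>x. c * u x) \<in> L2"
  by (rule L2_dominated[where C = "cmod c"]) (auto simp: norm_mult dest: L2_measurable)

lemma L2_scaleR: "u \<in> L2 \<Longrightarrow> (\<lambda>x. c *\<^sub>R u x) \<in> L2"
  using L2_cmult[of u "of_real c"] by (simp add: scaleR_conv_of_real)

lemma L2_uminus: "u \<in> L2 \<Longrightarrow> (\<lambda>x. - u x) \<in> L2"
  using L2_cmult[of u "-1"] by simp

lemma L2_diff: "u \<in> L2 \<Longrightarrow> v \<in> L2 \<Longrightarrow> (\<lambda>x. u x - v x) \<in> L2"
  using L2_add[of u "\<lambda>x. - v x"] L2_uminus[of v] by simp

section \<open>Translations of integrals and of mass\<close>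

lemma integral_shift:
  fixes f :: "'a::euclidean_space \<Rightarrow> 'b::{banach, second_countable_topology}"
  assumes [measurable]: "f \<in> borel_measurable borel"
  shows "(LINT x|lborel. f (x + h)) = (LINT x|lborel. f x)"
proof -
  have "(LINT x|lborel. f x) = (LINT x|distr lborel borel ((+) h). f x)"
    by (simp add: lborel_distr_plus)
  also have "\<dots> = (LINT x|lborel. f (h + x))"
    by (subst integral_distr) auto
  finally show ?thesis by (simp add: add.commute)
qed

lemma integrable_shift:
  fixes f :: "'a::euclidean_space \<Rightarrow> 'b::{banach, second_countable_topology}"
  assumes "integrable lborel f"
  shows "integrable lborel (\<lambda>x. f (x + h))"
proof -
  have [measurable]: "f \<in> borel_measurable borel"
    using borel_measurable_integrable[OF assms] by simp
  have "integrable (distr lborel borel ((+) h)) f"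
    using assms by (simp add: lborel_distr_plus)
  then show ?thesis by (subst (asm) integrable_distr_eq) (auto simp: add.commute)
qed

lemma nn_integral_shift:
  assumes [measurable]: "f \<in> borel_measurable borel"
  shows "(\<integral>\<^sup>+x. f (x + h) \<partial>lborel) = (\<integral>\<^sup>+x. f (x::'a::euclidean_space) \<partial>lborel)"
proof -
  have "(\<integral>\<^sup>+x. f x \<partial>lborel) = (\<integral>\<^sup>+x. f x \<partial>distr lborel borel ((+) h))"
    by (simp add: lborel_distr_plus)
  also have "\<dots> = (\<integral>\<^sup>+x. f (h + x) \<partial>lborel)"
    by (subst nn_integral_distr) auto
  finally show ?thesis by (simp add: add.commute)
qed

lemma L2_shift: "u \<in> L2 \<Longrightarrow> (\<lambda>x. u (x + h)) \<in> L2"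
  using integrable_shift[of "\<lambda>x. (cmod (u x))\<^sup>2" h]
    measurable_compose[of "\<lambda>x. x + h" borel borel u borel] by (simp add: L2_def)

lemma mass_shift: "u \<in> L2 \<Longrightarrow> mass (\<lambda>x. u (x + h)) = mass u"
  unfolding mass_def by (rule integral_shift) (measurable, rule L2_measurable)

lemma mass_mono:
  assumes "u \<in> L2" "v \<in> L2" "\<And>x. cmod (u x) \<le> cmod (v x)"
  shows "mass u \<le> mass v"
  unfolding mass_def using assms by (intro integral_mono L2_integrable power_mono) auto

lemma mass_cmult: "mass (\<lambda>x. c * u x) = (cmod c)\<^sup>2 * mass u"
  by (simp add: mass_def norm_mult power_mult_distrib)

lemma mass_scaleR: "mass (\<lambda>x. c *\<^sub>R u x) = c\<^sup>2 * mass u"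
  by (simp add: mass_def power_mult_distrib)

lemma mass_diff_commute: "mass (\<lambda>x. u x - v x) = mass (\<lambda>x. v x - u x)"
  by (simp add: mass_def norm_minus_commute)

lemma L2_norm_cmult: "L2_norm (\<lambda>x. c * u x) = cmod c * L2_norm u"
  by (simp add: L2_norm_mass mass_cmult real_sqrt_mult)

lemma L2_norm_diff_commute: "L2_norm (\<lambda>x. u x - v x) = L2_norm (\<lambda>x. v x - u x)"
  by (simp add: L2_norm_mass mass_diff_commute[of u])

section \<open>Parallelogram law, Cauchy-Schwarz and the triangle inequality\<close>

text \<open>Halves are used so that the midpoint appears: a lower bound for the mass or energy of a
  midpoint then controls the half-difference. Both the weak compactness argument and the final
  passage to \<open>H1\<close> have this shape.\<close>

lemma mass_parallelogram:
  assumes "u \<in> L2" "v \<in> L2"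
  shows "mass (\<lambda>x. (u x + v x) / 2) + mass (\<lambda>x. (u x - v x) / 2) = (mass u + mass v) / 2"
proof -
  have eq: "(cmod ((a + b) / 2))\<^sup>2 + (cmod ((a - b) / 2))\<^sup>2 = (cmod a)\<^sup>2 / 2 + (cmod b)\<^sup>2 / 2" for a b
    by (simp add: norm_divide power_divide cmod_power2 field_simps) (simp add: power2_eq_square algebra_simps)
  have "(\<lambda>x. (u x + v x) / 2) \<in> L2" "(\<lambda>x. (u x - v x) / 2) \<in> L2"
    using L2_cmult[OF L2_add[OF assms], of "1/2"] L2_cmult[OF L2_diff[OF assms], of "1/2"] by simp_all
  then have "mass (\<lambda>x. (u x + v x) / 2) + mass (\<lambda>x. (u x - v x) / 2) =
    (LINT x|lborel. (cmod ((u x + v x) / 2))\<^sup>2 + (cmod ((u x - v x) / 2))\<^sup>2)"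
    unfolding mass_def by (subst Bochner_Integration.integral_add) (simp_all only: L2_integrable)
  also have "\<dots> = (mass u + mass v) / 2"
    unfolding eq mass_def using assms[THEN L2_integrable] by simp
  finally show ?thesis .
qed

lemma L2_mult_integrable:
  assumes "u \<in> L2" "v \<in> L2"
  shows "integrable lborel (\<lambda>x. cmod (u x) * cmod (v x))"
proof -
  have [measurable]: "u \<in> borel_measurable borel" "v \<in> borel_measurable borel"
    using assms by (simp_all add: L2_def)
  have "integrable lborel (\<lambda>x. (cmod (u x))\<^sup>2 + (cmod (v x))\<^sup>2)"
    using assms[THEN L2_integrable] by simp
  then show ?thesis
  proof (rule Bochner_Integration.integrable_bound)
    show "AE x in lborel. norm (cmod (u x) * cmod (v x)) \<le> norm ((cmod (u x))\<^sup>2 + (cmod (v x))\<^sup>2)"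
    proof (intro AE_I2)
      fix x show "norm (cmod (u x) * cmod (v x)) \<le> norm ((cmod (u x))\<^sup>2 + (cmod (v x))\<^sup>2)"
        using sum_squares_bound[of "cmod (u x)" "cmod (v x)"]
          mult_nonneg_nonneg[OF norm_ge_zero norm_ge_zero, of "u x" "v x"] by (simp add: power2_eq_square; linarith)
    qed
  qed simp
qed

text \<open>Integrating (t |u| - |v|)^2 \<ge> 0 gives a quadratic inequality in \<open>t\<close>.
  The choice \<open>t = ?I / mass u\<close> yields the bound; if \<open>mass u = 0\<close>, a large
  \<open>t\<close> forces the mixed integral to vanish.\<close>

lemma L2_Cauchy_Schwarz:
  assumes "u \<in> L2" "v \<in> L2"
  shows "(LINT x|lborel. cmod (u x) * cmod (v x)) \<le> L2_norm u * L2_norm v"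
proof -
  let ?I = "LINT x|lborel. cmod (u x) * cmod (v x)"
  have quad: "2 * t * ?I \<le> t\<^sup>2 * mass u + mass v" for t
  proof -
    have "2 * t * ?I = (LINT x|lborel. 2 * t * (cmod (u x) * cmod (v x)))" by simp
    also have "\<dots> \<le> (LINT x|lborel. t\<^sup>2 * (cmod (u x))\<^sup>2 + (cmod (v x))\<^sup>2)"
    proof (rule integral_mono)
      show "integrable lborel (\<lambda>x. 2 * t * (cmod (u x) * cmod (v x)))"
        using L2_mult_integrable[OF assms] by simp
      show "integrable lborel (\<lambda>x. t\<^sup>2 * (cmod (u x))\<^sup>2 + (cmod (v x))\<^sup>2)"
        using assms[THEN L2_integrable] by simp
      show "2 * t * (cmod (u x) * cmod (v x)) \<le> t\<^sup>2 * (cmod (u x))\<^sup>2 + (cmod (v x))\<^sup>2" for x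
        using sum_squares_bound[of "t * cmod (u x)" "cmod (v x)"] by (simp add: power_mult_distrib mult.assoc)
    qed
    also have "\<dots> = t\<^sup>2 * mass u + mass v"
      unfolding mass_def using assms[THEN L2_integrable] by simp
    finally show ?thesis .
  qed
  have I0: "0 \<le> ?I" by simp
  show ?thesis
  proof (cases "mass u = 0")
    case True
    have "?I \<le> 0"
    proof (rule ccontr)
      assume "\<not> ?I \<le> 0"
      then show False using quad[of "(mass v + 1) / (2 * ?I)"] True by simp
    qed
    then show ?thesis using I0 by (simp add: L2_norm_mass True)
  next
    case False
    then have p: "mass u > 0" using mass_nonneg[of u] by linarith
    have "?I\<^sup>2 \<le> mass u * mass v"
      using quad[of "?I / mass u"] p by (simp add: field_simps power2_eq_square)
    then have "?I \<le> sqrt (mass u * mass v)" by (simp add: real_le_rsqrt)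
    then show ?thesis by (simp add: L2_norm_mass real_sqrt_mult)
  qed
qed

lemma L2_norm_triangle:
  assumes "u \<in> L2" "v \<in> L2"
  shows "L2_norm (\<lambda>x. u x + v x) \<le> L2_norm u + L2_norm v"
proof -
  have "mass (\<lambda>x. u x + v x) \<le> (LINT x|lborel. (cmod (u x))\<^sup>2 + 2 * (cmod (u x) * cmod (v x)) + (cmod (v x))\<^sup>2)"
    unfolding mass_def
  proof (rule integral_mono)
    show "integrable lborel (\<lambda>x. (cmod (u x + v x))\<^sup>2)"
      by (intro L2_integrable L2_add assms)
    show "integrable lborel (\<lambda>x. (cmod (u x))\<^sup>2 + 2 * (cmod (u x) * cmod (v x)) + (cmod (v x))\<^sup>2)"
      using assms[THEN L2_integrable] L2_mult_integrable[OF assms] by simp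
    show "(cmod (u x + v x))\<^sup>2 \<le> (cmod (u x))\<^sup>2 + 2 * (cmod (u x) * cmod (v x)) + (cmod (v x))\<^sup>2" for x
      using power_mono[OF norm_triangle_ineq[of "u x" "v x"], of 2] by (simp add: power2_sum)
  qed
  also have "\<dots> = mass u + 2 * (LINT x|lborel. cmod (u x) * cmod (v x)) + mass v"
    unfolding mass_def using assms[THEN L2_integrable] L2_mult_integrable[OF assms] by simp
  also have "\<dots> \<le> (L2_norm u + L2_norm v)\<^sup>2"
    using L2_Cauchy_Schwarz[OF assms] by (simp add: power2_sum L2_norm_sq)
  finally show ?thesis
    by (simp add: L2_norm_mass real_sqrt_le_iff sqrt_le_D real_le_lsqrt)
qed

lemma L2_norm_triangle_diff:
  assumes "u \<in> L2" "v \<in> L2" "w \<in> L2"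
  shows "L2_norm (\<lambda>x. u x - w x) \<le> L2_norm (\<lambda>x. u x - v x) + L2_norm (\<lambda>x. v x - w x)"
  using L2_norm_triangle[OF L2_diff[OF assms(1,2)] L2_diff[OF assms(2,3)]] by simp

lemma L2_norm_reverse_triangle:
  assumes "u \<in> L2" "v \<in> L2"
  shows "\<bar>L2_norm u - L2_norm v\<bar> \<le> L2_norm (\<lambda>x. u x - v x)"
  using L2_norm_triangle[OF L2_diff[OF assms] assms(2)] L2_norm_triangle[OF L2_diff[OF assms(2,1)] assms(1)]
    L2_norm_diff_commute[of u v] by simp

section \<open>Fatou's lemma and completeness of \<open>L2\<close>\<close>

lemma mass_nn_integral: "u \<in> L2 \<Longrightarrow> (\<integral>\<^sup>+x. ennreal ((cmod (u x))\<^sup>2) \<partial>lborel) = ennreal (mass u)"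
  unfolding mass_def by (intro nn_integral_eq_integral L2_integrable) auto

lemma L2_nn_integralI:
  assumes [measurable]: "u \<in> borel_measurable borel"
    and "(\<integral>\<^sup>+x. ennreal ((cmod (u x))\<^sup>2) \<partial>lborel) \<le> ennreal C" and "0 \<le> C"
  shows "u \<in> L2" "mass u \<le> C"
proof -
  have "integrable lborel (\<lambda>x. (cmod (u x))\<^sup>2)"
  proof (rule integrableI_bounded)
    show "(\<integral>\<^sup>+x. ennreal (norm ((cmod (u x))\<^sup>2)) \<partial>lborel) < \<infinity>"
      using le_less_trans[OF assms(2)] by simp
  qed simp
  then show "u \<in> L2" by (simp add: L2_def)
  from mass_nn_integral[OF this] show "mass u \<le> C" using assms(2,3) by simp
qed

text \<open>Fatou's lemma for squared moduli supplies membership of the limit and the bound at once.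
  Only the tail of the sequence enters a liminf, so the bound is asked eventually.\<close>

lemma L2_Fatou:
  assumes "\<And>k. f k \<in> L2" and [measurable]: "g \<in> borel_measurable borel"
    and lim: "AE x in lborel. (\<lambda>k. f k x) \<longlonglongrightarrow> g x"
    and le: "eventually (\<lambda>k. mass (f k) \<le> C) sequentially" and "0 \<le> C"
  shows "g \<in> L2" "mass g \<le> C"
proof -
  have [measurable]: "f k \<in> borel_measurable borel" for k
    using assms(1) by (simp add: L2_def)
  have "(\<integral>\<^sup>+x. ennreal ((cmod (g x))\<^sup>2) \<partial>lborel) \<le> (\<integral>\<^sup>+x. liminf (\<lambda>k. ennreal ((cmod (f k x))\<^sup>2)) \<partial>lborel)"
  proof (rule nn_integral_mono_AE)
    show "AE x in lborel. ennreal ((cmod (g x))\<^sup>2) \<le> liminf (\<lambda>k. ennreal ((cmod (f k x))\<^sup>2))"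
      using lim
    proof eventually_elim
      case (elim x)
      then have "(\<lambda>k. ennreal ((cmod (f k x))\<^sup>2)) \<longlonglongrightarrow> ennreal ((cmod (g x))\<^sup>2)"
        by (intro tendsto_intros)
      then show ?case using lim_imp_Liminf[OF sequentially_bot] by fastforce
    qed
  qed
  also have "\<dots> \<le> liminf (\<lambda>k. \<integral>\<^sup>+x. ennreal ((cmod (f k x))\<^sup>2) \<partial>lborel)"
    by (rule nn_integral_liminf) simp
  also have "\<dots> \<le> ennreal C"
  proof -
    have "liminf (\<lambda>k. \<integral>\<^sup>+x. ennreal ((cmod (f k x))\<^sup>2) \<partial>lborel) \<le> limsup (\<lambda>k. \<integral>\<^sup>+x. ennreal ((cmod (f k x))\<^sup>2) \<partial>lborel)"
      by (rule Liminf_le_Limsup) simp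
    also have "\<dots> \<le> ennreal C"
      by (rule Limsup_bounded) (use le in eventually_elim, simp add: mass_nn_integral[OF assms(1)] ennreal_leI)
    finally show ?thesis .
  qed
  finally have *: "(\<integral>\<^sup>+x. ennreal ((cmod (g x))\<^sup>2) \<partial>lborel) \<le> ennreal C" .
  show "g \<in> L2" "mass g \<le> C" using L2_nn_integralI[OF assms(2) * \<open>0 \<le> C\<close>] by auto
qed

text \<open>Squared increments of mass (1/4)^k remain summable after multiplication by 2^k. Hence
  almost everywhere the weighted series is finite, the increments at the point decay like (1/sqrt
  2)^k, and the telescoping series converges.\<close>

lemma L2_fast_Cauchy_AE_convergent:
  assumes L2: "\<And>k. f k \<in> L2" and fast: "\<And>k. mass (\<lambda>x. f (Suc k) x - f k x) \<le> (1/4) ^ k"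
  shows "AE x in lborel. convergent (\<lambda>k. f k x)"
proof -
  define h where "h k x = (cmod (f (Suc k) x - f k x))\<^sup>2" for k x
  have [measurable]: "f k \<in> borel_measurable borel" for k
    using L2 by (simp add: L2_def)
  have [measurable]: "h k \<in> borel_measurable borel" for k
    unfolding h_def by measurable
  have "(\<integral>\<^sup>+x. (\<Sum>k. ennreal (2 ^ k * h k x)) \<partial>lborel) = (\<Sum>k. \<integral>\<^sup>+x. ennreal (2 ^ k * h k x) \<partial>lborel)"
    by (rule nn_integral_suminf) simp
  also have "\<dots> \<le> (\<Sum>k. ennreal ((1/2) ^ k))"
  proof (rule suminf_le)
    fix k
    have "(\<integral>\<^sup>+x. ennreal (2 ^ k * h k x) \<partial>lborel) = ennreal (2 ^ k) * (\<integral>\<^sup>+x. ennreal (h k x) \<partial>lborel)"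
      by (subst nn_integral_cmult[symmetric]) (auto simp: ennreal_mult' h_def)
    also have "\<dots> = ennreal (2 ^ k * mass (\<lambda>x. f (Suc k) x - f k x))"
      unfolding h_def by (subst mass_nn_integral[OF L2_diff[OF L2 L2]]) (simp add: ennreal_mult')
    also have "\<dots> \<le> ennreal ((1/2) ^ k)"
    proof (rule ennreal_leI)
      have "2 ^ k * mass (\<lambda>x. f (Suc k) x - f k x) \<le> 2 ^ k * (1/4) ^ k"
        using fast by (intro mult_left_mono) auto
      also have "\<dots> = (1/2::real) ^ k" by (simp add: power_mult_distrib[symmetric])
      finally show "2 ^ k * mass (\<lambda>x. f (Suc k) x - f k x) \<le> (1/2) ^ k" .
    qed
    finally show "(\<integral>\<^sup>+x. ennreal (2 ^ k * h k x) \<partial>lborel) \<le> ennreal ((1/2) ^ k)" .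
  qed simp_all
  also have "\<dots> = ennreal (\<Sum>k. (1/2) ^ k)"
    by (rule suminf_ennreal2) auto
  also have "\<dots> < \<infinity>" by simp
  finally have "(\<integral>\<^sup>+x. (\<Sum>k. ennreal (2 ^ k * h k x)) \<partial>lborel) \<noteq> \<infinity>" by simp
  then have "AE x in lborel. (\<Sum>k. ennreal (2 ^ k * h k x)) \<noteq> \<infinity>"
    by (intro nn_integral_PInf_AE) auto
  then show ?thesis
  proof eventually_elim
    case (elim x)
    have summ: "summable (\<lambda>k. 2 ^ k * h k x)"
      using elim by (intro summable_suminf_not_top) (auto simp: h_def)
    obtain B where B: "\<And>k. norm (2 ^ k * h k x) \<le> B"
      using summable_imp_Bseq[OF summ] unfolding Bseq_def by blast
    have le: "cmod (f (Suc k) x - f k x) \<le> sqrt B * (1 / sqrt 2) ^ k" for k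
    proof -
      have "cmod (f (Suc k) x - f k x) = sqrt (h k x)" by (simp add: h_def)
      also have "h k x \<le> B / 2 ^ k" using B[of k] by (simp add: field_simps)
      then have "sqrt (h k x) \<le> sqrt (B / 2 ^ k)" by simp
      also have "\<dots> = sqrt B * (1 / sqrt 2) ^ k"
        by (simp add: real_sqrt_divide real_sqrt_power power_divide)
      finally show ?thesis .
    qed
    have "summable (\<lambda>k. f (Suc k) x - f k x)"
    proof (rule summable_comparison_test)
      show "summable (\<lambda>k. sqrt B * (1 / sqrt 2) ^ k)"
        by (intro summable_mult summable_geometric) simp
    qed (use le in auto)
    then have "convergent (\<lambda>n. \<Sum>k<n. f (Suc k) x - f k x)"
      by (simp add: summable_iff_convergent)
    then have "convergent (\<lambda>n. f n x - f 0 x)"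
      by (subst (asm) sum_lessThan_telescope)
    then have "convergent (\<lambda>n. (f n x - f 0 x) + f 0 x)"
      by (intro convergent_add convergent_const)
    then show ?case by simp
  qed
qed

text \<open>A fast subsequence has an almost everywhere limit, and Fatou's lemma carries the Cauchy
  estimate between \<open>f n\<close> and the subsequence over to \<open>f n\<close> and that
  limit.\<close>

lemma L2_complete:
  assumes L2: "\<And>n. f n \<in> L2"
    and Cauchy: "\<And>e. e > 0 \<Longrightarrow> \<exists>N. \<forall>m\<ge>N. \<forall>n\<ge>N. L2_norm (\<lambda>x. f m x - f n x) < e"
  obtains g where "g \<in> L2" "(\<lambda>n. L2_norm (\<lambda>x. f n x - g x)) \<longlonglongrightarrow> 0"
proof -
  have "\<forall>k. \<exists>N. \<forall>m\<ge>N. \<forall>n\<ge>N. L2_norm (\<lambda>x. f m x - f n x) < (1/2) ^ k"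
    using Cauchy by simp
  then obtain N where N: "\<And>k m n. m \<ge> N k \<Longrightarrow> n \<ge> N k \<Longrightarrow> L2_norm (\<lambda>x. f m x - f n x) < (1/2) ^ k"
    by metis
  \<comment> \<open>The maximum makes \<open>r\<close> nondecreasing and at least
    \<open>N k\<close>; the summand \<open>k\<close> makes \<open>r k\<close> exceed every threshold
    \<open>N j\<close> eventually.\<close>
  define r where "r k = k + Max (N ` {..k})" for k
  have rN: "N k \<le> r k" for k
    unfolding r_def by (rule order_trans[OF Max_ge le_add2]) auto
  have rmono: "r k \<le> r (Suc k)" for k
    unfolding r_def by (intro add_mono Max_mono) auto
  have small: "mass (\<lambda>x. f m x - f n x) \<le> (1/4) ^ k" if "m \<ge> N k" "n \<ge> N k" for m n k
  proof -
    have "(L2_norm (\<lambda>x. f m x - f n x))\<^sup>2 \<le> ((1/2) ^ k)\<^sup>2"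
      using N[OF that] by (intro power_mono) auto
    moreover have "((1/2) ^ k)\<^sup>2 = (1/4::real) ^ k"
      by (simp add: power2_eq_square power_mult_distrib[symmetric])
    ultimately show ?thesis by (simp only: L2_norm_sq)
  qed
  have ae: "AE x in lborel. convergent (\<lambda>k. f (r k) x)"
    by (rule L2_fast_Cauchy_AE_convergent)
      (use L2 small rN rmono order_trans in blast)+
  \<comment> \<open>Where the subsequence diverges, on a null set, \<open>lim\<close> has an
    unspecified value; \<open>g\<close> is measurable all the same.\<close>
  define g where "g x = lim (\<lambda>k. f (r k) x)" for x
  have [measurable]: "f n \<in> borel_measurable borel" for n
    using L2 by (simp add: L2_def)
  have [measurable]: "g \<in> borel_measurable borel"
    unfolding g_def by measurable
  have ae': "AE x in lborel. (\<lambda>k. f n x - f (r k) x) \<longlonglongrightarrow> f n x - g x" for n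
    using ae
  proof eventually_elim
    case (elim x)
    then show ?case unfolding g_def by (intro tendsto_intros) (simp add: convergent_LIMSEQ_iff)
  qed
  have close: "(\<lambda>x. f n x - g x) \<in> L2 \<and> mass (\<lambda>x. f n x - g x) \<le> (1/4) ^ j" if "n \<ge> N j" for n j
  proof -
    have ev: "eventually (\<lambda>k. mass (\<lambda>x. f n x - f (r k) x) \<le> (1/4) ^ j) sequentially"
    proof (rule eventually_sequentiallyI[of "N j"])
      fix k assume "N j \<le> k"
      also have "k \<le> r k" by (simp add: r_def)
      finally show "mass (\<lambda>x. f n x - f (r k) x) \<le> (1/4) ^ j" using small that by simp
    qed
    show ?thesis
      using L2_Fatou[of "\<lambda>k x. f n x - f (r k) x" "\<lambda>x. f n x - g x", OF L2_diff[OF L2 L2] _ ae' ev] by simp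
  qed
  have "(\<lambda>x. f (N 0) x - (f (N 0) x - g x)) \<in> L2"
    by (rule L2_diff[OF L2]) (use close[of 0 "N 0"] in auto)
  then have "(\<lambda>x. g x) \<in> L2" by (simp add: algebra_simps)
  then have gL2: "g \<in> L2" .
  have "(\<lambda>n. L2_norm (\<lambda>x. f n x - g x)) \<longlonglongrightarrow> 0"
  proof (rule LIMSEQ_I)
    fix e :: real assume "e > 0"
    then obtain j where j: "(1/2) ^ j < e" using real_arch_pow_inv[of e "1/2"] by auto
    show "\<exists>no. \<forall>n\<ge>no. norm (L2_norm (\<lambda>x. f n x - g x) - 0) < e"
    proof (intro exI allI impI)
      fix n assume "n \<ge> N j"
      have "L2_norm (\<lambda>x. f n x - g x) \<le> sqrt ((1/4) ^ j)"
        using close[OF \<open>n \<ge> N j\<close>] by (simp add: L2_norm_mass)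
      also have "\<dots> = (1/2) ^ j" by (simp add: real_sqrt_power real_sqrt_divide)
      finally show "norm (L2_norm (\<lambda>x. f n x - g x) - 0) < e" using j by simp
    qed
  qed
  with gL2 show ?thesis by (rule that)
qed

section \<open>Test functions and their density\<close>

lemma L2_dominated_convergence:
  assumes w: "w \<in> L2" and [measurable]: "\<And>k. f k \<in> borel_measurable borel" "g \<in> borel_measurable borel"
    and lim: "AE x in lborel. (\<lambda>k. f k x) \<longlonglongrightarrow> g x"
    and bound: "\<And>k x. cmod (f k x) \<le> cmod (w x)"
  shows "(\<lambda>k. L2_norm (\<lambda>x. f k x - g x)) \<longlonglongrightarrow> 0"
proof -
  have wm [measurable]: "w \<in> borel_measurable borel" using w by (rule L2_measurable)
  have "(\<lambda>k. LINT x|lborel. (cmod (f k x - g x))\<^sup>2) \<longlonglongrightarrow> (LINT x|(lborel::'a measure). 0)"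
  \<comment> \<open>The limit inherits the bound by \<open>w\<close>, so the difference is at most
    twice \<open>cmod (w x)\<close> and its square at most four times the square.\<close>
  proof (rule integral_dominated_convergence[where w = "\<lambda>x. 4 * (cmod (w x))\<^sup>2"])
    show "AE x in lborel. (\<lambda>k. (cmod (f k x - g x))\<^sup>2) \<longlonglongrightarrow> 0"
      using lim
    proof eventually_elim
      case (elim x)
      then have "(\<lambda>k. (cmod (f k x - g x))\<^sup>2) \<longlonglongrightarrow> (cmod (g x - g x))\<^sup>2"
        by (intro tendsto_intros)
      then show ?case by simp
    qed
    show "AE x in lborel. norm ((cmod (f k x - g x))\<^sup>2) \<le> 4 * (cmod (w x))\<^sup>2" for k
      using lim
    proof eventually_elim
      case (elim x)
      have g: "cmod (g x) \<le> cmod (w x)"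
        using tendsto_norm[OF elim] by (rule LIMSEQ_le_const2) (use bound in auto)
      have "(cmod (f k x - g x))\<^sup>2 \<le> (2 * cmod (w x))\<^sup>2"
        using norm_triangle_ineq4[of "f k x" "g x"] bound[of k x] g by (intro power_mono) auto
      then show ?case by (simp add: power_mult_distrib)
    qed
  qed (use L2_integrable[OF w] in auto)
  then have "(\<lambda>k. sqrt (mass (\<lambda>x. f k x - g x))) \<longlonglongrightarrow> sqrt 0"
    unfolding mass_def by (intro tendsto_real_sqrt) simp
  then show ?thesis by (simp add: L2_norm_mass)
qed

section \<open>Calculus in the classes \<open>C_k\<close>\<close>

text \<open>Derivatives are unique, so any explicit derivative may stand in for the
  \<open>frechet_derivative\<close> of the recursive definition.\<close>

lemma C_k_SucI:
  assumes "\<And>x. (f has_derivative f' x) (at x)" "\<And>i. i \<in> Basis \<Longrightarrow> C_k k (\<lambda>x. f' x i)"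
  shows "C_k (Suc k) f"
proof -
  have "f' x = frechet_derivative f (at x)" for x
    using assms(1) by (rule frechet_derivative_at)
  then show ?thesis using assms by (auto simp: differentiable_def)
qed

lemma C_k_Suc_continuous: "C_k (Suc k) f \<Longrightarrow> continuous_on UNIV f"
  by (auto intro!: continuous_at_imp_continuous_on differentiable_imp_continuous_within)

lemma C_k_Suc_has_derivative: "C_k (Suc k) f \<Longrightarrow> (f has_derivative frechet_derivative f (at x)) (at x)"
  using frechet_derivative_works by auto

lemma C_k_SucD: "C_k (Suc k) f \<Longrightarrow> C_k k f"
proof (induction k arbitrary: f)
  case 0
  then show ?case using C_k_Suc_continuous by fastforce
next
  case (Suc k)
  show ?case
    by (rule C_k_SucI[OF C_k_Suc_has_derivative[OF Suc.prems]])
      (rule Suc.IH, use Suc.prems in \<open>simp only: C_k.simps(2)[of "Suc k"]\<close>)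
qed

lemma C_k_const: "C_k k (\<lambda>x. c)"
  by (induction k arbitrary: c) auto

lemma C_k_add: "C_k k f \<Longrightarrow> C_k k g \<Longrightarrow> C_k k (\<lambda>x. f x + g x)"
proof (induction k arbitrary: f g)
  case 0
  then show ?case by (auto intro: continuous_intros)
next
  case (Suc k)
  show ?case
    by (rule C_k_SucI[OF has_derivative_add[OF C_k_Suc_has_derivative[OF Suc.prems(1)] C_k_Suc_has_derivative[OF Suc.prems(2)]]])
       (use Suc in auto)
qed

text \<open>The product rule leaves an undifferentiated factor in each term; \<open>C_k_SucD\<close>
  lowers it to class \<open>k\<close>, where the induction hypothesis applies.\<close>

lemma C_k_mult: "C_k k f \<Longrightarrow> C_k k g \<Longrightarrow> C_k k (\<lambda>x. f x * g x)"
proof (induction k arbitrary: f g)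
  case 0
  then show ?case by (auto intro: continuous_intros)
next
  case (Suc k)
  show ?case
  proof (rule C_k_SucI[OF has_derivative_mult[OF C_k_Suc_has_derivative[OF Suc.prems(1)] C_k_Suc_has_derivative[OF Suc.prems(2)]]])
    fix i :: 'a assume "i \<in> Basis"
    then show "C_k k (\<lambda>x. f x * frechet_derivative g (at x) i + frechet_derivative f (at x) i * g x)"
      using Suc.prems C_k_SucD[OF Suc.prems(1)] C_k_SucD[OF Suc.prems(2)]
      by (intro C_k_add Suc.IH) auto
  qed
qed

lemma C_k_prod: "finite A \<Longrightarrow> (\<And>i. i \<in> A \<Longrightarrow> C_k k (f i)) \<Longrightarrow> C_k k (\<lambda>x. \<Prod>i\<in>A. f i x)"
  by (induction A rule: finite_induct) (auto intro: C_k_const C_k_mult)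

lemma C_k_translate: "C_k k f \<Longrightarrow> C_k k (\<lambda>x. f (x + y))"
proof (induction k arbitrary: f)
  case 0
  then show ?case by (auto intro!: continuous_intros elim: continuous_on_compose2)
next
  case (Suc k)
  show ?case
  proof (rule C_k_SucI)
    show "((\<lambda>x. f (x + y)) has_derivative (\<lambda>h. frechet_derivative f (at (x + y)) h)) (at x)" for x
    proof (rule has_derivative_compose[OF _ C_k_Suc_has_derivative[OF Suc.prems]])
      show "((\<lambda>x. x + y) has_derivative (\<lambda>h. h)) (at x)" by (auto intro!: derivative_eq_intros)
    qed
  qed (use Suc in auto)
qed

section \<open>Smooth bump functions\<close>

text \<open>The classical smooth function exp(-c/t), extended by 0 to t \<le> 0. The powers of 1/t
  make the family closed under differentiation up to linear combinations, and letting
  \<open>c\<close> tend to 0 makes it approach the indicator of the half-line.\<close>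

definition flat :: "real \<Rightarrow> nat \<Rightarrow> real \<Rightarrow> real" where
  "flat c n t = (if t > 0 then exp (- c / t) / t ^ n else 0)"

text \<open>In terms of s = c/t the expression is s^n / exp s up to the constant c^n, and s tends to
  infinity.\<close>

lemma flat_tendsto_0:
  assumes "c > 0" shows "((\<lambda>t::real. exp (- c / t) / t ^ n) \<longlongrightarrow> 0) (at_right 0)"
proof -
  have lim: "filterlim (\<lambda>t::real. c / t) at_top (at_right 0)"
    using filterlim_tendsto_pos_mult_at_top[OF tendsto_const assms filterlim_inverse_at_top_right]
    by (simp add: divide_inverse)
  have "((\<lambda>t::real. (c / t) ^ n / exp (c / t)) \<longlongrightarrow> 0) (at_right 0)"
    by (rule filterlim_compose[OF tendsto_power_div_exp_0 lim])
  then have "((\<lambda>t::real. (1 / c ^ n) * ((c / t) ^ n / exp (c / t))) \<longlongrightarrow> (1 / c ^ n) * 0) (at_right 0)"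
    by (intro tendsto_intros)
  moreover have "(1 / c ^ n) * ((c / t) ^ n / exp (c / t)) = exp (- c / t) / t ^ n" for t
    using assms by (simp add: power_divide exp_minus field_simps)
  ultimately show ?thesis by simp
qed

text \<open>Away from 0 this is the quotient rule. At 0 the right difference quotient is the same
  function with one more power of 1/t, which tends to 0, and the left one vanishes.\<close>

lemma flat_has_derivative:
  assumes c: "c > 0"
  shows "(flat c n has_real_derivative (c * flat c (n + 2) t - n * flat c (n + 1) t)) (at t)"
proof (cases t "0::real" rule: linorder_cases)
  case less
  have "((\<lambda>t. 0) has_real_derivative 0) (at t)" by simp
  then have "(flat c n has_real_derivative 0) (at t)"
    by (rule DERIV_cong_ev[THEN iffD1, rotated -1, OF _ refl _ refl])
       (use less in \<open>auto simp: flat_def eventually_nhds intro!: exI[of _ "{..<0}"]\<close>)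
  then show ?thesis using less by (simp add: flat_def)
next
  case equal
  have "((\<lambda>h. flat c n h / h) \<longlongrightarrow> 0) (at_right 0)"
    by (rule Lim_transform_eventually[OF flat_tendsto_0[OF c, of "n + 1"]])
       (auto simp: flat_def eventually_at_filter)
  moreover have "((\<lambda>h. flat c n h / h) \<longlongrightarrow> 0) (at_left 0)"
    by (rule Lim_transform_eventually[OF tendsto_const])
       (auto simp: flat_def eventually_at_filter)
  ultimately have "((\<lambda>h. flat c n h / h) \<longlongrightarrow> 0) (at 0)"
    by (simp add: filterlim_split_at)
  then show ?thesis unfolding equal by (simp add: DERIV_def flat_def)
next
  case greater
  have "((\<lambda>t. exp (- c / t) / t ^ n) has_real_derivative (c * flat c (n + 2) t - n * flat c (n + 1) t)) (at t)"
  proof (rule DERIV_cong)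
    show "((\<lambda>t. exp (- c / t) / t ^ n) has_real_derivative
       ((exp (- c / t) * (c / t\<^sup>2)) * t ^ n - exp (- c / t) * (n * t ^ (n - 1))) / (t ^ n * t ^ n)) (at t)"
      using greater by (auto intro!: derivative_eq_intros simp: power2_eq_square)
    show "((exp (- c / t) * (c / t\<^sup>2)) * t ^ n - exp (- c / t) * (n * t ^ (n - 1))) / (t ^ n * t ^ n)
      = c * flat c (n + 2) t - n * flat c (n + 1) t"
      using greater by (cases n) (auto simp: flat_def field_simps power2_eq_square)
  qed
  then show ?thesis
    by (rule DERIV_cong_ev[THEN iffD1, rotated -1, OF _ refl _ refl])
       (use greater in \<open>auto simp: flat_def eventually_nhds intro!: exI[of _ "{0<..}"]\<close>)
qed

text \<open>The induction runs over all \<open>n\<close> simultaneously, because the derivative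
  involves \<open>n + 1\<close> and \<open>n + 2\<close>. An affine argument is built in because
  \<open>bump\<close> needs both orientations of each coordinate.\<close>

lemma C_k_flat:
  assumes c: "c > 0"
  shows "C_k k (\<lambda>x. flat c n (x \<bullet> v + a))"
proof (induction k arbitrary: n)
  case 0
  have "continuous_on UNIV (flat c n)"
    using flat_has_derivative[OF c] by (intro continuous_at_imp_continuous_on ballI) (rule DERIV_isCont)
  then show ?case
    by (auto intro!: continuous_intros elim: continuous_on_compose2)
next
  case (Suc k)
  show ?case
  proof (rule C_k_SucI)
    fix x
    have "((\<lambda>x. x \<bullet> v + a) has_derivative (\<lambda>h. h \<bullet> v)) (at x)"
      by (auto intro!: derivative_eq_intros)
    from has_derivative_compose[OF this flat_has_derivative[OF c, of n, unfolded has_field_derivative_def]]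
    show "((\<lambda>x. flat c n (x \<bullet> v + a)) has_derivative
      (\<lambda>h. (c * flat c (n + 2) (x \<bullet> v + a) + - real n * flat c (n + 1) (x \<bullet> v + a)) * (h \<bullet> v))) (at x)"
      by simp
  next
    fix i :: 'a
    show "C_k k (\<lambda>x. (c * flat c (n + 2) (x \<bullet> v + a) + - real n * flat c (n + 1) (x \<bullet> v + a)) * (i \<bullet> v))"
      by (intro C_k_mult C_k_add C_k_const Suc)
  qed
qed

text \<open>A product over the faces of the box: the first factor is positive beyond the lower face
  in direction \<open>i\<close>, the second before the upper one. The arguments have the form
  \<open>x \<bullet> v + a\<close> that \<open>C_k_flat\<close> handles.\<close>

definition bump :: "'a::euclidean_space \<Rightarrow> 'a \<Rightarrow> real \<Rightarrow> 'a \<Rightarrow> real" where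
  "bump a b c x = (\<Prod>i\<in>Basis. flat c 0 (x \<bullet> i + - (a \<bullet> i)) * flat c 0 (x \<bullet> (- i) + b \<bullet> i))"

lemma bump_zero: "x \<notin> box a b \<Longrightarrow> bump a b c x = 0"
  by (force simp: bump_def box_def flat_def)

lemma bump_bounds:
  assumes "c > 0" shows "0 \<le> bump a b c x" "bump a b c x \<le> 1"
proof -
  have fl: "0 \<le> flat c 0 t" "flat c 0 t \<le> 1" for t using assms by (auto simp: flat_def)
  show "0 \<le> bump a b c x" unfolding bump_def by (intro prod_nonneg) (auto simp: fl)
  show "bump a b c x \<le> 1" unfolding bump_def by (intro prod_le_1) (auto simp: fl mult_le_one)
qed

lemma bump_test_functions:
  assumes "c > 0" shows "bump a b c \<in> test_functions"
proof -
  have "C_k k (bump a b c)" for k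
    unfolding bump_def by (intro C_k_prod C_k_mult C_k_flat assms) auto
  moreover have "compact (closure {x. bump a b c x \<noteq> 0})"
    using bump_zero[of _ a b c] by (auto simp: compact_closure intro: bounded_subset[OF bounded_box[of a b]])
  ultimately show ?thesis by (simp add: test_functions_def)
qed

lemma bump_tendsto_indicator:
  "(\<lambda>k. bump a b (inverse (real (Suc k))) x) \<longlonglongrightarrow> indicator (box a b) x"
proof (cases "x \<in> box a b")
  case False
  then show ?thesis by (simp add: bump_zero)
next
  case True
  have fl: "(\<lambda>k. flat (inverse (real (Suc k))) 0 t) \<longlonglongrightarrow> 1" if "t > 0" for t
  proof -
    have "(\<lambda>k. exp (- inverse (real (Suc k)) / t)) \<longlonglongrightarrow> exp (- 0 / t)"
      using that by (intro tendsto_intros LIMSEQ_inverse_real_of_nat) auto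
    then show ?thesis using that by (simp add: flat_def)
  qed
  have "(\<lambda>k. bump a b (inverse (real (Suc k))) x) \<longlonglongrightarrow> (\<Prod>i\<in>(Basis::'a set). 1 * 1)"
    unfolding bump_def
    by (intro tendsto_prod tendsto_mult fl) (use True in \<open>auto simp: box_def\<close>)
  then show ?thesis using True by simp
qed

section \<open>Test functions: supports, closure properties and bounds\<close>

lemma test_C_k: "\<phi> \<in> test_functions \<Longrightarrow> C_k k \<phi>"
  by (simp add: test_functions_def)

lemma test_continuous: "\<phi> \<in> test_functions \<Longrightarrow> continuous_on UNIV \<phi>"
  using test_C_k[of \<phi> 0] by simp

lemma test_measurable [measurable_dest]: "\<phi> \<in> test_functions \<Longrightarrow> \<phi> \<in> borel_measurable borel"
  by (intro borel_measurable_continuous_onI test_continuous)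

lemma test_has_derivative: "\<phi> \<in> test_functions \<Longrightarrow> (\<phi> has_derivative frechet_derivative \<phi> (at x)) (at x)"
  by (rule C_k_Suc_has_derivative[where k = 0]) (rule test_C_k)

lemma test_support:
  assumes "\<phi> \<in> test_functions" obtains R where "R > 0" "\<And>x. norm x \<ge> R \<Longrightarrow> \<phi> x = 0"
proof -
  have "bounded {x. \<phi> x \<noteq> 0}"
    using assms compact_imp_bounded bounded_subset[OF _ closure_subset] by (auto simp: test_functions_def)
  then obtain R where "R > 0" "\<And>x. \<phi> x \<noteq> 0 \<Longrightarrow> norm x < R"
    by (auto simp: bounded_pos_less)
  then show ?thesis using that[of R] by (meson not_less)
qed

lemma C_k_all_supportI:
  assumes "\<And>k. C_k k \<phi>" "\<And>x. norm x > R \<Longrightarrow> \<phi> x = 0" shows "\<phi> \<in> test_functions"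
proof -
  have "bounded {x. \<phi> x \<noteq> 0}"
    using assms(2) by (intro boundedI[of _ R]) (auto simp: not_less[symmetric])
  then show ?thesis using assms(1) by (simp add: test_functions_def compact_closure)
qed

lemma test_add:
  assumes "\<phi> \<in> test_functions" "\<psi> \<in> test_functions"
  shows "(\<lambda>x. \<phi> x + \<psi> x) \<in> test_functions"
proof -
  obtain R1 R2 where "\<And>x. norm x \<ge> R1 \<Longrightarrow> \<phi> x = 0" "\<And>x. norm x \<ge> R2 \<Longrightarrow> \<psi> x = 0"
    using assms test_support by metis
  then show ?thesis
    using assms[THEN test_C_k] by (intro C_k_all_supportI[where R = "max R1 R2"] C_k_add) auto
qed

lemma test_cmult:
  assumes "\<phi> \<in> test_functions" shows "(\<lambda>x. c * \<phi> x) \<in> test_functions"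
proof -
  obtain R1 where "\<And>x. norm x \<ge> R1 \<Longrightarrow> \<phi> x = 0"
    using assms test_support by metis
  then show ?thesis
    using assms[THEN test_C_k] by (intro C_k_all_supportI[where R = "R1"] C_k_mult C_k_const) auto
qed

lemma test_translate:
  assumes "\<phi> \<in> test_functions" shows "(\<lambda>x. \<phi> (x + y)) \<in> test_functions"
proof -
  obtain R1 where R1: "\<And>x. norm x \<ge> R1 \<Longrightarrow> \<phi> x = 0"
    using assms test_support by metis
  show ?thesis
  proof (rule C_k_all_supportI)
    show "\<phi> (x + y) = 0" if "norm x > R1 + norm y" for x
      using R1[of "x + y"] norm_triangle_ineq4[of "x + y" y] that by simp
  qed (intro C_k_translate test_C_k assms)
qed

lemma test_derivative:
  assumes "\<phi> \<in> test_functions" "i \<in> Basis"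
  shows "(\<lambda>x. frechet_derivative \<phi> (at x) i) \<in> test_functions"
proof -
  obtain R1 where R1: "\<And>x. norm x \<ge> R1 \<Longrightarrow> \<phi> x = 0"
    using assms(1) test_support by metis
  show ?thesis
  proof (rule C_k_all_supportI)
    fix x :: 'a assume "norm x > R1"
    \<comment> \<open>Outside the closed ball of radius \<open>R1\<close> the function vanishes on
      an open set, so its derivative there is that of a constant.\<close>
    have "((\<lambda>x. 0) has_derivative frechet_derivative \<phi> (at x)) (at x)"
    proof (rule has_derivative_transform_within_open[OF test_has_derivative[OF assms(1)]])
      show "open {x::'a. norm x > R1}" by (intro open_Collect_less continuous_intros)
    qed (use R1 \<open>norm x > R1\<close> in auto)
    then have "frechet_derivative \<phi> (at x) = (\<lambda>h. 0)"
      using has_derivative_unique[OF _ has_derivative_const] by blast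
    then show "frechet_derivative \<phi> (at x) i = 0" by simp
  next
    show "C_k k (\<lambda>x. frechet_derivative \<phi> (at x) i)" for k
      using test_C_k[OF assms(1), of "Suc k"] assms(2) by simp
  qed
qed

lemma test_bounded:
  assumes "\<phi> \<in> test_functions" obtains B where "B > 0" "\<And>x. \<bar>\<phi> x\<bar> \<le> B"
proof -
  obtain R where R: "R > 0" "\<And>x. norm x \<ge> R \<Longrightarrow> \<phi> x = 0" using assms by (rule test_support) auto
  have "compact (\<phi> ` cball 0 R)"
    by (intro compact_continuous_image continuous_on_subset[OF test_continuous[OF assms]]) auto
  then obtain B where B: "B > 0" "\<And>x. norm x \<le> R \<Longrightarrow> \<bar>\<phi> x\<bar> \<le> B"
    by (auto dest!: compact_imp_bounded simp: bounded_pos)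
  have "\<bar>\<phi> x\<bar> \<le> B" for x
    using B R(2)[of x] by (cases "norm x \<le> R") auto
  with B(1) show ?thesis by (rule that)
qed

lemma test_L2:
  assumes "\<phi> \<in> test_functions" shows "(\<lambda>x. complex_of_real (\<phi> x)) \<in> L2"
proof -
  obtain R where R: "R > 0" "\<And>x. norm x \<ge> R \<Longrightarrow> \<phi> x = 0" using assms by (rule test_support) auto
  obtain B where B: "B > 0" "\<And>x. \<bar>\<phi> x\<bar> \<le> B" using assms by (rule test_bounded) auto
  have [measurable]: "\<phi> \<in> borel_measurable borel" using assms by (rule test_measurable)
  have "integrable lborel (\<lambda>x::'a. B\<^sup>2 * indicator (ball 0 R) x)"
    using emeasure_bounded_finite[OF bounded_ball, of "0::'a" R]
    by (intro integrable_mult_right integrable_real_indicator) auto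
  then have "integrable lborel (\<lambda>x. (\<phi> x)\<^sup>2)"
  proof (rule Bochner_Integration.integrable_bound)
    show "AE x in lborel. norm ((\<phi> x)\<^sup>2) \<le> norm (B\<^sup>2 * indicator (ball 0 R) x)"
    proof (intro AE_I2)
      fix x :: 'a
      have "(\<phi> x)\<^sup>2 \<le> B\<^sup>2" using B(2)[of x] by (simp add: abs_le_square_iff[symmetric])
      then show "norm ((\<phi> x)\<^sup>2) \<le> norm (B\<^sup>2 * indicator (ball 0 R) x)"
        using R(2)[of x] by (cases "norm x < R") auto
    qed
  qed simp
  then show ?thesis by (simp add: L2_def)
qed

section \<open>Density of the test functions in \<open>L2\<close>\<close>

text \<open>Membership in the \<open>L2\<close> closure of the test functions, as a predicate on
  real functions: its closure under sums, multiples and limits feeds the induction principles for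
  Borel sets and for measurable functions.\<close>

definition test_approx :: "('a::euclidean_space \<Rightarrow> real) \<Rightarrow> bool" where
  "test_approx f \<longleftrightarrow> (\<lambda>x. complex_of_real (f x)) \<in> L2 \<and>
     (\<forall>e>0. \<exists>\<phi>\<in>test_functions. L2_norm (\<lambda>x. complex_of_real (f x) - complex_of_real (\<phi> x)) < e)"

lemma test_approx_L2: "test_approx f \<Longrightarrow> (\<lambda>x. complex_of_real (f x)) \<in> L2"
  by (simp add: test_approx_def)

lemma test_approxE:
  assumes "test_approx f" "e > 0"
  obtains \<phi> where "\<phi> \<in> test_functions" "L2_norm (\<lambda>x. complex_of_real (f x) - complex_of_real (\<phi> x)) < e"
  using assms by (auto simp: test_approx_def)

lemma test_approx_add:
  assumes "test_approx f" "test_approx g" shows "test_approx (\<lambda>x. f x + g x)"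
  unfolding test_approx_def
proof (intro conjI allI impI)
  note L2 = assms[THEN test_approx_L2]
  show "(\<lambda>x. complex_of_real (f x + g x)) \<in> L2" using L2_add[OF L2] by simp
  fix e :: real assume "e > 0"
  then have e2: "e / 2 > 0" by simp
  obtain \<phi> where \<phi>: "\<phi> \<in> test_functions" "L2_norm (\<lambda>x. complex_of_real (f x) - complex_of_real (\<phi> x)) < e / 2"
    using assms(1) e2 by (rule test_approxE)
  obtain \<psi> where \<psi>: "\<psi> \<in> test_functions" "L2_norm (\<lambda>x. complex_of_real (g x) - complex_of_real (\<psi> x)) < e / 2"
    using assms(2) e2 by (rule test_approxE)
  show "\<exists>\<phi>\<in>test_functions. L2_norm (\<lambda>x. complex_of_real (f x + g x) - complex_of_real (\<phi> x)) < e"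
  proof (intro bexI)
    show "(\<lambda>x. \<phi> x + \<psi> x) \<in> test_functions" by (intro test_add \<phi> \<psi>)
    show "L2_norm (\<lambda>x. complex_of_real (f x + g x) - complex_of_real (\<phi> x + \<psi> x)) < e"
      using L2_norm_triangle[OF L2_diff[OF L2(1) test_L2[OF \<phi>(1)]] L2_diff[OF L2(2) test_L2[OF \<psi>(1)]]] \<phi>(2) \<psi>(2)
      by (simp add: algebra_simps)
  qed
qed

lemma test_approx_cmult:
  assumes "test_approx f" shows "test_approx (\<lambda>x. c * f x)"
  unfolding test_approx_def
proof (intro conjI allI impI)
  note L2 = test_approx_L2[OF assms]
  show "(\<lambda>x. complex_of_real (c * f x)) \<in> L2" using L2_cmult[OF L2, of "of_real c"] by simp
  fix e :: real assume e: "e > 0"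
  have "e / (\<bar>c\<bar> + 1) > 0" using e by (simp add: add_nonneg_pos)
  with assms obtain \<phi> where \<phi>: "\<phi> \<in> test_functions" "L2_norm (\<lambda>x. complex_of_real (f x) - complex_of_real (\<phi> x)) < e / (\<bar>c\<bar> + 1)"
    by (rule test_approxE)
  show "\<exists>\<phi>\<in>test_functions. L2_norm (\<lambda>x. complex_of_real (c * f x) - complex_of_real (\<phi> x)) < e"
  proof (intro bexI)
    show "(\<lambda>x. c * \<phi> x) \<in> test_functions" by (intro test_cmult \<phi>)
    have "L2_norm (\<lambda>x. complex_of_real (c * f x) - complex_of_real (c * \<phi> x)) =
       \<bar>c\<bar> * L2_norm (\<lambda>x. complex_of_real (f x) - complex_of_real (\<phi> x))"
      using L2_norm_cmult[of "of_real c" "\<lambda>x. complex_of_real (f x) - complex_of_real (\<phi> x)"]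
      by (simp add: right_diff_distrib)
    also have "\<dots> \<le> \<bar>c\<bar> * (e / (\<bar>c\<bar> + 1))" using \<phi>(2) by (intro mult_left_mono) auto
    also have "\<dots> < e" using e by (simp add: field_simps)
    finally show "L2_norm (\<lambda>x. complex_of_real (c * f x) - complex_of_real (c * \<phi> x)) < e" .
  qed
qed

lemma test_approx_limit:
  assumes "\<And>k. test_approx (f k)" and g: "(\<lambda>x. complex_of_real (g x)) \<in> L2"
    and lim: "(\<lambda>k. L2_norm (\<lambda>x. complex_of_real (f k x) - complex_of_real (g x))) \<longlonglongrightarrow> 0"
  shows "test_approx g"
  unfolding test_approx_def
proof (intro conjI allI impI g)
  fix e :: real assume "e > 0"
  then have e2: "e / 2 > 0" by simp
  obtain k where k: "L2_norm (\<lambda>x. complex_of_real (f k x) - complex_of_real (g x)) < e / 2"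
    using LIMSEQ_D[OF lim e2] by auto
  obtain \<phi> where \<phi>: "\<phi> \<in> test_functions" "L2_norm (\<lambda>x. complex_of_real (f k x) - complex_of_real (\<phi> x)) < e / 2"
    using assms(1) e2 by (rule test_approxE)
  show "\<exists>\<phi>\<in>test_functions. L2_norm (\<lambda>x. complex_of_real (g x) - complex_of_real (\<phi> x)) < e"
    using L2_norm_triangle_diff[OF g test_approx_L2[OF assms(1)] test_L2[OF \<phi>(1)], of k] k \<phi>
      L2_norm_diff_commute[of "\<lambda>x. complex_of_real (g x)" "\<lambda>x. complex_of_real (f k x)"]
    by (intro bexI[of _ \<phi>]) auto
qed

lemma indicator_L2:
  assumes [measurable]: "A \<in> sets borel" and "emeasure lborel A < \<infinity>"
  shows "(\<lambda>x. complex_of_real (indicator A x)) \<in> L2"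
proof -
  have "integrable lborel (indicator A :: 'a \<Rightarrow> real)"
    using assms by (intro integrable_real_indicator) auto
  moreover have "(cmod (complex_of_real (indicator A x)))\<^sup>2 = indicator A x" for x
    by (simp split: split_indicator)
  ultimately show ?thesis by (simp add: L2_def)
qed

lemma test_approx_box: "test_approx (indicator (box a b))"
proof (rule test_approx_limit)
  show *: "(\<lambda>x. complex_of_real (indicator (box a b) x)) \<in> L2"
    using emeasure_bounded_finite[OF bounded_box, of a b] by (intro indicator_L2) auto
  have pos: "inverse (real (Suc k)) > 0" for k by simp
  note t = bump_test_functions[OF pos, of a b]
  show "test_approx (bump a b (inverse (real (Suc k))))" for k
    unfolding test_approx_def
    using test_L2[OF t] t by (auto simp: L2_norm_def intro!: bexI[of _ "bump a b (inverse (real (Suc k)))"])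
  show "(\<lambda>k. L2_norm (\<lambda>x. complex_of_real (bump a b (inverse (real (Suc k))) x) -
          complex_of_real (indicator (box a b) x))) \<longlonglongrightarrow> 0"
  proof (rule L2_dominated_convergence[OF *])
    show "(\<lambda>x. complex_of_real (bump a b (inverse (real (Suc k))) x)) \<in> borel_measurable borel" for k
      by (rule L2_measurable[OF test_L2[OF t]])
    show "AE x in lborel. (\<lambda>k. complex_of_real (bump a b (inverse (real (Suc k))) x)) \<longlonglongrightarrow>
        complex_of_real (indicator (box a b) x)"
      by (intro AE_I2 tendsto_of_real bump_tendsto_indicator)
    show "cmod (complex_of_real (bump a b (inverse (real (Suc k))) x)) \<le> cmod (complex_of_real (indicator (box a b) x))" for k x
      using bump_bounds[OF pos, of a b k x] bump_zero[of x a b] by (cases "x \<in> box a b") auto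
  qed simp
qed

text \<open>A Dynkin argument: boxes are stable under intersection and generate the Borel sets,
  while the fixed box keeps every indicator in \<open>L2\<close>, so that complements and disjoint
  unions can be formed.\<close>

lemma test_approx_bounded_set:
  assumes "A \<in> sets borel" shows "test_approx (indicator (A \<inter> box a b))"
proof -
  let ?G = "range (\<lambda>(a, b). box a b :: 'a set)"
  have stable: "Int_stable ?G" by (auto simp: Int_stable_def box_Int_box)
  have sig: "sigma_sets UNIV ?G = sets borel"
    by (subst borel_eq_box) simp
  have fin: "emeasure lborel (B \<inter> box a b) < \<infinity>" for B :: "'a set"
    by (rule le_less_trans[OF emeasure_mono emeasure_lborel_box_finite[of a b]]) auto
  have "A \<in> sigma_sets UNIV ?G" using assms by (simp add: sig)
  \<comment> \<open>The induction rule wants the generator inside the power set of the universe.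
    That the boxes cover everything is discharged at the end: each point lies in the box of
    half-width 1 around it.\<close>
  with stable subset_Pow_Union[of ?G] have "test_approx (indicator (A \<inter> box a b))" if "\<Union>?G = UNIV"
    unfolding that
  proof (induction rule: sigma_sets_induct_disjoint)
    case (basic A)
    then show ?case by (auto simp: box_Int_box test_approx_box)
  next
    case empty
    show ?case using test_approx_cmult[OF test_approx_box[of 0 0], of 0] by simp
  next
    case (compl A)
    have "test_approx (\<lambda>x. indicator (box a b) x + (-1) * indicator (A \<inter> box a b) x)"
      by (intro test_approx_add test_approx_cmult test_approx_box compl)
    moreover have "indicator (box a b) x + (-1) * indicator (A \<inter> box a b) x = (indicator ((UNIV - A) \<inter> box a b) x :: real)" for x
      by (auto split: split_indicator)
    ultimately show ?case by (simp only:)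
  next
    case (union A)
    define f where "f n x = (\<Sum>i<n. indicator (A i \<inter> box a b) x :: real)" for n :: nat and x
    have meas: "A i \<in> sets borel" for i using union(2) sig by auto
    have f_eq: "f n x = indicator ((\<Union>i<n. A i) \<inter> box a b) x" for n x
    proof -
      have "disjoint_family_on (\<lambda>i. A i \<inter> box a b) {..<n}"
        using union(1) by (auto simp: disjoint_family_on_def)
      then have "f n x = indicator (\<Union>i<n. A i \<inter> box a b) x"
        unfolding f_def by (subst indicator_UN_disjoint) auto
      then show ?thesis by simp
    qed
    show ?case
    proof (rule test_approx_limit[where f = f])
      show "test_approx (f n)" for n
      proof (induction n)
        case 0
        show ?case using test_approx_cmult[OF test_approx_box[of 0 0], of 0] by (simp add: f_def[abs_def])
      next
        case (Suc n)
        then show ?case unfolding f_def lessThan_Suc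
          using test_approx_add[OF union(3)[of n] Suc] by (simp add: f_def)
      qed
      show *: "(\<lambda>x. complex_of_real (indicator ((\<Union>i. A i) \<inter> box a b) x)) \<in> L2"
        by (rule indicator_L2[OF _ fin]) (use meas in auto)
      show "(\<lambda>k. L2_norm (\<lambda>x. complex_of_real (f k x) - complex_of_real (indicator ((\<Union>i. A i) \<inter> box a b) x))) \<longlonglongrightarrow> 0"
      proof (rule L2_dominated_convergence[OF *])
        show "(\<lambda>x. complex_of_real (f k x)) \<in> borel_measurable borel" for k
          unfolding f_eq using meas by (intro L2_measurable[OF indicator_L2[OF _ fin]]) auto
        show "AE x in lborel. (\<lambda>k. complex_of_real (f k x)) \<longlonglongrightarrow> complex_of_real (indicator ((\<Union>i. A i) \<inter> box a b) x)"
        proof (intro AE_I2 tendsto_of_real)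
          fix x
          have "(\<lambda>k. indicator (\<Union>i<k. A i \<inter> box a b) x :: real) \<longlonglongrightarrow> indicator (\<Union>i. A i \<inter> box a b) x"
            by (rule LIMSEQ_indicator_UN)
          then show "(\<lambda>k. f k x) \<longlonglongrightarrow> indicator ((\<Union>i. A i) \<inter> box a b) x"
            unfolding f_eq by simp
        qed
        show "cmod (complex_of_real (f k x)) \<le> cmod (complex_of_real (indicator ((\<Union>i. A i) \<inter> box a b) x))" for k x
          unfolding f_eq by (auto split: split_indicator)
      qed (use L2_measurable[OF *] in simp)
    qed
  qed
  moreover have "\<Union>?G = UNIV"
  proof -
    have "x \<in> box (x - One) (x + One)" for x :: 'a by (auto simp: box_def inner_simps)
    then show ?thesis by blast
  qed
  ultimately show ?thesis by blast
qed

text \<open>Induction over indicators, multiples, sums and increasing limits. Everything stays in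
  \<open>L2\<close> because summands and earlier members of an increasing sequence are dominated by
  the function itself.\<close>

lemma test_approx_nonneg:
  assumes "f \<in> borel_measurable borel" "\<And>x. 0 \<le> f x" "(\<lambda>x. complex_of_real (f x)) \<in> L2"
  shows "test_approx f"
  using assms
proof (induction rule: borel_measurable_induct_real)
  case (set A)
  define B where "B n = A \<inter> box (- (real n *\<^sub>R One)) (real n *\<^sub>R (One::'a))" for n
  have [measurable]: "A \<in> sets borel" using set by simp
  show ?case
  proof (rule test_approx_limit[where f = "\<lambda>n. indicator (B n)"])
    show "test_approx (indicator (B n))" for n
      unfolding B_def by (rule test_approx_bounded_set) simp
    show "(\<lambda>k. L2_norm (\<lambda>x. complex_of_real (indicator (B k) x) - complex_of_real (indicator A x))) \<longlonglongrightarrow> 0"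
    proof (rule L2_dominated_convergence[OF set(2)])
      show "AE x in lborel. (\<lambda>k. complex_of_real (indicator (B k) x)) \<longlonglongrightarrow> complex_of_real (indicator A x)"
      proof (intro AE_I2 tendsto_of_real)
        fix x :: 'a
        obtain N where N: "norm x < real N" using reals_Archimedean2 by auto
        have "x \<in> box (- (real n *\<^sub>R One)) (real n *\<^sub>R One)" if "n \<ge> N" for n
        proof -
          have "\<bar>x \<bullet> i\<bar> < real n" if "i \<in> Basis" for i
            using Basis_le_norm[OF that, of x] N \<open>n \<ge> N\<close> by linarith
          then show ?thesis by (force simp: box_def)
        qed
        then have "eventually (\<lambda>n. indicator A x = (indicator (B n) x :: real)) sequentially"
          by (intro eventually_sequentiallyI[of N]) (auto simp: B_def split: split_indicator)
        then show "(\<lambda>k. indicator (B k) x) \<longlonglongrightarrow> (indicator A x :: real)"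
          by (rule Lim_transform_eventually[OF tendsto_const])
      qed
      show "cmod (complex_of_real (indicator (B k) x)) \<le> cmod (complex_of_real (indicator A x))" for k x
        by (auto simp: B_def split: split_indicator)
    qed (auto simp: B_def)
  qed (rule set)
next
  case (mult u c)
  show ?case
  proof (cases "c = 0")
    \<comment> \<open>If \<open>c = 0\<close>, the hypothesis on \<open>c * u\<close> says nothing
      about \<open>u\<close>; the zero function is the indicator of the empty box.\<close>
    case True
    then show ?thesis using test_approx_box[of 0 0] by (simp add: indicator_def[abs_def])
  next
    case False
    have "(\<lambda>x. of_real (1 / c) * complex_of_real (c * u x)) \<in> L2" by (rule L2_cmult[OF mult.prems])
    then have "(\<lambda>x. complex_of_real (u x)) \<in> L2" using False by simp
    then show ?thesis by (intro test_approx_cmult mult.IH)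
  qed
next
  case (add u v)
  have "(\<lambda>x. complex_of_real (u x)) \<in> L2"
    by (rule L2_dominated[OF add.prems, where C = 1]) (use add in \<open>auto simp del: of_real_add\<close>)
  moreover have "(\<lambda>x. complex_of_real (v x)) \<in> L2"
    by (rule L2_dominated[OF add.prems, where C = 1]) (use add in \<open>auto simp del: of_real_add\<close>)
  ultimately show ?case by (intro test_approx_add add.IH)
next
  case (seq U)
  have lim: "(\<lambda>i. U i x) \<longlonglongrightarrow> f x" for x using seq.hyps(4) by simp
  have le: "U i x \<le> f x" for i x
    using incseq_le[OF _ lim, of x i] seq.hyps(3) by (auto simp: incseq_def le_fun_def)
  have U: "(\<lambda>x. complex_of_real (U i x)) \<in> L2" for i
    by (rule L2_dominated[OF seq.prems, where C = 1])
      (use le[of i] seq.hyps(1,2) order_trans[OF seq.hyps(2) le] in auto)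
  show ?case
  proof (rule test_approx_limit[where f = U, OF _ seq.prems])
    show "(\<lambda>k. L2_norm (\<lambda>x. complex_of_real (U k x) - complex_of_real (f x))) \<longlonglongrightarrow> 0"
    proof (rule L2_dominated_convergence[OF seq.prems])
      show "AE x in lborel. (\<lambda>k. complex_of_real (U k x)) \<longlonglongrightarrow> complex_of_real (f x)"
        by (intro AE_I2 tendsto_of_real lim)
      show "cmod (complex_of_real (U k x)) \<le> cmod (complex_of_real (f x))" for k x
        using le[of k x] seq.hyps(2)[of k x] by simp
    qed (use L2_measurable[OF U] L2_measurable[OF seq.prems] in auto)
  qed (rule seq.IH[OF U])
qed

lemma test_approx_all:
  assumes "(\<lambda>x. complex_of_real (f x)) \<in> L2"
  shows "test_approx f"
proof -
  have "(\<lambda>x. Re (complex_of_real (f x))) \<in> borel_measurable borel"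
    using L2_measurable[OF assms] by measurable
  then have [measurable]: "f \<in> borel_measurable borel" by simp
  have "(\<lambda>x. complex_of_real (max 0 (f x))) \<in> L2"
    by (rule L2_dominated[OF assms, where C = 1]) auto
  then have "test_approx (\<lambda>x. max 0 (f x))"
    by (intro test_approx_nonneg) auto
  moreover have "(\<lambda>x. complex_of_real (max 0 (- f x))) \<in> L2"
    by (rule L2_dominated[OF assms, where C = 1]) auto
  then have "test_approx (\<lambda>x. max 0 (- f x))"
    by (intro test_approx_nonneg) auto
  ultimately have "test_approx (\<lambda>x. max 0 (f x) + (-1) * max 0 (- f x))"
    by (intro test_approx_add test_approx_cmult)
  moreover have "(\<lambda>x. max 0 (f x) + (-1) * max 0 (- f x)) = f" by (auto simp: max_def)
  ultimately show ?thesis by simp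
qed

text \<open>Testing with \<open>f\<close> itself would give n^2 \<le> C n for its norm n. A test
  function within \<open>e\<close> of \<open>f\<close> takes its place at the price of an error
  \<open>(C + n) * e\<close>, and \<open>e\<close> is arbitrary.\<close>

lemma L2_norm_le_by_test_functions:
  assumes f: "(\<lambda>x. complex_of_real (f x)) \<in> L2"
    and le: "\<And>\<phi>. \<phi> \<in> test_functions \<Longrightarrow> \<bar>LINT x|lborel. f x * \<phi> x\<bar> \<le> C * L2_norm (\<lambda>x. complex_of_real (\<phi> x))"
    and "0 \<le> C"
  shows "L2_norm (\<lambda>x. complex_of_real (f x)) \<le> C"
proof -
  let ?n = "L2_norm (\<lambda>x. complex_of_real (f x))"
  have "(\<lambda>x. Re (complex_of_real (f x))) \<in> borel_measurable borel"
    using L2_measurable[OF f] by measurable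
  then have [measurable]: "f \<in> borel_measurable borel" by simp
  have step: "?n * ?n \<le> C * ?n + (C + ?n) * e" if e: "e > 0" for e
  proof -
    obtain \<phi> where \<phi>: "\<phi> \<in> test_functions" "L2_norm (\<lambda>x. complex_of_real (f x) - complex_of_real (\<phi> x)) < e"
      using test_approx_all[OF f] e by (rule test_approxE)
    note p = test_L2[OF \<phi>(1)]
    have [measurable]: "\<phi> \<in> borel_measurable borel" using \<phi>(1) by (rule test_measurable)
    have i1: "integrable lborel (\<lambda>x. f x * \<phi> x)"
      by (rule Bochner_Integration.integrable_bound[OF L2_mult_integrable[OF f p]]) (auto simp: abs_mult)
    have i2: "integrable lborel (\<lambda>x. f x * (f x - \<phi> x))"
      by (rule Bochner_Integration.integrable_bound[OF L2_mult_integrable[OF f L2_diff[OF f p]]])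
        (auto simp: abs_mult norm_of_real simp flip: of_real_diff)
    have "?n * ?n = (LINT x|lborel. f x * \<phi> x + f x * (f x - \<phi> x))"
      by (simp add: power2_eq_square[symmetric] L2_norm_sq mass_def right_diff_distrib)
    also have "\<dots> = (LINT x|lborel. f x * \<phi> x) + (LINT x|lborel. f x * (f x - \<phi> x))"
      using i1 i2 by (rule Bochner_Integration.integral_add)
    finally have eq: "?n * ?n = (LINT x|lborel. f x * \<phi> x) + (LINT x|lborel. f x * (f x - \<phi> x))" .
    have "(LINT x|lborel. f x * \<phi> x) \<le> C * L2_norm (\<lambda>x. complex_of_real (\<phi> x))"
      using le[OF \<phi>(1)] by linarith
    also have "\<dots> \<le> C * (?n + e)"
      using L2_norm_reverse_triangle[OF f p] \<phi>(2) \<open>0 \<le> C\<close> by (intro mult_left_mono) linarith+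
    finally have a: "(LINT x|lborel. f x * \<phi> x) \<le> C * (?n + e)" .
    have "(LINT x|lborel. f x * (f x - \<phi> x)) \<le> (LINT x|lborel. cmod (complex_of_real (f x)) * cmod (complex_of_real (f x) - complex_of_real (\<phi> x)))"
      by (rule integral_mono[OF i2 L2_mult_integrable[OF f L2_diff[OF f p]]])
        (simp flip: of_real_diff add: norm_of_real abs_mult[symmetric])
    also have "\<dots> \<le> ?n * L2_norm (\<lambda>x. complex_of_real (f x) - complex_of_real (\<phi> x))"
      by (rule L2_Cauchy_Schwarz[OF f L2_diff[OF f p]])
    also have "\<dots> \<le> ?n * e" using \<phi>(2) by (intro mult_left_mono) auto
    finally show ?thesis using a eq by (simp add: algebra_simps)
  qed
  have "?n * ?n \<le> C * ?n"
  proof (rule field_le_epsilon)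
    fix e :: real assume e: "e > 0"
    define d where "d = C + ?n"
    have d: "0 \<le> d" using \<open>0 \<le> C\<close> by (simp add: d_def)
    then have "d * (e / (d + 1)) \<le> e" "e / (d + 1) > 0" using e by (simp_all add: field_simps)
    then show "?n * ?n \<le> C * ?n + e"
      using step[of "e / (d + 1)"] unfolding d_def by linarith
  qed
  then show ?thesis using \<open>0 \<le> C\<close> L2_norm_nonneg[of "\<lambda>x. complex_of_real (f x)"]
    by (cases "?n = 0") (auto simp: mult_le_cancel_right)
qed

section \<open>Weak derivatives as limits of difference quotients\<close>

lemma null_comparison:
  fixes f :: "nat \<Rightarrow> 'b::real_normed_vector"
  assumes "g \<longlonglongrightarrow> 0" "\<And>n. norm (f n) \<le> g n" shows "f \<longlonglongrightarrow> 0"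
  by (rule Lim_null_comparison[OF _ assms(1)]) (use assms(2) in auto)

lemma mass_0_AE:
  assumes "u \<in> L2" "mass u = 0" shows "AE x in lborel. u x = 0"
proof -
  have "AE x in lborel. (cmod (u x))\<^sup>2 = 0"
    using assms(2) integral_nonneg_eq_0_iff_AE[OF L2_integrable[OF assms(1)]] by (simp add: mass_def)
  then show ?thesis by simp
qed

lemma mass_cong_AE:
  assumes "AE x in lborel. u x = v x" and [measurable]: "u \<in> borel_measurable borel" "v \<in> borel_measurable borel"
  shows "mass u = mass v"
  unfolding mass_def by (rule integral_cong_AE) (use assms(1) in \<open>auto\<close>)

section \<open>Pairings with test functions and difference quotients\<close>

lemma test_scaleR_integrable:
  assumes "\<phi> \<in> test_functions" "u \<in> L2"
  shows "integrable lborel (\<lambda>x. \<phi> x *\<^sub>R u x)"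
  by (rule Bochner_Integration.integrable_bound[OF L2_mult_integrable[OF test_L2[OF assms(1)] assms(2)]])
    (use test_measurable[OF assms(1)] L2_measurable[OF assms(2)] in auto)

lemma test_scaleR_bound:
  assumes "(\<lambda>x. complex_of_real (\<phi> x)) \<in> L2" "u \<in> L2"
  shows "cmod (LINT x|lborel. \<phi> x *\<^sub>R u x) \<le> L2_norm (\<lambda>x. complex_of_real (\<phi> x)) * L2_norm u"
proof -
  have "cmod (LINT x|lborel. \<phi> x *\<^sub>R u x) \<le> (LINT x|lborel. cmod (\<phi> x *\<^sub>R u x))"
    by (rule integral_norm_bound)
  also have "\<dots> = (LINT x|lborel. cmod (complex_of_real (\<phi> x)) * cmod (u x))" by simp
  also have "\<dots> \<le> L2_norm (\<lambda>x. complex_of_real (\<phi> x)) * L2_norm u"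
    by (rule L2_Cauchy_Schwarz[OF assms])
  finally show ?thesis .
qed

lemma test_line_bound:
  assumes \<phi>: "\<phi> \<in> test_functions" and i: "i \<in> Basis"
    and B: "\<And>x. \<bar>frechet_derivative \<phi> (at x) i\<bar> \<le> B"
  shows "\<bar>\<phi> (x + h *\<^sub>R i) - \<phi> x\<bar> \<le> B * \<bar>h\<bar>"
proof -
  have d: "((\<lambda>s. \<phi> (x + s *\<^sub>R i)) has_real_derivative frechet_derivative \<phi> (at (x + s *\<^sub>R i)) i) (at s within UNIV)" for s
  proof -
    have "((\<lambda>s. x + s *\<^sub>R i) has_derivative (\<lambda>r. r *\<^sub>R i)) (at s)"
      by (auto intro!: derivative_eq_intros)
    from has_derivative_compose[OF this test_has_derivative[OF \<phi>]]
    have "((\<lambda>s. \<phi> (x + s *\<^sub>R i)) has_derivative (\<lambda>r. frechet_derivative \<phi> (at (x + s *\<^sub>R i)) (r *\<^sub>R i))) (at s)" .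
    moreover have "frechet_derivative \<phi> (at (x + s *\<^sub>R i)) (r *\<^sub>R i) = frechet_derivative \<phi> (at (x + s *\<^sub>R i)) i * r" for r
      using linear_scale[OF has_derivative_linear[OF test_has_derivative[OF \<phi>]]] by simp
    ultimately show ?thesis by (simp add: has_field_derivative_def)
  qed
  show ?thesis
    using field_differentiable_bound[OF convex_UNIV d, of B h 0] B by simp
qed

text \<open>The quotients converge pointwise to the partial derivative. Once the steps are below 1
  they are bounded by \<open>B\<close> and supported in the ball of radius \<open>R + 1\<close>, so
  dominated convergence applies to that tail.\<close>

lemma test_quotient_tendsto:
  assumes \<phi>: "\<phi> \<in> test_functions" and i: "i \<in> Basis" and X: "X \<longlonglongrightarrow> 0" "\<And>n. X n \<noteq> 0"
  shows "(\<lambda>n. L2_norm (\<lambda>x. complex_of_real ((\<phi> (x + X n *\<^sub>R i) - \<phi> x) / X n)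
            - complex_of_real (frechet_derivative \<phi> (at x) i))) \<longlonglongrightarrow> 0"
proof -
  let ?d = "\<lambda>x. frechet_derivative \<phi> (at x) i"
  obtain B where B: "B > 0" "\<And>x. \<bar>?d x\<bar> \<le> B"
    using test_derivative[OF \<phi> i] by (rule test_bounded) auto
  obtain R where R: "R > 0" "\<And>x. norm x \<ge> R \<Longrightarrow> \<phi> x = 0" using \<phi> by (rule test_support) auto
  have [measurable]: "\<phi> \<in> borel_measurable borel" "?d \<in> borel_measurable borel"
    using \<phi> test_derivative[OF \<phi> i] by (auto intro: test_measurable)
  obtain N where N: "\<And>n. n \<ge> N \<Longrightarrow> \<bar>X n\<bar> < 1" using LIMSEQ_D[OF X(1), of 1] by auto
  have w: "(\<lambda>x::'a. complex_of_real B * complex_of_real (indicator (ball 0 (R + 1)) x)) \<in> L2"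
    using emeasure_bounded_finite[OF bounded_ball, of "0::'a" "R + 1"] by (intro L2_cmult indicator_L2) auto
  have "(\<lambda>n. L2_norm (\<lambda>x. complex_of_real ((\<phi> (x + X (n + N) *\<^sub>R i) - \<phi> x) / X (n + N)) - complex_of_real (?d x))) \<longlonglongrightarrow> 0"
  proof (rule L2_dominated_convergence[OF w])
    show "AE x in lborel. (\<lambda>n. complex_of_real ((\<phi> (x + X (n + N) *\<^sub>R i) - \<phi> x) / X (n + N))) \<longlonglongrightarrow> complex_of_real (?d x)"
    proof (intro AE_I2 tendsto_of_real)
      fix x
      have "((\<lambda>s. x + s *\<^sub>R i) has_derivative (\<lambda>r. r *\<^sub>R i)) (at 0)"
        by (auto intro!: derivative_eq_intros)
      from has_derivative_compose[OF this, of \<phi> "frechet_derivative \<phi> (at x)"] test_has_derivative[OF \<phi>, of x]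
      have "((\<lambda>s. \<phi> (x + s *\<^sub>R i)) has_derivative (\<lambda>r. frechet_derivative \<phi> (at x) (r *\<^sub>R i))) (at 0)" by simp
      moreover have "frechet_derivative \<phi> (at x) (r *\<^sub>R i) = ?d x * r" for r
        using linear_scale[OF has_derivative_linear[OF test_has_derivative[OF \<phi>]]] by simp
      ultimately have "((\<lambda>s. \<phi> (x + s *\<^sub>R i)) has_real_derivative ?d x) (at 0)" by (simp add: has_field_derivative_def)
      then have "((\<lambda>h. (\<phi> (x + h *\<^sub>R i) - \<phi> x) / h) \<longlongrightarrow> ?d x) (at 0)" by (simp add: DERIV_def)
      then have "(\<lambda>n. (\<phi> (x + X n *\<^sub>R i) - \<phi> x) / X n) \<longlonglongrightarrow> ?d x"
        using X unfolding tendsto_at_iff_sequentially comp_def by blast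
      then show "(\<lambda>n. (\<phi> (x + X (n + N) *\<^sub>R i) - \<phi> x) / X (n + N)) \<longlonglongrightarrow> ?d x"
        by (rule LIMSEQ_ignore_initial_segment)
    qed
    show "cmod (complex_of_real ((\<phi> (x + X (n + N) *\<^sub>R i) - \<phi> x) / X (n + N)))
       \<le> cmod (complex_of_real B * complex_of_real (indicator (ball 0 (R + 1)) x))" for n x
    proof (cases "norm x < R + 1")
      case True
      have "\<bar>\<phi> (x + X (n + N) *\<^sub>R i) - \<phi> x\<bar> / \<bar>X (n + N)\<bar> \<le> B"
        using test_line_bound[OF \<phi> i B(2), of x "X (n + N)"] X(2)[of "n + N"] by (simp add: field_simps)
      then show ?thesis using True B(1) by (simp add: norm_mult norm_divide flip: of_real_diff)
    next
      case False
      have "norm (X (n + N) *\<^sub>R i) \<le> 1" using N[of "n + N"] i by simp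
      then have "norm (x + X (n + N) *\<^sub>R i) \<ge> R"
        using norm_diff_ineq[of x "X (n + N) *\<^sub>R i"] False by linarith
      then show ?thesis using R False by simp
    qed
  qed measurable
  then show ?thesis by (rule LIMSEQ_offset)
qed

text \<open>By duality the increment of \<open>f\<close> need only be tested against \<phi>. Moving
  the translation onto \<phi> gives k(s), the integral of \<phi>(x - s i) f(x), whose derivative is
  the integral of \<phi>(x - s i) g(x) by the weak identity. That is bounded uniformly in s by the
  product of the norms, and the mean value inequality finishes.\<close>

lemma real_weak_derivative_shift_bound:
  fixes f g :: "'a::euclidean_space \<Rightarrow> real"
  assumes f: "(\<lambda>x. complex_of_real (f x)) \<in> L2" and g: "(\<lambda>x. complex_of_real (g x)) \<in> L2" and i: "i \<in> Basis"
    and wd: "\<And>\<phi>. \<phi> \<in> test_functions \<Longrightarrow> (LINT x|lborel. frechet_derivative \<phi> (at x) i * f x) = - (LINT x|lborel. \<phi> x * g x)"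
  shows "L2_norm (\<lambda>x. complex_of_real (f (x + t *\<^sub>R i) - f x)) \<le> \<bar>t\<bar> * L2_norm (\<lambda>x. complex_of_real (g x))"
proof (rule L2_norm_le_by_test_functions)
  have "(\<lambda>x. Re (complex_of_real (f x))) \<in> borel_measurable borel" using L2_measurable[OF f] by measurable
  then have fm [measurable]: "f \<in> borel_measurable borel" by simp
  have fL: "(\<lambda>x. complex_of_real (f (x + t *\<^sub>R i))) \<in> L2" for t using L2_shift[OF f] .
  from L2_diff[OF fL f] show "(\<lambda>x. complex_of_real (f (x + t *\<^sub>R i) - f x)) \<in> L2" by simp
  fix \<phi> :: "'a \<Rightarrow> real" assume \<phi>: "\<phi> \<in> test_functions"
  let ?d = "\<lambda>x. frechet_derivative \<phi> (at x) i"
  have [measurable]: "\<phi> \<in> borel_measurable borel" "?d \<in> borel_measurable borel"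
    using \<phi> test_derivative[OF \<phi> i] by (auto intro: test_measurable)
  have int: "integrable lborel (\<lambda>x. \<psi> x * f x)" if "(\<lambda>x. complex_of_real (\<psi> x)) \<in> L2" "\<psi> \<in> borel_measurable borel" for \<psi> :: "'a \<Rightarrow> real"
    by (rule Bochner_Integration.integrable_bound[OF L2_mult_integrable[OF that(1) f]]) (use that(2) in \<open>auto simp: abs_mult\<close>)
  have bound: "\<bar>LINT x|lborel. \<psi> x * q x\<bar> \<le> L2_norm (\<lambda>x. complex_of_real (\<psi> x)) * L2_norm (\<lambda>x. complex_of_real (q x))"
    if "(\<lambda>x. complex_of_real (\<psi> x)) \<in> L2" "(\<lambda>x. complex_of_real (q x)) \<in> L2" for \<psi> q :: "'a \<Rightarrow> real"
    using test_scaleR_bound[OF that] by (simp add: scaleR_conv_of_real flip: of_real_mult)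
  define k where "k s = (LINT x|lborel. \<phi> (x - s *\<^sub>R i) * f x)" for s
  define k' where "k' s = - (LINT x|lborel. ?d (x - s *\<^sub>R i) * f x)" for s
  have tr: "(\<lambda>x. \<phi> (x - y)) \<in> test_functions" "(\<lambda>x. ?d (x - y)) \<in> test_functions" for y
    using test_translate[OF \<phi>, of "-y"] test_translate[OF test_derivative[OF \<phi> i], of "-y"] by simp_all
  have trd: "frechet_derivative (\<lambda>x. \<phi> (x - y)) (at x) i = ?d (x - y)" for x y
  proof -
    have "((\<lambda>x. \<phi> (x - y)) has_derivative frechet_derivative \<phi> (at (x - y))) (at x)"
    proof (rule has_derivative_compose[OF _ test_has_derivative[OF \<phi>]])
      show "((\<lambda>x. x - y) has_derivative (\<lambda>h. h)) (at x)" by (auto intro!: derivative_eq_intros)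
    qed
    then show ?thesis by (simp add: frechet_derivative_at[symmetric])
  qed
  have k'_eq: "k' s = (LINT x|lborel. \<phi> (x - s *\<^sub>R i) * g x)" for s
    unfolding k'_def using wd[OF tr(1)[of "s *\<^sub>R i"]] by (simp add: trd)
  have k'_le: "\<bar>k' s\<bar> \<le> L2_norm (\<lambda>x. complex_of_real (\<phi> x)) * L2_norm (\<lambda>x. complex_of_real (g x))" for s
    unfolding k'_eq using bound[OF test_L2[OF tr(1)[of "s *\<^sub>R i"]] g] mass_shift[OF test_L2[OF \<phi>], of "- (s *\<^sub>R i)"]
    by (simp add: L2_norm_mass)
  have "(k has_real_derivative k' s) (at s)" for s
    unfolding DERIV_def tendsto_at_iff_sequentially comp_def
  proof (intro allI impI)
    fix X :: "nat \<Rightarrow> real" assume X: "\<forall>n. X n \<in> UNIV - {0}" "X \<longlonglongrightarrow> 0"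
    \<comment> \<open>Increasing \<open>s\<close> moves \<phi> against the direction
      \<open>i\<close>, so the relevant difference quotient of \<phi> has step
      \<open>- X n\<close>.\<close>
    define e where "e n x = (\<phi> (x + (- X n) *\<^sub>R i) - \<phi> x) / (- X n) - ?d x" for n x
    have e_meas [measurable]: "e n \<in> borel_measurable borel" for n unfolding e_def by measurable
    have eL: "(\<lambda>x. complex_of_real (e n x)) \<in> L2" for n
    proof -
      have "(\<lambda>x. complex_of_real (1 / - X n) * (complex_of_real (\<phi> (x + (- X n) *\<^sub>R i)) - complex_of_real (\<phi> x)) - complex_of_real (?d x)) \<in> L2"
        by (rule L2_diff[OF L2_cmult[OF L2_diff[OF L2_shift[OF test_L2[OF \<phi>]] test_L2[OF \<phi>]]] test_L2[OF test_derivative[OF \<phi> i]]])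
      then show ?thesis unfolding e_def by (simp add: field_simps)
    qed
    have lim: "(\<lambda>n. L2_norm (\<lambda>x. complex_of_real (e n x)) * L2_norm (\<lambda>x. complex_of_real (f x))) \<longlonglongrightarrow> 0"
    proof (rule tendsto_mult_left_zero)
      have "(\<lambda>n. - X n) \<longlonglongrightarrow> 0" using tendsto_minus[OF X(2)] by simp
      from test_quotient_tendsto[OF \<phi> i this] X(1)
      show "(\<lambda>n. L2_norm (\<lambda>x. complex_of_real (e n x))) \<longlonglongrightarrow> 0"
        unfolding e_def by simp
    qed
    have le: "\<bar>(k (s + X n) - k s) / X n - k' s\<bar> \<le> L2_norm (\<lambda>x. complex_of_real (e n x)) * L2_norm (\<lambda>x. complex_of_real (f x))" for n
    proof -
      have X0: "X n \<noteq> 0" using X(1) by simp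
      have "e n (x - s *\<^sub>R i) * f x = (-1 / X n) * (\<phi> (x - (s + X n) *\<^sub>R i) * f x) + (1 / X n) * (\<phi> (x - s *\<^sub>R i) * f x) - ?d (x - s *\<^sub>R i) * f x" for x
        unfolding e_def using X0 by (simp add: field_simps scaleR_add_left)
      then have "(LINT x|lborel. e n (x - s *\<^sub>R i) * f x) = (-1 / X n) * k (s + X n) + (1 / X n) * k s + k' s"
        unfolding k_def k'_def using int[OF test_L2[OF tr(1)] test_measurable[OF tr(1)]] int[OF test_L2[OF tr(2)] test_measurable[OF tr(2)]]
        by simp
      then have "\<bar>(k (s + X n) - k s) / X n - k' s\<bar> = \<bar>LINT x|lborel. e n (x - s *\<^sub>R i) * f x\<bar>"
        by (simp add: diff_divide_distrib)
      also have "\<dots> \<le> L2_norm (\<lambda>x. complex_of_real (e n (x - s *\<^sub>R i))) * L2_norm (\<lambda>x. complex_of_real (f x))"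
        using bound[OF L2_shift[OF eL[of n], where h = "- (s *\<^sub>R i)"] f] by simp
      also have "L2_norm (\<lambda>x. complex_of_real (e n (x - s *\<^sub>R i))) = L2_norm (\<lambda>x. complex_of_real (e n x))"
        using mass_shift[OF eL[of n], where h = "- (s *\<^sub>R i)"] by (simp add: L2_norm_mass)
      finally show ?thesis .
    qed
    have "(\<lambda>n. (k (s + X n) - k s) / X n - k' s) \<longlonglongrightarrow> 0"
      by (rule Lim_null_comparison[OF _ lim]) (use le in auto)
    then show "(\<lambda>n. (k (s + X n) - k s) / X n) \<longlonglongrightarrow> k' s" by (simp add: LIM_zero_iff)
  qed
  then have "\<bar>k t - k 0\<bar> \<le> (L2_norm (\<lambda>x. complex_of_real (\<phi> x)) * L2_norm (\<lambda>x. complex_of_real (g x))) * \<bar>t - 0\<bar>"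
    using field_differentiable_bound[OF convex_UNIV, of k k' "L2_norm (\<lambda>x. complex_of_real (\<phi> x)) * L2_norm (\<lambda>x. complex_of_real (g x))" t 0] k'_le by simp
  moreover have "(LINT x|lborel. (f (x + t *\<^sub>R i) - f x) * \<phi> x) = k t - k 0"
  proof -
    have i1: "integrable lborel (\<lambda>x. \<phi> (x - t *\<^sub>R i) * f x)"
      by (rule int[OF test_L2[OF tr(1)] test_measurable[OF tr(1)]])
    have i2: "integrable lborel (\<lambda>x. \<phi> x * f (x + t *\<^sub>R i))"
      using integrable_shift[OF i1, of "t *\<^sub>R i"] by simp
    have "k t = (LINT x|lborel. \<phi> x * f (x + t *\<^sub>R i))"
      unfolding k_def using integral_shift[of "\<lambda>x. \<phi> (x - t *\<^sub>R i) * f x" "t *\<^sub>R i"] by simp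
    moreover have "(LINT x|lborel. (f (x + t *\<^sub>R i) - f x) * \<phi> x) = (LINT x|lborel. \<phi> x * f (x + t *\<^sub>R i)) - k 0"
      unfolding k_def using i2 int[OF test_L2[OF \<phi>] test_measurable[OF \<phi>]]
      by (subst Bochner_Integration.integral_diff[symmetric]) (auto simp: algebra_simps)
    ultimately show ?thesis by simp
  qed
  ultimately show "\<bar>LINT x|lborel. (f (x + t *\<^sub>R i) - f x) * \<phi> x\<bar> \<le> \<bar>t\<bar> * L2_norm (\<lambda>x. complex_of_real (g x)) * L2_norm (\<lambda>x. complex_of_real (\<phi> x))"
    by (simp add: mult_ac)
qed simp

lemma L2_Re_Im:
  assumes "u \<in> L2"
  shows "(\<lambda>x. complex_of_real (Re (u x))) \<in> L2" "(\<lambda>x. complex_of_real (Im (u x))) \<in> L2"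
  by (rule L2_dominated[OF assms, where C = 1]; use L2_measurable[OF assms] abs_Re_le_cmod abs_Im_le_cmod in simp)+

lemma mass_Re_Im:
  assumes "u \<in> L2"
  shows "mass u = mass (\<lambda>x. complex_of_real (Re (u x))) + mass (\<lambda>x. complex_of_real (Im (u x)))"
  unfolding mass_def using L2_Re_Im[OF assms, THEN L2_integrable]
  by (subst Bochner_Integration.integral_add[symmetric]) (auto simp: cmod_power2)

text \<open>Test functions are real-valued, so taking real and imaginary parts commutes with the
  pairing.\<close>

lemma has_weak_partial_Re_Im:
  assumes "has_weak_partial i u g" "u \<in> L2" "g \<in> L2" "\<phi> \<in> test_functions" "i \<in> Basis"
  shows "(LINT x|lborel. frechet_derivative \<phi> (at x) i * Re (u x)) = - (LINT x|lborel. \<phi> x * Re (g x))"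
    "(LINT x|lborel. frechet_derivative \<phi> (at x) i * Im (u x)) = - (LINT x|lborel. \<phi> x * Im (g x))"
proof -
  have "(LINT x|lborel. frechet_derivative \<phi> (at x) i *\<^sub>R u x) = - (LINT x|lborel. \<phi> x *\<^sub>R g x)"
    using assms by (simp add: has_weak_partial_def)
  moreover have i: "integrable lborel (\<lambda>x. frechet_derivative \<phi> (at x) i *\<^sub>R u x)" "integrable lborel (\<lambda>x. \<phi> x *\<^sub>R g x)"
    using assms by (auto intro: test_scaleR_integrable test_derivative)
  ultimately show "(LINT x|lborel. frechet_derivative \<phi> (at x) i * Re (u x)) = - (LINT x|lborel. \<phi> x * Re (g x))"
    "(LINT x|lborel. frechet_derivative \<phi> (at x) i * Im (u x)) = - (LINT x|lborel. \<phi> x * Im (g x))"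
    using integral_Re[OF i(1)] integral_Re[OF i(2)] integral_Im[OF i(1)] integral_Im[OF i(2)] by simp_all
qed

lemma weak_partial_shift_bound:
  assumes "has_weak_partial i u g" "u \<in> L2" "g \<in> L2" "i \<in> Basis"
  shows "mass (\<lambda>x. u (x + t *\<^sub>R i) - u x) \<le> mass g * t\<^sup>2"
proof -
  have "(L2_norm (\<lambda>x. complex_of_real (Re (u (x + t *\<^sub>R i)) - Re (u x))))\<^sup>2 \<le> (\<bar>t\<bar> * L2_norm (\<lambda>x. complex_of_real (Re (g x))))\<^sup>2"
    "(L2_norm (\<lambda>x. complex_of_real (Im (u (x + t *\<^sub>R i)) - Im (u x))))\<^sup>2 \<le> (\<bar>t\<bar> * L2_norm (\<lambda>x. complex_of_real (Im (g x))))\<^sup>2"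
    using real_weak_derivative_shift_bound[OF L2_Re_Im(1) L2_Re_Im(1) assms(4) has_weak_partial_Re_Im(1)]
      real_weak_derivative_shift_bound[OF L2_Re_Im(2) L2_Re_Im(2) assms(4) has_weak_partial_Re_Im(2)] assms
    by (auto intro!: power_mono simp del: of_real_diff minus_complex.sel)
  then have "mass (\<lambda>x. complex_of_real (Re (u (x + t *\<^sub>R i)) - Re (u x))) \<le> t\<^sup>2 * mass (\<lambda>x. complex_of_real (Re (g x)))"
    "mass (\<lambda>x. complex_of_real (Im (u (x + t *\<^sub>R i)) - Im (u x))) \<le> t\<^sup>2 * mass (\<lambda>x. complex_of_real (Im (g x)))"
    by (simp_all add: L2_norm_sq power_mult_distrib)
  then show ?thesis
    using mass_Re_Im[OF L2_diff[OF L2_shift[OF assms(2)] assms(2)], of "t *\<^sub>R i"] mass_Re_Im[OF assms(3)]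
    by (simp add: algebra_simps)
qed

text \<open>The difference of two candidates is annihilated by every test function, so the duality
  bound holds for it with constant 0.\<close>

lemma weak_partial_unique:
  assumes "has_weak_partial i u g" "has_weak_partial i u h" "u \<in> L2" "g \<in> L2" "h \<in> L2" "i \<in> Basis"
  shows "AE x in lborel. g x = h x"
proof -
  let ?d = "\<lambda>x. g x - h x"
  have dL: "?d \<in> L2" by (intro L2_diff assms)
  have eq: "(LINT x|lborel. \<phi> x *\<^sub>R ?d x) = 0" if "\<phi> \<in> test_functions" for \<phi>
    using assms(1,2) that test_scaleR_integrable[OF that] assms(4,5)
    by (simp add: has_weak_partial_def scaleR_diff_right)
  have "(LINT x|lborel. \<phi> x * Re (?d x)) = 0" "(LINT x|lborel. \<phi> x * Im (?d x)) = 0" if "\<phi> \<in> test_functions" for \<phi>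
    using eq[OF that] integral_Re[OF test_scaleR_integrable[OF that dL]] integral_Im[OF test_scaleR_integrable[OF that dL]]
    by simp_all
  then have "L2_norm (\<lambda>x. complex_of_real (Re (?d x))) \<le> 0" "L2_norm (\<lambda>x. complex_of_real (Im (?d x))) \<le> 0"
    using L2_Re_Im[OF dL] by (auto intro!: L2_norm_le_by_test_functions simp: mult.commute[of _ "_ (_ :: 'a) :: real"] simp del: minus_complex.sel)
  then have "mass (\<lambda>x. complex_of_real (Re (?d x))) = 0" "mass (\<lambda>x. complex_of_real (Im (?d x))) = 0"
    by (simp_all add: L2_norm_mass antisym)
  then have "mass ?d = 0" using mass_Re_Im[OF dL] by simp
  from mass_0_AE[OF dL this] show ?thesis by simp
qed

section \<open>Weak sequential limits from midpoint convexity\<close>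

text \<open>A dyadic version of the convex hull of the tail from index \<open>n\<close> on. Binary
  midpoints suffice, since the parallelogram law only ever compares two functions with their
  midpoint.\<close>

inductive_set midpoint_closure :: "(nat \<Rightarrow> 'a \<Rightarrow> complex) \<Rightarrow> nat \<Rightarrow> ('a \<Rightarrow> complex) set"
  for v :: "nat \<Rightarrow> 'a \<Rightarrow> complex" and n :: nat where
  tail: "n \<le> k \<Longrightarrow> v k \<in> midpoint_closure v n"
| midpoint: "f \<in> midpoint_closure v n \<Longrightarrow> g \<in> midpoint_closure v n \<Longrightarrow> (\<lambda>x. (f x + g x) / 2) \<in> midpoint_closure v n"

lemma midpoint_closure_antimono: "m \<le> n \<Longrightarrow> f \<in> midpoint_closure v n \<Longrightarrow> f \<in> midpoint_closure v m"
  by (rotate_tac, induction rule: midpoint_closure.induct) (auto intro: midpoint_closure.intros)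

lemma L2_midpoint: "f \<in> L2 \<Longrightarrow> g \<in> L2 \<Longrightarrow> (\<lambda>x. (f x + g x) / 2) \<in> L2"
  using L2_cmult[OF L2_add, of f g "1/2"] by simp

lemma midpoint_closure_L2:
  assumes "\<And>k. v k \<in> L2" "\<And>k. mass (v k) \<le> C" "f \<in> midpoint_closure v n"
  shows "f \<in> L2 \<and> mass f \<le> C"
  using assms(3)
proof induction
  case (midpoint f g)
  then have L2: "f \<in> L2" "g \<in> L2" and m: "mass f \<le> C" "mass g \<le> C" by auto
  have "mass (\<lambda>x. (f x + g x) / 2) \<le> C"
  proof -
    have "a \<le> C" if "a + b = (c + d) / 2" "0 \<le> b" "c \<le> C" "d \<le> C" for a b c d :: real
      using that by (simp add: field_simps)
    from this[OF mass_parallelogram[OF L2] mass_nonneg m] show ?thesis .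
  qed
  with L2_midpoint[OF L2] show ?case by simp
qed (use assms in auto)

text \<open>Discs in the complex plane are convex, so an estimate valid for the tail persists on its
  midpoint hull.\<close>

lemma midpoint_closure_functional:
  assumes "\<And>k. v k \<in> L2" "\<And>k. mass (v k) \<le> C" "f \<in> midpoint_closure v n" "\<phi> \<in> test_functions"
    and "\<And>k. k \<ge> n \<Longrightarrow> cmod ((LINT x|lborel. \<phi> x *\<^sub>R v k x) - l) \<le> e"
  shows "cmod ((LINT x|lborel. \<phi> x *\<^sub>R f x) - l) \<le> e"
  using assms(3)
proof induction
  case (midpoint f g)
  have L2: "f \<in> L2" "g \<in> L2" using midpoint.hyps midpoint_closure_L2[OF assms(1,2)] by auto
  have "(LINT x|lborel. \<phi> x *\<^sub>R ((f x + g x) / 2)) = (LINT x|lborel. (1/2) * (\<phi> x *\<^sub>R f x + \<phi> x *\<^sub>R g x))"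
    by (simp add: scaleR_conv_of_real field_simps)
  also have "\<dots> = (1/2) * ((LINT x|lborel. \<phi> x *\<^sub>R f x) + (LINT x|lborel. \<phi> x *\<^sub>R g x))"
    using test_scaleR_integrable[OF assms(4) L2(1)] test_scaleR_integrable[OF assms(4) L2(2)]
    by (subst integral_mult_right_zero) (simp only: Bochner_Integration.integral_add)
  finally have "(LINT x|lborel. \<phi> x *\<^sub>R ((f x + g x) / 2)) - l =
     (1/2) * ((LINT x|lborel. \<phi> x *\<^sub>R f x) - l) + (1/2) * ((LINT x|lborel. \<phi> x *\<^sub>R g x) - l)"
    by (simp add: algebra_simps)
  then show ?case
    using norm_triangle_ineq[of "(1/2) * ((LINT x|lborel. \<phi> x *\<^sub>R f x) - l)" "(1/2) * ((LINT x|lborel. \<phi> x *\<^sub>R g x) - l)"] midpoint.IH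
    by (simp add: norm_mult norm_divide)
qed (use assms in auto)

text \<open>
  Weak sequential compactness without a dual space: almost norm-minimal elements of the
  midpoint-convex hulls of the tails form a Cauchy sequence by the parallelogram law.
\<close>

lemma L2_weak_limit:
  assumes L2: "\<And>k. v k \<in> L2" and le: "\<And>k. mass (v k) \<le> C"
    and lim: "\<And>\<phi>. \<phi> \<in> test_functions \<Longrightarrow> (\<lambda>k. LINT x|lborel. \<phi> x *\<^sub>R v k x) \<longlonglongrightarrow> l \<phi>"
  obtains g where "g \<in> L2" "mass g \<le> C" "\<And>\<phi>. \<phi> \<in> test_functions \<Longrightarrow> (LINT x|lborel. \<phi> x *\<^sub>R g x) = l \<phi>"
proof -
  \<comment> \<open>The least mass in the hull of the \<open>n\<close>-th tail. The hulls shrink, so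
    \<open>d\<close> increases; it stays below \<open>C\<close> and therefore converges.\<close>
  define d where "d n = Inf (mass ` midpoint_closure v n)" for n
  have ne: "midpoint_closure v n \<noteq> {}" for n using midpoint_closure.tail[of n n v] by auto
  have bdd: "bdd_below (mass ` midpoint_closure v n)" for n by (auto intro!: bdd_belowI[of _ 0])
  have d_le: "d n \<le> mass f" if "f \<in> midpoint_closure v n" for n f
    unfolding d_def using that bdd by (auto intro: cInf_lower)
  have dC: "d n \<le> C" for n
    using d_le[OF midpoint_closure.tail[of n n v]] le[of n] by simp
  have "incseq d"
    unfolding incseq_def d_def
  proof (intro allI impI cInf_superset_mono image_mono subsetI)
    show "f \<in> midpoint_closure v m" if "m \<le> n" "f \<in> midpoint_closure v n" for m n f
      using that by (rule midpoint_closure_antimono)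
  qed (use ne bdd in auto)
  then obtain D where D: "d \<longlonglongrightarrow> D" using dC incseq_convergent[of d C] by blast
  have dD: "d n \<le> D" for n using \<open>incseq d\<close> D by (rule incseq_le)
  have "\<exists>f\<in>midpoint_closure v n. mass f < d n + 1 / real (Suc n)" for n
    using cInf_lessD[of "mass ` midpoint_closure v n" "d n + 1 / real (Suc n)"] ne[of n]
    by (auto simp: d_def)
  then obtain y where y: "\<And>n. y n \<in> midpoint_closure v n" "\<And>n. mass (y n) < d n + 1 / real (Suc n)"
    by metis
  have yL: "y n \<in> L2" "mass (y n) \<le> C" for n using midpoint_closure_L2[OF L2 le y(1)] by auto
  \<comment> \<open>The midpoint has mass at least \<open>d N\<close>, the two elements at most
    \<open>D + 1 / Suc N\<close>; the parallelogram law leaves only this gap for the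
    half-difference.\<close>
  have close: "mass (\<lambda>x. (y m x - y n x) / 2) \<le> (D - d N) + 1 / real (Suc N)" if "m \<ge> N" "n \<ge> N" for m n N
  proof -
    have "d N \<le> mass (\<lambda>x. (y m x + y n x) / 2)"
      using midpoint_closure_antimono[OF that(1) y(1)] midpoint_closure_antimono[OF that(2) y(1)]
      by (intro d_le midpoint_closure.midpoint)
    moreover have "mass (y m) \<le> D + 1 / real (Suc N)" if "m \<ge> N" for m
    proof -
      have "1 / real (Suc m) \<le> 1 / real (Suc N)" using that by (intro divide_left_mono) auto
      then show ?thesis using y(2)[of m] dD[of m] by linarith
    qed
    from this[OF that(1)] this[OF that(2)] have "(mass (y m) + mass (y n)) / 2 \<le> D + 1 / real (Suc N)" by simp
    ultimately show ?thesis using mass_parallelogram[OF yL(1) yL(1), of m n] by linarith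
  qed
  have lim0: "(\<lambda>N. 4 * ((D - d N) + 1 / real (Suc N))) \<longlonglongrightarrow> 4 * ((D - D) + 0)"
    by (intro tendsto_intros D) (use LIMSEQ_inverse_real_of_nat in \<open>simp add: inverse_eq_divide\<close>)
  obtain g where g: "g \<in> L2" "(\<lambda>n. L2_norm (\<lambda>x. y n x - g x)) \<longlonglongrightarrow> 0"
  proof (rule L2_complete[of y, OF yL(1)])
    fix e :: real assume e: "e > 0"
    then have "e\<^sup>2 > 0" by simp
    from order_tendstoD(2)[OF lim0, of "e\<^sup>2"] this obtain N where N: "4 * ((D - d N) + 1 / real (Suc N)) < e\<^sup>2"
      by (auto simp: eventually_sequentially)
    show "\<exists>N. \<forall>m\<ge>N. \<forall>n\<ge>N. L2_norm (\<lambda>x. y m x - y n x) < e"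
    proof (intro exI allI impI)
      fix m n assume "m \<ge> N" "n \<ge> N"
      from close[OF this] have "mass (\<lambda>x. y m x - y n x) < e\<^sup>2"
        using N mass_cmult[of "1/2" "\<lambda>x. y m x - y n x"] by (simp add: norm_divide power_divide)
      then show "L2_norm (\<lambda>x. y m x - y n x) < e"
        using e by (simp add: L2_norm_mass real_less_lsqrt)
    qed
  qed auto
  show ?thesis
  proof
    show "g \<in> L2" by fact
    have "L2_norm g \<le> sqrt C"
    proof (rule LIMSEQ_le_const2)
      have "L2_norm (\<lambda>x. y n x - g x) \<ge> \<bar>L2_norm (y n) - L2_norm g\<bar>" for n
        by (rule L2_norm_reverse_triangle[OF yL(1) g(1)])
      then have "(\<lambda>n. L2_norm (y n) - L2_norm g) \<longlonglongrightarrow> 0"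
        by (intro Lim_null_comparison[OF _ g(2)]) auto
      then show "(\<lambda>n. L2_norm (y n)) \<longlonglongrightarrow> L2_norm g" by (simp add: LIM_zero_iff)
      show "\<exists>N. \<forall>n\<ge>N. L2_norm (y n) \<le> sqrt C" using yL(2) by (auto simp: L2_norm_mass)
    qed
    then show "mass g \<le> C" by (simp add: L2_norm_mass)
    fix \<phi> :: "'a \<Rightarrow> real" assume \<phi>: "\<phi> \<in> test_functions"
    have "(\<lambda>n. LINT x|lborel. \<phi> x *\<^sub>R y n x) \<longlonglongrightarrow> l \<phi>"
    proof (rule LIMSEQ_I)
      fix e :: real assume "e > 0"
      then obtain N where N: "\<And>k. k \<ge> N \<Longrightarrow> cmod ((LINT x|lborel. \<phi> x *\<^sub>R v k x) - l \<phi>) < e / 2"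
        using LIMSEQ_D[OF lim[OF \<phi>], of "e/2"] by auto
      have "cmod ((LINT x|lborel. \<phi> x *\<^sub>R y n x) - l \<phi>) \<le> e / 2" if "n \<ge> N" for n
        by (rule midpoint_closure_functional[OF L2 le y(1) \<phi>]) (use N that in \<open>auto intro: less_imp_le order_trans\<close>)
      then show "\<exists>no. \<forall>n\<ge>no. norm ((LINT x|lborel. \<phi> x *\<^sub>R y n x) - l \<phi>) < e"
        using \<open>e > 0\<close> by (intro exI[of _ N] allI impI) (rule order_le_less_trans[of _ "e/2"], auto)
    qed
    moreover have "(\<lambda>n. LINT x|lborel. \<phi> x *\<^sub>R y n x) \<longlonglongrightarrow> (LINT x|lborel. \<phi> x *\<^sub>R g x)"
    proof -
      have "(\<lambda>n. L2_norm (\<lambda>x. complex_of_real (\<phi> x)) * L2_norm (\<lambda>x. y n x - g x)) \<longlonglongrightarrow> 0"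
        using tendsto_mult_right_zero[OF g(2)] .
      moreover have "cmod ((LINT x|lborel. \<phi> x *\<^sub>R y n x) - (LINT x|lborel. \<phi> x *\<^sub>R g x)) \<le>
         L2_norm (\<lambda>x. complex_of_real (\<phi> x)) * L2_norm (\<lambda>x. y n x - g x)" for n
        using test_scaleR_bound[OF test_L2[OF \<phi>] L2_diff[OF yL(1) g(1)], of n]
          test_scaleR_integrable[OF \<phi> yL(1)] test_scaleR_integrable[OF \<phi> g(1)]
        by (simp add: scaleR_diff_right)
      ultimately have "(\<lambda>n. (LINT x|lborel. \<phi> x *\<^sub>R y n x) - (LINT x|lborel. \<phi> x *\<^sub>R g x)) \<longlonglongrightarrow> 0"
        by (rule null_comparison)
      then show ?thesis by (simp add: LIM_zero_iff)
    qed
    ultimately show "(LINT x|lborel. \<phi> x *\<^sub>R g x) = l \<phi>" by (metis LIMSEQ_unique)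
  qed
qed

text \<open>The converse of the shift bound. The hypothesis bounds the mass of the difference
  quotients by \<open>C\<close>; a change of variables moves them onto the test function, where they
  converge, and the weak limit is the derivative sought.\<close>

lemma weak_partial_exists:
  assumes u: "u \<in> L2" and i: "i \<in> Basis"
    and le: "\<And>t. mass (\<lambda>x. u (x + t *\<^sub>R i) - u x) \<le> C * t\<^sup>2"
  obtains g where "g \<in> L2" "mass g \<le> C" "has_weak_partial i u g"
proof -
  define t where "t k = inverse (real (Suc k))" for k
  have t: "t k > 0" for k by (simp add: t_def)
  define v where "v k x = (u (x + t k *\<^sub>R i) - u x) / complex_of_real (t k)" for k x
  have vL: "v k \<in> L2" for k
    using L2_cmult[OF L2_diff[OF L2_shift[OF u] u], of "1 / complex_of_real (t k)"] by (simp add: v_def[abs_def])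
  have vC: "mass (v k) \<le> C" for k
  proof -
    have "mass (v k) = mass (\<lambda>x. u (x + t k *\<^sub>R i) - u x) / (t k)\<^sup>2"
      using mass_cmult[of "1 / complex_of_real (t k)" "\<lambda>x. u (x + t k *\<^sub>R i) - u x"]
      by (simp add: v_def[abs_def] norm_divide power_divide)
    also have "\<dots> \<le> C" using le[of "t k"] t[of k] by (simp add: field_simps)
    finally show ?thesis .
  qed
  have lim: "(\<lambda>k. LINT x|lborel. \<phi> x *\<^sub>R v k x) \<longlonglongrightarrow> - (LINT x|lborel. frechet_derivative \<phi> (at x) i *\<^sub>R u x)"
    if \<phi>: "\<phi> \<in> test_functions" for \<phi>
  proof -
    \<comment> \<open>After the change of variables the forward quotient of \<open>u\<close>
      becomes, up to sign, the quotient of \<phi> with step \<open>- t k\<close>; \<open>e k\<close>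
      is its deviation from the derivative.\<close>
    define e where "e k x = (\<phi> (x + (- t k) *\<^sub>R i) - \<phi> x) / (- t k) - frechet_derivative \<phi> (at x) i" for k x
    have tr: "(\<lambda>x. \<phi> (x - t k *\<^sub>R i)) \<in> test_functions" for k
      using test_translate[OF \<phi>, of "- (t k *\<^sub>R i)"] by simp
    have eT: "e k \<in> test_functions" for k
    proof -
      have "(\<lambda>x. ((- 1 / t k) * \<phi> (x - t k *\<^sub>R i) + (1 / t k) * \<phi> x) + (-1) * frechet_derivative \<phi> (at x) i) \<in> test_functions"
        by (intro test_add test_cmult tr \<phi> test_derivative i)
      moreover have "((- 1 / t k) * \<phi> (x - t k *\<^sub>R i) + (1 / t k) * \<phi> x) + (-1) * frechet_derivative \<phi> (at x) i = e k x" for x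
        unfolding e_def using t[of k] by (simp add: field_simps)
      ultimately show ?thesis by simp
    qed
    have eq: "(LINT x|lborel. \<phi> x *\<^sub>R v k x) = - (LINT x|lborel. frechet_derivative \<phi> (at x) i *\<^sub>R u x) - (LINT x|lborel. e k x *\<^sub>R u x)" for k
    proof -
      have i1: "integrable lborel (\<lambda>x. \<phi> (x - t k *\<^sub>R i) *\<^sub>R u x)" by (rule test_scaleR_integrable[OF tr u])
      have i2: "integrable lborel (\<lambda>x. \<phi> x *\<^sub>R u (x + t k *\<^sub>R i))"
        using integrable_shift[OF i1, of "t k *\<^sub>R i"] by simp
      have i3: "integrable lborel (\<lambda>x. \<phi> x *\<^sub>R u x)" by (rule test_scaleR_integrable[OF \<phi> u])
      have s: "(LINT x|lborel. \<phi> (x - t k *\<^sub>R i) *\<^sub>R u x) = (LINT x|lborel. \<phi> x *\<^sub>R u (x + t k *\<^sub>R i))"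
        using integral_shift[of "\<lambda>x. \<phi> (x - t k *\<^sub>R i) *\<^sub>R u x" "t k *\<^sub>R i"] borel_measurable_integrable[OF i1] by simp
      have "(LINT x|lborel. \<phi> x *\<^sub>R v k x) = (LINT x|lborel. (1 / t k) *\<^sub>R (\<phi> x *\<^sub>R u (x + t k *\<^sub>R i)) - (1 / t k) *\<^sub>R (\<phi> x *\<^sub>R u x))"
        by (intro Bochner_Integration.integral_cong) (simp_all add: v_def scaleR_conv_of_real right_diff_distrib diff_divide_distrib)
      also have "\<dots> = (1 / t k) *\<^sub>R (LINT x|lborel. \<phi> (x - t k *\<^sub>R i) *\<^sub>R u x) - (1 / t k) *\<^sub>R (LINT x|lborel. \<phi> x *\<^sub>R u x)"
        using i2 i3 s by (simp del: scaleR_scaleR)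
      also have "\<dots> = (LINT x|lborel. (1 / t k) *\<^sub>R (\<phi> (x - t k *\<^sub>R i) *\<^sub>R u x) - (1 / t k) *\<^sub>R (\<phi> x *\<^sub>R u x))"
        using i1 i3 by (simp del: scaleR_scaleR)
      also have "\<dots> = (LINT x|lborel. - (frechet_derivative \<phi> (at x) i *\<^sub>R u x) - e k x *\<^sub>R u x)"
        unfolding e_def using t[of k] by (intro Bochner_Integration.integral_cong) (simp_all add: scaleR_conv_of_real field_simps)
      also have "\<dots> = - (LINT x|lborel. frechet_derivative \<phi> (at x) i *\<^sub>R u x) - (LINT x|lborel. e k x *\<^sub>R u x)"
        using test_scaleR_integrable[OF test_derivative[OF \<phi> i] u] test_scaleR_integrable[OF eT u] by simp
      finally show ?thesis .
    qed
    have "(\<lambda>k. L2_norm (\<lambda>x. complex_of_real (e k x)) * L2_norm u) \<longlonglongrightarrow> 0"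
    proof (rule tendsto_mult_left_zero)
      have "(\<lambda>n. - t n) \<longlonglongrightarrow> 0" using tendsto_minus[OF LIMSEQ_inverse_real_of_nat] by (simp add: t_def[abs_def])
      from test_quotient_tendsto[OF \<phi> i this] t
      show "(\<lambda>n. L2_norm (\<lambda>x. complex_of_real (e n x))) \<longlonglongrightarrow> 0"
        unfolding e_def by (simp add: less_imp_neq[THEN not_sym])
    qed
    then have "(\<lambda>k. LINT x|lborel. e k x *\<^sub>R u x) \<longlonglongrightarrow> 0"
      by (rule Lim_null_comparison[rotated]) (use test_scaleR_bound[OF test_L2[OF eT] u] in auto)
    from tendsto_diff[OF tendsto_const this, of "- (LINT x|lborel. frechet_derivative \<phi> (at x) i *\<^sub>R u x)"]
    show ?thesis unfolding eq by simp
  qed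
  obtain g where "g \<in> L2" "mass g \<le> C"
    "\<And>\<phi>. \<phi> \<in> test_functions \<Longrightarrow> (LINT x|lborel. \<phi> x *\<^sub>R g x) = - (LINT x|lborel. frechet_derivative \<phi> (at x) i *\<^sub>R u x)"
    using L2_weak_limit[OF vL vC lim] by blast
  then show ?thesis by (intro that[of g]) (auto simp: has_weak_partial_def)
qed

section \<open>Rules for weak derivatives\<close>

lemma has_weak_partial_add:
  assumes "has_weak_partial i u g" "has_weak_partial i v h" "u \<in> L2" "v \<in> L2" "g \<in> L2" "h \<in> L2" "i \<in> Basis"
  shows "has_weak_partial i (\<lambda>x. u x + v x) (\<lambda>x. g x + h x)"
  using assms by (simp add: has_weak_partial_def scaleR_add_right test_scaleR_integrable test_derivative)

lemma has_weak_partial_cmult: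
  assumes "has_weak_partial i u g"
  shows "has_weak_partial i (\<lambda>x. c * u x) (\<lambda>x. c * g x)"
  using assms by (simp add: has_weak_partial_def flip: mult_scaleR_right)

lemma has_weak_partial_diff:
  assumes "has_weak_partial i u g" "has_weak_partial i v h" "u \<in> L2" "v \<in> L2" "g \<in> L2" "h \<in> L2" "i \<in> Basis"
  shows "has_weak_partial i (\<lambda>x. u x - v x) (\<lambda>x. g x - h x)"
  using assms by (simp add: has_weak_partial_def scaleR_diff_right test_scaleR_integrable test_derivative)

lemma has_weak_partial_shift:
  assumes "has_weak_partial i u g" "u \<in> L2" "g \<in> L2" "i \<in> Basis"
  shows "has_weak_partial i (\<lambda>x. u (x + y)) (\<lambda>x. g (x + y))"
  unfolding has_weak_partial_def
proof
  fix \<phi> :: "'a \<Rightarrow> real" assume \<phi>: "\<phi> \<in> test_functions"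
  have tr: "(\<lambda>x. \<phi> (x - y)) \<in> test_functions" using test_translate[OF \<phi>, of "-y"] by simp
  have trd: "frechet_derivative (\<lambda>x. \<phi> (x - y)) (at x) i = frechet_derivative \<phi> (at (x - y)) i" for x
  proof -
    have "((\<lambda>x. \<phi> (x - y)) has_derivative frechet_derivative \<phi> (at (x - y))) (at x)"
    proof (rule has_derivative_compose[OF _ test_has_derivative[OF \<phi>]])
      show "((\<lambda>x. x - y) has_derivative (\<lambda>h. h)) (at x)" by (auto intro!: derivative_eq_intros)
    qed
    then show ?thesis by (simp add: frechet_derivative_at[symmetric])
  qed
  have 1: "(LINT x|lborel. frechet_derivative \<phi> (at (x - y)) i *\<^sub>R u x) = - (LINT x|lborel. \<phi> (x - y) *\<^sub>R g x)"
    using assms(1) tr by (auto simp: has_weak_partial_def trd)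
  have i1: "integrable lborel (\<lambda>x. frechet_derivative \<phi> (at (x - y)) i *\<^sub>R u x)"
    using test_scaleR_integrable[OF test_derivative[OF tr assms(4)] assms(2)] by (simp add: trd)
  show "(LINT x|lborel. frechet_derivative \<phi> (at x) i *\<^sub>R u (x + y)) = - (LINT x|lborel. \<phi> x *\<^sub>R g (x + y))"
    using 1 integral_shift[OF borel_measurable_integrable[OF i1, simplified], of y]
      integral_shift[OF borel_measurable_integrable[OF test_scaleR_integrable[OF tr assms(3)], simplified], of y]
    by simp
qed

text \<open>Both sides of the defining identity are pairings with a fixed test function, hence
  continuous in \<open>L2\<close>.\<close>

lemma has_weak_partial_closed:
  assumes "\<And>n. has_weak_partial i (u n) (g n)" "\<And>n. u n \<in> L2" "\<And>n. g n \<in> L2" "v \<in> L2" "h \<in> L2" "i \<in> Basis"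
    and lim: "(\<lambda>n. L2_norm (\<lambda>x. u n x - v x)) \<longlonglongrightarrow> 0" "(\<lambda>n. L2_norm (\<lambda>x. g n x - h x)) \<longlonglongrightarrow> 0"
  shows "has_weak_partial i v h"
  unfolding has_weak_partial_def
proof
  fix \<phi> :: "'a \<Rightarrow> real" assume \<phi>: "\<phi> \<in> test_functions"
  have conv: "(\<lambda>n. LINT x|lborel. \<psi> x *\<^sub>R f n x) \<longlonglongrightarrow> (LINT x|lborel. \<psi> x *\<^sub>R w x)"
    if "\<psi> \<in> test_functions" "\<And>n. f n \<in> L2" "w \<in> L2" "(\<lambda>n. L2_norm (\<lambda>x. f n x - w x)) \<longlonglongrightarrow> 0" for \<psi> f w
  proof -
    have "(\<lambda>n. L2_norm (\<lambda>x. complex_of_real (\<psi> x)) * L2_norm (\<lambda>x. f n x - w x)) \<longlonglongrightarrow> 0"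
      using tendsto_mult_right_zero[OF that(4)] .
    moreover have "cmod ((LINT x|lborel. \<psi> x *\<^sub>R f n x) - (LINT x|lborel. \<psi> x *\<^sub>R w x)) \<le>
       L2_norm (\<lambda>x. complex_of_real (\<psi> x)) * L2_norm (\<lambda>x. f n x - w x)" for n
      using test_scaleR_bound[OF test_L2[OF that(1)] L2_diff[OF that(2,3)], of n]
        test_scaleR_integrable[OF that(1,2)] test_scaleR_integrable[OF that(1,3)]
      by (simp add: scaleR_diff_right)
    ultimately have "(\<lambda>n. (LINT x|lborel. \<psi> x *\<^sub>R f n x) - (LINT x|lborel. \<psi> x *\<^sub>R w x)) \<longlonglongrightarrow> 0"
      by (rule null_comparison)
    then show ?thesis by (simp add: LIM_zero_iff)
  qed
  have eq: "(LINT x|lborel. frechet_derivative \<phi> (at x) i *\<^sub>R u n x) = - (LINT x|lborel. \<phi> x *\<^sub>R g n x)" for n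
    using assms(1) \<phi> by (auto simp: has_weak_partial_def)
  show "(LINT x|lborel. frechet_derivative \<phi> (at x) i *\<^sub>R v x) = - (LINT x|lborel. \<phi> x *\<^sub>R h x)"
    using LIMSEQ_unique[OF conv[OF test_derivative[OF \<phi> assms(6)] assms(2,4) lim(1)]]
      tendsto_minus[OF conv[OF \<phi> assms(3,5) lim(2)]] by (simp add: eq)
qed

section \<open>The Sobolev space and the kinetic energy\<close>

lemma H1_L2: "u \<in> H1 \<Longrightarrow> u \<in> L2"
  by (simp add: H1_def)

lemma weak_partial_L2: "u \<in> H1 \<Longrightarrow> i \<in> Basis \<Longrightarrow> weak_partial i u \<in> L2"
  and has_weak_partial_weak_partial: "u \<in> H1 \<Longrightarrow> i \<in> Basis \<Longrightarrow> has_weak_partial i u (weak_partial i u)"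
proof -
  assume "u \<in> H1" "i \<in> Basis"
  then have "\<exists>g. g \<in> L2 \<and> has_weak_partial i u g" by (auto simp: H1_def)
  from someI_ex[OF this] show "weak_partial i u \<in> L2" "has_weak_partial i u (weak_partial i u)"
    by (auto simp: weak_partial_def)
qed

lemma H1I: "u \<in> L2 \<Longrightarrow> (\<And>i. i \<in> Basis \<Longrightarrow> g i \<in> L2) \<Longrightarrow> (\<And>i. i \<in> Basis \<Longrightarrow> has_weak_partial i u (g i)) \<Longrightarrow> u \<in> H1"
  by (auto simp: H1_def)

lemma weak_partial_AE_eq:
  assumes "u \<in> H1" "i \<in> Basis" "g \<in> L2" "has_weak_partial i u g"
  shows "AE x in lborel. weak_partial i u x = g x"
  by (rule weak_partial_unique[OF has_weak_partial_weak_partial[OF assms(1,2)] assms(4) H1_L2[OF assms(1)] weak_partial_L2[OF assms(1,2)] assms(3,2)])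

text \<open>\<open>weak_partial\<close> is an arbitrary choice and satisfies its algebraic rules
  only almost everywhere. Computations with it therefore pass through masses, which do not see null
  sets.\<close>

lemma mass_weak_partial:
  assumes "u \<in> H1" "i \<in> Basis" "g \<in> L2" "has_weak_partial i u g"
  shows "mass (weak_partial i u) = mass g"
  by (rule mass_cong_AE[OF weak_partial_AE_eq[OF assms]]) (auto intro: L2_measurable weak_partial_L2 assms)

definition kinetic :: "('a::euclidean_space \<Rightarrow> complex) \<Rightarrow> real" where
  "kinetic u = (\<Sum>i\<in>Basis. mass (weak_partial i u))"

lemma kinetic_nonneg [simp]: "0 \<le> kinetic u"
  unfolding kinetic_def by (intro sum_nonneg) simp

lemma integrable_grad_sq: "u \<in> H1 \<Longrightarrow> integrable lborel (grad_sq u)"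
  unfolding grad_sq_def[abs_def] by (intro Bochner_Integration.integrable_sum L2_integrable weak_partial_L2)

lemma integral_grad_sq: "u \<in> H1 \<Longrightarrow> (LINT x|lborel. grad_sq u x) = kinetic u"
  unfolding grad_sq_def kinetic_def mass_def
  by (rule Bochner_Integration.integral_sum) (auto intro!: L2_integrable weak_partial_L2)

lemma H1_norm_eq: "u \<in> H1 \<Longrightarrow> H1_norm u = sqrt (kinetic u + mass u)"
  unfolding H1_norm_def
  by (simp add: Bochner_Integration.integral_add integrable_grad_sq L2_integrable[OF H1_L2] integral_grad_sq flip: mass_def)

lemma H1_add: "u \<in> H1 \<Longrightarrow> v \<in> H1 \<Longrightarrow> (\<lambda>x. u x + v x) \<in> H1"
  by (rule H1I[where g = "\<lambda>i x. weak_partial i u x + weak_partial i v x"])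
    (simp_all add: L2_add H1_L2 weak_partial_L2 has_weak_partial_add has_weak_partial_weak_partial)

lemma H1_cmult: "u \<in> H1 \<Longrightarrow> (\<lambda>x. c * u x) \<in> H1"
  by (rule H1I[where g = "\<lambda>i x. c * weak_partial i u x"])
    (simp_all add: L2_cmult H1_L2 weak_partial_L2 has_weak_partial_cmult has_weak_partial_weak_partial)

lemma H1_diff: "u \<in> H1 \<Longrightarrow> v \<in> H1 \<Longrightarrow> (\<lambda>x. u x - v x) \<in> H1"
  using H1_add[of u "\<lambda>x. (-1) * v x"] H1_cmult[of v "-1"] by simp

lemma H1_shift: "u \<in> H1 \<Longrightarrow> (\<lambda>x. u (x + y)) \<in> H1"
  by (rule H1I[where g = "\<lambda>i x. weak_partial i u (x + y)"])
    (simp_all add: L2_shift H1_L2 weak_partial_L2 has_weak_partial_shift has_weak_partial_weak_partial)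

lemma mass_weak_partial_add:
  assumes "u \<in> H1" "v \<in> H1" "i \<in> Basis"
  shows "mass (weak_partial i (\<lambda>x. u x + v x)) = mass (\<lambda>x. weak_partial i u x + weak_partial i v x)"
  using assms by (intro mass_weak_partial H1_add L2_add weak_partial_L2 has_weak_partial_add has_weak_partial_weak_partial H1_L2)

lemma mass_weak_partial_cmult:
  assumes "u \<in> H1" "i \<in> Basis"
  shows "mass (weak_partial i (\<lambda>x. c * u x)) = (cmod c)\<^sup>2 * mass (weak_partial i u)"
  using mass_weak_partial[OF H1_cmult[OF assms(1)] assms(2) L2_cmult[OF weak_partial_L2[OF assms]] has_weak_partial_cmult[OF has_weak_partial_weak_partial[OF assms]]]
  by (simp add: mass_cmult)

lemma mass_weak_partial_diff:
  assumes "u \<in> H1" "v \<in> H1" "i \<in> Basis"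
  shows "mass (weak_partial i (\<lambda>x. u x - v x)) = mass (\<lambda>x. weak_partial i u x - weak_partial i v x)"
proof (intro mass_weak_partial H1_diff L2_diff weak_partial_L2 assms)
  show "has_weak_partial i (\<lambda>x. u x - v x) (\<lambda>x. weak_partial i u x - weak_partial i v x)"
    using assms by (intro has_weak_partial_diff has_weak_partial_weak_partial weak_partial_L2 H1_L2)
qed

lemma kinetic_cmult: "u \<in> H1 \<Longrightarrow> kinetic (\<lambda>x. c * u x) = (cmod c)\<^sup>2 * kinetic u"
  by (simp add: kinetic_def mass_weak_partial_cmult sum_distrib_left)

lemma kinetic_shift:
  assumes "u \<in> H1" shows "kinetic (\<lambda>x. u (x + y)) = kinetic u"
  unfolding kinetic_def
proof (rule sum.cong[OF refl])
  fix i :: 'a assume i: "i \<in> Basis"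
  have "mass (weak_partial i (\<lambda>x. u (x + y))) = mass (\<lambda>x. weak_partial i u (x + y))"
    using assms i by (intro mass_weak_partial H1_shift L2_shift weak_partial_L2 has_weak_partial_shift has_weak_partial_weak_partial H1_L2)
  then show "mass (weak_partial i (\<lambda>x. u (x + y))) = mass (weak_partial i u)"
    using mass_shift[OF weak_partial_L2[OF assms i]] by simp
qed

lemma kinetic_parallelogram:
  assumes "u \<in> H1" "v \<in> H1"
  shows "kinetic (\<lambda>x. (u x + v x) / 2) + kinetic (\<lambda>x. (u x - v x) / 2) = (kinetic u + kinetic v) / 2"
proof -
  have *: "mass (weak_partial i (\<lambda>x. (u x + v x) / 2)) + mass (weak_partial i (\<lambda>x. (u x - v x) / 2)) =
    (mass (weak_partial i u) + mass (weak_partial i v)) / 2" if i: "i \<in> Basis" for i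
    using mass_parallelogram[OF weak_partial_L2[OF assms(1) i] weak_partial_L2[OF assms(2) i]]
      mass_weak_partial_cmult[OF H1_add[OF assms] i, of "1/2"] mass_weak_partial_cmult[OF H1_diff[OF assms] i, of "1/2"]
      mass_weak_partial_add[OF assms i] mass_weak_partial_diff[OF assms i]
      mass_cmult[of "1/2" "\<lambda>x. weak_partial i u x + weak_partial i v x"]
      mass_cmult[of "1/2" "\<lambda>x. weak_partial i u x - weak_partial i v x"] by simp
  show ?thesis
    unfolding kinetic_def sum.distrib[symmetric] sum_divide_distrib by (intro sum.cong refl *)
qed

section \<open>Translation estimates and completeness of \<open>H1\<close>\<close>

text \<open>The constants are kept separately for each coordinate direction, because they add up
  exactly to \<open>kinetic\<close>. A single constant for all directions would cost a factor
  \<open>DIM('a)\<close> on the way back to derivatives.\<close>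

lemma shift_bound_Basis:
  assumes "u \<in> H1" "i \<in> Basis"
  shows "mass (\<lambda>x. u (x + t *\<^sub>R i) - u x) \<le> mass (weak_partial i u) * t\<^sup>2"
  by (rule weak_partial_shift_bound[OF has_weak_partial_weak_partial[OF assms] H1_L2[OF assms(1)] weak_partial_L2[OF assms] assms(2)])

text \<open>The path from x to x + h is walked along one coordinate of \<open>h\<close> at a time.
  The triangle inequality adds up the steps, and Cauchy-Schwarz over \<open>Basis\<close> recovers
  the kinetic energy as constant.\<close>

lemma H1_shift_bound:
  assumes u: "u \<in> H1"
  shows "mass (\<lambda>x. u (x + h) - u x) \<le> kinetic u * (norm h)\<^sup>2"
proof -
  note uL = H1_L2[OF u]
  let ?p = "\<lambda>i. L2_norm (weak_partial i u)"
  have "L2_norm (\<lambda>x. u (x + (\<Sum>i\<in>A. (h \<bullet> i) *\<^sub>R i)) - u x) \<le> (\<Sum>i\<in>A. \<bar>?p i\<bar> * \<bar>h \<bullet> i\<bar>)"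
    if "finite A" "A \<subseteq> Basis" for A
    using that
  proof (induction A rule: finite_induct)
    case empty
    show ?case by (simp add: L2_norm_def)
  next
    case (insert i A)
    let ?y = "\<Sum>i\<in>A. (h \<bullet> i) *\<^sub>R i"
    have i: "i \<in> Basis" using insert by simp
    have "L2_norm (\<lambda>x. u (x + ?y + (h \<bullet> i) *\<^sub>R i) - u (x + ?y)) \<le> ?p i * \<bar>h \<bullet> i\<bar>"
    proof -
      have "mass (\<lambda>x. u (x + ?y + (h \<bullet> i) *\<^sub>R i) - u (x + ?y)) = mass (\<lambda>x. u (x + (h \<bullet> i) *\<^sub>R i) - u x)"
        using mass_shift[OF L2_diff[OF L2_shift[OF uL, of "(h \<bullet> i) *\<^sub>R i"] uL], of ?y] .
      also have "\<dots> \<le> mass (weak_partial i u) * (h \<bullet> i)\<^sup>2"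
        by (rule shift_bound_Basis[OF u i])
      finally have "sqrt (mass (\<lambda>x. u (x + ?y + (h \<bullet> i) *\<^sub>R i) - u (x + ?y))) \<le> sqrt (mass (weak_partial i u) * (h \<bullet> i)\<^sup>2)"
        by simp
      then show ?thesis by (simp add: L2_norm_mass real_sqrt_mult)
    qed
    then show ?case
      using L2_norm_triangle_diff[OF L2_shift[OF uL] L2_shift[OF uL] uL, of "?y + (h \<bullet> i) *\<^sub>R i" ?y] insert
      by (simp add: add_ac)
  qed
  from this[of Basis] have "L2_norm (\<lambda>x. u (x + h) - u x) \<le> (\<Sum>i\<in>Basis. \<bar>?p i\<bar> * \<bar>h \<bullet> i\<bar>)"
    by (simp add: euclidean_representation)
  also have "\<dots> \<le> L2_set ?p Basis * L2_set (\<lambda>i. h \<bullet> i) Basis"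
    by (rule L2_set_mult_ineq)
  also have "L2_set ?p Basis = sqrt (kinetic u)" by (simp add: L2_set_def L2_norm_sq kinetic_def)
  also have "L2_set (\<lambda>i. h \<bullet> i) Basis = norm h" by (simp add: norm_eq_sqrt_inner[of h] euclidean_inner[of h h] L2_set_def power2_eq_square)
  finally have "(L2_norm (\<lambda>x. u (x + h) - u x))\<^sup>2 \<le> (sqrt (kinetic u) * norm h)\<^sup>2"
    by (intro power_mono) auto
  then show ?thesis by (simp add: L2_norm_sq power_mult_distrib)
qed

text \<open>The return from increments to derivatives: this is how cut and glued profiles are
  recognised as elements of \<open>H1\<close> and how their kinetic energy is bounded.\<close>

lemma H1_by_shift_bounds:
  assumes "u \<in> L2" and le: "\<And>i t. i \<in> Basis \<Longrightarrow> mass (\<lambda>x. u (x + t *\<^sub>R i) - u x) \<le> K i * t\<^sup>2"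
  shows "u \<in> H1" "kinetic u \<le> (\<Sum>i\<in>Basis. K i)"
proof -
  have "\<exists>g. g \<in> L2 \<and> mass g \<le> K i \<and> has_weak_partial i u g" if "i \<in> Basis" for i
    by (rule weak_partial_exists[OF assms(1) that le[OF that]]) blast
  then obtain g where g: "\<And>i. i \<in> Basis \<Longrightarrow> g i \<in> L2" "\<And>i. i \<in> Basis \<Longrightarrow> mass (g i) \<le> K i"
    "\<And>i. i \<in> Basis \<Longrightarrow> has_weak_partial i u (g i)" by metis
  show u: "u \<in> H1" by (rule H1I[OF assms(1) g(1,3)])
  show "kinetic u \<le> (\<Sum>i\<in>Basis. K i)"
    unfolding kinetic_def using mass_weak_partial[OF u _ g(1,3)] g(2) by (intro sum_mono) simp
qed

text \<open>The functions and each of their partial derivatives converge in \<open>L2\<close>;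
  closedness of the weak derivative identifies the limits of the partials with the partials of the
  limit.\<close>

lemma H1_complete:
  assumes H1: "\<And>n. u n \<in> H1"
    and Cauchy: "\<And>e. e > 0 \<Longrightarrow> \<exists>N. \<forall>m\<ge>N. \<forall>n\<ge>N. H1_norm (\<lambda>x. u m x - u n x) < e"
  obtains v where "v \<in> H1" "(\<lambda>n. H1_norm (\<lambda>x. u n x - v x)) \<longlonglongrightarrow> 0"
proof -
  have le1: "L2_norm w \<le> H1_norm w" if "w \<in> H1" for w :: "'a \<Rightarrow> complex"
    using that by (simp add: H1_norm_eq L2_norm_mass)
  have le2: "L2_norm (\<lambda>x. weak_partial i (u m) x - weak_partial i (u n) x) \<le> H1_norm (\<lambda>x. u m x - u n x)" if i: "i \<in> Basis" for i m n
  proof -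
    have "mass (\<lambda>x. weak_partial i (u m) x - weak_partial i (u n) x) = mass (weak_partial i (\<lambda>x. u m x - u n x))"
      by (rule mass_weak_partial_diff[OF H1 H1 i, symmetric])
    also have "\<dots> \<le> kinetic (\<lambda>x. u m x - u n x)"
      unfolding kinetic_def by (rule member_le_sum) (use i in auto)
    finally show ?thesis
      unfolding H1_norm_eq[OF H1_diff[OF H1 H1]] L2_norm_mass by (simp add: add_increasing2)
  qed
  obtain v where v: "v \<in> L2" "(\<lambda>n. L2_norm (\<lambda>x. u n x - v x)) \<longlonglongrightarrow> 0"
  proof (rule L2_complete[of u, OF H1_L2[OF H1]])
    fix e :: real assume "e > 0"
    from Cauchy[OF this] obtain N where N: "\<forall>m\<ge>N. \<forall>n\<ge>N. H1_norm (\<lambda>x. u m x - u n x) < e" ..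
    have "L2_norm (\<lambda>x. u m x - u n x) < e" if "m \<ge> N" "n \<ge> N" for m n
    proof -
      have "L2_norm (\<lambda>x. u m x - u n x) \<le> H1_norm (\<lambda>x. u m x - u n x)" by (rule le1[OF H1_diff[OF H1 H1]])
      also have "\<dots> < e" using N that by blast
      finally show ?thesis .
    qed
    then show "\<exists>N. \<forall>m\<ge>N. \<forall>n\<ge>N. L2_norm (\<lambda>x. u m x - u n x) < e" by auto
  qed auto
  have "\<exists>g. g \<in> L2 \<and> (\<lambda>n. L2_norm (\<lambda>x. weak_partial i (u n) x - g x)) \<longlonglongrightarrow> 0" if i: "i \<in> Basis" for i
  proof -
    have "\<exists>N. \<forall>m\<ge>N. \<forall>n\<ge>N. L2_norm (\<lambda>x. weak_partial i (u m) x - weak_partial i (u n) x) < e" if "e > 0" for e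
    proof -
      from Cauchy[OF that] obtain N where N: "\<forall>m\<ge>N. \<forall>n\<ge>N. H1_norm (\<lambda>x. u m x - u n x) < e" ..
      have "L2_norm (\<lambda>x. weak_partial i (u m) x - weak_partial i (u n) x) < e" if "m \<ge> N" "n \<ge> N" for m n
        using le2[OF i, of m n] N that by (blast intro: order_le_less_trans)
      then show ?thesis by auto
    qed
    then show ?thesis using L2_complete[of "\<lambda>n. weak_partial i (u n)", OF weak_partial_L2[OF H1 i]] by blast
  qed
  then obtain g where g: "\<And>i. i \<in> Basis \<Longrightarrow> g i \<in> L2"
    "\<And>i. i \<in> Basis \<Longrightarrow> (\<lambda>n. L2_norm (\<lambda>x. weak_partial i (u n) x - g i x)) \<longlonglongrightarrow> 0" by metis
  have wp: "has_weak_partial i v (g i)" if i: "i \<in> Basis" for i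
    by (rule has_weak_partial_closed[OF has_weak_partial_weak_partial[OF H1 i] H1_L2[OF H1] weak_partial_L2[OF H1 i] v(1) g(1)[OF i] i v(2) g(2)[OF i]])
  have vH: "v \<in> H1" by (rule H1I[OF v(1) g(1) wp])
  have eq: "mass (weak_partial i (\<lambda>x. u n x - v x)) = (L2_norm (\<lambda>x. weak_partial i (u n) x - g i x))\<^sup>2" if i: "i \<in> Basis" for i n
    unfolding L2_norm_sq
  proof (rule mass_weak_partial[OF H1_diff[OF H1 vH] i L2_diff[OF weak_partial_L2[OF H1 i] g(1)[OF i]]])
    show "has_weak_partial i (\<lambda>x. u n x - v x) (\<lambda>x. weak_partial i (u n) x - g i x)"
      by (rule has_weak_partial_diff[OF has_weak_partial_weak_partial[OF H1 i] wp[OF i] H1_L2[OF H1] v(1) weak_partial_L2[OF H1 i] g(1)[OF i] i])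
  qed
  have "(\<lambda>n. sqrt ((\<Sum>i\<in>Basis. (L2_norm (\<lambda>x. weak_partial i (u n) x - g i x))\<^sup>2) + (L2_norm (\<lambda>x. u n x - v x))\<^sup>2)) \<longlonglongrightarrow>
     sqrt ((\<Sum>i\<in>(Basis::'a set). 0\<^sup>2) + 0\<^sup>2)"
    by (intro tendsto_intros g v)
  then have "(\<lambda>n. H1_norm (\<lambda>x. u n x - v x)) \<longlonglongrightarrow> 0"
    by (simp add: H1_norm_eq[OF H1_diff[OF H1 vH]] kinetic_def eq L2_norm_sq)
  with vH show ?thesis by (rule that)
qed

text \<open>The norm is the Euclidean length of the vector formed by the \<open>L2\<close> norms of
  the partial derivatives and of the function, so the triangle inequalities in \<open>L2\<close> and
  in Euclidean space combine.\<close>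

lemma H1_norm_triangle:
  assumes "u \<in> H1" "v \<in> H1"
  shows "H1_norm (\<lambda>x. u x + v x) \<le> H1_norm u + H1_norm v"
proof -
  let ?p = "\<lambda>w i. L2_norm (weak_partial i w)"
  have eq: "H1_norm w = sqrt ((L2_set (?p w) Basis)\<^sup>2 + (L2_norm w)\<^sup>2)" if "w \<in> H1" for w :: "'a \<Rightarrow> complex"
    using that by (simp add: H1_norm_eq L2_set_def L2_norm_sq sum_nonneg kinetic_def)
  have "L2_set (?p (\<lambda>x. u x + v x)) Basis \<le> L2_set (\<lambda>i. ?p u i + ?p v i) Basis"
  proof (rule L2_set_mono)
    fix i :: 'a assume i: "i \<in> Basis"
    have "?p (\<lambda>x. u x + v x) i = L2_norm (\<lambda>x. weak_partial i u x + weak_partial i v x)"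
      unfolding L2_norm_mass mass_weak_partial_add[OF assms i] ..
    also have "\<dots> \<le> ?p u i + ?p v i"
      by (rule L2_norm_triangle[OF weak_partial_L2[OF assms(1) i] weak_partial_L2[OF assms(2) i]])
    finally show "?p (\<lambda>x. u x + v x) i \<le> ?p u i + ?p v i" .
  qed simp
  also have "\<dots> \<le> L2_set (?p u) Basis + L2_set (?p v) Basis" by (rule L2_set_triangle_ineq)
  finally have 1: "L2_set (?p (\<lambda>x. u x + v x)) Basis \<le> L2_set (?p u) Basis + L2_set (?p v) Basis" .
  have "H1_norm (\<lambda>x. u x + v x) \<le> sqrt ((L2_set (?p u) Basis + L2_set (?p v) Basis)\<^sup>2 + (L2_norm u + L2_norm v)\<^sup>2)"
    unfolding eq[OF H1_add[OF assms]]
    by (intro real_sqrt_le_mono add_mono power_mono 1 L2_norm_triangle H1_L2 assms L2_set_nonneg L2_norm_nonneg)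
  also have "\<dots> \<le> H1_norm u + H1_norm v"
    unfolding eq[OF assms(1)] eq[OF assms(2)] by (rule real_sqrt_sum_squares_triangle_ineq)
  finally show ?thesis .
qed

section \<open>Vanishing sequences\<close>

definition mass_on :: "'a::euclidean_space set \<Rightarrow> ('a \<Rightarrow> complex) \<Rightarrow> real" where
  "mass_on A u = (LINT x|lborel. indicator A x * (cmod (u x))\<^sup>2)"

lemma integrable_mass_on:
  assumes "u \<in> L2" and [measurable]: "A \<in> sets borel"
  shows "integrable lborel (\<lambda>x. indicator A x * (cmod (u x))\<^sup>2)"
  using integrable_mult_indicator[OF _ L2_integrable[OF assms(1)], of A] by simp

lemma mass_on_nonneg [simp]: "0 \<le> mass_on A u"
  unfolding mass_on_def by simp

lemma mass_on_mono:
  assumes "u \<in> L2" "A \<subseteq> B" "A \<in> sets borel" "B \<in> sets borel"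
  shows "mass_on A u \<le> mass_on B u"
  unfolding mass_on_def
  by (intro integral_mono integrable_mass_on assms mult_right_mono) (use assms(2) in \<open>auto split: split_indicator\<close>)

lemma mass_on_UNIV: "mass_on UNIV u = mass u"
  by (simp add: mass_on_def mass_def)

lemma mass_on_le_mass:
  assumes "u \<in> L2" "A \<in> sets borel" shows "mass_on A u \<le> mass u"
  using mass_on_mono[of u A UNIV] assms by (simp add: mass_on_UNIV)

lemma nn_integral_mass_on:
  assumes "u \<in> L2" "A \<in> sets borel"
  shows "(\<integral>\<^sup>+x. ennreal (indicator A x * (cmod (u x))\<^sup>2) \<partial>lborel) = ennreal (mass_on A u)"
  unfolding mass_on_def by (intro nn_integral_eq_integral integrable_mass_on assms) auto

abbreviation unit_ball_volume :: "'a::euclidean_space itself \<Rightarrow> real" where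
  "unit_ball_volume _ \<equiv> measure lborel (ball (0::'a) 1)"

lemma emeasure_lborel_ball: "emeasure lborel (ball (y::'a::euclidean_space) r) = ennreal (measure lborel (ball y r))"
  by (rule emeasure_eq_ennreal_measure) (use emeasure_bounded_finite[OF bounded_ball, of y r] in auto)

text \<open>
  For \<open>u\<close> in \<^const>\<open>H1\<close> this holds with \<open>K\<close> the squared norm of the gradient. It is the only form
  in which derivatives enter the estimates, and it passes to moduli and cutoffs without a chain rule.
\<close>

definition shift_bounded :: "real \<Rightarrow> ('a::euclidean_space \<Rightarrow> complex) \<Rightarrow> bool" where
  "shift_bounded K u \<longleftrightarrow> u \<in> L2 \<and> 0 \<le> K \<and> (\<forall>h. mass (\<lambda>x. u (x + h) - u x) \<le> K * (norm h)\<^sup>2)"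

lemma shift_boundedD:
  assumes "shift_bounded K u"
  shows "u \<in> L2" "0 \<le> K" "\<And>h. mass (\<lambda>x. u (x + h) - u x) \<le> K * (norm h)\<^sup>2"
  using assms by (auto simp: shift_bounded_def)

text \<open>
  If \<open>\<bar>u(x)\<bar> > l\<close> while the mass of \<open>u\<close> near \<open>x\<close> is small, then \<open>u\<close> differs from \<open>u(x)\<close> by
  at least \<open>l / 2\<close> on a large part of a ball around \<open>x\<close>; integrating over \<open>x\<close> turns
  this into a weak-type Sobolev estimate.
\<close>

lemma level_set_bound:
  fixes u :: "'a::euclidean_space \<Rightarrow> complex"
  assumes u: "u \<in> L2" and "l > 0" "s > 0" "0 \<le> K"
    and shift: "\<And>h. mass (\<lambda>x. u (x + h) - u x) \<le> K * (norm h)\<^sup>2"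
    and loc: "\<And>y. mass_on (ball y s) u \<le> M" and M: "8 * M \<le> l\<^sup>2 * measure lborel (ball (0::'a) s)"
  shows "emeasure lborel {x. l < cmod (u x)} \<le> ennreal (8 * K * s\<^sup>2 / l\<^sup>2)"
proof -
  have [measurable]: "u \<in> borel_measurable borel" using u by (rule L2_measurable)
  define V where "V = measure lborel (ball (0::'a) s)"
  have V: "V > 0" using \<open>s > 0\<close> by (simp add: V_def content_ball_pos)
  define B where "B = ball (0::'a) s"
  have [measurable]: "B \<in> sets borel" by (simp add: B_def)
  have eB: "emeasure lborel B = ennreal V" by (simp add: B_def V_def emeasure_lborel_ball)
  define E where "E = {x. l < cmod (u x)}"
  have [measurable]: "E \<in> sets borel" unfolding E_def by measurable
  define D where "D x = (\<integral>\<^sup>+h. ennreal (indicator B h * (cmod (u (x + h) - u x))\<^sup>2) \<partial>lborel)" for x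
  have [measurable]: "D \<in> borel_measurable borel" unfolding D_def by measurable
  have loc_meas: "(\<lambda>y. ennreal (indicator (ball x s) y * (cmod (u y))\<^sup>2)) \<in> borel_measurable borel" for x
  proof -
    have "(\<lambda>y. indicator (ball x s) y * (cmod (u y))\<^sup>2) \<in> borel_measurable borel"
      using borel_measurable_integrable[OF integrable_mass_on[OF u borel_open[OF open_ball], of x s]] by simp
    then show ?thesis by (rule measurable_compose[OF _ measurable_ennreal])
  qed
  \<comment> \<open>For each \<open>h\<close> in the ball either the value at \<open>x + h\<close>
    or the increment has modulus at least \<open>l / 2\<close>, which gives
    \<open>l\<^sup>2 * V / 4\<close> in total. By the hypothesis on \<open>M\<close> the local mass
    accounts for at most half of this; the rest is left for \<open>D x\<close>.\<close>
  have lower: "ennreal (l\<^sup>2 * V / 8) \<le> D x" if x: "x \<in> E" for x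
  proof -
    have "ennreal (l\<^sup>2 / 4 * V) = (\<integral>\<^sup>+h. ennreal (l\<^sup>2 / 4) * indicator B h \<partial>lborel)"
      by (subst nn_integral_cmult_indicator) (use V in \<open>auto simp: eB simp flip: ennreal_mult'\<close>)
    also have "\<dots> \<le> (\<integral>\<^sup>+h. ennreal (indicator B h * (cmod (u (x + h) - u x))\<^sup>2) + ennreal (indicator (ball x s) (h + x) * (cmod (u (h + x)))\<^sup>2) \<partial>lborel)"
    proof (rule nn_integral_mono)
      fix h
      show "ennreal (l\<^sup>2 / 4) * indicator B h \<le> ennreal (indicator B h * (cmod (u (x + h) - u x))\<^sup>2) + ennreal (indicator (ball x s) (h + x) * (cmod (u (h + x)))\<^sup>2)"
      proof (cases "h \<in> B")
        case True
        then have "h + x \<in> ball x s" by (simp add: B_def dist_norm)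
        have "l\<^sup>2 / 4 \<le> (cmod (u (x + h) - u x))\<^sup>2 + (cmod (u (h + x)))\<^sup>2"
        proof (cases "cmod (u (h + x)) \<ge> l / 2")
          case True
          then have "(l/2)\<^sup>2 \<le> (cmod (u (h + x)))\<^sup>2" using \<open>l > 0\<close> by (intro power_mono) auto
          then show ?thesis by (simp add: power_divide add_increasing)
        next
          case False
          then have "l / 2 \<le> cmod (u (x + h) - u x)"
            using norm_triangle_ineq2[of "u x" "u (x + h)"] x by (simp add: E_def add.commute norm_minus_commute)
          then have "(l/2)\<^sup>2 \<le> (cmod (u (x + h) - u x))\<^sup>2" using \<open>l > 0\<close> by (intro power_mono) auto
          then show ?thesis by (simp add: power_divide add_increasing2)
        qed
        then show ?thesis using True \<open>h + x \<in> ball x s\<close> by (simp flip: ennreal_plus add: ennreal_leI)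
      qed simp
    qed
    also have "\<dots> = D x + (\<integral>\<^sup>+h. ennreal (indicator (ball x s) (h + x) * (cmod (u (h + x)))\<^sup>2) \<partial>lborel)"
      unfolding D_def
    proof (rule nn_integral_add)
      from measurable_compose[OF _ loc_meas, of "\<lambda>h. h + x" borel x]
      show "(\<lambda>h. ennreal (indicator (ball x s) (h + x) * (cmod (u (h + x)))\<^sup>2)) \<in> borel_measurable lborel" by simp
    qed measurable
    also have "(\<integral>\<^sup>+h. ennreal (indicator (ball x s) (h + x) * (cmod (u (h + x)))\<^sup>2) \<partial>lborel) = ennreal (mass_on (ball x s) u)"
      using nn_integral_shift[OF loc_meas, of x x] nn_integral_mass_on[OF u borel_open[OF open_ball], of x s] by simp
    also have "\<dots> \<le> ennreal (l\<^sup>2 * V / 8)"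
      using loc[of x] M by (intro ennreal_leI) (simp add: V_def)
    finally have "ennreal (l\<^sup>2 / 4 * V) \<le> D x + ennreal (l\<^sup>2 * V / 8)" by (simp add: add_left_mono)
    moreover have "ennreal (l\<^sup>2 / 4 * V) = ennreal (l\<^sup>2 * V / 8) + ennreal (l\<^sup>2 * V / 8)"
      using V by (simp flip: ennreal_plus)
    ultimately show ?thesis by (simp add: ennreal_add_left_cancel_le add.commute)
  qed
  have "ennreal (l\<^sup>2 * V / 8) * emeasure lborel E = (\<integral>\<^sup>+x. ennreal (l\<^sup>2 * V / 8) * indicator E x \<partial>lborel)"
    by (subst nn_integral_cmult_indicator) auto
  also have "\<dots> \<le> (\<integral>\<^sup>+x. D x \<partial>lborel)"
    by (intro nn_integral_mono) (use lower in \<open>auto split: split_indicator\<close>)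
  also have "\<dots> = (\<integral>\<^sup>+h. (\<integral>\<^sup>+x. ennreal (indicator B h * (cmod (u (x + h) - u x))\<^sup>2) \<partial>lborel) \<partial>lborel)"
    unfolding D_def by (rule lborel_pair.Fubini'[symmetric]) measurable
  also have "\<dots> \<le> (\<integral>\<^sup>+h. ennreal (K * s\<^sup>2) * indicator B h \<partial>lborel)"
  proof (rule nn_integral_mono)
    fix h
    show "(\<integral>\<^sup>+x. ennreal (indicator B h * (cmod (u (x + h) - u x))\<^sup>2) \<partial>lborel) \<le> ennreal (K * s\<^sup>2) * indicator B h"
    proof (cases "h \<in> B")
      case True
      then have "K * (norm h)\<^sup>2 \<le> K * s\<^sup>2"
        using \<open>0 \<le> K\<close> by (intro mult_left_mono power_mono) (auto simp: B_def)
      then show ?thesis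
        using True mass_nn_integral[OF L2_diff[OF L2_shift[OF u] u], of h] shift[of h] by (simp add: ennreal_leI)
    qed simp
  qed
  also have "\<dots> = ennreal (K * s\<^sup>2) * ennreal V" by (subst nn_integral_cmult_indicator) (auto simp: eB)
  finally have *: "ennreal (l\<^sup>2 * V / 8) * emeasure lborel E \<le> ennreal (K * s\<^sup>2) * ennreal V" .
  have c: "l\<^sup>2 * V / 8 > 0" using V \<open>l > 0\<close> by simp
  have "ennreal (l\<^sup>2 * V / 8) * emeasure lborel E \<le> ennreal (l\<^sup>2 * V / 8) * ennreal (8 * K * s\<^sup>2 / l\<^sup>2)"
    using * V \<open>l > 0\<close> \<open>0 \<le> K\<close> by (simp flip: ennreal_mult' add: mult_ac)
  then have "emeasure lborel E \<le> ennreal (8 * K * s\<^sup>2 / l\<^sup>2)"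
    using c by (subst (asm) ennreal_mult_le_mult_iff) auto
  then show ?thesis by (simp add: E_def)
qed

text \<open>At or below the level \<open>l\<close>, the power p is traded for a square. Above it,
  the least \<open>k\<close> with \<open>y \<le> 2 ^ Suc k * l\<close> also satisfies
  \<open>2 ^ k * l < y\<close>, so the single \<open>k\<close>-th summand dominates.\<close>

lemma dyadic_powr_bound:
  assumes "l > 0" "y \<ge> 0" "p > 2"
  shows "ennreal (y powr p) \<le> ennreal (l powr (p - 2) * y\<^sup>2) + (\<Sum>k. ennreal ((2 ^ Suc k * l) powr p) * indicator {y. 2 ^ k * l < y} y)"
proof (cases "y \<le> l")
  case True
  have "y powr p \<le> l powr (p - 2) * y\<^sup>2"
  proof (cases "y = 0")
    case False
    then have "y powr p = y powr (p - 2) * y\<^sup>2" using assms by (simp add: powr_diff powr_numeral)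
    also have "\<dots> \<le> l powr (p - 2) * y\<^sup>2" using assms True by (intro mult_right_mono powr_mono2) auto
    finally show ?thesis .
  qed simp
  then show ?thesis by (simp add: ennreal_leI add_increasing2)
next
  case False
  obtain n where n: "y / l < 2 ^ n" using real_arch_pow[of 2 "y / l"] by auto
  have "\<exists>k. y \<le> 2 ^ Suc k * l"
    using n assms by (intro exI[of _ n]) (auto simp: field_simps intro: order_trans[of _ "2 ^ n * l"])
  then have ex: "\<exists>k. y \<le> 2 ^ Suc k * l" .
  define k where "k = (LEAST k. y \<le> 2 ^ Suc k * l)"
  have k1: "y \<le> 2 ^ Suc k * l" unfolding k_def by (rule LeastI_ex[OF ex])
  have k2: "2 ^ k * l < y"
  proof (cases k)
    case 0
    then show ?thesis using False by simp
  next
    case (Suc j)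
    have "\<not> y \<le> 2 ^ Suc j * l" using not_less_Least[of j "\<lambda>k. y \<le> 2 ^ Suc k * l"] Suc by (simp add: k_def)
    then show ?thesis using Suc by simp
  qed
  have "ennreal (y powr p) \<le> ennreal ((2 ^ Suc k * l) powr p) * indicator {y. 2 ^ k * l < y} y"
    using k1 k2 assms by (auto intro!: ennreal_leI powr_mono2)
  also have "\<dots> \<le> (\<Sum>k. ennreal ((2 ^ Suc k * l) powr p) * indicator {y. 2 ^ k * l < y} y)"
    using sum_le_suminf[of "\<lambda>k. ennreal ((2 ^ Suc k * l) powr p) * indicator {y. 2 ^ k * l < y} y" "{k}"]
    by (simp del: sum_mult_indicator power_Suc)
  finally show ?thesis by (simp add: add_increasing)
qed

text \<open>
  The weak-type bound at the critical exponent \<open>2 + 4/N\<close>, summed over dyadic levels. Taking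
  \<open>M\<close> to be the total mass gives a Gagliardo--Nirenberg inequality, letting
  \<open>M\<close> tend to 0 gives Lions' vanishing lemma.
\<close>

lemma subcritical_powr_bound:
  fixes p :: real
  assumes p: "2 < p" "p < 2 + 4 / real DIM('a::euclidean_space)"
  shows "\<exists>C\<ge>0. \<forall>(u::'a \<Rightarrow> complex) K M l. shift_bounded K u \<longrightarrow>
       M > 0 \<longrightarrow> (\<forall>y. mass_on (ball y 1) u \<le> M) \<longrightarrow> l > 0 \<longrightarrow> 8 * M \<le> l\<^sup>2 * unit_ball_volume TYPE('a) \<longrightarrow>
       integrable lborel (\<lambda>x. cmod (u x) powr p) \<and>
       (LINT x|lborel. cmod (u x) powr p) \<le> l powr (p - 2) * mass u + C * K * M powr (2 / real DIM('a)) * l powr (p - (2 + 4 / real DIM('a)))"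
proof -
  define N where "N = real DIM('a)"
  have N: "N > 0" by (simp add: N_def)
  define q where "q = 2 + 4 / N"
  define V where "V = unit_ball_volume TYPE('a)"
  have V: "V > 0" by (simp add: V_def content_ball_pos)
  define c where "c = 8 * (8 / V) powr (2 / N)"
  have c0: "c \<ge> 0" by (simp add: c_def)
  \<comment> \<open>The ratio of the dyadic series: doubling the level multiplies the power by 2^p
    and the measure bound by 2^(-q). It is below 1 because \<open>p\<close> is subcritical.\<close>
  define rr where "rr = (2::real) powr (p - q)"
  have rr: "0 \<le> rr" "rr < 1" using p powr_less_mono[of "p - q" 0 2] by (auto simp: rr_def q_def N_def)
  define C where "C = 2 powr p * c * (1 / (1 - rr))"
  have C0: "C \<ge> 0" using rr c0 by (simp add: C_def)
  have main: "integrable lborel (\<lambda>x. cmod (u x) powr p) \<and>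
       (LINT x|lborel. cmod (u x) powr p) \<le> l powr (p - 2) * mass u + C * K * M powr (2 / N) * l powr (p - q)"
    if u: "u \<in> L2" and K: "0 \<le> K" and shift: "\<And>h. mass (\<lambda>x. u (x + h) - u x) \<le> K * (norm h)\<^sup>2"
      and M: "M > 0" and loc: "\<And>y. mass_on (ball y 1) u \<le> M" and l: "l > 0" and lM: "8 * M \<le> l\<^sup>2 * V"
    for u :: "'a \<Rightarrow> complex" and K M l
  proof -
    have [measurable]: "u \<in> borel_measurable borel" using u by (rule L2_measurable)
    have level: "emeasure lborel {x. t < cmod (u x)} \<le> ennreal (c * K * M powr (2 / N) * t powr (- q))" if t: "t \<ge> l" for t
    proof -
      have t0: "t > 0" using t l by simp
      \<comment> \<open>At level \<open>t\<close> the radius \<open>s\<close> is chosen such that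
        its ball has volume \<open>8 * M / t\<^sup>2\<close>, the least that
        \<open>level_set_bound\<close> admits. Since \<open>t \<ge> l\<close>, this radius is at
        most 1 and the local mass bound on unit balls applies.\<close>
      define b where "b = 8 * M / (t\<^sup>2 * V)"
      define s where "s = b powr (1 / N)"
      have base: "0 < b" unfolding b_def using M t0 V by simp
      have "l\<^sup>2 * V \<le> t\<^sup>2 * V" using t l V by (intro mult_right_mono power_mono) auto
      then have "b \<le> 1" unfolding b_def using order_trans[OF lM] t0 V by (simp add: divide_le_eq)
      then have s1: "s \<le> 1" unfolding s_def using base N powr_mono2[of "1/N" b 1] by simp
      have s0: "s > 0" unfolding s_def using base by simp
      have sN: "s ^ DIM('a) = b"
        unfolding s_def using base N by (simp add: powr_realpow[symmetric] powr_powr N_def)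
      have cont: "measure lborel (ball (0::'a) s) = 8 * M / t\<^sup>2"
        using content_ball_conv_unit_ball[of s "0::'a"] s0 sN V by (simp add: V_def b_def)
      have "emeasure lborel {x. t < cmod (u x)} \<le> ennreal (8 * K * s\<^sup>2 / t\<^sup>2)"
      proof (rule level_set_bound[OF u t0 s0 K shift])
        show "mass_on (ball y s) u \<le> M" for y
          using mass_on_mono[OF u, of "ball y s" "ball y 1"] s1 loc[of y] by (simp add: subset_ball)
        show "8 * M \<le> t\<^sup>2 * measure lborel (ball (0::'a) s)" unfolding cont using t0 by simp
      qed
      also have "8 * K * s\<^sup>2 / t\<^sup>2 = c * K * M powr (2 / N) * t powr (- q)"
      proof -
        have "s\<^sup>2 = b powr (2 / N)"
          unfolding s_def using base by (simp add: powr_realpow[symmetric] powr_powr)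
        also have "b = (8 / V) * M * t powr (-2)"
          unfolding b_def using t0 V by (simp add: powr_minus powr_numeral field_simps)
        also have "((8 / V) * M * t powr (-2)) powr (2 / N) = (8 / V) powr (2 / N) * M powr (2 / N) * t powr (- 4 / N)"
          by (subst powr_mult, subst powr_mult) (simp add: powr_powr)
        finally have s2: "s\<^sup>2 = (8 / V) powr (2 / N) * M powr (2 / N) * t powr (- 4 / N)" .
        have "t powr (- q) = t powr (- 4 / N) * t powr (-2)" by (simp add: q_def algebra_simps flip: powr_add)
        also have "\<dots> = t powr (- 4 / N) / t\<^sup>2" using t0 by (simp add: powr_minus powr_numeral divide_inverse)
        finally show ?thesis unfolding s2 c_def by simp
      qed
      finally show ?thesis .
    qed
    define Q where "Q = c * K * M powr (2 / N)"
    have Q0: "Q \<ge> 0" using c0 K by (simp add: Q_def)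
    have "(\<integral>\<^sup>+x. ennreal (cmod (u x) powr p) \<partial>lborel) \<le>
      (\<integral>\<^sup>+x. ennreal (l powr (p - 2) * (cmod (u x))\<^sup>2) + (\<Sum>k. ennreal ((2 ^ Suc k * l) powr p) * indicator {y. 2 ^ k * l < y} (cmod (u x))) \<partial>lborel)"
      by (intro nn_integral_mono dyadic_powr_bound l p) simp
    also have "\<dots> = (\<integral>\<^sup>+x. ennreal (l powr (p - 2) * (cmod (u x))\<^sup>2) \<partial>lborel) + (\<integral>\<^sup>+x. (\<Sum>k. ennreal ((2 ^ Suc k * l) powr p) * indicator {y. 2 ^ k * l < y} (cmod (u x))) \<partial>lborel)"
      by (rule nn_integral_add) auto
    also have "(\<integral>\<^sup>+x. ennreal (l powr (p - 2) * (cmod (u x))\<^sup>2) \<partial>lborel) = ennreal (l powr (p - 2) * mass u)"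
      using mass_nn_integral[OF u] by (simp add: ennreal_mult' nn_integral_cmult)
    also have "(\<integral>\<^sup>+x. (\<Sum>k. ennreal ((2 ^ Suc k * l) powr p) * indicator {y. 2 ^ k * l < y} (cmod (u x))) \<partial>lborel)
       = (\<Sum>k. \<integral>\<^sup>+x. ennreal ((2 ^ Suc k * l) powr p) * indicator {y. 2 ^ k * l < y} (cmod (u x)) \<partial>lborel)"
      by (rule nn_integral_suminf) auto
    also have "\<dots> \<le> (\<Sum>k. ennreal (2 powr p * Q * l powr (p - q) * rr ^ k))"
    proof (rule suminf_le)
      fix k
      have tk: "2 ^ k * l \<ge> l" "2 ^ k * l > 0" using l by auto
      have "(\<integral>\<^sup>+x. ennreal ((2 ^ Suc k * l) powr p) * indicator {y. 2 ^ k * l < y} (cmod (u x)) \<partial>lborel)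
        = (\<integral>\<^sup>+x. ennreal ((2 ^ Suc k * l) powr p) * indicator {x. 2 ^ k * l < cmod (u x)} x \<partial>lborel)"
        by (intro nn_integral_cong) (auto split: split_indicator)
      also have "\<dots> = ennreal ((2 ^ Suc k * l) powr p) * emeasure lborel {x. 2 ^ k * l < cmod (u x)}"
        by (subst nn_integral_cmult_indicator) auto
      also have "\<dots> \<le> ennreal ((2 ^ Suc k * l) powr p) * ennreal (Q * (2 ^ k * l) powr (- q))"
        unfolding Q_def by (intro mult_left_mono level tk) simp
      also have "\<dots> = ennreal ((2 ^ Suc k * l) powr p * (Q * (2 ^ k * l) powr (- q)))"
        by (simp add: ennreal_mult')
      also have "(2 ^ Suc k * l) powr p * (Q * (2 ^ k * l) powr (- q)) = 2 powr p * Q * l powr (p - q) * rr ^ k"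
      proof -
        have "(2 ^ Suc k * l) powr p = 2 powr p * (2 ^ k * l) powr p"
          using l by (simp add: powr_mult mult.assoc)
        moreover have "(2 ^ k * l) powr p * (2 ^ k * l) powr (- q) = (2 ^ k * l) powr (p - q)"
          by (simp flip: powr_add)
        moreover have "(2 ^ k * l) powr (p - q) = rr ^ k * l powr (p - q)"
          unfolding rr_def using l by (simp add: powr_mult powr_realpow[symmetric] powr_powr mult.commute)
        ultimately show ?thesis by (simp add: mult_ac)
      qed
      finally show "(\<integral>\<^sup>+x. ennreal ((2 ^ Suc k * l) powr p) * indicator {y. 2 ^ k * l < y} (cmod (u x)) \<partial>lborel)
         \<le> ennreal (2 powr p * Q * l powr (p - q) * rr ^ k)" .
    qed simp_all
    also have "\<dots> = ennreal (\<Sum>k. 2 powr p * Q * l powr (p - q) * rr ^ k)"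
      by (rule suminf_ennreal2) (use Q0 rr in \<open>auto intro!: summable_mult summable_geometric\<close>)
    also have "(\<Sum>k. 2 powr p * Q * l powr (p - q) * rr ^ k) = C * K * M powr (2 / N) * l powr (p - q)"
      using rr by (subst suminf_mult) (auto intro!: summable_geometric simp: suminf_geometric C_def Q_def)
    finally have le: "(\<integral>\<^sup>+x. ennreal (cmod (u x) powr p) \<partial>lborel) \<le> ennreal (l powr (p - 2) * mass u + C * K * M powr (2 / N) * l powr (p - q))"
      using C0 K by (simp add: add_left_mono)
    have int: "integrable lborel (\<lambda>x. cmod (u x) powr p)"
      by (rule integrableI_bounded) (use le_less_trans[OF le] in auto)
    have "ennreal (LINT x|lborel. cmod (u x) powr p) \<le> ennreal (l powr (p - 2) * mass u + C * K * M powr (2 / N) * l powr (p - q))"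
      using le by (subst nn_integral_eq_integral[OF int, symmetric]) auto
    then show ?thesis using int C0 K by (subst (asm) ennreal_le_iff) auto
  qed
  show ?thesis
    using C0 main unfolding shift_bounded_def V_def N_def q_def by (intro exI[of _ C]) blast
qed

text \<open>With the total mass as local bound, the coefficient of \<open>K\<close> is a constant
  times l^(p - q). The exponent is negative, so a high level \<open>l\<close> pushes it below
  \<open>e\<close>; the low values contribute only a constant.\<close>

lemma subcritical_coercive:
  fixes p e m :: real
  assumes p: "2 < p" "p < 2 + 4 / real DIM('a::euclidean_space)" and "e > 0" "m > 0"
  shows "\<exists>C\<ge>0. \<forall>(u::'a \<Rightarrow> complex) K. shift_bounded K u \<longrightarrow> mass u \<le> m \<longrightarrow>
       integrable lborel (\<lambda>x. cmod (u x) powr p) \<and> (LINT x|lborel. cmod (u x) powr p) \<le> e * K + C"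
proof -
  define q where "q = 2 + 4 / real DIM('a)"
  define V where "V = unit_ball_volume TYPE('a)"
  have V: "V > 0" by (simp add: V_def content_ball_pos)
  obtain C where C: "C \<ge> 0" and
    bound: "\<forall>(u::'a \<Rightarrow> complex) K M l. shift_bounded K u \<longrightarrow>
       M > 0 \<longrightarrow> (\<forall>y. mass_on (ball y 1) u \<le> M) \<longrightarrow> l > 0 \<longrightarrow> 8 * M \<le> l\<^sup>2 * V \<longrightarrow>
       integrable lborel (\<lambda>x. cmod (u x) powr p) \<and>
       (LINT x|lborel. cmod (u x) powr p) \<le> l powr (p - 2) * mass u + C * K * M powr (2 / real DIM('a)) * l powr (p - q)"
    using subcritical_powr_bound[OF p] unfolding q_def V_def by blast
  define c where "c = C * m powr (2 / real DIM('a))"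
  have c: "c \<ge> 0" using C by (simp add: c_def)
  have "((\<lambda>l. c * l powr (p - q)) \<longlongrightarrow> c * 0) at_top"
    using p by (intro tendsto_intros tendsto_neg_powr filterlim_ident) (simp add: q_def)
  then have "eventually (\<lambda>l. c * l powr (p - q) < e) at_top"
    using \<open>e > 0\<close> by (intro order_tendstoD) auto
  moreover have "eventually (\<lambda>l. l \<ge> sqrt (8 * m / V)) at_top" "eventually (\<lambda>l::real. l > 0) at_top"
    by (rule eventually_ge_at_top eventually_gt_at_top)+
  ultimately have "eventually (\<lambda>l. c * l powr (p - q) < e \<and> l \<ge> sqrt (8 * m / V) \<and> l > 0) at_top"
    by eventually_elim auto
  then obtain l where l: "c * l powr (p - q) < e" "l \<ge> sqrt (8 * m / V)" "l > 0"
    using eventually_happens by force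
  have "(sqrt (8 * m / V))\<^sup>2 \<le> l\<^sup>2" using l V \<open>m > 0\<close> by (intro power_mono) auto
  then have lV: "8 * m \<le> l\<^sup>2 * V" using V \<open>m > 0\<close> by (simp add: field_simps)
  show ?thesis
  proof (intro exI[of _ "l powr (p - 2) * m"] conjI allI impI)
    fix u :: "'a \<Rightarrow> complex" and K :: real
    assume sb: "shift_bounded K u" and "mass u \<le> m"
    note u = shift_boundedD[OF sb] \<open>mass u \<le> m\<close>
    have loc: "mass_on (ball y 1) u \<le> m" for y
      using mass_on_le_mass[OF u(1), of "ball y 1"] u(4) by simp
    have b: "integrable lborel (\<lambda>x. cmod (u x) powr p)"
       "(LINT x|lborel. cmod (u x) powr p) \<le> l powr (p - 2) * mass u + C * K * m powr (2 / real DIM('a)) * l powr (p - q)"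
      using bound[rule_format, OF sb \<open>m > 0\<close> loc l(3) lV] by auto
    have "C * K * m powr (2 / real DIM('a)) * l powr (p - q) = (c * l powr (p - q)) * K" by (simp add: c_def)
    also have "\<dots> \<le> e * K" using l(1) u(2) by (intro mult_right_mono) auto
    finally have "C * K * m powr (2 / real DIM('a)) * l powr (p - q) \<le> e * K" .
    moreover have "l powr (p - 2) * mass u \<le> l powr (p - 2) * m" using u(4) by (intro mult_left_mono) auto
    ultimately show "(LINT x|lborel. cmod (u x) powr p) \<le> e * K + l powr (p - 2) * m"
      using b(2) by argo
    show "integrable lborel (\<lambda>x. cmod (u x) powr p)" by (rule b)
  qed (use \<open>m > 0\<close> in simp)
qed

lemma subcritical_vanishing:
  fixes p e m K :: real
  assumes p: "2 < p" "p < 2 + 4 / real DIM('a::euclidean_space)" and "e > 0" "m > 0" "0 \<le> K"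
  shows "\<exists>\<sigma>>0. \<forall>(u::'a \<Rightarrow> complex). shift_bounded K u \<longrightarrow> mass u \<le> m \<longrightarrow>
       (\<forall>y. mass_on (ball y 1) u \<le> \<sigma>) \<longrightarrow> integrable lborel (\<lambda>x. cmod (u x) powr p) \<and> (LINT x|lborel. cmod (u x) powr p) \<le> e"
proof -
  define N where "N = real DIM('a)"
  have N: "N > 0" by (simp add: N_def)
  define q where "q = 2 + 4 / N"
  define V where "V = unit_ball_volume TYPE('a)"
  have V: "V > 0" by (simp add: V_def content_ball_pos)
  obtain C where C: "C \<ge> 0" and
    bound: "\<forall>(u::'a \<Rightarrow> complex) K M l. shift_bounded K u \<longrightarrow>
       M > 0 \<longrightarrow> (\<forall>y. mass_on (ball y 1) u \<le> M) \<longrightarrow> l > 0 \<longrightarrow> 8 * M \<le> l\<^sup>2 * V \<longrightarrow>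
       integrable lborel (\<lambda>x. cmod (u x) powr p) \<and>
       (LINT x|lborel. cmod (u x) powr p) \<le> l powr (p - 2) * mass u + C * K * M powr (2 / N) * l powr (p - q)"
    using subcritical_powr_bound[OF p] unfolding q_def V_def N_def by blast
  define A where "A = m + C * K * (V / 8) powr (2 / N)"
  have A: "A > 0" using C assms by (simp add: A_def add_pos_nonneg)
  define l where "l = (e / A) powr (1 / (p - 2))"
  have l: "l > 0" using A \<open>e > 0\<close> by (simp add: l_def)
  have lp: "l powr (p - 2) = e / A" unfolding l_def using A p \<open>e > 0\<close> by (simp add: powr_powr)
  define \<sigma> where "\<sigma> = l\<^sup>2 * V / 8"
  have s: "\<sigma> > 0" using l V by (simp add: \<sigma>_def)
  have pw: "\<sigma> powr (2 / N) * l powr (p - q) = (V / 8) powr (2 / N) * l powr (p - 2)"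
  proof -
    have sig: "\<sigma> = (V / 8) * l powr 2" using l by (simp add: \<sigma>_def powr_numeral)
      have "((V / 8) * l powr 2) powr (2 / N) = (V / 8) powr (2 / N) * (l powr 2) powr (2 / N)"
        by (rule powr_mult)
      then have "\<sigma> powr (2 / N) = (V / 8) powr (2 / N) * l powr (4 / N)"
        unfolding sig by (simp add: powr_powr)
    moreover have "l powr (4 / N) * l powr (p - q) = l powr (p - 2)" by (simp add: q_def flip: powr_add)
    ultimately show ?thesis by (simp add: mult.assoc)
  qed
  show ?thesis
  proof (intro exI[of _ \<sigma>] conjI allI impI s)
    fix u :: "'a \<Rightarrow> complex"
    assume sb: "shift_bounded K u" and u: "mass u \<le> m" "\<forall>y. mass_on (ball y 1) u \<le> \<sigma>"
    have b: "integrable lborel (\<lambda>x. cmod (u x) powr p)"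
       "(LINT x|lborel. cmod (u x) powr p) \<le> l powr (p - 2) * mass u + C * K * \<sigma> powr (2 / N) * l powr (p - q)"
      using bound[rule_format, OF sb s u(2)[rule_format] l] by (auto simp: \<sigma>_def)
    have "l powr (p - 2) * mass u \<le> l powr (p - 2) * m" using u(1) by (intro mult_left_mono) auto
    moreover have "C * K * \<sigma> powr (2 / N) * l powr (p - q) = l powr (p - 2) * (C * K * (V / 8) powr (2 / N))"
      using pw by (simp add: mult_ac)
    moreover have "l powr (p - 2) * m + l powr (p - 2) * (C * K * (V / 8) powr (2 / N)) = e"
    proof -
      have "l powr (p - 2) * m + l powr (p - 2) * (C * K * (V / 8) powr (2 / N)) = l powr (p - 2) * A"
        by (simp add: A_def distrib_left)
      then show ?thesis unfolding lp using A by simp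
    qed
    ultimately show "(LINT x|lborel. cmod (u x) powr p) \<le> e"
      using b(2) by argo
    show "integrable lborel (\<lambda>x. cmod (u x) powr p)" by (rule b)
  qed
qed

section \<open>Compactness of tight sequences\<close>

lemma L2_scaleR_indicator: "u \<in> L2 \<Longrightarrow> A \<in> sets borel \<Longrightarrow> (\<lambda>x. indicator A x *\<^sub>R u x) \<in> L2"
  by (rule L2_dominated[where C = 1]) (auto dest: L2_measurable split: split_indicator)

lemma mass_scaleR_indicator: "mass (\<lambda>x. indicator A x *\<^sub>R u x) = mass_on A u"
  unfolding mass_def mass_on_def by (intro Bochner_Integration.integral_cong) (auto split: split_indicator)

lemma integrable_indicator_L2:
  assumes "u \<in> L2" "A \<in> sets borel" "emeasure lborel A < \<infinity>"
  shows "integrable lborel (\<lambda>x. indicator A x *\<^sub>R u x)"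
proof -
  have "integrable lborel (\<lambda>x. cmod (complex_of_real (indicator A x)) * cmod (u x))"
    by (rule L2_mult_integrable[OF indicator_L2[OF assms(2,3)] assms(1)])
  then show ?thesis
    by (rule Bochner_Integration.integrable_bound) (use L2_measurable[OF assms(1)] assms(2) in \<open>auto split: split_indicator\<close>)
qed

definition ball_integral :: "real \<Rightarrow> 'a::euclidean_space \<Rightarrow> ('a \<Rightarrow> complex) \<Rightarrow> complex" where
  "ball_integral d c u = (LINT x|lborel. indicator (ball c d) x *\<^sub>R u x)"

lemma emeasure_ball_finite: "emeasure lborel (ball c d) < \<infinity>"
  using emeasure_bounded_finite[OF bounded_ball, of c d] .

lemma measure_ball_translate: "measure lborel (ball (c::'a::euclidean_space) d) = measure lborel (ball (0::'a) d)"
  by (cases "d \<ge> 0") (simp_all add: content_ball ball_empty)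

lemma ball_integral_diff:
  "u \<in> L2 \<Longrightarrow> v \<in> L2 \<Longrightarrow> ball_integral d c (\<lambda>x. u x - v x) = ball_integral d c u - ball_integral d c v"
  unfolding ball_integral_def scaleR_diff_right
  by (intro Bochner_Integration.integral_diff integrable_indicator_L2 emeasure_ball_finite) auto

lemma ball_integral_bound:
  assumes "u \<in> L2"
  shows "cmod (ball_integral d c u) \<le> sqrt (measure lborel (ball c d)) * L2_norm u"
proof -
  have "mass (\<lambda>x::'a. complex_of_real (indicator (ball c d) x)) = measure lborel (ball c d)"
  proof -
    have "(cmod (complex_of_real (indicator (ball c d) x)))\<^sup>2 = indicator (ball c d) x" for x :: 'a
      by (auto split: split_indicator)
    then show ?thesis by (simp add: mass_def)
  qed
  then show ?thesis
    using test_scaleR_bound[OF indicator_L2[OF _ emeasure_ball_finite] assms, of c d]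
    by (simp add: ball_integral_def L2_norm_mass)
qed

text \<open>Jensen's inequality on a ball, obtained by applying Cauchy-Schwarz to
  \<open>w - u\<close> there. It is stated in \<open>ennreal\<close> so that it can be integrated
  afterwards over the point at which \<open>w\<close> is a value of \<open>u\<close>.\<close>

lemma average_deviation:
  fixes u :: "'a::euclidean_space \<Rightarrow> complex" and c :: 'a
  assumes u: "u \<in> L2" and d: "d > 0"
  defines "V \<equiv> measure lborel (ball (0::'a) d)"
  shows "ennreal (V * (cmod (w - ball_integral d c u / complex_of_real V))\<^sup>2) \<le>
    (\<integral>\<^sup>+z. ennreal (indicator (ball c d) z * (cmod (w - u z))\<^sup>2) \<partial>lborel)"
proof -
  have V: "V > 0" using d by (simp add: V_def content_ball_pos)
  define g where "g z = w * complex_of_real (indicator (ball c d) z) - indicator (ball c d) z *\<^sub>R u z" for z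
  have gL: "g \<in> L2" unfolding g_def
    by (intro L2_diff L2_cmult indicator_L2 L2_scaleR_indicator u emeasure_ball_finite) auto
  have g_eq: "indicator (ball c d) z *\<^sub>R g z = g z" for z by (simp add: g_def split: split_indicator)
  have int1: "integrable lborel (\<lambda>z::'a. w * complex_of_real (indicator (ball c d) z))"
    using emeasure_ball_finite[of c d] by (intro integrable_mult_right integrable_of_real integrable_real_indicator) auto
  have int: "(LINT z|lborel. g z) = w * complex_of_real V - ball_integral d c u"
    unfolding g_def ball_integral_def using int1 integrable_indicator_L2[OF u _ emeasure_ball_finite]
    by (subst Bochner_Integration.integral_diff) (auto simp: V_def measure_ball_translate[of c])
  have "cmod (w * complex_of_real V - ball_integral d c u) \<le> sqrt V * L2_norm g"
    using ball_integral_bound[OF gL, of d c] unfolding ball_integral_def g_eq int V_def measure_ball_translate[of c] .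
  moreover have "w * complex_of_real V - ball_integral d c u = complex_of_real V * (w - ball_integral d c u / complex_of_real V)"
    using V by (simp add: right_diff_distrib)
  ultimately have "V * cmod (w - ball_integral d c u / complex_of_real V) \<le> sqrt V * L2_norm g"
    using V by (simp add: norm_mult)
  then have "(V * cmod (w - ball_integral d c u / complex_of_real V))\<^sup>2 \<le> (sqrt V * L2_norm g)\<^sup>2"
    using V by (intro power_mono) auto
  then have "V * (V * (cmod (w - ball_integral d c u / complex_of_real V))\<^sup>2) \<le> V * mass g"
    using V by (simp add: power_mult_distrib L2_norm_sq) (simp add: power2_eq_square mult_ac)
  then have "V * (cmod (w - ball_integral d c u / complex_of_real V))\<^sup>2 \<le> mass g" using V by simp
  moreover have "(\<integral>\<^sup>+z. ennreal (indicator (ball c d) z * (cmod (w - u z))\<^sup>2) \<partial>lborel) = ennreal (mass g)"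
    unfolding mass_nn_integral[OF gL, symmetric] by (intro nn_integral_cong) (auto simp: g_def split: split_indicator)
  ultimately show ?thesis by (simp add: ennreal_leI)
qed

text \<open>
  A Poincare-type inequality: up to an error controlled by the modulus of continuity, the mass of
  \<open>u\<close> on a ball is controlled by finitely many averages of \<open>u\<close>.
\<close>

lemma mass_on_ball_by_averages:
  fixes u :: "'a::euclidean_space \<Rightarrow> complex"
  assumes sb: "shift_bounded K u" and d: "d > 0" and X: "finite X" "ball 0 R \<subseteq> (\<Union>c\<in>X. ball c d)"
  defines "V \<equiv> measure lborel (ball (0::'a) d)"
  shows "mass_on (ball 0 R) u \<le> 8 * 2 ^ DIM('a) * d\<^sup>2 * K + 2 * measure lborel (ball (0::'a) R) * (\<Sum>c\<in>X. (cmod (ball_integral d c u) / V)\<^sup>2)"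
proof -
  note u = shift_boundedD[OF sb]
  have [measurable]: "u \<in> borel_measurable borel" using u(1) by (rule L2_measurable)
  have V: "V > 0" using d by (simp add: V_def content_ball_pos)
  \<comment> \<open>Two points of a ball of radius \<open>d\<close> differ by less than
    \<open>2 * d\<close>, so displacements in \<open>B\<close> reach every point used in an
    average.\<close>
  define B where "B = ball (0::'a) (2 * d)"
  have [measurable]: "B \<in> sets borel" "ball (c::'a) t \<in> sets borel" for c t by (simp_all add: B_def)
  have mB: "measure lborel B = 2 ^ DIM('a) * V" using d by (simp add: B_def V_def content_ball power_mult_distrib)
  have eB: "emeasure lborel B = ennreal (2 ^ DIM('a) * V)"
    unfolding mB[symmetric] unfolding B_def by (rule emeasure_lborel_ball)
  define S where "S = (\<Sum>c\<in>X. (cmod (ball_integral d c u) / V)\<^sup>2)"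
  have S: "S \<ge> 0" by (simp add: S_def sum_nonneg)
  define D where "D x = (\<integral>\<^sup>+h. ennreal (indicator B h * (cmod (u (x + h) - u x))\<^sup>2) \<partial>lborel)" for x
  have [measurable]: "D \<in> borel_measurable borel" unfolding D_def by measurable
  have pt: "ennreal (indicator (ball 0 R) y * (cmod (u y))\<^sup>2) \<le> ennreal (2 / V) * D y + ennreal (2 * S) * indicator (ball 0 R) y" for y
  proof (cases "y \<in> ball 0 R")
    case True
    then obtain c where c: "c \<in> X" "y \<in> ball c d" using X(2) by blast
    define A where "A = ball_integral d c u / complex_of_real V"
    have cA: "(cmod A)\<^sup>2 \<le> S"
    proof -
      have "cmod A = cmod (ball_integral d c u) / V" using V by (simp add: A_def norm_divide)
      then show ?thesis unfolding S_def using c(1) X(1)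
        by (simp add: member_le_sum[where f = "\<lambda>c. (cmod (ball_integral d c u) / V)\<^sup>2"])
    qed
    have "ennreal (V * (cmod (u y - A))\<^sup>2) \<le> (\<integral>\<^sup>+z. ennreal (indicator (ball c d) z * (cmod (u y - u z))\<^sup>2) \<partial>lborel)"
      unfolding A_def V_def by (rule average_deviation[OF u(1) d])
    also have "\<dots> = (\<integral>\<^sup>+h. ennreal (indicator (ball c d) (h + y) * (cmod (u y - u (h + y)))\<^sup>2) \<partial>lborel)"
      by (rule nn_integral_shift[symmetric]) measurable
    also have "\<dots> \<le> D y"
      unfolding D_def
    proof (rule nn_integral_mono, rule ennreal_leI)
      fix h
      have "indicator (ball c d) (h + y) \<le> (indicator B h :: real)"
      proof (cases "h + y \<in> ball c d")
        case True
        have "dist 0 h \<le> dist (h + y) c + dist c y" using dist_triangle[of "h + y" y c] by (simp add: dist_norm)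
        also have "\<dots> < 2 * d" using True c(2) by (simp add: dist_commute)
        finally show ?thesis by (simp add: B_def split: split_indicator)
      qed simp
      then show "indicator (ball c d) (h + y) * (cmod (u y - u (h + y)))\<^sup>2 \<le> indicator B h * (cmod (u (y + h) - u y))\<^sup>2"
        by (simp add: norm_minus_commute[of "u y"] add.commute[of h] mult_right_mono)
    qed
    finally have "ennreal (2 / V) * ennreal (V * (cmod (u y - A))\<^sup>2) \<le> ennreal (2 / V) * D y"
      by (rule mult_left_mono) simp
    then have dev: "ennreal (2 * (cmod (u y - A))\<^sup>2) \<le> ennreal (2 / V) * D y"
      using V by (simp flip: ennreal_mult')
    have "(cmod (u y))\<^sup>2 \<le> 2 * (cmod (u y - A))\<^sup>2 + 2 * S"
      using sq_norm_add_le[of "u y - A" A] cA by simp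
    then have "ennreal ((cmod (u y))\<^sup>2) \<le> ennreal (2 * (cmod (u y - A))\<^sup>2) + ennreal (2 * S)"
      using S by (simp flip: ennreal_plus add: ennreal_leI)
    also have "\<dots> \<le> ennreal (2 / V) * D y + ennreal (2 * S)" using dev by (rule add_right_mono)
    finally show ?thesis using True by simp
  qed simp
  have "ennreal (mass_on (ball 0 R) u) \<le> (\<integral>\<^sup>+y. ennreal (2 / V) * D y + ennreal (2 * S) * indicator (ball 0 R) y \<partial>lborel)"
    unfolding nn_integral_mass_on[OF u(1) borel_open[OF open_ball], symmetric] by (intro nn_integral_mono pt)
  also have "\<dots> = ennreal (2 / V) * (\<integral>\<^sup>+y. D y \<partial>lborel) + ennreal (2 * S) * emeasure lborel (ball (0::'a) R)"
    by (subst nn_integral_add) (auto simp: nn_integral_cmult nn_integral_cmult_indicator)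
  also have "(\<integral>\<^sup>+y. D y \<partial>lborel) = (\<integral>\<^sup>+h. (\<integral>\<^sup>+x. ennreal (indicator B h * (cmod (u (x + h) - u x))\<^sup>2) \<partial>lborel) \<partial>lborel)"
    unfolding D_def by (rule lborel_pair.Fubini'[symmetric]) measurable
  also have "\<dots> \<le> (\<integral>\<^sup>+h. ennreal (K * (2 * d)\<^sup>2) * indicator B h \<partial>lborel)"
  proof (rule nn_integral_mono)
    fix h
    show "(\<integral>\<^sup>+x. ennreal (indicator B h * (cmod (u (x + h) - u x))\<^sup>2) \<partial>lborel) \<le> ennreal (K * (2 * d)\<^sup>2) * indicator B h"
    proof (cases "h \<in> B")
      case True
      then have "K * (norm h)\<^sup>2 \<le> K * (2 * d)\<^sup>2"
        using u(2) by (intro mult_left_mono power_mono) (auto simp: B_def)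
      then have "mass (\<lambda>x. u (x + h) - u x) \<le> K * (2 * d)\<^sup>2" using u(3)[of h] by linarith
      then show ?thesis
        using True mass_nn_integral[OF L2_diff[OF L2_shift[OF u(1)] u(1)], of h] by (simp add: ennreal_leI)
    qed simp
  qed
  also have "\<dots> = ennreal (K * (2 * d)\<^sup>2) * ennreal (2 ^ DIM('a) * V)"
    by (subst nn_integral_cmult_indicator) (auto simp: eB)
  also have "ennreal (2 / V) * (ennreal (K * (2 * d)\<^sup>2) * ennreal (2 ^ DIM('a) * V)) + ennreal (2 * S) * emeasure lborel (ball (0::'a) R)
     = ennreal (2 / V * (K * (2 * d)\<^sup>2 * (2 ^ DIM('a) * V)) + 2 * S * measure lborel (ball (0::'a) R))"
    unfolding emeasure_lborel_ball using V S u(2) by (simp add: ennreal_mult' flip: ennreal_plus ennreal_mult')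
  \<comment> \<open>The constant collects 2 from splitting a square, \<open>(2 * d)\<^sup>2\<close>
    from the shift bound and \<open>2 ^ DIM('a)\<close> from the volume of the doubled ball.\<close>
  also have "2 / V * (K * (2 * d)\<^sup>2 * (2 ^ DIM('a) * V)) = 8 * 2 ^ DIM('a) * d\<^sup>2 * K"
    using V by (simp add: power_mult_distrib)
  finally have "ennreal (mass_on (ball 0 R) u) \<le> ennreal (8 * 2 ^ DIM('a) * d\<^sup>2 * K + 2 * S * measure lborel (ball (0::'a) R))"
    by (simp add: add_right_mono mult_left_mono)
  then have "mass_on (ball 0 R) u \<le> 8 * 2 ^ DIM('a) * d\<^sup>2 * K + 2 * S * measure lborel (ball (0::'a) R)"
    using S u(2) by (subst (asm) ennreal_le_iff) auto
  then show ?thesis by (simp add: S_def mult_ac)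
qed

section \<open>Extraction of subsequences\<close>

lemma finite_family_convergent_subseq:
  fixes g :: "'i \<Rightarrow> nat \<Rightarrow> complex"
  assumes "finite A" "\<And>a. a \<in> A \<Longrightarrow> bounded (range (g a))"
  shows "\<exists>r::nat \<Rightarrow> nat. strict_mono r \<and> (\<forall>a\<in>A. convergent (\<lambda>n. g a (r n)))"
  using assms
proof (induction A rule: finite_induct)
  case empty
  then show ?case by (auto intro!: exI[of _ id] strict_mono_id)
next
  case (insert a A)
  then obtain r where r: "strict_mono r" "\<forall>a\<in>A. convergent (\<lambda>n. g a (r n))" by auto
  have "bounded (range (\<lambda>n. g a (r n)))"
    by (rule bounded_subset[OF insert.prems[of a]]) auto
  then obtain l s where s: "strict_mono s" "((\<lambda>n. g a (r n)) \<circ> s) \<longlonglongrightarrow> l"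
    using bounded_imp_convergent_subsequence by blast
  have "convergent (\<lambda>n. g b (r (s n)))" if "b \<in> A" for b
    using r(2) that s(1) convergent_subseq_convergent[of "\<lambda>n. g b (r n)" s] by (auto simp: o_def)
  moreover have "convergent (\<lambda>n. g a (r (s n)))" using s(2) by (auto simp: convergent_def o_def)
  ultimately show ?case using strict_mono_o[OF r(1) s(1)]
    by (intro exI[of _ "r \<circ> s"] conjI) (assumption, auto)
qed

lemma mass_diff_le: "u \<in> L2 \<Longrightarrow> v \<in> L2 \<Longrightarrow> mass (\<lambda>x. u x - v x) \<le> 2 * mass u + 2 * mass v"
proof -
  assume uv: "u \<in> L2" "v \<in> L2"
  have "mass (\<lambda>x. u x - v x) = 4 * mass (\<lambda>x. (u x - v x) / 2)"
    using mass_cmult[of "1/2" "\<lambda>x. u x - v x"] by (simp add: norm_divide power_divide)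
  also have "\<dots> \<le> 4 * ((mass u + mass v) / 2)"
    unfolding mass_parallelogram[OF uv, symmetric] by simp
  finally show ?thesis by simp
qed

lemma mass_on_diff_le:
  assumes "u \<in> L2" "v \<in> L2" "A \<in> sets borel"
  shows "mass_on A (\<lambda>x. u x - v x) \<le> 2 * mass_on A u + 2 * mass_on A v"
  using mass_diff_le[OF L2_scaleR_indicator[OF assms(1,3)] L2_scaleR_indicator[OF assms(2,3)]]
  by (simp add: mass_scaleR_indicator flip: scaleR_diff_right)

lemma shift_bounded_diff:
  assumes "shift_bounded K u" "shift_bounded K v"
  shows "shift_bounded (4 * K) (\<lambda>x. u x - v x)"
  unfolding shift_bounded_def
proof (intro conjI allI)
  note u = shift_boundedD[OF assms(1)] and v = shift_boundedD[OF assms(2)]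
  show "(\<lambda>x. u x - v x) \<in> L2" by (rule L2_diff[OF u(1) v(1)])
  show "0 \<le> 4 * K" using u(2) by simp
  fix h
  show "mass (\<lambda>x. u (x + h) - v (x + h) - (u x - v x)) \<le> 4 * K * (norm h)\<^sup>2"
    using mass_diff_le[OF L2_diff[OF L2_shift[OF u(1)] u(1)] L2_diff[OF L2_shift[OF v(1)] v(1)], of h h] u(3)[of h] v(3)[of h]
    by (simp add: algebra_simps)
qed

lemma mass_split:
  assumes "u \<in> L2" "A \<in> sets borel"
  shows "mass u = mass_on A u + mass_on (- A) u"
proof -
  have "(cmod (u x))\<^sup>2 = indicator A x * (cmod (u x))\<^sup>2 + indicator (- A) x * (cmod (u x))\<^sup>2" for x
    by (auto split: split_indicator)
  then show ?thesis
    unfolding mass_def mass_on_def using assms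
    by (subst Bochner_Integration.integral_add[symmetric]) (auto intro: integrable_mass_on)
qed

text \<open>At a fixed tolerance only finitely many numbers matter. Outside a ball the mass is small
  by tightness; inside, finitely many averages control it up to the modulus of continuity, and
  Bolzano-Weierstrass brings those averages together.\<close>

lemma L2_close_subsequence:
  fixes f :: "nat \<Rightarrow> 'a::euclidean_space \<Rightarrow> complex"
  assumes sb: "\<And>n. shift_bounded K (f n)" and m: "\<And>n. mass (f n) \<le> m"
    and tight: "\<And>e. e > 0 \<Longrightarrow> \<exists>R N. \<forall>n\<ge>N. mass_on (- ball 0 R) (f n) \<le> e" and e: "e > 0"
  shows "\<exists>r::nat \<Rightarrow> nat. strict_mono r \<and> (\<forall>i j. L2_norm (\<lambda>x. f (r i) x - f (r j) x) \<le> e)"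
proof -
  have L2: "f n \<in> L2" for n using shift_boundedD(1)[OF sb] .
  have K: "K \<ge> 0" using shift_boundedD(2)[OF sb] .
  \<comment> \<open>The outer mass of a difference is at most twice the sum of the two outer masses,
    hence at most \<open>e\<^sup>2 / 4\<close>.\<close>
  have "e\<^sup>2 / 16 > 0" using e by simp
  then obtain R N where RN: "\<And>n. n \<ge> N \<Longrightarrow> mass_on (- ball 0 R) (f n) \<le> e\<^sup>2 / 16" using tight by blast
  define c where "c = 8 * 2 ^ DIM('a) * (4 * K)"
  have c: "c \<ge> 0" using K by (simp add: c_def)
  \<comment> \<open>This radius makes the continuity error of a difference, whose shift constant is
    \<open>4 * K\<close>, at most \<open>e\<^sup>2 / 4\<close>.\<close>
  define d where "d = sqrt (e\<^sup>2 / 4 / (c + 1))"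
  have d: "d > 0" using e c by (simp add: d_def)
  have le: "c * d\<^sup>2 \<le> (c + 1) * d\<^sup>2" by (simp add: algebra_simps)
  have d2: "d\<^sup>2 = e\<^sup>2 / 4 / (c + 1)" using c by (simp add: d_def)
  have "(c + 1) * d\<^sup>2 = e\<^sup>2 / 4" unfolding d2 using c by (simp add: field_simps)
  with le have cd: "8 * 2 ^ DIM('a) * d\<^sup>2 * (4 * K) \<le> e\<^sup>2 / 4" by (simp add: c_def mult_ac)
  define V where "V = measure lborel (ball (0::'a) d)"
  have V: "V > 0" using d by (simp add: V_def content_ball_pos)
  obtain X where X: "finite X" "cball (0::'a) R \<subseteq> (\<Union>c\<in>X. ball c d)"
  proof -
    have "x \<in> (\<Union>c\<in>UNIV. ball c d)" for x :: 'a using d by (intro UN_I[of x]) auto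
    then have "cball (0::'a) R \<subseteq> (\<Union>c\<in>UNIV. ball c d)" by blast
    then show ?thesis
      using compactE_image[of "cball (0::'a) R" UNIV "\<lambda>c. ball c d"] that by (metis compact_cball open_ball)
  qed
  have bd: "bounded (range (\<lambda>n. ball_integral d c (f (n + N))))" for c
  proof (rule boundedI)
    fix z assume "z \<in> range (\<lambda>n. ball_integral d c (f (n + N)))"
    then obtain n where z: "z = ball_integral d c (f n)" by auto
    show "cmod z \<le> sqrt (measure lborel (ball c d)) * sqrt m"
      unfolding z using m[of n]
      by (intro order_trans[OF ball_integral_bound[OF L2] mult_left_mono]) (auto simp: L2_norm_mass)
  qed
  from finite_family_convergent_subseq[OF X(1), of "\<lambda>c n. ball_integral d c (f (n + N))"] bd
  obtain r where r: "strict_mono r" "\<And>c. c \<in> X \<Longrightarrow> convergent (\<lambda>n. ball_integral d c (f (r n + N)))" by auto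
  define A where "A = 2 * measure lborel (ball (0::'a) R) * real (card X)"
  have A: "A \<ge> 0" by (simp add: A_def)
  \<comment> \<open>If all averages agree within \<open>t\<close>, their total contribution is at
    most \<open>e\<^sup>2 / 4\<close>. The three contributions together stay below
    \<open>e\<^sup>2\<close>.\<close>
  define t where "t = sqrt (e\<^sup>2 / 4 / (A + 1)) * V"
  have t: "t > 0" using e A V by (simp add: t_def)
  have "\<exists>n0. \<forall>c\<in>X. \<forall>i\<ge>n0. \<forall>j\<ge>n0. cmod (ball_integral d c (f (r i + N)) - ball_integral d c (f (r j + N))) < t"
    using X(1) r(2)
  proof (induction X rule: finite_induct)
    case (insert c X)
    then obtain n1 where n1: "\<forall>c\<in>X. \<forall>i\<ge>n1. \<forall>j\<ge>n1. cmod (ball_integral d c (f (r i + N)) - ball_integral d c (f (r j + N))) < t" by auto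
    obtain n2 where n2: "\<forall>i\<ge>n2. \<forall>j\<ge>n2. cmod (ball_integral d c (f (r i + N)) - ball_integral d c (f (r j + N))) < t"
      using CauchyD[OF convergent_Cauchy[OF insert.prems[of c]] t] by auto
    show ?case using n1 n2 by (intro exI[of _ "max n1 n2"]) auto
  qed simp
  then obtain n0 where n0: "\<And>c i j. c \<in> X \<Longrightarrow> i \<ge> n0 \<Longrightarrow> j \<ge> n0 \<Longrightarrow> cmod (ball_integral d c (f (r i + N)) - ball_integral d c (f (r j + N))) < t"
    by blast
  define s where "s n = r (n + n0) + N" for n
  show ?thesis
  proof (intro exI[of _ s] conjI allI)
    show "strict_mono s" using r(1) by (auto simp: s_def strict_mono_def)
    fix i j
    define g where "g x = f (s i) x - f (s j) x" for x
    have gs: "shift_bounded (4 * K) g" unfolding g_def by (rule shift_bounded_diff[OF sb sb])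
    have gL: "g \<in> L2" using shift_boundedD(1)[OF gs] .
    have "mass_on (- ball 0 R) g \<le> 2 * mass_on (- ball 0 R) (f (s i)) + 2 * mass_on (- ball 0 R) (f (s j))"
      unfolding g_def by (rule mass_on_diff_le[OF L2 L2]) auto
    also have "\<dots> \<le> e\<^sup>2 / 4" using RN[of "s i"] RN[of "s j"] by (simp add: s_def)
    finally have out: "mass_on (- ball 0 R) g \<le> e\<^sup>2 / 4" .
    have "(\<Sum>c\<in>X. (cmod (ball_integral d c g) / V)\<^sup>2) \<le> (\<Sum>c\<in>X. (t / V)\<^sup>2)"
    proof (intro sum_mono power_mono divide_right_mono)
      fix c assume "c \<in> X"
      then show "cmod (ball_integral d c g) \<le> t"
        using n0[of c "i + n0" "j + n0"] by (simp add: g_def[abs_def] s_def ball_integral_diff L2)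
    qed (use V in auto)
    also have "\<dots> = real (card X) * (e\<^sup>2 / 4 / (A + 1))"
      using V A by (simp add: t_def)
    finally have "2 * measure lborel (ball (0::'a) R) * (\<Sum>c\<in>X. (cmod (ball_integral d c g) / V)\<^sup>2) \<le>
       2 * measure lborel (ball (0::'a) R) * (real (card X) * (e\<^sup>2 / 4 / (A + 1)))"
      by (intro mult_left_mono) auto
    also have "\<dots> = A * (e\<^sup>2 / 4 / (A + 1))" by (simp add: A_def)
    also have "\<dots> \<le> e\<^sup>2 / 4" using A by (simp add: field_simps)
    finally have avg: "2 * measure lborel (ball (0::'a) R) * (\<Sum>c\<in>X. (cmod (ball_integral d c g) / V)\<^sup>2) \<le> e\<^sup>2 / 4" .
    have "mass_on (ball 0 R) g \<le> e\<^sup>2 / 4 + e\<^sup>2 / 4"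
      using mass_on_ball_by_averages[OF gs d X(1), of R] X(2) cd avg unfolding V_def by (smt (verit) ball_subset_cball order_trans)
    then have "mass g \<le> e\<^sup>2"
      using mass_split[OF gL borel_open[OF open_ball], of 0 R] out zero_le_power2[of e] by linarith
    then have "L2_norm g \<le> sqrt (e\<^sup>2)" unfolding L2_norm_mass by (rule real_sqrt_le_mono)
    then show "L2_norm (\<lambda>x. f (s i) x - f (s j) x) \<le> e" using e by (simp add: g_def[abs_def])
  qed
qed

text \<open>Closeness within a tolerance is inherited by subsequences, so a diagonal sequence over
  the tolerances \<open>1 / Suc k\<close> is Cauchy.\<close>

lemma L2_compact_subsequence:
  fixes f :: "nat \<Rightarrow> 'a::euclidean_space \<Rightarrow> complex"
  assumes sb: "\<And>n. shift_bounded K (f n)" and m: "\<And>n. mass (f n) \<le> m"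
    and tight: "\<And>e. e > 0 \<Longrightarrow> \<exists>R N. \<forall>n\<ge>N. mass_on (- ball 0 R) (f n) \<le> e"
  shows "\<exists>r::nat \<Rightarrow> nat. strict_mono r \<and>
    (\<forall>e>0. \<exists>N. \<forall>i\<ge>N. \<forall>j\<ge>N. L2_norm (\<lambda>x. f (r i) x - f (r j) x) < e)"
proof -
  define P where "P k s \<longleftrightarrow> (\<forall>i j. L2_norm (\<lambda>x. f (s i) x - f (s j) x) \<le> 1 / real (Suc k))" for k and s :: "nat \<Rightarrow> nat"
  interpret subseqs P
  proof
    fix k and s :: "nat \<Rightarrow> nat" assume s: "strict_mono s"
    have "\<exists>r::nat \<Rightarrow> nat. strict_mono r \<and> (\<forall>i j. L2_norm (\<lambda>x. f (s (r i)) x - f (s (r j)) x) \<le> 1 / real (Suc k))"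
    proof (rule L2_close_subsequence[of K "\<lambda>n. f (s n)" m])
      fix e :: real assume "e > 0"
      then obtain R N where "\<forall>n\<ge>N. mass_on (- ball 0 R) (f n) \<le> e" using tight by blast
      then show "\<exists>R N. \<forall>n\<ge>N. mass_on (- ball 0 R) (f (s n)) \<le> e"
        using seq_suble[OF s] by (intro exI[of _ R] exI[of _ N]) (meson order_trans)
    qed (use sb m in auto)
    then show "\<exists>r'. strict_mono r' \<and> P k (s \<circ> r')" by (simp add: P_def)
  qed
  have "P k (diagseq \<circ> ((+) (Suc k)))" for k
    by (rule diagseq_holds) (simp add: P_def)
  then have holds: "L2_norm (\<lambda>x. f ((diagseq \<circ> ((+) (Suc k))) i) x - f ((diagseq \<circ> ((+) (Suc k))) j) x) \<le> 1 / real (Suc k)" for k i j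
    by (subst (asm) P_def) blast
  show ?thesis
  proof (rule exI[of _ diagseq], rule conjI[OF subseq_diagseq], intro allI impI)
    fix e :: real assume "e > 0"
    then obtain k where k: "inverse (real (Suc k)) < e" using reals_Archimedean by auto
    show "\<exists>N. \<forall>i\<ge>N. \<forall>j\<ge>N. L2_norm (\<lambda>x. f (diagseq i) x - f (diagseq j) x) < e"
    proof (intro exI[of _ "Suc k"] allI impI)
      fix i j assume "i \<ge> Suc k" "j \<ge> Suc k"
      then have "L2_norm (\<lambda>x. f (diagseq i) x - f (diagseq j) x) \<le> 1 / real (Suc k)"
        using holds[of k "i - Suc k" "j - Suc k"] by simp
      also have "\<dots> < e" using k by (simp add: inverse_eq_divide)
      finally show "L2_norm (\<lambda>x. f (diagseq i) x - f (diagseq j) x) < e" .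
    qed
  qed
qed

section \<open>The nonlinearity\<close>

text \<open>Young's inequality with the conjugate exponents (s + t)/s and (s + t)/t.\<close>

lemma weighted_powr_le:
  fixes a c s t :: real
  assumes "0 \<le> a" "0 \<le> c" "s > 0" "t > 0"
  shows "a powr s * c powr t \<le> s / (s + t) * a powr (s + t) + t / (s + t) * c powr (s + t)"
proof -
  have e: "1 / ((s + t) / s) + 1 / ((s + t) / t) = 1"
    using assms by (simp add: add_divide_distrib[symmetric])
  have "a powr s * c powr t \<le> (a powr s) powr ((s + t) / s) / ((s + t) / s) + (c powr t) powr ((s + t) / t) / ((s + t) / t)"
    by (rule Youngs_inequality[OF _ _ e]) (use assms in auto)
  then show ?thesis using assms by (simp add: powr_powr mult_ac)
qed

lemma powr_le_square: "0 \<le> a \<Longrightarrow> a \<le> 1 \<Longrightarrow> 2 \<le> s \<Longrightarrow> a powr s \<le> (a::real)\<^sup>2"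
  using powr_mono'[of 2 s a] by (cases "a = 0") auto

text \<open>After normalisation a^2 + b^2 = c^2 + d^2 = 1. Young's inequality separates the
  couplings into pure powers of exponent s + t \<ge> 2, which on [0, 1] are at most the squares; the
  weights s/(s + t) and t/(s + t) then add up to 1.\<close>

lemma powr_coupling_superadditive:
  fixes x1 x2 y1 y2 s t :: real
  assumes nn: "0 \<le> x1" "0 \<le> x2" "0 \<le> y1" "0 \<le> y2" and st: "s > 0" "t > 0" "s + t \<ge> 2"
  shows "x1 powr s * x2 powr t + y1 powr s * y2 powr t \<le> norm (x1, y1) powr s * norm (x2, y2) powr t"
proof -
  define w1 where "w1 = norm (x1, y1)"
  define w2 where "w2 = norm (x2, y2)"
  have sq: "w1\<^sup>2 = x1\<^sup>2 + y1\<^sup>2" "w2\<^sup>2 = x2\<^sup>2 + y2\<^sup>2" by (simp_all add: w1_def w2_def norm_Pair)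
  have w0: "w1 \<ge> 0" "w2 \<ge> 0" by (simp_all add: w1_def w2_def)
  show ?thesis
  proof (cases "w1 = 0 \<or> w2 = 0")
    case True
    then have "(x1 = 0 \<and> y1 = 0) \<or> (x2 = 0 \<and> y2 = 0)" by (auto simp: w1_def w2_def zero_prod_def)
    then show ?thesis by auto
  next
    case False
    then have w: "w1 > 0" "w2 > 0" using w0 by auto
    have le: "x1 \<le> w1" "y1 \<le> w1" "x2 \<le> w2" "y2 \<le> w2"
      using norm_fst_le[of x1 y1] norm_snd_le[of y1 x1] norm_fst_le[of x2 y2] norm_snd_le[of y2 x2] nn
      by (simp_all add: w1_def w2_def)
    define a b c d where "a = x1 / w1" and "b = y1 / w1" and "c = x2 / w2" and "d = y2 / w2"
    have ab: "a\<^sup>2 + b\<^sup>2 = 1" "c\<^sup>2 + d\<^sup>2 = 1"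
      using w unfolding a_def b_def c_def d_def power_divide add_divide_distrib[symmetric] sq[symmetric] by simp_all
    have rng: "0 \<le> a" "a \<le> 1" "0 \<le> b" "b \<le> 1" "0 \<le> c" "c \<le> 1" "0 \<le> d" "d \<le> 1"
      using w le nn by (simp_all add: a_def b_def c_def d_def)
    have "a powr s * c powr t + b powr s * d powr t \<le>
       (s / (s + t) * a powr (s + t) + t / (s + t) * c powr (s + t)) + (s / (s + t) * b powr (s + t) + t / (s + t) * d powr (s + t))"
      by (intro add_mono weighted_powr_le rng st)
    also have "\<dots> \<le> (s / (s + t) * a\<^sup>2 + t / (s + t) * c\<^sup>2) + (s / (s + t) * b\<^sup>2 + t / (s + t) * d\<^sup>2)"
      using st by (intro add_mono mult_left_mono powr_le_square rng) auto
    also have "\<dots> = s / (s + t) * (a\<^sup>2 + b\<^sup>2) + t / (s + t) * (c\<^sup>2 + d\<^sup>2)" by (simp add: algebra_simps)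
    also have "\<dots> = 1" unfolding ab using st by (simp flip: add_divide_distrib)
    finally have "(a powr s * c powr t + b powr s * d powr t) * (w1 powr s * w2 powr t) \<le> 1 * (w1 powr s * w2 powr t)"
      by (intro mult_right_mono) auto
    moreover have "x1 = a * w1" "y1 = b * w1" "x2 = c * w2" "y2 = d * w2"
      using w by (simp_all add: a_def b_def c_def d_def)
    ultimately show ?thesis
      unfolding w1_def[symmetric] w2_def[symmetric] by (simp add: powr_mult algebra_simps)
  qed
qed

text \<open>The coupling inequality with equal components and the exponent split in half.\<close>

lemma powr_superadditive:
  fixes x y p :: real
  assumes "0 \<le> x" "0 \<le> y" "p \<ge> 2"
  shows "x powr p + y powr p \<le> norm (x, y) powr p"
  using powr_coupling_superadditive[of x x y y "p / 2" "p / 2"] assms by (simp flip: powr_add)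

text \<open>Of each power, two factors are kept as a square and the remaining exponent
  \<open>p - 2 > 0\<close> is applied to something strictly smaller than the norm.\<close>

lemma powr_strict_superadditive:
  fixes x y p :: real
  assumes "0 < x" "0 < y" "p > 2"
  shows "x powr p + y powr p < norm (x, y) powr p"
proof -
  define w where "w = norm (x, y)"
  have sq: "w\<^sup>2 = x\<^sup>2 + y\<^sup>2" by (simp add: w_def norm_Pair)
  have w: "w > 0" using assms by (simp add: w_def zero_prod_def)
  have l: "x < w" "y < w" using sq w assms power2_less_imp_less[of x w] power2_less_imp_less[of y w] by simp_all
  have *: "z powr p < z\<^sup>2 * w powr (p - 2)" if "0 < z" "z < w" for z
  proof -
    have "z powr p = z powr 2 * z powr (p - 2)" by (simp flip: powr_add)
    also have "\<dots> < z powr 2 * w powr (p - 2)" using that assms by (intro mult_strict_left_mono powr_less_mono2) auto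
    finally show ?thesis using that by simp
  qed
  have "x powr p + y powr p < x\<^sup>2 * w powr (p - 2) + y\<^sup>2 * w powr (p - 2)"
    using *[OF assms(1) l(1)] *[OF assms(2) l(2)] by simp
  also have "\<dots> = w powr 2 * w powr (p - 2)" using w by (simp add: sq distrib_right)
  also have "\<dots> = w powr p" by (simp flip: powr_add)
  finally show ?thesis by (simp add: w_def)
qed

lemma continuous_on_powr_pos:
  fixes f :: "'b::topological_space \<Rightarrow> real"
  assumes "continuous_on S f" "\<And>x. x \<in> S \<Longrightarrow> 0 \<le> f x" "a > 0"
  shows "continuous_on S (\<lambda>x. f x powr a)"
  using assms by (intro continuous_on_powr' continuous_on_const) auto

text \<open>Homogeneity scales the base point to unit length. A perturbation that is small relative
  to the base is handled by uniform continuity on a compact square. Otherwise the base is at most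
  \<open>D / d\<close>, both coordinates are at most \<open>(1 / d + 1) * D\<close>, and
  monotonicity gives the term with \<open>C\<close>.\<close>

lemma homogeneous_perturbation:
  fixes g :: "real \<Rightarrow> real \<Rightarrow> real"
  assumes cont: "continuous_on {z. 0 \<le> fst z \<and> 0 \<le> snd z} (\<lambda>z. g (fst z) (snd z))"
    and mono: "\<And>a b a' b'. 0 \<le> a \<Longrightarrow> a \<le> a' \<Longrightarrow> 0 \<le> b \<Longrightarrow> b \<le> b' \<Longrightarrow> g a b \<le> g a' b'"
    and hom: "\<And>c a b. c > 0 \<Longrightarrow> 0 \<le> a \<Longrightarrow> 0 \<le> b \<Longrightarrow> g (c * a) (c * b) = c powr s * g a b"
    and g0: "g 0 0 = 0" and e: "e > 0"
  shows "\<exists>C\<ge>0. \<forall>b1 b2 d1 d2. 0 \<le> b1 \<longrightarrow> 0 \<le> b2 \<longrightarrow> 0 \<le> d1 \<longrightarrow> 0 \<le> d2 \<longrightarrow>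
    g (b1 + d1) (b2 + d2) \<le> g b1 b2 + e * norm (b1, b2) powr s + C * norm (d1, d2) powr s"
proof -
  have g_nn: "0 \<le> g a b" if "0 \<le> a" "0 \<le> b" for a b using mono[of 0 a 0 b] that g0 by simp
  \<comment> \<open>Scaled coordinates are at most 1 and their perturbations below
    \<open>d \<le> 1\<close>, so the side length 2 suffices.\<close>
  define S where "S = cbox (0::real, 0::real) (2, 2)"
  have S: "z \<in> S \<longleftrightarrow> 0 \<le> fst z \<and> fst z \<le> 2 \<and> 0 \<le> snd z \<and> snd z \<le> 2" for z
    unfolding S_def by (cases z) (auto simp: cbox_Pair_eq)
  have "uniformly_continuous_on S (\<lambda>z. g (fst z) (snd z))"
    by (rule compact_uniformly_continuous) (auto intro!: continuous_on_subset[OF cont] simp: S S_def[symmetric], simp add: S_def)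
  then obtain d0 where d0: "d0 > 0" "\<And>z z'. z \<in> S \<Longrightarrow> z' \<in> S \<Longrightarrow> dist z' z < d0 \<Longrightarrow> dist (g (fst z') (snd z')) (g (fst z) (snd z)) < e"
    using e unfolding uniformly_continuous_on_def by metis
  define d where "d = min d0 1"
  have d: "0 < d" "d \<le> 1" "d \<le> d0" using d0 by (auto simp: d_def)
  define C where "C = (1 / d + 1) powr s * g 1 1"
  have C: "C \<ge> 0" using g_nn[of 1 1] by (simp add: C_def)
  have "g (b1 + d1) (b2 + d2) \<le> g b1 b2 + e * norm (b1, b2) powr s + C * norm (d1, d2) powr s"
    if nn: "0 \<le> b1" "0 \<le> b2" "0 \<le> d1" "0 \<le> d2" for b1 b2 d1 d2
  proof -
    define B where "B = norm (b1, b2)"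
    define D where "D = norm (d1, d2)"
    have bB: "b1 \<le> B" "b2 \<le> B" "d1 \<le> D" "d2 \<le> D" "B \<ge> 0" "D \<ge> 0"
      using norm_fst_le[of b1 b2] norm_snd_le[of b2 b1] norm_fst_le[of d1 d2] norm_snd_le[of d2 d1] nn
      by (auto simp: B_def D_def)
    show ?thesis
    proof (cases "D < d * B")
      case True
      then have B: "B > 0" using bB d by (metis less_eq_real_def mult_zero_right not_less)
      define z where "z = (b1 / B + d1 / B, b2 / B + d2 / B)"
      define z' where "z' = (b1 / B, b2 / B)"
      have DB: "D / B < d" using True B by (simp add: divide_less_eq)
      have q: "b1 / B \<le> 1" "b2 / B \<le> 1" "d1 / B \<le> D / B" "d2 / B \<le> D / B" using bB B by (simp_all add: divide_right_mono)
      have "b1 / B + d1 / B \<le> 2" "b2 / B + d2 / B \<le> 2" "b1 / B \<le> 2" "b2 / B \<le> 2" using q DB d by linarith+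
      then have zS: "z \<in> S" "z' \<in> S" using nn B unfolding S z_def z'_def by auto
      have "dist z z' = norm ((1 / B) *\<^sub>R (d1, d2))" by (simp add: dist_norm z_def z'_def)
      also have "\<dots> = D / B" unfolding norm_scaleR using B by (simp add: D_def)
      finally have "dist z z' < d0" using DB d by linarith
      from d0(2)[OF zS(2,1) this] have "g (fst z) (snd z) \<le> g (fst z') (snd z') + e"
        by (simp add: dist_real_def)
      then have "B powr s * g (fst z) (snd z) \<le> B powr s * (g (fst z') (snd z') + e)" by (intro mult_left_mono) auto
      moreover have "B powr s * g (fst z) (snd z) = g (b1 + d1) (b2 + d2)"
        using hom[of B "b1 / B + d1 / B" "b2 / B + d2 / B"] B nn by (simp add: z_def distrib_left)
      moreover have "B powr s * g (fst z') (snd z') = g b1 b2"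
        using hom[of B "b1 / B" "b2 / B"] B nn by (simp add: z'_def)
      moreover have "0 \<le> C * D powr s" using C by simp
      ultimately show ?thesis by (simp add: B_def[symmetric] D_def[symmetric] distrib_left mult.commute)
    next
      case False
      then have BD: "B \<le> D / d" using d by (simp add: field_simps)
      show ?thesis
      proof (cases "D = 0")
        case True
        then have "B = 0" using BD bB by simp
        then have "b1 = 0" "b2 = 0" "d1 = 0" "d2 = 0" using True bB nn by auto
        then show ?thesis using g0 by simp
      next
        case False
        then have D: "D > 0" using bB by simp
        define c where "c = (1 / d + 1) * D"
        have c: "c > 0" using D d by (simp add: c_def add_pos_pos)
        have "b1 + d1 \<le> c" "b2 + d2 \<le> c" using bB BD by (simp_all add: c_def distrib_right)
        then have "g (b1 + d1) (b2 + d2) \<le> g (c * 1) (c * 1)" using nn by (intro mono) auto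
        also have "\<dots> = c powr s * g 1 1" by (rule hom) (use c in auto)
        also have "\<dots> = C * D powr s" by (simp add: c_def C_def powr_mult mult_ac)
        finally show ?thesis
          using g_nn[OF nn(1,2)] e by (simp add: B_def[symmetric] D_def[symmetric] add_increasing)
      qed
    qed
  qed
  with C show ?thesis by blast
qed

text \<open>
  Only the modulus matters. The function is used both to treat a pair as one function and to glue
  two profiles: masses add, and mean-square increments do not exceed the sum of those of the parts.
\<close>

definition combine :: "('a \<Rightarrow> complex) \<Rightarrow> ('a \<Rightarrow> complex) \<Rightarrow> 'a \<Rightarrow> complex" where
  "combine u v x = complex_of_real (norm (u x, v x))"

lemma cmod_combine: "cmod (combine u v x) = norm (cmod (u x), cmod (v x))"
  by (simp add: combine_def norm_Pair)

lemma cmod_combine_sq: "(cmod (combine u v x))\<^sup>2 = (cmod (u x))\<^sup>2 + (cmod (v x))\<^sup>2"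
  by (simp add: combine_def norm_Pair)

lemma combine_measurable:
  assumes [measurable]: "u \<in> borel_measurable borel" "v \<in> borel_measurable borel"
  shows "combine u v \<in> borel_measurable borel"
  unfolding combine_def[abs_def] norm_Pair by measurable

lemma combine_L2: "u \<in> L2 \<Longrightarrow> v \<in> L2 \<Longrightarrow> combine u v \<in> L2"
  unfolding L2_def by (auto simp: cmod_combine_sq intro: combine_measurable)

lemma mass_combine: "u \<in> L2 \<Longrightarrow> v \<in> L2 \<Longrightarrow> mass (combine u v) = mass u + mass v"
  unfolding mass_def cmod_combine_sq by (intro Bochner_Integration.integral_add L2_integrable)

lemma mass_on_combine: "u \<in> L2 \<Longrightarrow> v \<in> L2 \<Longrightarrow> A \<in> sets borel \<Longrightarrow> mass_on A (combine u v) = mass_on A u + mass_on A v"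
  unfolding mass_on_def cmod_combine_sq distrib_left by (intro Bochner_Integration.integral_add integrable_mass_on)

lemma combine_diff_le: "(cmod (combine u v x - combine u v y))\<^sup>2 \<le> (cmod (u x - u y))\<^sup>2 + (cmod (v x - v y))\<^sup>2"
proof -
  have "cmod (combine u v x - combine u v y) = \<bar>norm (u x, v x) - norm (u y, v y)\<bar>"
    by (simp add: combine_def flip: of_real_diff)
  also have "\<dots> \<le> norm ((u x, v x) - (u y, v y))" by (rule norm_triangle_ineq3)
  finally have "(cmod (combine u v x - combine u v y))\<^sup>2 \<le> (norm ((u x, v x) - (u y, v y)))\<^sup>2"
    by (intro power_mono) auto
  then show ?thesis by (simp add: norm_Pair)
qed

lemma mass_shift_combine_le:
  assumes "u \<in> L2" "v \<in> L2"
  shows "mass (\<lambda>x. combine u v (x + h) - combine u v x) \<le> mass (\<lambda>x. u (x + h) - u x) + mass (\<lambda>x. v (x + h) - v x)"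
proof -
  note L = L2_diff[OF L2_shift[OF assms(1)] assms(1), of h] L2_diff[OF L2_shift[OF assms(2)] assms(2), of h]
  note M = combine_L2[OF assms]
  have "mass (\<lambda>x. combine u v (x + h) - combine u v x) \<le> (LINT x|lborel. (cmod (u (x + h) - u x))\<^sup>2 + (cmod (v (x + h) - v x))\<^sup>2)"
    unfolding mass_def using L[THEN L2_integrable] L2_integrable[OF L2_diff[OF L2_shift[OF M] M]]
    by (intro integral_mono combine_diff_le) auto
  also have "\<dots> = mass (\<lambda>x. u (x + h) - u x) + mass (\<lambda>x. v (x + h) - v x)"
    unfolding mass_def using L[THEN L2_integrable] by simp
  finally show ?thesis .
qed

lemma shift_bounded_combine:
  assumes "shift_bounded K u" "shift_bounded L v"
  shows "shift_bounded (K + L) (combine u v)"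
proof -
  note u = shift_boundedD[OF assms(1)] and v = shift_boundedD[OF assms(2)]
  have "mass (\<lambda>x. combine u v (x + h) - combine u v x) \<le> (K + L) * (norm h)\<^sup>2" for h
    using order_trans[OF mass_shift_combine_le[OF u(1) v(1)] add_mono[OF u(3) v(3)], of h] by (simp add: distrib_right)
  then show ?thesis using u v by (simp add: shift_bounded_def combine_L2)
qed

lemma H1_shift_bounded: "u \<in> H1 \<Longrightarrow> shift_bounded (kinetic u) u"
  by (simp add: shift_bounded_def H1_L2 H1_shift_bound)

lemma shift_bounded_mono: "shift_bounded K u \<Longrightarrow> K \<le> L \<Longrightarrow> shift_bounded L u"
  unfolding shift_bounded_def by (auto intro: order_trans[OF _ mult_right_mono])

section \<open>The nonlinearity of the system\<close>

locale nls_system =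
  fixes space :: "'a::euclidean_space itself" and \<mu>1 \<mu>2 p1 p2 r1 r2 \<beta> :: real
  assumes \<beta>: "\<beta> > 0" and \<mu>: "\<mu>1 > 0" "\<mu>2 > 0" and r: "r1 > 1" "r2 > 1"
    and p1: "2 < p1" "p1 < 2 + 4 / real DIM('a)" and p2: "2 < p2" "p2 < 2 + 4 / real DIM('a)"
    and rr: "r1 + r2 < 2 + 4 / real DIM('a)"
begin

definition Phi :: "real \<Rightarrow> real \<Rightarrow> real" where
  "Phi x y = \<mu>1 / p1 * x powr p1 + \<mu>2 / p2 * y powr p2 + \<beta> * x powr r1 * y powr r2"

text \<open>One scalar function for the three growth rates of \<open>Phi\<close>. Evaluated at the
  norm of a pair it dominates \<open>Phi\<close> up to \<open>cH\<close>, so estimates for the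
  single function \<open>combine u v\<close> control the pair.\<close>

definition H :: "real \<Rightarrow> real" where
  "H t = t powr p1 + t powr p2 + t powr (r1 + r2)"

lemma coeff_pos: "\<mu>1 / p1 > 0" "\<mu>2 / p2 > 0"
  using \<mu> p1 p2 by simp_all

lemma Phi_nonneg: "0 \<le> Phi x y"
  unfolding Phi_def using coeff_pos \<beta> by (intro add_nonneg_nonneg mult_nonneg_nonneg) auto

lemma H_nonneg: "0 \<le> H t"
  by (simp add: H_def)

lemma Phi_mono: "0 \<le> a \<Longrightarrow> a \<le> a' \<Longrightarrow> 0 \<le> b \<Longrightarrow> b \<le> b' \<Longrightarrow> Phi a b \<le> Phi a' b'"
  unfolding Phi_def using coeff_pos \<beta> p1 p2 r
  by (intro add_mono mult_mono powr_mono2) (auto intro: mult_left_mono powr_mono2)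

definition cH :: real where "cH = \<mu>1 / p1 + \<mu>2 / p2 + \<beta>"

lemma cH_pos: "cH > 0"
  using coeff_pos \<beta> by (simp add: cH_def add_pos_pos)

lemma Phi_le_H:
  assumes "0 \<le> x" "0 \<le> y" shows "Phi x y \<le> cH * H (norm (x, y))"
proof -
  define n where "n = norm (x, y)"
  have le: "x \<le> n" "y \<le> n" "n \<ge> 0" using norm_fst_le[of x y] norm_snd_le[of y x] assms by (auto simp: n_def)
  have "x powr p1 \<le> H n" "y powr p2 \<le> H n"
    using powr_mono2[OF _ assms(1) le(1), of p1] powr_mono2[OF _ assms(2) le(2), of p2] p1 p2
    by (auto simp: H_def add_increasing add_increasing2)
  moreover have "x powr r1 * y powr r2 \<le> n powr r1 * n powr r2" using assms le r by (intro mult_mono powr_mono2) auto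
  then have "x powr r1 * y powr r2 \<le> H n" by (simp add: H_def add_increasing flip: powr_add)
  ultimately have "Phi x y \<le> \<mu>1 / p1 * H n + \<mu>2 / p2 * H n + \<beta> * H n"
    unfolding Phi_def mult.assoc using coeff_pos \<beta> by (intro add_mono mult_left_mono) auto
  then show ?thesis by (simp add: n_def cH_def algebra_simps)
qed

lemma Phi_continuous: "continuous_on {z. 0 \<le> fst z \<and> 0 \<le> snd z} (\<lambda>z. Phi (fst z) (snd z))"
  unfolding Phi_def using p1 p2 r
  by (intro continuous_on_add continuous_on_mult continuous_on_const continuous_on_powr_pos continuous_on_fst continuous_on_snd continuous_on_id) auto

lemma Phi_superadditive:
  assumes "0 \<le> x1" "0 \<le> x2" "0 \<le> y1" "0 \<le> y2"
  shows "Phi x1 x2 + Phi y1 y2 \<le> Phi (norm (x1, y1)) (norm (x2, y2))"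
proof -
  have "\<mu>1 / p1 * (x1 powr p1 + y1 powr p1) \<le> \<mu>1 / p1 * norm (x1, y1) powr p1"
    using coeff_pos p1 by (intro mult_left_mono powr_superadditive assms) auto
  moreover have "\<mu>2 / p2 * (x2 powr p2 + y2 powr p2) \<le> \<mu>2 / p2 * norm (x2, y2) powr p2"
    using coeff_pos p2 by (intro mult_left_mono powr_superadditive assms) auto
  moreover have "\<beta> * (x1 powr r1 * x2 powr r2 + y1 powr r1 * y2 powr r2) \<le> \<beta> * (norm (x1, y1) powr r1 * norm (x2, y2) powr r2)"
    using \<beta> r by (intro mult_left_mono powr_coupling_superadditive assms) auto
  ultimately show ?thesis unfolding Phi_def by (simp add: distrib_left mult.assoc)
qed

text \<open>If the two nonzero points share a positive component, the corresponding pure power gains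
  strictly. If they lie on different axes, neither has a coupling term, whereas the glued point has
  a positive one.\<close>

lemma Phi_strictly_superadditive:
  assumes nn: "0 \<le> x1" "0 \<le> x2" "0 \<le> y1" "0 \<le> y2" and "(x1, x2) \<noteq> 0" "(y1, y2) \<noteq> 0"
  shows "Phi x1 x2 + Phi y1 y2 < Phi (norm (x1, y1)) (norm (x2, y2))"
proof -
  have 1: "\<mu>1 / p1 * (x1 powr p1 + y1 powr p1) \<le> \<mu>1 / p1 * norm (x1, y1) powr p1"
    using coeff_pos p1 by (intro mult_left_mono powr_superadditive assms) auto
  have 2: "\<mu>2 / p2 * (x2 powr p2 + y2 powr p2) \<le> \<mu>2 / p2 * norm (x2, y2) powr p2"
    using coeff_pos p2 by (intro mult_left_mono powr_superadditive assms) auto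
  have 3: "\<beta> * (x1 powr r1 * x2 powr r2 + y1 powr r1 * y2 powr r2) \<le> \<beta> * (norm (x1, y1) powr r1 * norm (x2, y2) powr r2)"
    using \<beta> r by (intro mult_left_mono powr_coupling_superadditive assms) auto
  consider "x1 > 0" "y1 > 0" | "x2 > 0" "y2 > 0" | "x1 > 0" "y1 = 0" "x2 = 0" "y2 > 0" | "x1 = 0" "y1 > 0" "x2 > 0" "y2 = 0"
    using assms by (auto simp: zero_prod_def less_le)
  then show ?thesis
  proof cases
    case 1
    then have "\<mu>1 / p1 * (x1 powr p1 + y1 powr p1) < \<mu>1 / p1 * norm (x1, y1) powr p1"
      using coeff_pos p1 by (intro mult_strict_left_mono powr_strict_superadditive) auto
    with 2 3 show ?thesis unfolding Phi_def by (simp add: distrib_left mult.assoc)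
  next
    case 2
    then have "\<mu>2 / p2 * (x2 powr p2 + y2 powr p2) < \<mu>2 / p2 * norm (x2, y2) powr p2"
      using coeff_pos p2 by (intro mult_strict_left_mono powr_strict_superadditive) auto
    with \<open>\<mu>1 / p1 * (x1 powr p1 + y1 powr p1) \<le> \<mu>1 / p1 * norm (x1, y1) powr p1\<close> 3
    show ?thesis unfolding Phi_def by (simp add: distrib_left mult.assoc)
  next
    case 3
    then show ?thesis unfolding Phi_def using \<beta> r p1 p2 by (simp add: norm_Pair)
  next
    case 4
    then show ?thesis unfolding Phi_def using \<beta> r p1 p2 by (simp add: norm_Pair)
  qed
qed

text \<open>The strict gain is continuous, hence bounded away from 0 on a compact set. The lower
  cutoff \<open>e\<close> keeps away from the origin, where the gain degenerates; the upper cutoff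
  \<open>L\<close> provides compactness.\<close>

lemma Phi_gap:
  assumes "0 < e"
  shows "\<exists>c>0. \<forall>x1 x2 y1 y2. 0 \<le> x1 \<longrightarrow> 0 \<le> x2 \<longrightarrow> 0 \<le> y1 \<longrightarrow> 0 \<le> y2 \<longrightarrow>
    e \<le> norm (x1, x2) \<longrightarrow> norm (x1, x2) \<le> L \<longrightarrow> e \<le> norm (y1, y2) \<longrightarrow> norm (y1, y2) \<le> L \<longrightarrow>
    Phi x1 x2 + Phi y1 y2 + c \<le> Phi (norm (x1, y1)) (norm (x2, y2))"
proof -
  let ?Q = "{z::real \<times> real. 0 \<le> fst z \<and> 0 \<le> snd z}"
  define A where "A = {z::real \<times> real. 0 \<le> fst z \<and> 0 \<le> snd z \<and> e \<le> norm z \<and> norm z \<le> L}"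
  have cA: "compact A"
  proof -
    have "closed A" unfolding A_def
      by (intro closed_Collect_conj closed_Collect_le continuous_intros)
    moreover have "bounded A" unfolding A_def by (intro boundedI[of _ L]) auto
    ultimately show ?thesis by (simp add: compact_eq_bounded_closed)
  qed
  define G where "G z = Phi (norm (fst (fst z), fst (snd z))) (norm (snd (fst z), snd (snd z))) - Phi (fst (fst z)) (snd (fst z)) - Phi (fst (snd z)) (snd (snd z))" for z :: "(real \<times> real) \<times> (real \<times> real)"
  have contG: "continuous_on (A \<times> A) G"
    unfolding G_def
  proof (intro continuous_on_diff)
    show "continuous_on (A \<times> A) (\<lambda>z. Phi (norm (fst (fst z), fst (snd z))) (norm (snd (fst z), snd (snd z))))"
      by (rule continuous_on_compose2[OF Phi_continuous, of "A \<times> A" "\<lambda>z. (norm (fst (fst z), fst (snd z)), norm (snd (fst z), snd (snd z)))", simplified])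
         (auto intro!: continuous_intros)
    show "continuous_on (A \<times> A) (\<lambda>z. Phi (fst (fst z)) (snd (fst z)))"
      by (rule continuous_on_compose2[OF Phi_continuous, of "A \<times> A" "\<lambda>z. fst z"])
         (auto intro!: continuous_intros simp: A_def)
    show "continuous_on (A \<times> A) (\<lambda>z. Phi (fst (snd z)) (snd (snd z)))"
      by (rule continuous_on_compose2[OF Phi_continuous, of "A \<times> A" "\<lambda>z. snd z"])
         (auto intro!: continuous_intros simp: A_def)
  qed
  show ?thesis
  proof (cases "A = {}")
    \<comment> \<open>No admissible point exists, so any positive constant serves.\<close>
    case True
    then show ?thesis by (intro exI[of _ 1]) (auto simp: A_def)
  next
    case False
    then obtain z where z: "z \<in> A \<times> A" "\<And>y. y \<in> A \<times> A \<Longrightarrow> G z \<le> G y"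
      using continuous_attains_inf[OF compact_Times[OF cA cA] _ contG] by blast
    obtain x1 x2 y1 y2 where z_eq: "z = ((x1, x2), (y1, y2))" by (metis prod.exhaust)
    have "G z > 0"
      using z(1) Phi_strictly_superadditive[of x1 x2 y1 y2] \<open>0 < e\<close> unfolding z_eq G_def A_def by force
    moreover have "Phi x1 x2 + Phi y1 y2 + G z \<le> Phi (norm (x1, y1)) (norm (x2, y2))"
      if "0 \<le> x1" "0 \<le> x2" "0 \<le> y1" "0 \<le> y2" "e \<le> norm (x1, x2)" "norm (x1, x2) \<le> L" "e \<le> norm (y1, y2)" "norm (y1, y2) \<le> L" for x1 x2 y1 y2
      using z(2)[of "((x1, x2), (y1, y2))"] that by (auto simp: G_def A_def)
    ultimately show ?thesis by blast
  qed
qed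

text \<open>\<open>Phi\<close> is not homogeneous, but its three terms are. Each gets the relative
  error \<open>e / cH\<close>, and their coefficients add up to \<open>cH\<close>.\<close>

lemma Phi_perturbation:
  assumes e: "e > 0"
  shows "\<exists>C\<ge>0. \<forall>(b1::real) (b2::real) (d1::real) (d2::real). 0 \<le> b1 \<longrightarrow> 0 \<le> b2 \<longrightarrow> 0 \<le> d1 \<longrightarrow> 0 \<le> d2 \<longrightarrow>
    Phi (b1 + d1) (b2 + d2) \<le> Phi b1 b2 + e * H (norm (b1, b2)) + C * H (norm (d1, d2))"
proof -
  define e' where "e' = e / cH"
  have e': "e' > 0" using e cH_pos by (simp add: e'_def)
  have "\<exists>C\<ge>0. \<forall>(b1::real) (b2::real) (d1::real) (d2::real). 0 \<le> b1 \<longrightarrow> 0 \<le> b2 \<longrightarrow> 0 \<le> d1 \<longrightarrow> 0 \<le> d2 \<longrightarrow>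
    (b1 + d1) powr p1 \<le> b1 powr p1 + e' * norm (b1, b2) powr p1 + C * norm (d1, d2) powr p1"
    using p1 e' by (intro homogeneous_perturbation[where g = "\<lambda>x y. x powr p1" and s = p1 and e = e'])
      (auto intro!: continuous_on_powr_pos continuous_on_fst continuous_on_snd continuous_on_id powr_mono2 simp: powr_mult)
  then obtain C1 where C1: "C1 \<ge> 0" "\<forall>(b1::real) (b2::real) (d1::real) (d2::real). 0 \<le> b1 \<longrightarrow> 0 \<le> b2 \<longrightarrow> 0 \<le> d1 \<longrightarrow> 0 \<le> d2 \<longrightarrow>
    (b1 + d1) powr p1 \<le> b1 powr p1 + e' * norm (b1, b2) powr p1 + C1 * norm (d1, d2) powr p1" by auto
  have "\<exists>C\<ge>0. \<forall>(b1::real) (b2::real) (d1::real) (d2::real). 0 \<le> b1 \<longrightarrow> 0 \<le> b2 \<longrightarrow> 0 \<le> d1 \<longrightarrow> 0 \<le> d2 \<longrightarrow>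
    (b2 + d2) powr p2 \<le> b2 powr p2 + e' * norm (b1, b2) powr p2 + C * norm (d1, d2) powr p2"
    using p2 e' by (intro homogeneous_perturbation[where g = "\<lambda>x y. y powr p2" and s = p2 and e = e'])
      (auto intro!: continuous_on_powr_pos continuous_on_fst continuous_on_snd continuous_on_id powr_mono2 simp: powr_mult)
  then obtain C2 where C2: "C2 \<ge> 0" "\<forall>(b1::real) (b2::real) (d1::real) (d2::real). 0 \<le> b1 \<longrightarrow> 0 \<le> b2 \<longrightarrow> 0 \<le> d1 \<longrightarrow> 0 \<le> d2 \<longrightarrow>
    (b2 + d2) powr p2 \<le> b2 powr p2 + e' * norm (b1, b2) powr p2 + C2 * norm (d1, d2) powr p2" by auto
  have "\<exists>C\<ge>0. \<forall>(b1::real) (b2::real) (d1::real) (d2::real). 0 \<le> b1 \<longrightarrow> 0 \<le> b2 \<longrightarrow> 0 \<le> d1 \<longrightarrow> 0 \<le> d2 \<longrightarrow>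
    (b1 + d1) powr r1 * (b2 + d2) powr r2 \<le> b1 powr r1 * b2 powr r2 + e' * norm (b1, b2) powr (r1 + r2) + C * norm (d1, d2) powr (r1 + r2)"
    using r e' by (intro homogeneous_perturbation[where g = "\<lambda>x y. x powr r1 * y powr r2" and s = "r1 + r2" and e = e'])
      (auto intro!: continuous_on_mult continuous_on_powr_pos continuous_on_fst continuous_on_snd continuous_on_id mult_mono powr_mono2 simp: powr_mult powr_add)
  then obtain C3 where C3: "C3 \<ge> 0" "\<forall>(b1::real) (b2::real) (d1::real) (d2::real). 0 \<le> b1 \<longrightarrow> 0 \<le> b2 \<longrightarrow> 0 \<le> d1 \<longrightarrow> 0 \<le> d2 \<longrightarrow>
    (b1 + d1) powr r1 * (b2 + d2) powr r2 \<le> b1 powr r1 * b2 powr r2 + e' * norm (b1, b2) powr (r1 + r2) + C3 * norm (d1, d2) powr (r1 + r2)" by auto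
  define C where "C = C1 + C2 + C3"
  show ?thesis
  proof (intro exI[of _ "cH * C"] conjI allI impI)
    show "0 \<le> cH * C" using cH_pos C1 C2 C3 by (simp add: C_def)
    fix b1 b2 d1 d2 :: real assume nn: "0 \<le> b1" "0 \<le> b2" "0 \<le> d1" "0 \<le> d2"
    define X where "X = e' * H (norm (b1, b2)) + C * H (norm (d1, d2))"
    have mono: "a \<le> X" if "a \<le> e' * norm (b1, b2) powr s + D * norm (d1, d2) powr s" "s \<in> {p1, p2, r1 + r2}" "0 \<le> D" "D \<le> C" for a s D
    proof -
      have "t powr s \<le> H t" for t using that(2) by (auto simp: H_def add_increasing add_increasing2)
      then have "e' * norm (b1, b2) powr s + D * norm (d1, d2) powr s \<le> X"
        unfolding X_def using e' that by (intro add_mono mult_left_mono mult_mono) (auto simp: H_nonneg)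
      with that(1) show ?thesis by simp
    qed
    have "(b1 + d1) powr p1 - b1 powr p1 \<le> X"
      by (rule mono[of _ p1 C1]) (use C1(2)[rule_format, OF nn] C1(1) C2(1) C3(1) in \<open>auto simp: C_def\<close>)
    moreover have "(b2 + d2) powr p2 - b2 powr p2 \<le> X"
      by (rule mono[of _ p2 C2]) (use C2(2)[rule_format, OF nn] C1(1) C2(1) C3(1) in \<open>auto simp: C_def\<close>)
    moreover have "(b1 + d1) powr r1 * (b2 + d2) powr r2 - b1 powr r1 * b2 powr r2 \<le> X"
      by (rule mono[of _ "r1 + r2" C3]) (use C3(2)[rule_format, OF nn] C1(1) C2(1) C3(1) in \<open>auto simp: C_def\<close>)
    ultimately have "\<mu>1 / p1 * ((b1 + d1) powr p1 - b1 powr p1) + \<mu>2 / p2 * ((b2 + d2) powr p2 - b2 powr p2)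
       + \<beta> * ((b1 + d1) powr r1 * (b2 + d2) powr r2 - b1 powr r1 * b2 powr r2) \<le> \<mu>1 / p1 * X + \<mu>2 / p2 * X + \<beta> * X"
      using coeff_pos \<beta> by (intro add_mono mult_left_mono) auto
    also have "\<dots> = cH * X" by (simp add: cH_def algebra_simps)
    also have "\<dots> = e * H (norm (b1, b2)) + cH * C * H (norm (d1, d2))"
      using cH_pos by (simp add: X_def e'_def distrib_left)
    finally show "Phi (b1 + d1) (b2 + d2) \<le> Phi b1 b2 + e * H (norm (b1, b2)) + cH * C * H (norm (d1, d2))"
      unfolding Phi_def by (simp add: algebra_simps)
  qed
qed

end

section \<open>Potential energy and functions of negative energy\<close>

lemma mass_on_shift:
  assumes "u \<in> L2" "A \<in> sets borel"
  shows "mass_on A (\<lambda>x. u (x + h)) = mass_on ((\<lambda>x. x - h) -` A) u"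
proof -
  have "(LINT x|lborel. indicator A (x + h - h) * (cmod (u (x + h)))\<^sup>2) = (LINT x|lborel. indicator A (x - h) * (cmod (u x))\<^sup>2)"
  proof (rule integral_shift)
    have [measurable]: "u \<in> borel_measurable borel" "A \<in> sets borel" using assms by (auto dest: L2_measurable)
    show "(\<lambda>x. indicator A (x - h) * (cmod (u x))\<^sup>2) \<in> borel_measurable borel" by measurable
  qed
  then show ?thesis by (simp add: mass_on_def indicator_def)
qed

lemma shift_bounded_shift:
  assumes "shift_bounded K u" shows "shift_bounded K (\<lambda>x. u (x + y))"
proof -
  note u = shift_boundedD[OF assms]
  have "mass (\<lambda>x. u (x + h + y) - u (x + y)) = mass (\<lambda>x. u (x + h) - u x)" for h
    using mass_shift[OF L2_diff[OF L2_shift[OF u(1), of h] u(1)], of y] by (simp add: add_ac)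
  then show ?thesis using u by (simp add: shift_bounded_def L2_shift)
qed

section \<open>Intermediate level sets and their overlap\<close>

text \<open>On the unit ball, values below \<open>e\<close> carry at most a quarter of
  \<open>\<delta>\<close>, and so do values above \<open>L\<close>, by the bound on the p-th powers.
  At least half of \<open>\<delta>\<close> sits where the modulus is intermediate; since each point
  there contributes at most \<open>L\<^sup>2\<close>, this set has measure at least
  \<open>\<eta>\<close>.\<close>

lemma level_measure_bound:
  fixes p \<delta> B :: real
  assumes p: "p > 2" and "\<delta> > 0" "B \<ge> 0"
  shows "\<exists>e>0. \<exists>L. \<exists>\<eta>>0. \<forall>(F::'a::euclidean_space \<Rightarrow> complex) y. F \<in> L2 \<longrightarrow> integrable lborel (\<lambda>x. cmod (F x) powr p) \<longrightarrow>
     (LINT x|lborel. cmod (F x) powr p) \<le> B \<longrightarrow> \<delta> \<le> mass_on (ball y 1) F \<longrightarrow>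
     \<eta> \<le> measure lborel {x \<in> ball y 1. e \<le> cmod (F x) \<and> cmod (F x) \<le> L}"
proof -
  define V where "V = measure lborel (ball (0::'a) 1)"
  have V: "V > 0" by (simp add: V_def content_ball_pos)
  define e where "e = sqrt (\<delta> / (4 * V))"
  have e: "e > 0" "e\<^sup>2 * V = \<delta> / 4" using V \<open>\<delta> > 0\<close> by (simp_all add: e_def)
  define L where "L = (4 * (B + 1) / \<delta>) powr (1 / (p - 2))"
  have L: "L > 0" using \<open>\<delta> > 0\<close> \<open>B \<ge> 0\<close> by (simp add: L_def)
  have Lp: "L powr (p - 2) = 4 * (B + 1) / \<delta>" unfolding L_def using p \<open>\<delta> > 0\<close> \<open>B \<ge> 0\<close> by (simp add: powr_powr)
  have LB: "L powr (2 - p) * B \<le> \<delta> / 4"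
  proof -
    have "L powr (2 - p) = \<delta> / (4 * (B + 1))" using Lp powr_minus[of L "p - 2"] by simp
    then have "L powr (2 - p) * B = \<delta> / 4 * (B / (B + 1))" by (simp add: field_simps)
    also have "\<dots> \<le> \<delta> / 4 * 1" using \<open>\<delta> > 0\<close> \<open>B \<ge> 0\<close> by (intro mult_left_mono) auto
    finally show ?thesis by simp
  qed
  define \<eta> where "\<eta> = \<delta> / (2 * L\<^sup>2)"
  have "\<eta> \<le> measure lborel {x \<in> ball y 1. e \<le> cmod (F x) \<and> cmod (F x) \<le> L}"
    if F: "F \<in> L2" and int: "integrable lborel (\<lambda>x. cmod (F x) powr p)" and le: "(LINT x|lborel. cmod (F x) powr p) \<le> B"
      and big: "\<delta> \<le> mass_on (ball y 1) F" for F :: "'a \<Rightarrow> complex" and y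
  proof -
    have [measurable]: "F \<in> borel_measurable borel" using F by (rule L2_measurable)
    define E where "E = {x \<in> ball y 1. e \<le> cmod (F x) \<and> cmod (F x) \<le> L}"
    have [measurable]: "ball y 1 \<in> sets borel" by simp
    have E: "E \<in> sets borel" unfolding E_def by measurable
    have Efin: "emeasure lborel E < \<infinity>"
      by (rule le_less_trans[OF emeasure_mono emeasure_ball_finite[of y 1]]) (auto simp: E_def)
    have i1: "integrable lborel (indicator (ball y 1) :: 'a \<Rightarrow> real)" "integrable lborel (indicator E :: 'a \<Rightarrow> real)"
      using E Efin emeasure_ball_finite[of y 1] by (auto intro!: integrable_real_indicator)
    have "mass_on (ball y 1) F \<le> (LINT x|lborel. e\<^sup>2 * indicator (ball y 1) x + L\<^sup>2 * indicator E x + L powr (2 - p) * cmod (F x) powr p)"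
      unfolding mass_on_def
    proof (rule integral_mono)
      show "integrable lborel (\<lambda>x. indicator (ball y 1) x * (cmod (F x))\<^sup>2)" by (rule integrable_mass_on[OF F]) simp
      show "integrable lborel (\<lambda>x. e\<^sup>2 * indicator (ball y 1) x + L\<^sup>2 * indicator E x + L powr (2 - p) * cmod (F x) powr p)"
        using i1 int by simp
      fix x
      let ?r = "e\<^sup>2 * indicator (ball y 1) x + L\<^sup>2 * indicator E x + L powr (2 - p) * cmod (F x) powr p"
      have r0: "0 \<le> e\<^sup>2 * indicator (ball y 1) x" "0 \<le> L\<^sup>2 * indicator E x" "0 \<le> L powr (2 - p) * cmod (F x) powr p" by auto
      consider "x \<notin> ball y 1" | "x \<in> ball y 1" "cmod (F x) < e" | "x \<in> E" | "cmod (F x) > L" "x \<in> ball y 1"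
        by (cases "x \<in> ball y 1"; cases "cmod (F x) < e"; cases "L < cmod (F x)") (auto simp: E_def)
      then show "indicator (ball y 1) x * (cmod (F x))\<^sup>2 \<le> ?r"
      proof cases
        case 1
        then show ?thesis using r0 by simp
      next
        case 2
        then have "(cmod (F x))\<^sup>2 \<le> e\<^sup>2" by (intro power_mono) auto
        moreover have "indicator (ball y 1) x = (1::real)" using 2 by simp
        ultimately show ?thesis using r0(2,3) by (simp only:)
      next
        case 3
        then have "(cmod (F x))\<^sup>2 \<le> L\<^sup>2" "x \<in> ball y 1" by (auto simp: E_def intro: power_mono)
        moreover have "indicator (ball y 1) x = (1::real)" "indicator E x = (1::real)" using 3 by (simp_all add: E_def)
        moreover have "0 \<le> e\<^sup>2" by simp
        ultimately show ?thesis using r0(3) by (simp only: mult_1 mult_1_right)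
      next
        case 4
        let ?t = "cmod (F x)"
        have t: "?t > 0" using 4 L by linarith
        have "?t\<^sup>2 = ?t powr (2 - p) * ?t powr p" using t by (simp flip: powr_add)
        also have "\<dots> \<le> L powr (2 - p) * ?t powr p"
          using 4 L p by (intro mult_right_mono powr_mono2') auto
        finally have "?t\<^sup>2 \<le> L powr (2 - p) * ?t powr p" .
        moreover have "indicator (ball y 1) x = (1::real)" using 4 by simp
        ultimately show ?thesis using r0(1,2) by (simp only: mult_1)
      qed
    qed
    also have "\<dots> = e\<^sup>2 * V + L\<^sup>2 * measure lborel E + L powr (2 - p) * (LINT x|lborel. cmod (F x) powr p)"
      using i1 int by (simp add: V_def measure_ball_translate[of y])
    also have "L powr (2 - p) * (LINT x|lborel. cmod (F x) powr p) \<le> L powr (2 - p) * B"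
      using le by (intro mult_left_mono) auto
    finally have "\<delta> \<le> \<delta> / 4 + L\<^sup>2 * measure lborel E + \<delta> / 4" using big LB e by linarith
    then have "\<delta> / 2 \<le> L\<^sup>2 * measure lborel E" by simp
    then have "\<eta> \<le> measure lborel E" using L by (simp add: \<eta>_def field_simps)
    then show ?thesis unfolding E_def .
  qed
  moreover have "\<eta> > 0" using L \<open>\<delta> > 0\<close> by (simp add: \<eta>_def)
  ultimately show ?thesis using e(1) by blast
qed

text \<open>By Tonelli's theorem the overlap, integrated over all translations, equals the product
  of the two measures, which is at least \<open>\<eta>\<^sup>2\<close>. Only translations in a ball
  of radius 2 contribute, so some overlap reaches the average. The factor 2 in the denominator turns
  the count into a strict contradiction.\<close>

lemma overlap_by_translation:
  fixes y z :: "'a::euclidean_space"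
  assumes E: "E \<in> sets borel" "E \<subseteq> ball y 1" and G: "G \<in> sets borel" "G \<subseteq> ball z 1"
    and \<eta>: "\<eta> > 0" "\<eta> \<le> measure lborel E" "\<eta> \<le> measure lborel G"
  shows "\<exists>h. \<eta>\<^sup>2 / (2 * measure lborel (ball (0::'a) 2)) \<le> measure lborel {x \<in> E. x + h \<in> G}"
proof (rule ccontr)
  have [measurable]: "E \<in> sets borel" "G \<in> sets borel" by fact+
  define V where "V = measure lborel (ball (0::'a) 2)"
  have V: "V > 0" by (simp add: V_def content_ball_pos)
  define c where "c = \<eta>\<^sup>2 / (2 * V)"
  assume "\<not> (\<exists>h. \<eta>\<^sup>2 / (2 * measure lborel (ball (0::'a) 2)) \<le> measure lborel {x \<in> E. x + h \<in> G})"
  then have small: "measure lborel {x \<in> E. x + h \<in> G} < c" for h by (auto simp: c_def V_def not_le)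
  have fin: "emeasure lborel A = ennreal (measure lborel A)" if "A \<subseteq> ball w 1" for A and w :: 'a
  proof (rule emeasure_eq_ennreal_measure)
    show "emeasure lborel A \<noteq> top"
      using le_less_trans[OF emeasure_mono[OF that] emeasure_ball_finite[of w 1]] by auto
  qed
  define W where "W h = (\<integral>\<^sup>+x. indicator E x * indicator G (x + h) \<partial>lborel)" for h
  have W_le: "W h \<le> ennreal c * indicator (ball (z - y) 2) h" for h
  proof (cases "h \<in> ball (z - y) 2")
    case True
    have "W h = (\<integral>\<^sup>+x. indicator {x \<in> E. x + h \<in> G} x \<partial>lborel)"
      unfolding W_def by (intro nn_integral_cong) (auto split: split_indicator)
    also have "\<dots> = emeasure lborel {x \<in> E. x + h \<in> G}" by (rule nn_integral_indicator) measurable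
    also have "\<dots> = ennreal (measure lborel {x \<in> E. x + h \<in> G})" by (rule fin[of _ y]) (use E in auto)
    also have "\<dots> \<le> ennreal c" using small[of h] by (intro ennreal_leI) simp
    finally show ?thesis using True by simp
  next
    case False
    have "x + h \<notin> G" if "x \<in> E" for x
    proof
      assume "x + h \<in> G"
      then have "dist z (x + h) < 1" "dist y x < 1" using E G that by auto
      moreover have "dist (z - y) h \<le> dist z (x + h) + dist y x"
        using norm_triangle_ineq4[of "z - (x + h)" "y - x"] by (simp add: dist_norm algebra_simps)
      ultimately show False using False by simp
    qed
    then have "W h = (\<integral>\<^sup>+x. 0 \<partial>(lborel::'a measure))"
      unfolding W_def by (intro nn_integral_cong) (auto split: split_indicator)
    then show ?thesis by simp
  qed
  have "ennreal (\<eta> * \<eta>) \<le> ennreal (measure lborel E) * ennreal (measure lborel G)"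
    using \<eta> by (simp add: mult_mono flip: ennreal_mult)
  also have "\<dots> = emeasure lborel E * emeasure lborel G" using fin[OF E(2)] fin[OF G(2)] by simp
  also have "\<dots> = (\<integral>\<^sup>+x. (\<integral>\<^sup>+h. indicator E x * indicator G (x + h) \<partial>lborel) \<partial>lborel)"
  proof -
    have "(\<integral>\<^sup>+h. indicator E x * indicator G (x + h) \<partial>lborel) = indicator E x * emeasure lborel G" for x :: 'a
    proof -
      have "(\<integral>\<^sup>+h. indicator E x * indicator G (x + h) \<partial>lborel) = indicator E x * (\<integral>\<^sup>+h. indicator G (h + x) \<partial>lborel)"
        by (subst nn_integral_cmult[symmetric]) (auto simp: add.commute)
      then show ?thesis using nn_integral_shift[of "indicator G" x] by simp
    qed
    then show ?thesis by (simp add: nn_integral_multc)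
  qed
  also have "\<dots> = (\<integral>\<^sup>+h. W h \<partial>lborel)"
    unfolding W_def by (rule lborel_pair.Fubini') measurable
  also have "\<dots> \<le> (\<integral>\<^sup>+h. ennreal c * indicator (ball (z - y) 2) h \<partial>lborel)"
    by (intro nn_integral_mono W_le)
  also have "\<dots> = ennreal c * ennreal V"
    by (subst nn_integral_cmult_indicator) (auto simp: emeasure_lborel_ball V_def measure_ball_translate[of "z - y"])
  also have "\<dots> = ennreal (\<eta>\<^sup>2 / 2)" using V by (simp add: c_def flip: ennreal_mult')
  finally show False using \<eta> by (simp add: power2_eq_square)
qed

section \<open>Tents as trial functions\<close>

definition tent :: "real \<Rightarrow> 'a::euclidean_space \<Rightarrow> complex" where
  "tent R x = complex_of_real (max 0 (1 - norm x / R))"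

text \<open>Increments are at most |h|/R and vanish unless x or x + h lies in the ball of radius
  \<open>R\<close>, which accounts for the factor 2. The lower mass bound uses only the half ball,
  where the tent is at least 1/2.\<close>

lemma tent_facts:
  assumes R: "R > 0"
  defines "V \<equiv> measure lborel (ball (0::'a) 1)"
  shows "(tent R :: 'a::euclidean_space \<Rightarrow> complex) \<in> L2"
    "mass (tent R :: 'a \<Rightarrow> complex) \<le> V * R ^ DIM('a)"
    "V * (R / 2) ^ DIM('a) / 4 \<le> mass (tent R :: 'a \<Rightarrow> complex)"
    "\<And>h::'a. mass (\<lambda>x. tent R (x + h) - tent R x) \<le> 2 * V * R ^ DIM('a) / R\<^sup>2 * (norm h)\<^sup>2"
    "\<And>x::'a. x \<in> ball 0 (R / 2) \<Longrightarrow> 1 / 2 \<le> cmod (tent R x)"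
proof -
  have m [measurable]: "(tent R :: 'a \<Rightarrow> complex) \<in> borel_measurable borel"
    unfolding tent_def[abs_def] by measurable
  have vol: "measure lborel (ball (0::'a) s) = V * s ^ DIM('a)" if "s > 0" for s
    using content_ball_conv_unit_ball[of s "0::'a"] that by (simp add: V_def mult.commute)
  have bI: "(\<lambda>x::'a. complex_of_real (indicator (ball 0 s) x)) \<in> L2" for s
    by (rule indicator_L2[OF _ emeasure_ball_finite]) simp
  have bM: "mass (\<lambda>x::'a. complex_of_real (indicator (ball 0 s) x)) = V * s ^ DIM('a)" if "s > 0" for s
  proof -
    have "(cmod (complex_of_real (indicator (ball 0 s) x)))\<^sup>2 = indicator (ball 0 s) x" for x :: 'a
      by (auto split: split_indicator)
    then show ?thesis using vol[OF that] by (simp add: mass_def)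
  qed
  have le: "cmod (tent R x) \<le> 1 * cmod (complex_of_real (indicator (ball 0 R) x))" for x :: 'a
    using R by (auto simp: tent_def split: split_indicator)
  show L: "(tent R :: 'a \<Rightarrow> complex) \<in> L2" by (rule L2_dominated[OF bI m le])
  show "mass (tent R :: 'a \<Rightarrow> complex) \<le> V * R ^ DIM('a)"
    using mass_mono[OF L bI, of R] le bM[OF R] by simp
  show half: "\<And>x::'a. x \<in> ball 0 (R / 2) \<Longrightarrow> 1 / 2 \<le> cmod (tent R x)"
  proof -
    fix x :: 'a assume "x \<in> ball 0 (R / 2)"
    then have "norm x / R \<le> 1 / 2" using R by (simp add: divide_le_eq)
    then have "1 / 2 \<le> max 0 (1 - norm x / R)" by (intro max.coboundedI2) linarith
    then show "1 / 2 \<le> cmod (tent R x)" unfolding tent_def norm_of_real by (rule order_trans[OF _ abs_ge_self])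
  qed
  have "mass (\<lambda>x::'a. (1/2) * complex_of_real (indicator (ball 0 (R/2)) x)) \<le> mass (tent R :: 'a \<Rightarrow> complex)"
  proof (rule mass_mono[OF L2_cmult[OF bI] L])
    show "cmod ((1/2) * complex_of_real (indicator (ball 0 (R/2)) x)) \<le> cmod (tent R x)" for x :: 'a
      using half[of x] by (auto split: split_indicator)
  qed
  then show "V * (R / 2) ^ DIM('a) / 4 \<le> mass (tent R :: 'a \<Rightarrow> complex)"
    unfolding mass_cmult using bM[of "R/2"] R by (simp add: power2_eq_square norm_divide)
  fix h :: 'a
  let ?I = "\<lambda>x::'a. complex_of_real (indicator (ball 0 R) x)"
  have lip: "cmod (tent R (x + h) - tent R x) \<le> norm h / R" for x :: 'a
  proof -
    have "cmod (tent R (x + h) - tent R x) = \<bar>max 0 (1 - norm (x + h) / R) - max 0 (1 - norm x / R)\<bar>"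
      by (simp add: tent_def flip: of_real_diff)
    also have "\<dots> \<le> \<bar>norm (x + h) / R - norm x / R\<bar>" by (auto simp: max_def abs_if)
    also have "\<dots> = \<bar>norm (x + h) - norm x\<bar> / R" using R by (simp flip: diff_divide_distrib)
    also have "\<dots> \<le> norm h / R"
      using norm_triangle_ineq3[of "x + h" x] R by (intro divide_right_mono) auto
    finally show ?thesis .
  qed
  have pt: "(cmod (tent R (x + h) - tent R x))\<^sup>2 \<le> (norm h / R)\<^sup>2 * ((cmod (?I (x + h)))\<^sup>2 + (cmod (?I x))\<^sup>2)" for x
  proof (cases "x \<in> ball 0 R \<or> x + h \<in> ball 0 R")
    case True
    then have "1 \<le> (cmod (?I (x + h)))\<^sup>2 + (cmod (?I x))\<^sup>2" by auto
    then have "(norm h / R)\<^sup>2 * 1 \<le> (norm h / R)\<^sup>2 * ((cmod (?I (x + h)))\<^sup>2 + (cmod (?I x))\<^sup>2)" by (intro mult_left_mono) auto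
    moreover have "(cmod (tent R (x + h) - tent R x))\<^sup>2 \<le> (norm h / R)\<^sup>2" using lip[of x] by (intro power_mono) auto
    ultimately show ?thesis by linarith
  next
    case False
    then have "tent R (x + h) = 0" "tent R x = 0" using R by (auto simp: tent_def)
    then show ?thesis by simp
  qed
  have "mass (\<lambda>x. tent R (x + h) - tent R x) \<le> (LINT x|lborel. (norm h / R)\<^sup>2 * ((cmod (?I (x + h)))\<^sup>2 + (cmod (?I x))\<^sup>2))"
    unfolding mass_def
    by (rule integral_mono[OF L2_integrable[OF L2_diff[OF L2_shift[OF L] L]] _ pt])
      (intro integrable_mult_right Bochner_Integration.integrable_add L2_integrable[OF bI] L2_integrable[OF L2_shift[OF bI]])
  also have "\<dots> = (norm h / R)\<^sup>2 * (mass (\<lambda>x. ?I (x + h)) + mass ?I)"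
    unfolding mass_def using L2_integrable[OF bI] L2_integrable[OF L2_shift[OF bI]] by simp
  also have "\<dots> = 2 * V * R ^ DIM('a) / R\<^sup>2 * (norm h)\<^sup>2"
    unfolding mass_shift[OF bI] bM[OF R] by (simp add: power_divide)
  finally show "mass (\<lambda>x. tent R (x + h) - tent R x) \<le> 2 * V * R ^ DIM('a) / R\<^sup>2 * (norm h)\<^sup>2" .
qed

text \<open>Rescaled tents of prescribed mass: the kinetic energy is of order \<open>R\<^sup>-\<^sup>2\<close>, the potential
  energy of the slower order \<open>R\<close> to the power \<open>N - N p / 2 > -2\<close>.\<close>

lemma scaled_tent:
  fixes R d p :: real
  assumes R: "R > 0" and d: "d \<ge> 0" and p: "p > 2"
  defines "V \<equiv> measure lborel (ball (0::'a::euclidean_space) 1)"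
  shows "\<exists>f::'a \<Rightarrow> complex. f \<in> H1 \<and> mass f = d \<and> kinetic f \<le> real DIM('a) * (8 * 2 ^ DIM('a)) * d / R\<^sup>2 \<and>
    (integrable lborel (\<lambda>x. cmod (f x) powr p) \<longrightarrow>
     (d / (V * R ^ DIM('a))) powr (p / 2) * (1 / 2) powr p * (V * (R / 2) ^ DIM('a)) \<le> (LINT x|lborel. cmod (f x) powr p))"
proof -
  note t = tent_facts[OF R, where 'a = 'a, folded V_def]
  have V: "V > 0" by (simp add: V_def content_ball_pos)
  define v where "v = mass (tent R :: 'a \<Rightarrow> complex)"
  have "V * (R / 2) ^ DIM('a) / 4 > 0" using V R by simp
  then have v: "v > 0" using t(3) by (simp add: v_def)
  define s where "s = sqrt (d / v)"
  have s: "s \<ge> 0" "s\<^sup>2 = d / v" using v d by (simp_all add: s_def)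
  define f :: "'a \<Rightarrow> complex" where "f x = s *\<^sub>R tent R x" for x
  have fL: "f \<in> L2" unfolding f_def by (rule L2_scaleR[OF t(1)])
  have fm: "mass f = d" unfolding f_def mass_scaleR s using v by (simp add: v_def)
  have sh: "mass (\<lambda>x. f (x + h) - f x) \<le> (8 * 2 ^ DIM('a) * d / R\<^sup>2) * (norm h)\<^sup>2" for h
  proof -
    have "mass (\<lambda>x. f (x + h) - f x) = d / v * mass (\<lambda>x. tent R (x + h) - tent R x :: complex)"
      unfolding f_def scaleR_diff_right[symmetric] mass_scaleR s ..
    also have "\<dots> \<le> d / v * (2 * V * R ^ DIM('a) / R\<^sup>2 * (norm h)\<^sup>2)"
      using t(4)[of h] d v by (intro mult_left_mono) auto
    also have "\<dots> = d * (2 * V * R ^ DIM('a) / R\<^sup>2 * (norm h)\<^sup>2) / v" by simp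
    \<comment> \<open>With the lower bound for \<open>v\<close> in the denominator all volumes
      cancel, and 2 * 4 * 2^N remains.\<close>
    also have "\<dots> \<le> d * (2 * V * R ^ DIM('a) / R\<^sup>2 * (norm h)\<^sup>2) / (V * (R / 2) ^ DIM('a) / 4)"
      using t(3) V R d v by (intro divide_left_mono mult_nonneg_nonneg mult_pos_pos) (auto simp: v_def)
    also have "\<dots> = (8 * 2 ^ DIM('a) * d / R\<^sup>2) * (norm h)\<^sup>2"
      using V R by (simp add: power_divide field_simps)
    finally show ?thesis .
  qed
  have fH: "f \<in> H1" "kinetic f \<le> (\<Sum>i\<in>(Basis::'a set). 8 * 2 ^ DIM('a) * d / R\<^sup>2)"
  proof -
    have *: "mass (\<lambda>x. f (x + t *\<^sub>R i) - f x) \<le> (8 * 2 ^ DIM('a) * d / R\<^sup>2) * t\<^sup>2" if "i \<in> Basis" for i t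
      using sh[of "t *\<^sub>R i"] that by simp
    show "f \<in> H1" "kinetic f \<le> (\<Sum>i\<in>(Basis::'a set). 8 * 2 ^ DIM('a) * d / R\<^sup>2)"
      using H1_by_shift_bounds[of f "\<lambda>i. 8 * 2 ^ DIM('a) * d / R\<^sup>2", OF fL *] by auto
  qed
  have "(d / (V * R ^ DIM('a))) powr (p / 2) * (1 / 2) powr p * (V * (R / 2) ^ DIM('a)) \<le> (LINT x|lborel. cmod (f x) powr p)"
    if int: "integrable lborel (\<lambda>x. cmod (f x) powr p)"
  proof -
    have mB: "measure lborel (ball (0::'a) (R/2)) = V * (R / 2) ^ DIM('a)"
      using content_ball_conv_unit_ball[of "R/2" "0::'a"] R by (simp add: V_def mult.commute)
    have "s powr p = (d / v) powr (p / 2)" unfolding s_def using d v by (simp add: powr_half_sqrt[symmetric] powr_powr)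
    moreover have "d / (V * R ^ DIM('a)) \<le> d / v" using t(2) v d V R by (intro divide_left_mono) (auto simp: v_def)
    then have "(d / (V * R ^ DIM('a))) powr (p / 2) \<le> (d / v) powr (p / 2)" using p d V R by (intro powr_mono2) auto
    ultimately have "(d / (V * R ^ DIM('a))) powr (p / 2) * (1 / 2) powr p * (V * (R / 2) ^ DIM('a))
      \<le> s powr p * (1 / 2) powr p * (V * (R / 2) ^ DIM('a))"
      using V R by (intro mult_right_mono) auto
    also have "\<dots> = (s * (1/2)) powr p * (V * (R / 2) ^ DIM('a))" by (simp only: powr_mult)
    also have "\<dots> = (LINT x|lborel. (s * (1/2)) powr p * indicator (ball (0::'a) (R/2)) x)" using mB by simp
    also have "\<dots> \<le> (LINT x|lborel. cmod (f x) powr p)"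
    proof (rule integral_mono[OF _ int])
      show "integrable lborel (\<lambda>x. (s * (1/2)) powr p * indicator (ball (0::'a) (R/2)) x)"
        using emeasure_ball_finite[of "0::'a" "R/2"] by (intro integrable_mult_right integrable_real_indicator) auto
      fix x :: 'a
      show "(s * (1/2)) powr p * indicator (ball 0 (R/2)) x \<le> cmod (f x) powr p"
      proof (cases "x \<in> ball 0 (R/2)")
        case True
        have "s * (1/2) \<le> s * cmod (tent R x)" using t(5)[OF True] s(1) by (rule mult_left_mono)
        then have "s * (1/2) \<le> cmod (f x)" unfolding f_def using s(1) by simp
        then have "(s * (1/2)) powr p \<le> cmod (f x) powr p" using s p by (intro powr_mono2) auto
        then show ?thesis using True by simp
      qed simp
    qed
    finally show ?thesis .
  qed
  with fH fm show ?thesis by (intro exI[of _ f]) (auto simp: mult.assoc)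
qed

text \<open>The right-hand side is a constant times R^(g - 2), where g = 2 + N - N p / 2 is positive
  exactly because \<open>p\<close> is subcritical. Hence it eventually beats R^(-2), and
  \<open>R0\<close> solves B = c R^g unless 1 is larger.\<close>

lemma tent_scaling_threshold:
  fixes p k d B V :: real and N :: nat
  assumes p: "2 < p" "p < 2 + 4 / real N" and N: "N > 0" and "k > 0" "d > 0" "V > 0" "B \<ge> 0"
  shows "\<exists>R0>0. \<forall>R\<ge>R0. B / R\<^sup>2 \<le> k * ((d / (V * R ^ N)) powr (p / 2) * (1 / 2) powr p * (V * (R / 2) ^ N))"
proof -
  define g where "g = 2 + real N - real N * p / 2"
  have "real N * p < real N * (2 + 4 / real N)" using p N by (intro mult_strict_left_mono) auto
  also have "real N * (2 + 4 / real N) = 2 * real N + 4" using N by (simp add: distrib_left)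
  finally have g: "g > 0" by (simp add: g_def)
  define c where "c = k * (d powr (p / 2) * V powr (- p / 2) * (1 / 2) powr p * V / 2 ^ N)"
  have c: "c > 0" using assms by (simp add: c_def)
  define R0 where "R0 = max 1 ((B / c) powr (1 / g))"
  have "B / R\<^sup>2 \<le> k * ((d / (V * R ^ N)) powr (p / 2) * (1 / 2) powr p * (V * (R / 2) ^ N))" if R: "R \<ge> R0" for R
  proof -
    have R1: "R \<ge> 1" "R \<ge> (B / c) powr (1 / g)" using R by (auto simp: R0_def)
    have "B / c = ((B / c) powr (1 / g)) powr g" using g c \<open>B \<ge> 0\<close> by (simp add: powr_powr)
    also have "\<dots> \<le> R powr g" using R1 g by (intro powr_mono2) auto
    finally have Bc: "B \<le> c * R powr g" using c by (simp add: field_simps)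
    have "(d / (V * R ^ N)) powr (p / 2) = d powr (p / 2) * V powr (- p / 2) * R powr (- (real N * p / 2))"
    proof -
      have eq: "d / (V * R ^ N) = d * V powr (-1) * R powr (- real N)"
        using R1 \<open>V > 0\<close> by (simp add: powr_minus powr_realpow field_simps)
      show ?thesis unfolding eq powr_mult powr_powr by simp
    qed
    then have "k * ((d / (V * R ^ N)) powr (p / 2) * (1 / 2) powr p * (V * (R / 2) ^ N)) = c * (R powr (- (real N * p / 2)) * R ^ N)"
      by (simp add: c_def power_divide field_simps)
    also have "R powr (- (real N * p / 2)) * R ^ N = R powr (g - 2)"
      using R1 by (simp add: powr_realpow[symmetric] g_def flip: powr_add)
    also have "c * R powr (g - 2) = c * R powr g / R\<^sup>2" using R1 by (simp add: powr_diff)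
    finally have eq: "k * ((d / (V * R ^ N)) powr (p / 2) * (1 / 2) powr p * (V * (R / 2) ^ N)) = c * R powr g / R\<^sup>2" .
    show ?thesis unfolding eq by (intro divide_right_mono Bc) simp
  qed
  moreover have "R0 > 0" by (simp add: R0_def)
  ultimately show ?thesis by blast
qed

section \<open>Energy of a pair: integrability, gain from overlap and negative energy\<close>

context nls_system
begin

definition potential :: "('a \<Rightarrow> complex) \<Rightarrow> ('a \<Rightarrow> complex) \<Rightarrow> real" where
  "potential u v = (LINT x|lborel. Phi (cmod (u x)) (cmod (v x)))"

definition J :: "('a \<Rightarrow> complex) \<Rightarrow> ('a \<Rightarrow> complex) \<Rightarrow> real" where
  "J u v = (kinetic u + kinetic v) / 2 - potential u v"

definition Hint :: "('a \<Rightarrow> complex) \<Rightarrow> real" where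
  "Hint u = (LINT x|lborel. H (cmod (u x)))"

lemma energy_eq_J:
  assumes "u \<in> H1" "v \<in> H1" shows "energy \<mu>1 \<mu>2 p1 p2 r1 r2 \<beta> u v = J u v"
  using assms
  by (simp add: energy_def J_def potential_def Phi_def Bochner_Integration.integral_add integrable_grad_sq integral_grad_sq)

text \<open>The exponents \<open>p1\<close>, \<open>p2\<close> and \<open>r1 + r2\<close> all lie
  strictly between 2 and 2 + 4/N, the last one above 2 because both summands exceed 1. Each is
  allotted a third of \<open>e\<close>.\<close>

lemma Hint_coercive:
  assumes e: "e > 0" and m: "m > 0"
  shows "\<exists>C\<ge>0. \<forall>(u::'a \<Rightarrow> complex) K. shift_bounded K u \<longrightarrow> mass u \<le> m \<longrightarrow>
     integrable lborel (\<lambda>x. H (cmod (u x))) \<and> Hint u \<le> e * K + C"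
proof -
  have e3: "e / 3 > 0" using e by simp
  have r2: "2 < r1 + r2" using r by simp
  obtain C1 where C1: "C1 \<ge> 0" "\<forall>(u::'a \<Rightarrow> complex) K. shift_bounded K u \<longrightarrow> mass u \<le> m \<longrightarrow>
     integrable lborel (\<lambda>x. cmod (u x) powr p1) \<and> (LINT x|lborel. cmod (u x) powr p1) \<le> e / 3 * K + C1"
    using subcritical_coercive[OF p1 e3 m] by blast
  obtain C2 where C2: "C2 \<ge> 0" "\<forall>(u::'a \<Rightarrow> complex) K. shift_bounded K u \<longrightarrow> mass u \<le> m \<longrightarrow>
     integrable lborel (\<lambda>x. cmod (u x) powr p2) \<and> (LINT x|lborel. cmod (u x) powr p2) \<le> e / 3 * K + C2"
    using subcritical_coercive[OF p2 e3 m] by blast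
  obtain C3 where C3: "C3 \<ge> 0" "\<forall>(u::'a \<Rightarrow> complex) K. shift_bounded K u \<longrightarrow> mass u \<le> m \<longrightarrow>
     integrable lborel (\<lambda>x. cmod (u x) powr (r1 + r2)) \<and> (LINT x|lborel. cmod (u x) powr (r1 + r2)) \<le> e / 3 * K + C3"
    using subcritical_coercive[OF r2 rr e3 m] by blast
  show ?thesis
  proof (intro exI[of _ "C1 + C2 + C3"] conjI allI impI)
    fix u :: "'a \<Rightarrow> complex" and K assume u: "shift_bounded K u" "mass u \<le> m"
    note b = C1(2)[rule_format, OF u] C2(2)[rule_format, OF u] C3(2)[rule_format, OF u]
    show "integrable lborel (\<lambda>x. H (cmod (u x)))" using b by (simp add: H_def)
    have "Hint u = (LINT x|lborel. cmod (u x) powr p1) + (LINT x|lborel. cmod (u x) powr p2) + (LINT x|lborel. cmod (u x) powr (r1 + r2))"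
      unfolding Hint_def H_def using b by simp
    then show "Hint u \<le> e * K + (C1 + C2 + C3)" using b by (simp add: field_simps)
  qed (use C1 C2 C3 in simp)
qed

lemma Hint_vanishing:
  assumes e: "e > 0" and m: "m > 0" and K: "K \<ge> 0"
  shows "\<exists>\<sigma>>0. \<forall>(u::'a \<Rightarrow> complex). shift_bounded K u \<longrightarrow> mass u \<le> m \<longrightarrow> (\<forall>y. mass_on (ball y 1) u \<le> \<sigma>) \<longrightarrow> Hint u \<le> e"
proof -
  have e3: "e / 3 > 0" using e by simp
  have r2: "2 < r1 + r2" using r by simp
  obtain s1 where s1: "s1 > 0" "\<forall>(u::'a \<Rightarrow> complex). shift_bounded K u \<longrightarrow> mass u \<le> m \<longrightarrow> (\<forall>y. mass_on (ball y 1) u \<le> s1) \<longrightarrow>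
     integrable lborel (\<lambda>x. cmod (u x) powr p1) \<and> (LINT x|lborel. cmod (u x) powr p1) \<le> e / 3"
    using subcritical_vanishing[OF p1 e3 m K] by blast
  obtain s2 where s2: "s2 > 0" "\<forall>(u::'a \<Rightarrow> complex). shift_bounded K u \<longrightarrow> mass u \<le> m \<longrightarrow> (\<forall>y. mass_on (ball y 1) u \<le> s2) \<longrightarrow>
     integrable lborel (\<lambda>x. cmod (u x) powr p2) \<and> (LINT x|lborel. cmod (u x) powr p2) \<le> e / 3"
    using subcritical_vanishing[OF p2 e3 m K] by blast
  obtain s3 where s3: "s3 > 0" "\<forall>(u::'a \<Rightarrow> complex). shift_bounded K u \<longrightarrow> mass u \<le> m \<longrightarrow> (\<forall>y. mass_on (ball y 1) u \<le> s3) \<longrightarrow>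
     integrable lborel (\<lambda>x. cmod (u x) powr (r1 + r2)) \<and> (LINT x|lborel. cmod (u x) powr (r1 + r2)) \<le> e / 3"
    using subcritical_vanishing[OF r2 rr e3 m K] by blast
  show ?thesis
  proof (intro exI[of _ "min s1 (min s2 s3)"] conjI allI impI)
    fix u :: "'a \<Rightarrow> complex" assume u: "shift_bounded K u" "mass u \<le> m" "\<forall>y. mass_on (ball y 1) u \<le> min s1 (min s2 s3)"
    have b: "integrable lborel (\<lambda>x. cmod (u x) powr p1)" "(LINT x|lborel. cmod (u x) powr p1) \<le> e / 3"
      "integrable lborel (\<lambda>x. cmod (u x) powr p2)" "(LINT x|lborel. cmod (u x) powr p2) \<le> e / 3"
      "integrable lborel (\<lambda>x. cmod (u x) powr (r1 + r2))" "(LINT x|lborel. cmod (u x) powr (r1 + r2)) \<le> e / 3"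
      using s1(2)[rule_format, OF u(1,2)] s2(2)[rule_format, OF u(1,2)] s3(2)[rule_format, OF u(1,2)] u(3) by auto
    have "Hint u = (LINT x|lborel. cmod (u x) powr p1) + (LINT x|lborel. cmod (u x) powr p2) + (LINT x|lborel. cmod (u x) powr (r1 + r2))"
      unfolding Hint_def H_def using b by simp
    then show "Hint u \<le> e" using b by simp
  qed (use s1 s2 s3 in simp)
qed

lemma Phi_measurable:
  assumes [measurable]: "u \<in> borel_measurable borel" "v \<in> borel_measurable borel"
  shows "(\<lambda>x. Phi (cmod (u x)) (cmod (v x))) \<in> borel_measurable borel"
  unfolding Phi_def by measurable

lemma Phi_integrable_H:
  assumes "u \<in> borel_measurable borel" "v \<in> borel_measurable borel" "integrable lborel (\<lambda>x. H (cmod (combine u v x)))"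
  shows "integrable lborel (\<lambda>x. Phi (cmod (u x)) (cmod (v x)))" "potential u v \<le> cH * Hint (combine u v)"
proof -
  have i: "integrable lborel (\<lambda>x. cH * H (cmod (combine u v x)))" using assms(3) by simp
  have le: "Phi (cmod (u x)) (cmod (v x)) \<le> cH * H (cmod (combine u v x))" for x
    unfolding cmod_combine by (rule Phi_le_H) auto
  show int: "integrable lborel (\<lambda>x. Phi (cmod (u x)) (cmod (v x)))"
    by (rule Bochner_Integration.integrable_bound[OF i])
      (use Phi_measurable[OF assms(1,2)] le cH_pos in \<open>auto simp: Phi_nonneg H_nonneg\<close>)
  have "potential u v \<le> (LINT x|lborel. cH * H (cmod (combine u v x)))"
    unfolding potential_def by (rule integral_mono[OF int i le])
  then show "potential u v \<le> cH * Hint (combine u v)" by (simp add: Hint_def)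
qed

lemma H_integrable:
  fixes u :: "'a \<Rightarrow> complex"
  assumes "shift_bounded K u" shows "integrable lborel (\<lambda>x. H (cmod (u x)))"
proof -
  have "mass u + 1 > 0" using mass_nonneg[of u] by linarith
  from Hint_coercive[OF zero_less_one this] obtain C where "\<forall>(v::'a \<Rightarrow> complex) K. shift_bounded K v \<longrightarrow> mass v \<le> mass u + 1 \<longrightarrow>
     integrable lborel (\<lambda>x. H (cmod (v x))) \<and> Hint v \<le> 1 * K + C" by blast
  from this[rule_format, OF assms(1)] show ?thesis by simp
qed

lemma Phi_integrable:
  assumes "shift_bounded K u" "shift_bounded L v"
  shows "integrable lborel (\<lambda>x. Phi (cmod (u x)) (cmod (v x)))" "potential u v \<le> cH * Hint (combine u v)"
  using Phi_integrable_H[OF _ _ H_integrable[OF shift_bounded_combine[OF assms]]] assms[THEN shift_boundedD(1)]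
  by (auto dest: L2_measurable)

lemma potential_shift:
  assumes [measurable]: "u \<in> borel_measurable borel" "v \<in> borel_measurable borel"
  shows "potential (\<lambda>x. u (x + y)) (\<lambda>x. v (x + y)) = potential u v"
  unfolding potential_def by (rule integral_shift[OF Phi_measurable[OF assms]])

lemma potential_superadditive:
  assumes "shift_bounded K1 f1" "shift_bounded K2 f2" "shift_bounded M1 g1" "shift_bounded M2 g2"
  shows "potential f1 f2 + potential g1 g2 \<le> potential (combine f1 g1) (combine f2 g2)"
proof -
  note i = Phi_integrable(1)[OF assms(1,2)] Phi_integrable(1)[OF assms(3,4)]
  have "potential f1 f2 + potential g1 g2 = (LINT x|lborel. Phi (cmod (f1 x)) (cmod (f2 x)) + Phi (cmod (g1 x)) (cmod (g2 x)))"
    unfolding potential_def using i by simp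
  also have "\<dots> \<le> potential (combine f1 g1) (combine f2 g2)"
    unfolding potential_def
  proof (rule integral_mono)
    show "integrable lborel (\<lambda>x. Phi (cmod (combine f1 g1 x)) (cmod (combine f2 g2 x)))"
      by (rule Phi_integrable(1)[OF shift_bounded_combine[OF assms(1,3)] shift_bounded_combine[OF assms(2,4)]])
    show "Phi (cmod (f1 x)) (cmod (f2 x)) + Phi (cmod (g1 x)) (cmod (g2 x)) \<le> Phi (cmod (combine f1 g1 x)) (cmod (combine f2 g2 x))" for x
      unfolding cmod_combine by (rule Phi_superadditive) auto
  qed (use i in simp)
  finally show ?thesis .
qed

text \<open>
  Two profiles that both keep some mass in a unit ball can be translated so that they overlap, and
  then the potential is superadditive with a definite gain.
\<close>

lemma potential_gain:
  assumes "\<delta> > 0" "m > 0" "K \<ge> 0"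
  shows "\<exists>\<kappa>>0. \<forall>(f1::'a \<Rightarrow> complex) f2 g1 g2 y z. shift_bounded K f1 \<longrightarrow> shift_bounded K f2 \<longrightarrow> shift_bounded K g1 \<longrightarrow> shift_bounded K g2 \<longrightarrow>
    mass (combine f1 f2) \<le> m \<longrightarrow> mass (combine g1 g2) \<le> m \<longrightarrow> \<delta> \<le> mass_on (ball y 1) (combine f1 f2) \<longrightarrow> \<delta> \<le> mass_on (ball z 1) (combine g1 g2) \<longrightarrow>
    (\<exists>h. potential f1 f2 + potential g1 g2 + \<kappa> \<le> potential (combine f1 (\<lambda>x. g1 (x + h))) (combine f2 (\<lambda>x. g2 (x + h))))"
proof -
  obtain C where C: "C \<ge> 0" "\<forall>(u::'a \<Rightarrow> complex) K. shift_bounded K u \<longrightarrow> mass u \<le> m \<longrightarrow>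
     integrable lborel (\<lambda>x. cmod (u x) powr p1) \<and> (LINT x|lborel. cmod (u x) powr p1) \<le> 1 * K + C"
    using subcritical_coercive[OF p1 zero_less_one \<open>m > 0\<close>] by blast
  \<comment> \<open>The shift constant of a combined pair is \<open>2 * K\<close>, so
    \<open>2 * K + C\<close> bounds the integral of its \<open>p1\<close>-th power.\<close>
  have "2 * K + C \<ge> 0" using C \<open>K \<ge> 0\<close> by simp
  from level_measure_bound[OF p1(1) \<open>\<delta> > 0\<close> this, where 'a = 'a]
  obtain e L \<eta> where e: "e > 0" and \<eta>: "\<eta> > 0" and lev: "\<And>(F::'a \<Rightarrow> complex) y. F \<in> L2 \<Longrightarrow> integrable lborel (\<lambda>x. cmod (F x) powr p1) \<Longrightarrow>
     (LINT x|lborel. cmod (F x) powr p1) \<le> 2 * K + C \<Longrightarrow> \<delta> \<le> mass_on (ball y 1) F \<Longrightarrow>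
     \<eta> \<le> measure lborel {x \<in> ball y 1. e \<le> cmod (F x) \<and> cmod (F x) \<le> L}" by blast
  obtain c where c: "c > 0" and gap: "\<And>x1 x2 y1 y2. 0 \<le> x1 \<Longrightarrow> 0 \<le> x2 \<Longrightarrow> 0 \<le> y1 \<Longrightarrow> 0 \<le> y2 \<Longrightarrow>
    e \<le> norm (x1, x2) \<Longrightarrow> norm (x1, x2) \<le> L \<Longrightarrow> e \<le> norm (y1, y2) \<Longrightarrow> norm (y1, y2) \<le> L \<Longrightarrow>
    Phi x1 x2 + Phi y1 y2 + c \<le> Phi (norm (x1, y1)) (norm (x2, y2))"
    using Phi_gap[OF e, of L] by blast
  define w where "w = \<eta>\<^sup>2 / (2 * measure lborel (ball (0::'a) 2))"
  have w: "w > 0" using \<eta> by (simp add: w_def content_ball_pos)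
  show ?thesis
  proof (intro exI[of _ "c * w"] conjI allI impI)
    show "0 < c * w" using c w by simp
    fix f1 f2 g1 g2 :: "'a \<Rightarrow> complex" and y z
    assume f: "shift_bounded K f1" "shift_bounded K f2" and g: "shift_bounded K g1" "shift_bounded K g2"
      and m: "mass (combine f1 f2) \<le> m" "mass (combine g1 g2) \<le> m"
      and big: "\<delta> \<le> mass_on (ball y 1) (combine f1 f2)" "\<delta> \<le> mass_on (ball z 1) (combine g1 g2)"
    have sb: "shift_bounded (2 * K) (combine f1 f2)" "shift_bounded (2 * K) (combine g1 g2)"
      unfolding mult_2 by (rule shift_bounded_combine[OF f] shift_bounded_combine[OF g])+
    have L2: "combine f1 f2 \<in> L2" "combine g1 g2 \<in> L2" using sb[THEN shift_boundedD(1)] .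
    have [measurable]: "combine f1 f2 \<in> borel_measurable borel" "combine g1 g2 \<in> borel_measurable borel"
      using L2 by (auto dest: L2_measurable)
    have [measurable]: "ball t 1 \<in> sets borel" for t :: 'a by simp
    define E where "E = {x \<in> ball y 1. e \<le> cmod (combine f1 f2 x) \<and> cmod (combine f1 f2 x) \<le> L}"
    define G where "G = {x \<in> ball z 1. e \<le> cmod (combine g1 g2 x) \<and> cmod (combine g1 g2 x) \<le> L}"
    have E: "E \<in> sets borel" "E \<subseteq> ball y 1" unfolding E_def by (measurable, auto)
    have G: "G \<in> sets borel" "G \<subseteq> ball z 1" unfolding G_def by (measurable, auto)
    have "\<eta> \<le> measure lborel E" unfolding E_def
      by (rule lev[OF L2(1) _ _ big(1)]) (use C(2)[rule_format, OF sb(1) m(1)] in auto)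
    moreover have "\<eta> \<le> measure lborel G" unfolding G_def
      by (rule lev[OF L2(2) _ _ big(2)]) (use C(2)[rule_format, OF sb(2) m(2)] in auto)
    ultimately obtain h where h: "w \<le> measure lborel {x \<in> E. x + h \<in> G}"
      using overlap_by_translation[OF E G \<eta>] by (auto simp: w_def)
    \<comment> \<open>On this overlap both pairs have intermediate norm at the same point, so
      \<open>gap\<close> contributes at least \<open>c\<close> throughout \<open>A\<close>.\<close>
    define A where "A = {x \<in> E. x + h \<in> G}"
    have [measurable]: "E \<in> sets borel" "G \<in> sets borel" by fact+
    have A: "A \<in> sets borel" unfolding A_def by measurable
    have Afin: "emeasure lborel A < \<infinity>"
      by (rule le_less_trans[OF emeasure_mono emeasure_ball_finite[of y 1]]) (use E in \<open>auto simp: A_def\<close>)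
    let ?g1 = "\<lambda>x. g1 (x + h)" and ?g2 = "\<lambda>x. g2 (x + h)"
    have gh: "shift_bounded K ?g1" "shift_bounded K ?g2" using g by (auto intro: shift_bounded_shift)
    note i = Phi_integrable(1)[OF f] Phi_integrable(1)[OF gh]
    have iA: "integrable lborel (indicator A :: 'a \<Rightarrow> real)" using A Afin by (intro integrable_real_indicator) auto
    have "potential f1 f2 + potential g1 g2 + c * w \<le> potential f1 f2 + potential ?g1 ?g2 + c * measure lborel A"
      using h c potential_shift[of g1 g2 h] g[THEN shift_boundedD(1)] by (simp add: A_def L2_measurable)
    also have "\<dots> = (LINT x|lborel. Phi (cmod (f1 x)) (cmod (f2 x)) + Phi (cmod (?g1 x)) (cmod (?g2 x)) + c * indicator A x)"
      unfolding potential_def using i iA by simp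
    also have "\<dots> \<le> potential (combine f1 ?g1) (combine f2 ?g2)"
      unfolding potential_def
    proof (rule integral_mono)
      show "integrable lborel (\<lambda>x. Phi (cmod (combine f1 ?g1 x)) (cmod (combine f2 ?g2 x)))"
        by (rule Phi_integrable(1)[OF shift_bounded_combine[OF f(1) gh(1)] shift_bounded_combine[OF f(2) gh(2)]])
      fix x
      show "Phi (cmod (f1 x)) (cmod (f2 x)) + Phi (cmod (?g1 x)) (cmod (?g2 x)) + c * indicator A x \<le> Phi (cmod (combine f1 ?g1 x)) (cmod (combine f2 ?g2 x))"
      proof (cases "x \<in> A")
        case True
        then show ?thesis
          using gap[of "cmod (f1 x)" "cmod (f2 x)" "cmod (?g1 x)" "cmod (?g2 x)"] by (auto simp: A_def E_def G_def cmod_combine)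
      next
        case False
        then show ?thesis unfolding cmod_combine using Phi_superadditive[of "cmod (f1 x)" "cmod (f2 x)" "cmod (?g1 x)" "cmod (?g2 x)"] by simp
      qed
    qed (use i iA in simp)
    finally show "\<exists>h. potential f1 f2 + potential g1 g2 + c * w \<le> potential (combine f1 (\<lambda>x. g1 (x + h))) (combine f2 (\<lambda>x. g2 (x + h)))" by blast
  qed
qed

lemma potential_ge:
  assumes "u \<in> H1" "v \<in> H1"
  shows "integrable lborel (\<lambda>x. cmod (u x) powr p1)" "\<mu>1 / p1 * (LINT x|lborel. cmod (u x) powr p1) \<le> potential u v"
    "integrable lborel (\<lambda>x. cmod (v x) powr p2)" "\<mu>2 / p2 * (LINT x|lborel. cmod (v x) powr p2) \<le> potential u v"
proof -
  note i = Phi_integrable(1)[OF H1_shift_bounded[OF assms(1)] H1_shift_bounded[OF assms(2)]]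
  have m: "u \<in> borel_measurable borel" "v \<in> borel_measurable borel" using assms by (auto dest!: H1_L2 L2_measurable)
  have le1: "\<mu>1 / p1 * cmod (u x) powr p1 \<le> Phi (cmod (u x)) (cmod (v x))"
    and le2: "\<mu>2 / p2 * cmod (v x) powr p2 \<le> Phi (cmod (u x)) (cmod (v x))" for x
  proof -
    have "0 \<le> \<mu>1 / p1 * cmod (u x) powr p1" "0 \<le> \<mu>2 / p2 * cmod (v x) powr p2" "0 \<le> \<beta> * cmod (u x) powr r1 * cmod (v x) powr r2"
      using coeff_pos \<beta> by (intro mult_nonneg_nonneg; simp)+
    then show "\<mu>1 / p1 * cmod (u x) powr p1 \<le> Phi (cmod (u x)) (cmod (v x))"
      "\<mu>2 / p2 * cmod (v x) powr p2 \<le> Phi (cmod (u x)) (cmod (v x))" unfolding Phi_def by linarith+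
  qed
  show 1: "integrable lborel (\<lambda>x. cmod (u x) powr p1)"
    using subcritical_coercive[OF p1 zero_less_one, of "mass u + 1"] H1_shift_bounded[OF assms(1)] by (auto simp: add_nonneg_pos)
  show 2: "integrable lborel (\<lambda>x. cmod (v x) powr p2)"
    using subcritical_coercive[OF p2 zero_less_one, of "mass v + 1"] H1_shift_bounded[OF assms(2)] by (auto simp: add_nonneg_pos)
  show "\<mu>1 / p1 * (LINT x|lborel. cmod (u x) powr p1) \<le> potential u v"
    using integral_mono[OF integrable_mult_right[OF 1] i le1] by (simp add: potential_def)
  show "\<mu>2 / p2 * (LINT x|lborel. cmod (v x) powr p2) \<le> potential u v"
    using integral_mono[OF integrable_mult_right[OF 2] i le2] by (simp add: potential_def)
qed

text \<open>One of the two masses is at least \<open>\<delta> / 2\<close>. Its tent at scale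
  \<open>R\<close> already has potential at least \<open>(b + 1) / R\<^sup>2\<close>, while half the
  total kinetic energy is at most \<open>b / R\<^sup>2\<close>. The scale depends only on
  \<open>\<delta>\<close> and \<open>a\<close>, which makes the negative bound uniform in the
  masses.\<close>

lemma negative_energy_filler:
  assumes "\<delta> > 0" "a > 0"
  shows "\<exists>c>0. \<forall>d1 d2. 0 \<le> d1 \<longrightarrow> d1 \<le> a \<longrightarrow> 0 \<le> d2 \<longrightarrow> d2 \<le> a \<longrightarrow> \<delta> \<le> d1 + d2 \<longrightarrow>
    (\<exists>f g. f \<in> H1 \<and> g \<in> H1 \<and> mass f = d1 \<and> mass g = d2 \<and> J f g \<le> - c)"
proof -
  let ?N = "DIM('a)"
  define V where "V = measure lborel (ball (0::'a) 1)"
  have V: "V > 0" by (simp add: V_def content_ball_pos)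
  define b where "b = real ?N * (8 * 2 ^ ?N) * a"
  have b: "b \<ge> 0" using assms by (simp add: b_def)
  have d2: "\<delta> / 2 > 0" using assms by simp
  obtain R1 where R1: "R1 > 0" "\<And>R. R \<ge> R1 \<Longrightarrow> (b + 1) / R\<^sup>2 \<le> \<mu>1 / p1 * ((\<delta> / 2 / (V * R ^ ?N)) powr (p1 / 2) * (1 / 2) powr p1 * (V * (R / 2) ^ ?N))"
    using tent_scaling_threshold[OF p1 DIM_positive coeff_pos(1) d2 V, of "b + 1"] b by auto
  obtain R2 where R2: "R2 > 0" "\<And>R. R \<ge> R2 \<Longrightarrow> (b + 1) / R\<^sup>2 \<le> \<mu>2 / p2 * ((\<delta> / 2 / (V * R ^ ?N)) powr (p2 / 2) * (1 / 2) powr p2 * (V * (R / 2) ^ ?N))"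
    using tent_scaling_threshold[OF p2 DIM_positive coeff_pos(2) d2 V, of "b + 1"] b by auto
  define R where "R = max R1 R2"
  have R: "R > 0" "R \<ge> R1" "R \<ge> R2" using R1 R2 by (auto simp: R_def)
  show ?thesis
  proof (intro exI[of _ "1 / R\<^sup>2"] conjI allI impI)
    show "0 < 1 / R\<^sup>2" using R by simp
    fix d1 d2 assume d: "0 \<le> d1" "d1 \<le> a" "0 \<le> d2" "d2 \<le> a" "\<delta> \<le> d1 + d2"
    obtain f :: "'a \<Rightarrow> complex" where f: "f \<in> H1" "mass f = d1" "kinetic f \<le> real ?N * (8 * 2 ^ ?N) * d1 / R\<^sup>2"
      "integrable lborel (\<lambda>x. cmod (f x) powr p1) \<longrightarrow>
       (d1 / (V * R ^ ?N)) powr (p1 / 2) * (1 / 2) powr p1 * (V * (R / 2) ^ ?N) \<le> (LINT x|lborel. cmod (f x) powr p1)"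
      using scaled_tent[OF R(1) d(1) p1(1), where 'a = 'a] unfolding V_def by blast
    obtain g :: "'a \<Rightarrow> complex" where g: "g \<in> H1" "mass g = d2" "kinetic g \<le> real ?N * (8 * 2 ^ ?N) * d2 / R\<^sup>2"
      "integrable lborel (\<lambda>x. cmod (g x) powr p2) \<longrightarrow>
       (d2 / (V * R ^ ?N)) powr (p2 / 2) * (1 / 2) powr p2 * (V * (R / 2) ^ ?N) \<le> (LINT x|lborel. cmod (g x) powr p2)"
      using scaled_tent[OF R(1) d(3) p2(1), where 'a = 'a] unfolding V_def by blast
    have "real ?N * (8 * 2 ^ ?N) * d1 / R\<^sup>2 \<le> b / R\<^sup>2" "real ?N * (8 * 2 ^ ?N) * d2 / R\<^sup>2 \<le> b / R\<^sup>2"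
      unfolding b_def using d by (intro divide_right_mono mult_left_mono; simp)+
    then have "kinetic f \<le> b / R\<^sup>2" "kinetic g \<le> b / R\<^sup>2" using f(3) g(3) order_trans by blast+
    then have k: "(kinetic f + kinetic g) / 2 \<le> b / R\<^sup>2" by argo
    note pg = potential_ge[OF f(1) g(1)]
    have mono: "(\<delta> / 2 / (V * R ^ ?N)) powr (p / 2) * (1 / 2) powr p * (V * (R / 2) ^ ?N) \<le> (d / (V * R ^ ?N)) powr (p / 2) * (1 / 2) powr p * (V * (R / 2) ^ ?N)"
      if "\<delta> / 2 \<le> d" "p > 0" for d p
      using that V R assms by (intro mult_right_mono powr_mono2 divide_right_mono) auto
    have "(b + 1) / R\<^sup>2 \<le> potential f g"
    proof (cases "\<delta> / 2 \<le> d1")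
      case True
      have "(b + 1) / R\<^sup>2 \<le> \<mu>1 / p1 * ((\<delta> / 2 / (V * R ^ ?N)) powr (p1 / 2) * (1 / 2) powr p1 * (V * (R / 2) ^ ?N))" by (rule R1(2)[OF R(2)])
      also have "\<dots> \<le> \<mu>1 / p1 * (LINT x|lborel. cmod (f x) powr p1)"
        using p1 coeff_pos by (intro mult_left_mono order_trans[OF mono[OF True] f(4)[rule_format, OF pg(1)]]) auto
      also note pg(2)
      finally show ?thesis .
    next
      case False
      then have d2: "\<delta> / 2 \<le> d2" using d by linarith
      have "(b + 1) / R\<^sup>2 \<le> \<mu>2 / p2 * ((\<delta> / 2 / (V * R ^ ?N)) powr (p2 / 2) * (1 / 2) powr p2 * (V * (R / 2) ^ ?N))" by (rule R2(2)[OF R(3)])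
      also have "\<dots> \<le> \<mu>2 / p2 * (LINT x|lborel. cmod (g x) powr p2)"
        using p2 coeff_pos by (intro mult_left_mono order_trans[OF mono[OF d2] g(4)[rule_format, OF pg(3)]]) auto
      also note pg(4)
      finally show ?thesis .
    qed
    then have "J f g \<le> b / R\<^sup>2 - (b + 1) / R\<^sup>2" unfolding J_def using k by linarith
    also have "\<dots> = - (1 / R\<^sup>2)" by (simp add: add_divide_distrib)
    finally show "\<exists>f g. f \<in> H1 \<and> g \<in> H1 \<and> mass f = d1 \<and> mass g = d2 \<and> J f g \<le> - (1 / R\<^sup>2)" using f g by blast
  qed
qed

end

section \<open>Concentration of almost minimisers\<close>

text \<open>The angle rises linearly from 0 at radius \<open>R\<close> to \<open>pi / 2\<close> at
  radius \<open>2 * R\<close>. Cosine and sine of one angle form a quadratic partition of unity, so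
  the masses of the two pieces add up exactly.\<close>

definition cutoff_angle :: "'a::euclidean_space \<Rightarrow> real \<Rightarrow> 'a \<Rightarrow> real" where
  "cutoff_angle y R x = pi / 2 * max 0 (min 1 (dist y x / R - 1))"

definition cut_in :: "'a::euclidean_space \<Rightarrow> real \<Rightarrow> ('a \<Rightarrow> complex) \<Rightarrow> 'a \<Rightarrow> complex" where
  "cut_in y R u x = cos (cutoff_angle y R x) *\<^sub>R u x"

definition cut_out :: "'a::euclidean_space \<Rightarrow> real \<Rightarrow> ('a \<Rightarrow> complex) \<Rightarrow> 'a \<Rightarrow> complex" where
  "cut_out y R u x = sin (cutoff_angle y R x) *\<^sub>R u x"

lemma cut_near:
  assumes "R > 0" "dist y x \<le> R" shows "cut_in y R u x = u x" "cut_out y R u x = 0"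
proof -
  have "dist y x / R - 1 \<le> 0" using assms by simp
  then have "cutoff_angle y R x = 0" by (simp add: cutoff_angle_def max_def min_def)
  then show "cut_in y R u x = u x" "cut_out y R u x = 0" by (simp_all add: cut_in_def cut_out_def)
qed

lemma cut_far:
  assumes "R > 0" "2 * R \<le> dist y x" shows "cut_in y R u x = 0" "cut_out y R u x = u x"
proof -
  have "1 \<le> dist y x / R - 1" using assms by (simp add: field_simps)
  then have angle: "cutoff_angle y R x = pi / 2" by (simp add: cutoff_angle_def max_def min_def)
  show "cut_in y R u x = 0" "cut_out y R u x = u x" unfolding cut_in_def cut_out_def angle by simp_all
qed

lemma cut_le: "cmod (cut_in y R u x) \<le> cmod (u x)" "cmod (cut_out y R u x) \<le> cmod (u x)"
  by (simp_all add: cut_in_def cut_out_def mult_left_le_one_le)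

lemma cut_measurable [measurable (raw)]:
  assumes [measurable]: "u \<in> borel_measurable borel"
  shows "cut_in y R u \<in> borel_measurable borel" "cut_out y R u \<in> borel_measurable borel"
  unfolding cut_in_def[abs_def] cut_out_def[abs_def] cutoff_angle_def by measurable

lemma cut_L2: assumes "u \<in> L2" shows "cut_in y R u \<in> L2" "cut_out y R u \<in> L2"
  using L2_dominated[OF assms cut_measurable(1)[OF L2_measurable[OF assms]], of y R 1]
    L2_dominated[OF assms cut_measurable(2)[OF L2_measurable[OF assms]], of y R 1] cut_le[of y R u] by simp_all

lemma cut_square_sum: "(cmod (cut_in y R u x))\<^sup>2 + (cmod (cut_out y R u x))\<^sup>2 = (cmod (u x))\<^sup>2"
  by (simp add: cut_in_def cut_out_def power_mult_distrib flip: distrib_right)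

lemma mass_cut_sum: "u \<in> L2 \<Longrightarrow> mass (cut_in y R u) + mass (cut_out y R u) = mass u"
  unfolding mass_def using L2_integrable[OF cut_L2(1), of u y R] L2_integrable[OF cut_L2(2), of u y R]
  by (subst Bochner_Integration.integral_add[symmetric]) (simp_all add: cut_square_sum)

lemma cutoff_angle_Lipschitz:
  assumes "R > 0" shows "\<bar>cutoff_angle y R x - cutoff_angle y R z\<bar> \<le> pi / (2 * R) * dist x z"
proof -
  have "\<bar>max 0 (min 1 (dist y x / R - 1)) - max 0 (min 1 (dist y z / R - 1))\<bar> \<le> \<bar>dist y x / R - dist y z / R\<bar>"
    by (auto simp: max_def min_def abs_if)
  also have "\<dots> = \<bar>dist y x - dist y z\<bar> / R" using assms by (simp flip: diff_divide_distrib)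
  also have "\<dots> \<le> dist x z / R"
    using assms abs_dist_diff_le[of x y z] by (intro divide_right_mono) (auto simp: dist_commute)
  finally have "pi / 2 * \<bar>max 0 (min 1 (dist y x / R - 1)) - max 0 (min 1 (dist y z / R - 1))\<bar> \<le> pi / 2 * (dist x z / R)"
    by (intro mult_left_mono) auto
  moreover have "\<bar>cutoff_angle y R x - cutoff_angle y R z\<bar> = pi / 2 * \<bar>max 0 (min 1 (dist y x / R - 1)) - max 0 (min 1 (dist y z / R - 1))\<bar>"
    unfolding cutoff_angle_def right_diff_distrib[symmetric] abs_mult by simp
  ultimately show ?thesis by simp
qed

text \<open>Cutting with a point \<open>(cos t, sin t)\<close> of the unit circle preserves squares, so only the
  variation of the angle costs energy.\<close>

lemma rotation_difference:
  fixes a b :: complex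
  shows "(cmod (cos t *\<^sub>R a - cos s *\<^sub>R b))\<^sup>2 + (cmod (sin t *\<^sub>R a - sin s *\<^sub>R b))\<^sup>2 \<le>
    (cmod (a - b))\<^sup>2 + (t - s)\<^sup>2 * (((cmod a)\<^sup>2 + (cmod b)\<^sup>2) / 2)"
proof -
  have "(cmod (cos t *\<^sub>R a - cos s *\<^sub>R b))\<^sup>2 + (cmod (sin t *\<^sub>R a - sin s *\<^sub>R b))\<^sup>2 =
    ((cos t)\<^sup>2 + (sin t)\<^sup>2) * (a \<bullet> a) + ((cos s)\<^sup>2 + (sin s)\<^sup>2) * (b \<bullet> b) - 2 * (cos t * cos s + sin t * sin s) * (a \<bullet> b)"
    unfolding power2_norm_eq_inner
    by (simp add: inner_diff inner_commute power2_eq_square algebra_simps del: sin_cos_squared_add sin_cos_squared_add2 sin_cos_squared_add3)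
  also have "\<dots> = a \<bullet> a + b \<bullet> b - 2 * cos (t - s) * (a \<bullet> b)"
    unfolding sin_cos_squared_add2 by (simp add: cos_diff)
  also have "\<dots> = (cmod (a - b))\<^sup>2 + 2 * (1 - cos (t - s)) * (a \<bullet> b)"
    unfolding power2_norm_eq_inner by (simp add: inner_diff inner_commute algebra_simps)
  also have "2 * (1 - cos (t - s)) * (a \<bullet> b) \<le> (t - s)\<^sup>2 * (((cmod a)\<^sup>2 + (cmod b)\<^sup>2) / 2)"
  proof -
    have c: "2 * (1 - cos (t - s)) \<le> (t - s)\<^sup>2"
    proof -
      have "cos (t - s) = 1 - 2 * (sin ((t - s) / 2))\<^sup>2"
        using cos_double_sin[of "(t - s) / 2"] by (simp only: times_divide_eq_right nonzero_mult_div_cancel_left[OF zero_neq_numeral[symmetric]])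
      moreover have "(sin ((t - s) / 2))\<^sup>2 \<le> ((t - s) / 2)\<^sup>2"
        by (rule abs_sin_x_le_abs_x[of "(t - s) / 2", unfolded abs_le_square_iff])
      ultimately show ?thesis by (simp add: power_divide)
    qed
    have ab: "a \<bullet> b \<le> ((cmod a)\<^sup>2 + (cmod b)\<^sup>2) / 2"
      using zero_le_power2[of "cmod (a - b)"] unfolding power2_norm_eq_inner by (simp add: inner_diff inner_commute)
    have "2 * (1 - cos (t - s)) * (a \<bullet> b) \<le> 2 * (1 - cos (t - s)) * (((cmod a)\<^sup>2 + (cmod b)\<^sup>2) / 2)"
      by (intro mult_left_mono ab) auto
    also have "\<dots> \<le> (t - s)\<^sup>2 * (((cmod a)\<^sup>2 + (cmod b)\<^sup>2) / 2)"
      by (intro mult_right_mono c) auto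
    finally show ?thesis .
  qed
  finally show ?thesis by simp
qed

text \<open>The two pieces are estimated jointly: with separate bounds the increments of
  \<open>u\<close> would be counted twice. The error stems from the Lipschitz constant
  \<open>pi / (2 * R)\<close> of the angle.\<close>

lemma mass_shift_cut:
  assumes u: "u \<in> L2" and R: "R > 0"
  shows "mass (\<lambda>x. cut_in y R u (x + h) - cut_in y R u x) + mass (\<lambda>x. cut_out y R u (x + h) - cut_out y R u x)
    \<le> mass (\<lambda>x. u (x + h) - u x) + (pi / (2 * R))\<^sup>2 * mass u * (norm h)\<^sup>2"
proof -
  define c where "c = (pi / (2 * R) * norm h)\<^sup>2"
  have c: "c \<ge> 0" by (simp add: c_def)
  note L = L2_diff[OF L2_shift[OF cut_L2(1)[OF u, of y R], of h] cut_L2(1)[OF u]] L2_diff[OF L2_shift[OF cut_L2(2)[OF u, of y R], of h] cut_L2(2)[OF u]]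
  note Lu = L2_diff[OF L2_shift[OF u, of h] u]
  have "mass (\<lambda>x. cut_in y R u (x + h) - cut_in y R u x) + mass (\<lambda>x. cut_out y R u (x + h) - cut_out y R u x)
    = (LINT x|lborel. (cmod (cut_in y R u (x + h) - cut_in y R u x))\<^sup>2 + (cmod (cut_out y R u (x + h) - cut_out y R u x))\<^sup>2)"
    unfolding mass_def using L[THEN L2_integrable] by simp
  also have "\<dots> \<le> (LINT x|lborel. (cmod (u (x + h) - u x))\<^sup>2 + c * (((cmod (u (x + h)))\<^sup>2 + (cmod (u x))\<^sup>2) / 2))"
  proof (rule integral_mono)
    show "integrable lborel (\<lambda>x. (cmod (cut_in y R u (x + h) - cut_in y R u x))\<^sup>2 + (cmod (cut_out y R u (x + h) - cut_out y R u x))\<^sup>2)"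
      using L[THEN L2_integrable] by simp
    show "integrable lborel (\<lambda>x. (cmod (u (x + h) - u x))\<^sup>2 + c * (((cmod (u (x + h)))\<^sup>2 + (cmod (u x))\<^sup>2) / 2))"
      using L2_integrable[OF Lu] L2_integrable[OF u] L2_integrable[OF L2_shift[OF u, of h]] by simp
    fix x
    have "(cutoff_angle y R (x + h) - cutoff_angle y R x)\<^sup>2 \<le> c"
      unfolding c_def using cutoff_angle_Lipschitz[OF R, of y "x + h" x] R by (subst abs_le_square_iff[symmetric]) (simp add: dist_norm)
    then have "(cutoff_angle y R (x + h) - cutoff_angle y R x)\<^sup>2 * (((cmod (u (x + h)))\<^sup>2 + (cmod (u x))\<^sup>2) / 2) \<le> c * (((cmod (u (x + h)))\<^sup>2 + (cmod (u x))\<^sup>2) / 2)"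
      by (intro mult_right_mono) auto
    with rotation_difference[of "cutoff_angle y R (x + h)" "u (x + h)" "cutoff_angle y R x" "u x"]
    show "(cmod (cut_in y R u (x + h) - cut_in y R u x))\<^sup>2 + (cmod (cut_out y R u (x + h) - cut_out y R u x))\<^sup>2 \<le>
       (cmod (u (x + h) - u x))\<^sup>2 + c * (((cmod (u (x + h)))\<^sup>2 + (cmod (u x))\<^sup>2) / 2)"
      unfolding cut_in_def cut_out_def by linarith
  qed
  also have "\<dots> = mass (\<lambda>x. u (x + h) - u x) + c * ((mass (\<lambda>x. u (x + h)) + mass u) / 2)"
    unfolding mass_def using L2_integrable[OF Lu] L2_integrable[OF u] L2_integrable[OF L2_shift[OF u, of h]] by simp
  also have "\<dots> = mass (\<lambda>x. u (x + h) - u x) + (pi / (2 * R))\<^sup>2 * mass u * (norm h)\<^sup>2"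
    by (simp add: mass_shift[OF u] c_def power_mult_distrib power_divide)
  finally show ?thesis .
qed

lemma shift_bounded_cut:
  assumes "shift_bounded K u" "R > 0"
  shows "shift_bounded (K + (pi / (2 * R))\<^sup>2 * mass u) (cut_in y R u)" "shift_bounded (K + (pi / (2 * R))\<^sup>2 * mass u) (cut_out y R u)"
proof -
  note u = shift_boundedD[OF assms(1)]
  have *: "mass (\<lambda>x. cut_in y R u (x + h) - cut_in y R u x) + mass (\<lambda>x. cut_out y R u (x + h) - cut_out y R u x)
    \<le> (K + (pi / (2 * R))\<^sup>2 * mass u) * (norm h)\<^sup>2" for h
    using order_trans[OF mass_shift_cut[OF u(1) assms(2)] add_right_mono[OF u(3)]] by (simp add: distrib_right)
  have nn: "0 \<le> K + (pi / (2 * R))\<^sup>2 * mass u" using u(2) by simp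
  show "shift_bounded (K + (pi / (2 * R))\<^sup>2 * mass u) (cut_in y R u)" "shift_bounded (K + (pi / (2 * R))\<^sup>2 * mass u) (cut_out y R u)"
    unfolding shift_bounded_def using * nn cut_L2[OF u(1)]
    by (auto intro: order_trans[OF _ *] simp: add_increasing add_increasing2)
qed

lemma mass_on_cong: "(\<And>x. x \<in> A \<Longrightarrow> cmod (u x) = cmod (v x)) \<Longrightarrow> mass_on A u = mass_on A v"
  unfolding mass_on_def by (intro Bochner_Integration.integral_cong) (auto split: split_indicator)

text \<open>With the constant \<open>1 / (4 * cH)\<close> the potential absorbs at most a quarter of
  the kinetic energy, and \<open>J\<close> retains another quarter.\<close>

lemma (in nls_system) kinetic_coercive:
  assumes s: "a1 + a2 > 0"
  shows "\<exists>C\<ge>0. \<forall>(u::'a \<Rightarrow> complex) (v::'a \<Rightarrow> complex). u \<in> H1 \<longrightarrow> v \<in> H1 \<longrightarrow> mass u = a1 \<longrightarrow> mass v = a2 \<longrightarrow> kinetic u + kinetic v \<le> 4 * J u v + C"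
proof -
  have e: "1 / (4 * cH) > 0" using cH_pos by simp
  from Hint_coercive[OF e s] obtain C where C: "C \<ge> 0" "\<forall>(u::'a \<Rightarrow> complex) K. shift_bounded K u \<longrightarrow> mass u \<le> a1 + a2 \<longrightarrow>
     integrable lborel (\<lambda>x. H (cmod (u x))) \<and> Hint u \<le> 1 / (4 * cH) * K + C" by blast
  show ?thesis
  proof (intro exI[of _ "4 * cH * C"] conjI allI impI)
    show "0 \<le> 4 * cH * C" using C cH_pos by simp
    fix u v :: "'a \<Rightarrow> complex" assume u: "u \<in> H1" "v \<in> H1" "mass u = a1" "mass v = a2"
    have "mass (combine u v) \<le> a1 + a2" using mass_combine[OF H1_L2[OF u(1)] H1_L2[OF u(2)]] u by simp
    with C(2) shift_bounded_combine[OF H1_shift_bounded[OF u(1)] H1_shift_bounded[OF u(2)]]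
    have "Hint (combine u v) \<le> 1 / (4 * cH) * (kinetic u + kinetic v) + C" by blast
    then have "cH * Hint (combine u v) \<le> cH * (1 / (4 * cH) * (kinetic u + kinetic v) + C)" using cH_pos by (intro mult_left_mono) auto
    also have "\<dots> = (kinetic u + kinetic v) / 4 + cH * C" using cH_pos by (simp add: distrib_left)
    finally have "potential u v \<le> (kinetic u + kinetic v) / 4 + cH * C"
      using Phi_integrable(2)[OF H1_shift_bounded[OF u(1)] H1_shift_bounded[OF u(2)]] by simp
    then show "kinetic u + kinetic v \<le> 4 * J u v + 4 * cH * C" unfolding J_def by argo
  qed
qed

section \<open>Consequences of a lower bound for the energy\<close>

text \<open>Only the lower bound by \<open>m\<close> is assumed here. That \<open>m\<close> is
  approached enters through hypotheses such as \<open>J u v \<le> m + \<tau>\<close> and through the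
  limit of a minimising sequence.\<close>

locale nls_min = nls_system space \<mu>1 \<mu>2 p1 p2 r1 r2 \<beta>
  for space :: "'a::euclidean_space itself" and \<mu>1 \<mu>2 p1 p2 r1 r2 \<beta> :: real +
  fixes a1 a2 m :: real
  assumes a: "a1 > 0" "a2 > 0"
    and lower: "\<And>u v :: 'a \<Rightarrow> complex. u \<in> H1 \<Longrightarrow> v \<in> H1 \<Longrightarrow> mass u = a1 \<Longrightarrow> mass v = a2 \<Longrightarrow> m \<le> J u v"
begin

text \<open>The glued pair has the prescribed masses, so \<open>m\<close> bounds its energy.
  Increments of the two parts are bounded jointly, in the form in which the cutoff estimate delivers
  them.\<close>

lemma compare_combine:
  assumes sb: "shift_bounded L1 f1" "shift_bounded L2' f2" "shift_bounded M1 g1" "shift_bounded M2 g2"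
    and mass: "mass f1 + mass g1 = a1" "mass f2 + mass g2 = a2"
    and K1: "\<And>i t. i \<in> Basis \<Longrightarrow> mass (\<lambda>x. f1 (x + t *\<^sub>R i) - f1 x) + mass (\<lambda>x. g1 (x + t *\<^sub>R i) - g1 x) \<le> K1 i * t\<^sup>2"
    and K2: "\<And>i t. i \<in> Basis \<Longrightarrow> mass (\<lambda>x. f2 (x + t *\<^sub>R i) - f2 x) + mass (\<lambda>x. g2 (x + t *\<^sub>R i) - g2 x) \<le> K2 i * t\<^sup>2"
  shows "m \<le> ((\<Sum>i\<in>(Basis::'a set). K1 i) + (\<Sum>i\<in>(Basis::'a set). K2 i)) / 2 - potential (combine f1 g1) (combine f2 g2)"
proof -
  note L = sb[THEN shift_boundedD(1)]
  have 1: "combine f1 g1 \<in> H1" "kinetic (combine f1 g1) \<le> (\<Sum>i\<in>(Basis::'a set). K1 i)"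
    using H1_by_shift_bounds[OF combine_L2[OF L(1,3)] order_trans[OF mass_shift_combine_le[OF L(1,3)] K1]] by auto
  have 2: "combine f2 g2 \<in> H1" "kinetic (combine f2 g2) \<le> (\<Sum>i\<in>(Basis::'a set). K2 i)"
    using H1_by_shift_bounds[OF combine_L2[OF L(2,4)] order_trans[OF mass_shift_combine_le[OF L(2,4)] K2]] by auto
  have "m \<le> J (combine f1 g1) (combine f2 g2)"
    by (rule lower[OF 1(1) 2(1)]) (simp_all add: mass_combine L mass)
  then show ?thesis using 1(2) 2(2) unfolding J_def by argo
qed

text \<open>Missing mass is filled up by a pair of negative energy. Gluing raises neither the
  kinetic sum nor lowers the potential sum, so the energy of the original pair exceeds that of an
  admissible one.\<close>

lemma lower_smaller_mass:
  assumes v: "v1 \<in> H1" "v2 \<in> H1" and le: "mass v1 \<le> a1" "mass v2 \<le> a2"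
  shows "m \<le> J v1 v2"
proof (cases "mass v1 = a1 \<and> mass v2 = a2")
  case True
  then show ?thesis using lower[OF v] by simp
next
  case False
  define d1 where "d1 = a1 - mass v1"
  define d2 where "d2 = a2 - mass v2"
  have d: "0 \<le> d1" "d1 \<le> a1 + a2" "0 \<le> d2" "d2 \<le> a1 + a2" "d1 + d2 > 0"
    using le a False mass_nonneg[of v1] mass_nonneg[of v2] unfolding d1_def d2_def by argo+
  have "a1 + a2 > 0" using a by simp
  from negative_energy_filler[OF d(5) this] d obtain c f g
    where c: "c > 0" and f: "f \<in> H1" "g \<in> H1" "mass f = d1" "mass g = d2" "J f g \<le> - c" by blast
  note sb = H1_shift_bounded[OF v(1)] H1_shift_bounded[OF v(2)] H1_shift_bounded[OF f(1)] H1_shift_bounded[OF f(2)]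
  have "m \<le> ((\<Sum>i\<in>Basis. mass (weak_partial i v1) + mass (weak_partial i f)) + (\<Sum>i\<in>Basis. mass (weak_partial i v2) + mass (weak_partial i g))) / 2
     - potential (combine v1 f) (combine v2 g)"
  proof (rule compare_combine[OF sb])
    show "mass v1 + mass f = a1" "mass v2 + mass g = a2" using f by (simp_all add: d1_def d2_def)
    fix i :: 'a and t assume i: "i \<in> Basis"
    show "mass (\<lambda>x. v1 (x + t *\<^sub>R i) - v1 x) + mass (\<lambda>x. f (x + t *\<^sub>R i) - f x) \<le> (mass (weak_partial i v1) + mass (weak_partial i f)) * t\<^sup>2"
      using add_mono[OF shift_bound_Basis[OF v(1) i] shift_bound_Basis[OF f(1) i], of t t] by (simp add: distrib_right)
    show "mass (\<lambda>x. v2 (x + t *\<^sub>R i) - v2 x) + mass (\<lambda>x. g (x + t *\<^sub>R i) - g x) \<le> (mass (weak_partial i v2) + mass (weak_partial i g)) * t\<^sup>2"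
      using add_mono[OF shift_bound_Basis[OF v(2) i] shift_bound_Basis[OF f(2) i], of t t] by (simp add: distrib_right)
  qed
  then have "m \<le> (kinetic v1 + kinetic f + (kinetic v2 + kinetic g)) / 2 - potential (combine v1 f) (combine v2 g)"
    by (simp add: sum.distrib kinetic_def)
  then show ?thesis
    using potential_superadditive[OF sb] f(5) c unfolding J_def by argo
qed

lemma m_negative: "m < 0"
proof -
  have s: "a1 + a2 > 0" using a by simp
  have "0 \<le> a1" "a1 \<le> a1 + a2" "0 \<le> a2" "a2 \<le> a1 + a2" using a by auto
  with negative_energy_filler[OF s s] obtain c f g
    where "c > 0" "f \<in> H1" "g \<in> H1" "mass f = a1" "mass g = a2" "J f g \<le> - c" by blast
  with lower[of f g] show ?thesis by simp
qed

text \<open>If every unit ball carried little mass, the potential would be at most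
  \<open>- m / 4\<close>. Then \<open>J\<close> would be at least \<open>m / 4\<close>, which is
  larger than \<open>m / 2\<close> because \<open>m\<close> is negative.\<close>

lemma nonvanishing:
  assumes "K \<ge> 0"
  shows "\<exists>\<delta>>0. \<forall>u v. u \<in> H1 \<longrightarrow> v \<in> H1 \<longrightarrow> mass u = a1 \<longrightarrow> mass v = a2 \<longrightarrow> kinetic u + kinetic v \<le> K \<longrightarrow> J u v \<le> m / 2 \<longrightarrow>
    (\<exists>y. \<delta> \<le> mass_on (ball y 1) (combine u v))"
proof -
  have e: "- m / (4 * cH) > 0" and s: "a1 + a2 > 0" using cH_pos a m_negative by (auto intro!: divide_pos_pos divide_neg_pos)
  from Hint_vanishing[OF e s assms] obtain \<delta> where \<delta>: "\<delta> > 0" "\<forall>(u::'a \<Rightarrow> complex). shift_bounded K u \<longrightarrow> mass u \<le> a1 + a2 \<longrightarrow>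
     (\<forall>y. mass_on (ball y 1) u \<le> \<delta>) \<longrightarrow> Hint u \<le> - m / (4 * cH)" by blast
  show ?thesis
  proof (intro exI[of _ \<delta>] conjI allI impI \<delta>(1))
    fix u v :: "'a \<Rightarrow> complex"
    assume u: "u \<in> H1" "v \<in> H1" "mass u = a1" "mass v = a2" and k: "kinetic u + kinetic v \<le> K" and J: "J u v \<le> m / 2"
    note sb = H1_shift_bounded[OF u(1)] H1_shift_bounded[OF u(2)]
    have mm: "mass (combine u v) \<le> a1 + a2" using mass_combine[OF H1_L2[OF u(1)] H1_L2[OF u(2)]] u by simp
    show "\<exists>y. \<delta> \<le> mass_on (ball y 1) (combine u v)"
    proof (rule ccontr)
      assume "\<not> ?thesis"
      then have "\<forall>y. mass_on (ball y 1) (combine u v) \<le> \<delta>" by (meson less_imp_le not_le)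
      with \<delta>(2) shift_bounded_mono[OF shift_bounded_combine[OF sb] k] mm
      have "Hint (combine u v) \<le> - m / (4 * cH)" by blast
      then have "cH * Hint (combine u v) \<le> cH * (- m / (4 * cH))" using cH_pos by (intro mult_left_mono) auto
      then have "potential u v \<le> - m / 4" using Phi_integrable(2)[OF sb] cH_pos by simp
      moreover have "0 \<le> kinetic u" "0 \<le> kinetic v" by simp_all
      ultimately show False using J m_negative unfolding J_def by argo
    qed
  qed
qed

text \<open>
  Pigeonhole on dyadic annuli: some annulus carries little potential, and cutting there costs
  little. If the outer piece does not vanish, translating it onto the inner piece gains a
  definite amount; if it vanishes, it is replaced by a filler of negative energy.
\<close>

lemma tightness_step:
  assumes \<delta>: "\<delta> > 0" and \<epsilon>: "\<epsilon> > 0" and K: "K \<ge> 0"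
  shows "\<exists>R>0. \<exists>\<tau>>0. \<forall>u v y. u \<in> H1 \<longrightarrow> v \<in> H1 \<longrightarrow> mass u = a1 \<longrightarrow> mass v = a2 \<longrightarrow> kinetic u + kinetic v \<le> K \<longrightarrow>
    \<delta> \<le> mass_on (ball y 1) (combine u v) \<longrightarrow> J u v \<le> m + \<tau> \<longrightarrow> mass_on (- ball y R) (combine u v) < \<epsilon>"
proof -
  have s: "a1 + a2 > 0" using a by simp
  \<comment> \<open>A common shift constant for all cut pieces at radii at least 1.\<close>
  define Kc where "Kc = K + (pi / 2)\<^sup>2 * (a1 + a2)"
  have Kc: "Kc \<ge> 0" using K s by (simp add: Kc_def)
  obtain Cp where Cp: "Cp \<ge> 0" "\<forall>(u::'a \<Rightarrow> complex) K. shift_bounded K u \<longrightarrow> mass u \<le> a1 + a2 \<longrightarrow>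
     integrable lborel (\<lambda>x. H (cmod (u x))) \<and> Hint u \<le> 1 * K + Cp" using Hint_coercive[OF zero_less_one s] by blast
  define Fm where "Fm = cH * (K + Cp)"
  have Fm: "Fm \<ge> 0" using cH_pos K Cp by (simp add: Fm_def)
  obtain c where c: "c > 0" and filler: "\<And>d1 d2. 0 \<le> d1 \<Longrightarrow> d1 \<le> a1 + a2 \<Longrightarrow> 0 \<le> d2 \<Longrightarrow> d2 \<le> a1 + a2 \<Longrightarrow> \<epsilon> \<le> d1 + d2 \<Longrightarrow>
    (\<exists>f g. f \<in> H1 \<and> g \<in> H1 \<and> mass f = d1 \<and> mass g = d2 \<and> J f g \<le> - c)"
    using negative_energy_filler[OF \<epsilon> s] by blast
  have e: "c / (4 * cH) > 0" using c cH_pos by simp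
  have Kc2: "2 * Kc \<ge> 0" using Kc by simp
  obtain \<sigma> where \<sigma>: "\<sigma> > 0" and vanish: "\<And>u::'a \<Rightarrow> complex. shift_bounded (2 * Kc) u \<Longrightarrow> mass u \<le> a1 + a2 \<Longrightarrow>
     (\<forall>y. mass_on (ball y 1) u \<le> \<sigma>) \<Longrightarrow> Hint u \<le> c / (4 * cH)" using Hint_vanishing[OF e s Kc2] by blast
  have "min \<delta> \<sigma> > 0" using \<delta> \<sigma> by simp
  from potential_gain[OF this s Kc] obtain \<kappa> where \<kappa>: "\<kappa> > 0" and gain: "\<And>(f1::'a \<Rightarrow> complex) f2 g1 g2 y z.
    shift_bounded Kc f1 \<Longrightarrow> shift_bounded Kc f2 \<Longrightarrow> shift_bounded Kc g1 \<Longrightarrow> shift_bounded Kc g2 \<Longrightarrow>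
    mass (combine f1 f2) \<le> a1 + a2 \<Longrightarrow> mass (combine g1 g2) \<le> a1 + a2 \<Longrightarrow> min \<delta> \<sigma> \<le> mass_on (ball y 1) (combine f1 f2) \<Longrightarrow>
    min \<delta> \<sigma> \<le> mass_on (ball z 1) (combine g1 g2) \<Longrightarrow>
    (\<exists>h. potential f1 f2 + potential g1 g2 + \<kappa> \<le> potential (combine f1 (\<lambda>x. g1 (x + h))) (combine f2 (\<lambda>x. g2 (x + h))))" by blast
  \<comment> \<open>Each comparison below loses at most \<open>3 * \<tau>\<close>: once for almost
    minimality, once for the kinetic cost of cutting and once for the potential on the annulus. The
    filler case loses a further \<open>c / 4\<close>, against a gain of \<open>c\<close>.\<close>
  define \<tau> where "\<tau> = min c \<kappa> / 8"
  have \<tau>: "\<tau> > 0" "8 * \<tau> \<le> c" "8 * \<tau> \<le> \<kappa>" using c \<kappa> by (auto simp: \<tau>_def)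
  \<comment> \<open>\<open>E / R\<^sup>2\<close> is the cost of cutting at radius \<open>R\<close>,
    that is, half the increase of the bound on the kinetic sum.\<close>
  define E where "E = real DIM('a) * (pi / 2)\<^sup>2 * (a1 + a2) / 2"
  have E: "E \<ge> 0" using s by (simp add: E_def)
  define R0 where "R0 = 1 + E / \<tau>"
  have R0: "R0 \<ge> 1" using E \<tau> by (simp add: R0_def)
  have ER: "E / R\<^sup>2 \<le> \<tau>" if "R \<ge> R0" for R
  proof -
    have "R * 1 \<le> R * R" using that R0 by (intro mult_left_mono) auto
    then have "E / \<tau> \<le> R\<^sup>2" using that by (simp add: R0_def power2_eq_square)
    then show ?thesis using \<tau> that R0 by (simp add: field_simps)
  qed
  \<comment> \<open>The number of dyadic annuli: the one with the least potential carries at most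
    \<open>Fm / L\<close>, hence at most \<open>\<tau>\<close>.\<close>
  obtain L :: nat where L: "Fm / \<tau> < real L" using reals_Archimedean2 by blast
  then have L0: "real L > 0" using Fm \<tau> by (smt (verit) divide_nonneg_pos)
  have FL: "Fm / real L \<le> \<tau>" using L L0 \<tau> by (simp add: field_simps)
  have pos: "0 < 2 ^ L * R0" using R0 by simp
  show ?thesis
  proof (rule exI[of _ "2 ^ L * R0"], rule conjI[OF pos], rule exI[of _ \<tau>], rule conjI[OF \<tau>(1)], intro allI impI)
    fix u v :: "'a \<Rightarrow> complex" and y
    assume u: "u \<in> H1" and v: "v \<in> H1" and mu: "mass u = a1" and mv: "mass v = a2" and k: "kinetic u + kinetic v \<le> K"
      and big: "\<delta> \<le> mass_on (ball y 1) (combine u v)" and J: "J u v \<le> m + \<tau>"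
    note sbu = H1_shift_bounded[OF u]
    note sbv = H1_shift_bounded[OF v]
    have uL: "u \<in> L2" "v \<in> L2" using u v by (auto intro: H1_L2)
    have cL: "combine u v \<in> L2" by (rule combine_L2[OF uL])
    have mm: "mass (combine u v) = a1 + a2" using mass_combine[OF uL] mu mv by simp
    have int: "integrable lborel (\<lambda>x. Phi (cmod (u x)) (cmod (v x)))" by (rule Phi_integrable(1)[OF sbu sbv])
    have pF: "potential u v \<le> Fm"
    proof -
      have "Hint (combine u v) \<le> 1 * K + Cp"
        using Cp(2) shift_bounded_mono[OF shift_bounded_combine[OF sbu sbv] k] mm by simp
      then have "cH * Hint (combine u v) \<le> Fm" unfolding Fm_def using cH_pos by (intro mult_left_mono) auto
      then show ?thesis using Phi_integrable(2)[OF sbu sbv] by simp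
    qed
    define rad where "rad l = 2 ^ l * R0" for l :: nat
    have rad: "rad l \<ge> R0" "rad l \<ge> 1" "rad l > 0" "rad (Suc l) = 2 * rad l" for l
    proof -
      have "1 * R0 \<le> 2 ^ l * R0" using R0 by (intro mult_right_mono) auto
      then have "rad l \<ge> R0" by (simp add: rad_def)
      moreover have "rad (Suc l) = 2 * rad l" by (simp add: rad_def)
      ultimately show "rad l \<ge> R0" "rad l \<ge> 1" "rad l > 0" "rad (Suc l) = 2 * rad l" using R0 by linarith+
    qed
    define A where "A l = ball y (2 * rad l) - ball y (rad l)" for l
    have A_meas [measurable]: "A l \<in> sets borel" for l by (simp add: A_def)
    have intA: "integrable lborel (\<lambda>x. indicator (A l) x * Phi (cmod (u x)) (cmod (v x)))" for l
      using integrable_mult_indicator[OF _ int, of "A l"] by simp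
    have "\<exists>l<L. (LINT x|lborel. indicator (A l) x * Phi (cmod (u x)) (cmod (v x))) \<le> Fm / real L"
    proof (rule ccontr)
      assume "\<not> ?thesis"
      then have "(\<Sum>l<L. Fm / real L) < (\<Sum>l<L. LINT x|lborel. indicator (A l) x * Phi (cmod (u x)) (cmod (v x)))"
        using L0 by (intro sum_strict_mono) (auto simp: not_le)
      also have "\<dots> = (LINT x|lborel. (\<Sum>l<L. indicator (A l) x * Phi (cmod (u x)) (cmod (v x))))"
        using intA by (intro Bochner_Integration.integral_sum[symmetric]) auto
      also have "\<dots> \<le> potential u v"
        unfolding potential_def
      proof (rule integral_mono)
        fix x
        \<comment> \<open>Consecutive annuli are disjoint; their indicators telescope and sum to at
          most 1.\<close>
        have "(\<Sum>l<L. indicator (A l) x :: real) = (\<Sum>l<L. indicator (ball y (rad (Suc l))) x - indicator (ball y (rad l)) x)"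
        proof (intro sum.cong refl)
          fix l
          have "ball y (rad l) \<subseteq> ball y (rad (Suc l))" using rad[of l] by (intro subset_ball) simp
          then show "(indicator (A l) x :: real) = indicator (ball y (rad (Suc l))) x - indicator (ball y (rad l)) x"
            by (auto simp: A_def rad(4) split: split_indicator)
        qed
        also have "\<dots> = indicator (ball y (rad L)) x - indicator (ball y (rad 0)) x"
          by (rule sum_lessThan_telescope)
        also have "\<dots> \<le> 1" by (auto split: split_indicator)
        finally have "(\<Sum>l<L. indicator (A l) x) * Phi (cmod (u x)) (cmod (v x)) \<le> 1 * Phi (cmod (u x)) (cmod (v x))"
          by (intro mult_right_mono Phi_nonneg)
        then show "(\<Sum>l<L. indicator (A l) x * Phi (cmod (u x)) (cmod (v x))) \<le> Phi (cmod (u x)) (cmod (v x))"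
          by (simp only: sum_distrib_right mult_1)
        show "integrable lborel (\<lambda>x. \<Sum>l<L. indicator (A l) x * Phi (cmod (u x)) (cmod (v x)))"
          by (intro Bochner_Integration.integrable_sum intA)
      qed (rule int)
      also have "\<dots> \<le> Fm" by (rule pF)
      finally show False using L0 by simp
    qed
    then obtain l where l: "l < L" "(LINT x|lborel. indicator (A l) x * Phi (cmod (u x)) (cmod (v x))) \<le> Fm / real L" by blast
    define R where "R = rad l"
    have R: "R \<ge> R0" "R \<ge> 1" "R > 0" using rad[of l] by (auto simp: R_def)
    \<comment> \<open>The whole transition region lies inside the final radius, so outside it the
      outer piece coincides with the original pair.\<close>
    have far: "2 * R \<le> 2 ^ L * R0"
    proof -
      have "2 ^ Suc l * R0 \<le> 2 ^ L * R0" using l(1) R0 by (intro mult_right_mono power_increasing) auto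
      then show ?thesis by (simp add: R_def rad_def)
    qed
    let ?f1 = "cut_in y R u" and ?f2 = "cut_in y R v" and ?g1 = "cut_out y R u" and ?g2 = "cut_out y R v"
    define q where "q = (pi / (2 * R))\<^sup>2"
    have q: "q = (pi / 2)\<^sup>2 / R\<^sup>2" "q \<ge> 0" by (simp_all add: q_def power_divide power_mult_distrib)
    have q1: "q \<le> (pi / 2)\<^sup>2"
    proof -
      have "1\<^sup>2 \<le> R\<^sup>2" using R by (intro power_mono) auto
      then show ?thesis unfolding q(1) by (simp add: divide_le_eq mult_left_le)
    qed
    have sb: "shift_bounded Kc ?f1" "shift_bounded Kc ?f2" "shift_bounded Kc ?g1" "shift_bounded Kc ?g2"
    proof -
      have "kinetic u + q * mass u \<le> Kc" "kinetic v + q * mass v \<le> Kc"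
      proof -
        have "q * a1 \<le> (pi / 2)\<^sup>2 * (a1 + a2)" "q * a2 \<le> (pi / 2)\<^sup>2 * (a1 + a2)"
          using q1 a by (auto intro!: mult_mono)
        then show "kinetic u + q * mass u \<le> Kc" "kinetic v + q * mass v \<le> Kc"
          unfolding Kc_def mu mv using k kinetic_nonneg[of u] kinetic_nonneg[of v] by linarith+
      qed
      then show "shift_bounded Kc ?f1" "shift_bounded Kc ?f2" "shift_bounded Kc ?g1" "shift_bounded Kc ?g2"
        using shift_bounded_cut[OF sbu R(3), of y] shift_bounded_cut[OF sbv R(3), of y] shift_bounded_mono unfolding q_def by blast+
    qed
    have gsum: "mass ?f1 + mass ?g1 = a1" "mass ?f2 + mass ?g2 = a2" using mass_cut_sum[OF uL(1)] mass_cut_sum[OF uL(2)] mu mv by auto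
    have coord: "mass (\<lambda>x. cut_in y R w (x + t *\<^sub>R i) - cut_in y R w x) + mass (\<lambda>x. cut_out y R w (x + t *\<^sub>R i) - cut_out y R w x) \<le>
      (mass (weak_partial i w) + q * mass w) * t\<^sup>2" if "w \<in> H1" "i \<in> Basis" for w i t
      using order_trans[OF mass_shift_cut[OF H1_L2[OF that(1)] R(3)] add_right_mono[OF shift_bound_Basis[OF that]]] that(2)
      by (simp add: distrib_right q_def)
    have gm: "mass (combine ?f1 ?f2) \<le> a1 + a2" "mass (combine ?g1 ?g2) \<le> a1 + a2"
      using gsum mass_combine[OF cut_L2(1)[OF uL(1), of y R] cut_L2(1)[OF uL(2), of y R]] mass_combine[OF cut_L2(2)[OF uL(1), of y R] cut_L2(2)[OF uL(2), of y R]]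
        mass_nonneg[of ?f1] mass_nonneg[of ?f2] mass_nonneg[of ?g1] mass_nonneg[of ?g2] by linarith+
    \<comment> \<open>Off the annulus one piece is the original pair, and the other can only add a
      nonnegative term. On the annulus the potential is written off entirely.\<close>
    have split: "potential u v \<le> potential ?f1 ?f2 + potential ?g1 ?g2 + \<tau>"
    proof -
      note i = Phi_integrable(1)[OF sb(1,2)] Phi_integrable(1)[OF sb(3,4)]
      have "potential u v \<le> (LINT x|lborel. Phi (cmod (?f1 x)) (cmod (?f2 x)) + Phi (cmod (?g1 x)) (cmod (?g2 x)) + indicator (A l) x * Phi (cmod (u x)) (cmod (v x)))"
        unfolding potential_def
      proof (rule integral_mono[OF int])
        fix x
        consider "dist y x < R" | "2 * R \<le> dist y x" | "x \<in> A l" unfolding A_def R_def by (cases "dist y x < rad l"; cases "2 * rad l \<le> dist y x") simp_all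
        then show "Phi (cmod (u x)) (cmod (v x)) \<le> Phi (cmod (?f1 x)) (cmod (?f2 x)) + Phi (cmod (?g1 x)) (cmod (?g2 x)) + indicator (A l) x * Phi (cmod (u x)) (cmod (v x))"
        proof cases
          case 1
          then show ?thesis using cut_near[OF R(3), of y x] by (simp add: Phi_nonneg)
        next
          case 2
          then show ?thesis using cut_far[OF R(3), of y x] by (simp add: Phi_nonneg)
        next
          case 3
          then show ?thesis by (simp add: Phi_nonneg)
        qed
      qed (use i intA in simp)
      also have "\<dots> = potential ?f1 ?f2 + potential ?g1 ?g2 + (LINT x|lborel. indicator (A l) x * Phi (cmod (u x)) (cmod (v x)))"
        unfolding potential_def using i intA by simp
      finally show ?thesis using l(2) FL by linarith
    qed
    have sumq: "(\<Sum>i\<in>(Basis::'a set). mass (weak_partial i u) + q * mass u) + (\<Sum>i\<in>(Basis::'a set). mass (weak_partial i v) + q * mass v) \<le> kinetic u + kinetic v + 2 * \<tau>"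
    proof -
      have "(\<Sum>i\<in>(Basis::'a set). mass (weak_partial i u) + q * mass u) + (\<Sum>i\<in>(Basis::'a set). mass (weak_partial i v) + q * mass v)
        = kinetic u + kinetic v + real DIM('a) * q * (a1 + a2)"
        by (simp add: sum.distrib kinetic_def mu mv algebra_simps)
      also have "real DIM('a) * q * (a1 + a2) = 2 * (E / R\<^sup>2)" by (simp add: E_def q(1))
      finally show ?thesis using ER[OF R(1)] by linarith
    qed
    show "mass_on (- ball y (2 ^ L * R0)) (combine u v) < \<epsilon>"
    proof (rule ccontr)
      assume "\<not> ?thesis"
      then have out: "\<epsilon> \<le> mass_on (- ball y (2 ^ L * R0)) (combine u v)" by simp
      have fbig: "min \<delta> \<sigma> \<le> mass_on (ball y 1) (combine ?f1 ?f2)"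
      proof -
        have "mass_on (ball y 1) (combine ?f1 ?f2) = mass_on (ball y 1) (combine u v)"
          using cut_near(1)[OF R(3), of y] R(2) by (intro mass_on_cong) (auto simp: combine_def)
        then show ?thesis using big by simp
      qed
      have gout: "\<epsilon> \<le> mass ?g1 + mass ?g2"
      proof -
        have "\<epsilon> \<le> mass_on (- ball y (2 ^ L * R0)) (combine ?g1 ?g2)"
          using out far cut_far(2)[OF R(3), of y] by (subst mass_on_cong[where v = "combine u v"]) (auto simp: combine_def)
        also have "\<dots> \<le> mass (combine ?g1 ?g2)"
          by (rule mass_on_le_mass[OF combine_L2[OF cut_L2(2)[OF uL(1)] cut_L2(2)[OF uL(2)]]]) auto
        finally show ?thesis using mass_combine[OF cut_L2(2)[OF uL(1), of y R] cut_L2(2)[OF uL(2), of y R]] by simp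
      qed
      show False
      proof (cases "\<exists>z. \<sigma> \<le> mass_on (ball z 1) (combine ?g1 ?g2)")
        case True
        then obtain z where z: "min \<delta> \<sigma> \<le> mass_on (ball z 1) (combine ?g1 ?g2)" by (auto intro: order_trans[OF min.cobounded2])
        obtain h where h: "potential ?f1 ?f2 + potential ?g1 ?g2 + \<kappa> \<le> potential (combine ?f1 (\<lambda>x. ?g1 (x + h))) (combine ?f2 (\<lambda>x. ?g2 (x + h)))"
          using gain[OF sb gm fbig z] by blast
        \<comment> \<open>Translating the outer piece leaves the masses of its increments unchanged,
          so the joint bound \<open>coord\<close> still applies.\<close>
        have sh: "mass (\<lambda>x. cut_out y R w (x + t + h) - cut_out y R w (x + h)) = mass (\<lambda>x. cut_out y R w (x + t) - cut_out y R w x)"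
          if "w \<in> L2" for w t
          using mass_shift[OF L2_diff[OF L2_shift[OF cut_L2(2)[OF that], of y R t] cut_L2(2)[OF that]], of h] by (simp add: add_ac)
        have "m \<le> ((\<Sum>i\<in>(Basis::'a set). mass (weak_partial i u) + q * mass u) + (\<Sum>i\<in>(Basis::'a set). mass (weak_partial i v) + q * mass v)) / 2
          - potential (combine ?f1 (\<lambda>x. ?g1 (x + h))) (combine ?f2 (\<lambda>x. ?g2 (x + h)))"
        proof (rule compare_combine[OF sb(1,2) shift_bounded_shift[OF sb(3)] shift_bounded_shift[OF sb(4)]])
          show "mass ?f1 + mass (\<lambda>x. ?g1 (x + h)) = a1" "mass ?f2 + mass (\<lambda>x. ?g2 (x + h)) = a2"
            using gsum mass_shift[OF cut_L2(2)[OF uL(1)]] mass_shift[OF cut_L2(2)[OF uL(2)]] by simp_all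
          fix i :: 'a and t assume i: "i \<in> Basis"
          show "mass (\<lambda>x. ?f1 (x + t *\<^sub>R i) - ?f1 x) + mass (\<lambda>x. ?g1 (x + t *\<^sub>R i + h) - ?g1 (x + h)) \<le> (mass (weak_partial i u) + q * mass u) * t\<^sup>2"
            unfolding sh[OF uL(1)] by (rule coord[OF u i])
          show "mass (\<lambda>x. ?f2 (x + t *\<^sub>R i) - ?f2 x) + mass (\<lambda>x. ?g2 (x + t *\<^sub>R i + h) - ?g2 (x + h)) \<le> (mass (weak_partial i v) + q * mass v) * t\<^sup>2"
            unfolding sh[OF uL(2)] by (rule coord[OF v i])
        qed
        then show False using h split sumq J \<tau> \<kappa> unfolding J_def by argo
      next
        case False
        then have "\<forall>z. mass_on (ball z 1) (combine ?g1 ?g2) \<le> \<sigma>" by (meson less_imp_le not_le)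
        moreover have "shift_bounded (2 * Kc) (combine ?g1 ?g2)" unfolding mult_2 by (rule shift_bounded_combine[OF sb(3,4)])
        ultimately have "Hint (combine ?g1 ?g2) \<le> c / (4 * cH)" using vanish gm(2) by blast
        then have "cH * Hint (combine ?g1 ?g2) \<le> cH * (c / (4 * cH))" using cH_pos by (intro mult_left_mono) auto
        then have pg: "potential ?g1 ?g2 \<le> c / 4" using Phi_integrable(2)[OF sb(3,4)] cH_pos by simp
        have "mass ?g1 \<le> a1 + a2" "mass ?g2 \<le> a1 + a2"
          using gsum a mass_nonneg[of ?f1] mass_nonneg[of ?f2] by linarith+
        from filler[OF mass_nonneg this(1) mass_nonneg this(2) gout]
        obtain F G where FG: "F \<in> H1" "G \<in> H1" "mass F = mass ?g1" "mass G = mass ?g2" "J F G \<le> - c" by blast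
        note sbF = H1_shift_bounded[OF FG(1)] H1_shift_bounded[OF FG(2)]
        have "m \<le> ((\<Sum>i\<in>(Basis::'a set). (mass (weak_partial i u) + q * mass u) + mass (weak_partial i F)) + (\<Sum>i\<in>(Basis::'a set). (mass (weak_partial i v) + q * mass v) + mass (weak_partial i G))) / 2
          - potential (combine ?f1 F) (combine ?f2 G)"
        proof (rule compare_combine[OF sb(1,2) sbF])
          show "mass ?f1 + mass F = a1" "mass ?f2 + mass G = a2" using gsum FG by simp_all
          fix i :: 'a and t assume i: "i \<in> Basis"
          \<comment> \<open>The outer piece has been replaced by the filler, so the joint bound is
            used for the inner piece alone.\<close>
          have c1: "mass (\<lambda>x. cut_in y R w (x + t *\<^sub>R i) - cut_in y R w x) \<le> (mass (weak_partial i w) + q * mass w) * t\<^sup>2" if "w \<in> H1" for w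
            using coord[OF that i, of t] mass_nonneg[of "\<lambda>x. cut_out y R w (x + t *\<^sub>R i) - cut_out y R w x"] by linarith
          show "mass (\<lambda>x. ?f1 (x + t *\<^sub>R i) - ?f1 x) + mass (\<lambda>x. F (x + t *\<^sub>R i) - F x) \<le> ((mass (weak_partial i u) + q * mass u) + mass (weak_partial i F)) * t\<^sup>2"
            using add_mono[OF c1[OF u] shift_bound_Basis[OF FG(1) i, of t]] by (simp only: distrib_right)
          show "mass (\<lambda>x. ?f2 (x + t *\<^sub>R i) - ?f2 x) + mass (\<lambda>x. G (x + t *\<^sub>R i) - G x) \<le> ((mass (weak_partial i v) + q * mass v) + mass (weak_partial i G)) * t\<^sup>2"
            using add_mono[OF c1[OF v] shift_bound_Basis[OF FG(2) i, of t]] by (simp only: distrib_right)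
        qed
        moreover have "(\<Sum>i\<in>(Basis::'a set). (mass (weak_partial i u) + q * mass u) + mass (weak_partial i F)) = (\<Sum>i\<in>(Basis::'a set). mass (weak_partial i u) + q * mass u) + kinetic F"
          "(\<Sum>i\<in>(Basis::'a set). (mass (weak_partial i v) + q * mass v) + mass (weak_partial i G)) = (\<Sum>i\<in>(Basis::'a set). mass (weak_partial i v) + q * mass v) + kinetic G"
          unfolding kinetic_def by (rule sum.distrib)+
        moreover have "potential ?f1 ?f2 + potential F G \<le> potential (combine ?f1 F) (combine ?f2 G)"
          by (rule potential_superadditive[OF sb(1,2) sbF])
        ultimately show False using pg FG(5) split sumq J \<tau> c unfolding J_def by argo
      qed
    qed
  qed
qed

end

section \<open>Convergence in the Sobolev norm\<close>

context nls_min
begin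

text \<open>
  The midpoint of two almost minimisers has no more mass than prescribed, hence energy at least
  \<open>m\<close>; by the parallelogram law the kinetic energy of the difference is then small as
  soon as the potential energies are close.
\<close>

lemma almost_minimisers_close:
  assumes K: "K \<ge> 0" and e: "e > 0"
  shows "\<exists>\<sigma>>0. \<exists>\<tau>>0. \<forall>u1 u2 v1 v2. u1 \<in> H1 \<longrightarrow> u2 \<in> H1 \<longrightarrow> v1 \<in> H1 \<longrightarrow> v2 \<in> H1 \<longrightarrow>
    mass u1 = a1 \<longrightarrow> mass u2 = a2 \<longrightarrow> mass v1 = a1 \<longrightarrow> mass v2 = a2 \<longrightarrow>
    kinetic u1 + kinetic u2 \<le> K \<longrightarrow> kinetic v1 + kinetic v2 \<le> K \<longrightarrow> J u1 u2 \<le> m + \<tau> \<longrightarrow> J v1 v2 \<le> m + \<tau> \<longrightarrow>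
    mass (\<lambda>x. u1 x - v1 x) + mass (\<lambda>x. u2 x - v2 x) \<le> \<sigma> \<longrightarrow>
    kinetic (\<lambda>x. u1 x - v1 x) + kinetic (\<lambda>x. u2 x - v2 x) \<le> e"
proof -
  have s: "a1 + a2 > 0" using a by simp
  obtain Cp where Cp: "Cp \<ge> 0" "\<forall>(u::'a \<Rightarrow> complex) K. shift_bounded K u \<longrightarrow> mass u \<le> a1 + a2 \<longrightarrow>
     integrable lborel (\<lambda>x. H (cmod (u x))) \<and> Hint u \<le> 1 * K + Cp" using Hint_coercive[OF zero_less_one s] by blast
  define B where "B = K + Cp"
  have B: "B \<ge> 0" using K Cp by (simp add: B_def)
  \<comment> \<open>\<open>e1\<close> is matched to the bound \<open>B\<close> for the midpoint and
    \<open>\<eta>\<close> below to the constant \<open>C\<close>, so that each error term of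
    \<open>pert\<close> is at most \<open>e / 32\<close>.\<close>
  define e1 where "e1 = e / (32 * (B + 1))"
  have e1: "e1 > 0" using e B by (simp add: e1_def)
  have e1B: "e1 * B \<le> e / 32"
  proof -
    have "e1 * B = e / 32 * (B / (B + 1))" by (simp add: e1_def)
    also have "\<dots> \<le> e / 32 * 1" using e B by (intro mult_left_mono) auto
    finally show ?thesis by simp
  qed
  obtain C where C: "C \<ge> 0" and pert: "\<And>b1 b2 d1 d2. 0 \<le> b1 \<Longrightarrow> 0 \<le> b2 \<Longrightarrow> 0 \<le> d1 \<Longrightarrow> 0 \<le> d2 \<Longrightarrow>
    Phi (b1 + d1) (b2 + d2) \<le> Phi b1 b2 + e1 * H (norm (b1, b2)) + C * H (norm (d1, d2))"
    using Phi_perturbation[OF e1] by blast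
  define \<eta> where "\<eta> = e / (32 * (C + 1))"
  have \<eta>: "\<eta> > 0" using e C by (simp add: \<eta>_def)
  have C\<eta>: "C * \<eta> \<le> e / 32"
  proof -
    have "C * \<eta> = e / 32 * (C / (C + 1))" by (simp add: \<eta>_def)
    also have "\<dots> \<le> e / 32 * 1" using e C by (intro mult_left_mono) auto
    finally show ?thesis by simp
  qed
  obtain \<sigma> where \<sigma>: "\<sigma> > 0" and vanish: "\<And>u::'a \<Rightarrow> complex. shift_bounded K u \<Longrightarrow> mass u \<le> a1 + a2 \<Longrightarrow>
     (\<forall>y. mass_on (ball y 1) u \<le> \<sigma>) \<Longrightarrow> Hint u \<le> \<eta>" using Hint_vanishing[OF \<eta> s K] by blast
  \<comment> \<open>The kinetic energy of the half-differences comes out at most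
    \<open>2 * \<tau> + e / 8\<close>, which is \<open>3 * e / 16\<close>; passing to the
    differences multiplies this by 4.\<close>
  define \<tau> where "\<tau> = e / 32"
  have \<tau>: "\<tau> > 0" using e by (simp add: \<tau>_def)
  show ?thesis
  proof (rule exI[of _ \<sigma>], rule conjI[OF \<sigma>], rule exI[of _ \<tau>], rule conjI[OF \<tau>], intro allI impI)
    fix u1 u2 v1 v2 :: "'a \<Rightarrow> complex"
    assume u: "u1 \<in> H1" "u2 \<in> H1" and v: "v1 \<in> H1" "v2 \<in> H1" and mu: "mass u1 = a1" "mass u2 = a2" and mv: "mass v1 = a1" "mass v2 = a2"
      and ku: "kinetic u1 + kinetic u2 \<le> K" and kv: "kinetic v1 + kinetic v2 \<le> K" and J: "J u1 u2 \<le> m + \<tau>" "J v1 v2 \<le> m + \<tau>"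
      and d: "mass (\<lambda>x. u1 x - v1 x) + mass (\<lambda>x. u2 x - v2 x) \<le> \<sigma>"
    define V1 where "V1 x = (u1 x + v1 x) / 2" for x
    define V2 where "V2 x = (u2 x + v2 x) / 2" for x
    define D1 where "D1 x = (u1 x - v1 x) / 2" for x
    define D2 where "D2 x = (u2 x - v2 x) / 2" for x
    have V: "V1 \<in> H1" "V2 \<in> H1"
      unfolding V1_def V2_def using H1_cmult[OF H1_add[OF u(1) v(1)], of "1/2"] H1_cmult[OF H1_add[OF u(2) v(2)], of "1/2"] by simp_all
    have D: "D1 \<in> H1" "D2 \<in> H1"
      unfolding D1_def D2_def using H1_cmult[OF H1_diff[OF u(1) v(1)], of "1/2"] H1_cmult[OF H1_diff[OF u(2) v(2)], of "1/2"] by simp_all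
    have k1: "kinetic V1 + kinetic D1 = (kinetic u1 + kinetic v1) / 2" "kinetic V2 + kinetic D2 = (kinetic u2 + kinetic v2) / 2"
      unfolding V1_def V2_def D1_def D2_def by (rule kinetic_parallelogram[OF u(1) v(1)] kinetic_parallelogram[OF u(2) v(2)])+
    have m1: "mass V1 + mass D1 = a1" "mass V2 + mass D2 = a2"
      unfolding V1_def V2_def D1_def D2_def
      using mass_parallelogram[OF H1_L2[OF u(1)] H1_L2[OF v(1)]] mass_parallelogram[OF H1_L2[OF u(2)] H1_L2[OF v(2)]] mu mv by simp_all
    have nn: "0 \<le> mass V1" "0 \<le> mass V2" "0 \<le> mass D1" "0 \<le> mass D2" "0 \<le> kinetic V1" "0 \<le> kinetic V2" "0 \<le> kinetic D1" "0 \<le> kinetic D2" by simp_all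
    have "mass V1 \<le> a1" "mass V2 \<le> a2" using m1 nn by linarith+
    then have mJ: "m \<le> J V1 V2" by (rule lower_smaller_mass[OF V])
    note sV = H1_shift_bounded[OF V(1)] H1_shift_bounded[OF V(2)] and sD = H1_shift_bounded[OF D(1)] H1_shift_bounded[OF D(2)]
    have "kinetic V1 + kinetic V2 \<le> K" "kinetic D1 + kinetic D2 \<le> K" using k1 ku kv nn by argo+
    then have sb: "shift_bounded K (combine V1 V2)" "shift_bounded K (combine D1 D2)"
      using shift_bounded_mono[OF shift_bounded_combine[OF sV]] shift_bounded_mono[OF shift_bounded_combine[OF sD]] by blast+
    have mV: "mass (combine V1 V2) \<le> a1 + a2" "mass (combine D1 D2) \<le> a1 + a2"
      using mass_combine[OF H1_L2[OF V(1)] H1_L2[OF V(2)]] mass_combine[OF H1_L2[OF D(1)] H1_L2[OF D(2)]] m1 nn by linarith+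
    have HV: "Hint (combine V1 V2) \<le> B" using Cp(2) sb(1) mV(1) by (auto simp: B_def)
    have D4: "mass (\<lambda>x. u1 x - v1 x) = 4 * mass D1" "mass (\<lambda>x. u2 x - v2 x) = 4 * mass D2"
      "kinetic (\<lambda>x. u1 x - v1 x) = 4 * kinetic D1" "kinetic (\<lambda>x. u2 x - v2 x) = 4 * kinetic D2"
    proof -
      have "(\<lambda>x. u1 x - v1 x) = (\<lambda>x. 2 * D1 x)" "(\<lambda>x. u2 x - v2 x) = (\<lambda>x. 2 * D2 x)" by (simp_all add: D1_def D2_def fun_eq_iff)
      then show "mass (\<lambda>x. u1 x - v1 x) = 4 * mass D1" "mass (\<lambda>x. u2 x - v2 x) = 4 * mass D2"
        "kinetic (\<lambda>x. u1 x - v1 x) = 4 * kinetic D1" "kinetic (\<lambda>x. u2 x - v2 x) = 4 * kinetic D2"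
        using mass_cmult[of 2 D1] mass_cmult[of 2 D2] kinetic_cmult[OF D(1), of 2] kinetic_cmult[OF D(2), of 2] by simp_all
    qed
    \<comment> \<open>Small total mass bounds the mass in every unit ball, so the vanishing lemma
      applies to the half-differences.\<close>
    have HD: "Hint (combine D1 D2) \<le> \<eta>"
    proof (rule vanish[OF sb(2) mV(2)], rule allI)
      fix y
      have "mass_on (ball y 1) (combine D1 D2) \<le> mass (combine D1 D2)"
        by (rule mass_on_le_mass[OF shift_boundedD(1)[OF sb(2)]]) simp
      also have "\<dots> = mass D1 + mass D2" by (rule mass_combine[OF H1_L2[OF D(1)] H1_L2[OF D(2)]])
      also have "\<dots> \<le> \<sigma>" using d D4 nn by linarith
      finally show "mass_on (ball y 1) (combine D1 D2) \<le> \<sigma>" .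
    qed
    \<comment> \<open>Each of the two original pairs is the midpoint plus or minus the
      half-difference, so both are covered by the same domination by moduli.\<close>
    have P: "potential w1 w2 \<le> potential V1 V2 + e / 16"
      if w: "w1 \<in> H1" "w2 \<in> H1" and le: "\<And>x. cmod (w1 x) \<le> cmod (V1 x) + cmod (D1 x)" "\<And>x. cmod (w2 x) \<le> cmod (V2 x) + cmod (D2 x)" for w1 w2
    proof -
      note i = Phi_integrable(1)[OF sV] H_integrable[OF sb(1)] H_integrable[OF sb(2)]
      have "potential w1 w2 \<le> (LINT x|lborel. Phi (cmod (V1 x)) (cmod (V2 x)) + e1 * H (cmod (combine V1 V2 x)) + C * H (cmod (combine D1 D2 x)))"
        unfolding potential_def
      proof (rule integral_mono)
        show "integrable lborel (\<lambda>x. Phi (cmod (w1 x)) (cmod (w2 x)))"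
          by (rule Phi_integrable(1)[OF H1_shift_bounded[OF w(1)] H1_shift_bounded[OF w(2)]])
        show "integrable lborel (\<lambda>x. Phi (cmod (V1 x)) (cmod (V2 x)) + e1 * H (cmod (combine V1 V2 x)) + C * H (cmod (combine D1 D2 x)))"
          using i by simp
        fix x
        have "Phi (cmod (w1 x)) (cmod (w2 x)) \<le> Phi (cmod (V1 x) + cmod (D1 x)) (cmod (V2 x) + cmod (D2 x))"
          by (rule Phi_mono[OF norm_ge_zero le(1) norm_ge_zero le(2)])
        also have "\<dots> \<le> Phi (cmod (V1 x)) (cmod (V2 x)) + e1 * H (cmod (combine V1 V2 x)) + C * H (cmod (combine D1 D2 x))"
          unfolding cmod_combine by (rule pert) auto
        finally show "Phi (cmod (w1 x)) (cmod (w2 x)) \<le> Phi (cmod (V1 x)) (cmod (V2 x)) + e1 * H (cmod (combine V1 V2 x)) + C * H (cmod (combine D1 D2 x))" .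
      qed
      also have "\<dots> = potential V1 V2 + e1 * Hint (combine V1 V2) + C * Hint (combine D1 D2)"
        unfolding potential_def Hint_def using i by simp
      finally have 1: "potential w1 w2 \<le> potential V1 V2 + e1 * Hint (combine V1 V2) + C * Hint (combine D1 D2)" .
      have "e1 * Hint (combine V1 V2) \<le> e1 * B" "C * Hint (combine D1 D2) \<le> C * \<eta>"
        using e1 C HV HD by (auto intro: mult_left_mono)
      then show ?thesis using 1 e1B C\<eta> by linarith
    qed
    have tri: "cmod p \<le> cmod ((p + q) / 2) + cmod ((p - q) / 2)" "cmod q \<le> cmod ((p + q) / 2) + cmod ((p - q) / 2)" for p q :: complex
      using norm_triangle_ineq[of "(p + q) / 2" "(p - q) / 2"] norm_triangle_ineq4[of "(p + q) / 2" "(p - q) / 2"]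
      by (simp_all add: diff_divide_distrib add_divide_distrib)
    have "potential u1 u2 \<le> potential V1 V2 + e / 16"
      by (rule P[OF u]) (unfold V1_def V2_def D1_def D2_def, rule tri(1), rule tri(1))
    moreover have "potential v1 v2 \<le> potential V1 V2 + e / 16"
      by (rule P[OF v]) (unfold V1_def V2_def D1_def D2_def, rule tri(2), rule tri(2))
    ultimately have "kinetic D1 + kinetic D2 \<le> 2 * \<tau> + e / 8"
      using J mJ k1 unfolding J_def by argo
    then show "kinetic (\<lambda>x. u1 x - v1 x) + kinetic (\<lambda>x. u2 x - v2 x) \<le> e"
      unfolding D4 \<tau>_def using e by argo
  qed
qed

lemma J_shift:
  assumes "u \<in> H1" "v \<in> H1" shows "J (\<lambda>x. u (x + c)) (\<lambda>x. v (x + c)) = J u v"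
  unfolding J_def kinetic_shift[OF assms(1)] kinetic_shift[OF assms(2)]
  using potential_shift[of u v c] assms by (simp add: H1_L2 L2_measurable)

text \<open>The translations are chosen once for the whole sequence, at the balls found by
  \<open>nonvanishing\<close>. The claim is made for every subsequence, as relative compactness of
  the range requires.\<close>

lemma precompact_up_to_translation:
  fixes u v :: "nat \<Rightarrow> 'a \<Rightarrow> complex"
  assumes H1: "\<And>n. u n \<in> H1" "\<And>n. v n \<in> H1" and mass: "\<And>n. mass (u n) = a1" "\<And>n. mass (v n) = a2"
    and lim: "(\<lambda>n. J (u n) (v n)) \<longlonglongrightarrow> m"
  shows "\<exists>c. \<forall>r::nat \<Rightarrow> nat. strict_mono r \<longrightarrow> (\<exists>s::nat \<Rightarrow> nat. strict_mono s \<and>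
    (\<forall>e>0. \<exists>N. \<forall>i\<ge>N. \<forall>j\<ge>N.
      H1_norm (\<lambda>x. u (r (s i)) (x + c (r (s i))) - u (r (s j)) (x + c (r (s j)))) < e \<and>
      H1_norm (\<lambda>x. v (r (s i)) (x + c (r (s i))) - v (r (s j)) (x + c (r (s j)))) < e))"
proof -
  obtain C0 where C0: "C0 \<ge> 0" "\<And>u v. u \<in> H1 \<Longrightarrow> v \<in> H1 \<Longrightarrow> mass u = a1 \<Longrightarrow> mass v = a2 \<Longrightarrow> kinetic u + kinetic v \<le> 4 * J u v + C0"
    using kinetic_coercive[of a1 a2] a by (auto simp: add_pos_pos)
  obtain b where b: "\<And>n. \<bar>J (u n) (v n)\<bar> \<le> b"
    using Bseq_eq_bounded[of "\<lambda>n. J (u n) (v n)"] convergent_imp_Bseq[OF convergentI[OF lim]] by (auto simp: Bseq_def)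
  define K where "K = 4 * b + C0"
  have k: "kinetic (u n) + kinetic (v n) \<le> K" for n
    using C0(2)[OF H1(1)[of n] H1(2)[of n] mass(1)[of n] mass(2)[of n]] b[of n] unfolding K_def by linarith
  have K: "K \<ge> 0" using k[of 0] kinetic_nonneg[of "u 0"] kinetic_nonneg[of "v 0"] by linarith
  have ev: "\<exists>N. \<forall>n\<ge>N. J (u n) (v n) \<le> t" if "m < t" for t
    using order_tendstoD(2)[OF lim that] by (auto simp: eventually_sequentially intro: less_imp_le)
  obtain \<delta> where \<delta>: "\<delta> > 0" and nonvan: "\<And>u v. u \<in> H1 \<Longrightarrow> v \<in> H1 \<Longrightarrow> mass u = a1 \<Longrightarrow> mass v = a2 \<Longrightarrow> kinetic u + kinetic v \<le> K \<Longrightarrow> J u v \<le> m / 2 \<Longrightarrow>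
    (\<exists>y. \<delta> \<le> mass_on (ball y 1) (combine u v))" using nonvanishing[OF K] by blast
  have "m < m / 2" using m_negative by simp
  then obtain N0 where N0: "\<And>n. n \<ge> N0 \<Longrightarrow> J (u n) (v n) \<le> m / 2" using ev by blast
  \<comment> \<open>Below \<open>N0\<close> the energy may be too large for nonvanishing; the centre
    is arbitrary at those finitely many indices.\<close>
  have "\<exists>y. n \<ge> N0 \<longrightarrow> \<delta> \<le> mass_on (ball y 1) (combine (u n) (v n))" for n
    using nonvan[OF H1 mass k N0] by blast
  then obtain c where c: "\<And>n. n \<ge> N0 \<Longrightarrow> \<delta> \<le> mass_on (ball (c n) 1) (combine (u n) (v n))" by metis
  define U where "U n x = u n (x + c n)" for n x
  define V where "V n x = v n (x + c n)" for n x
  have UV: "U n \<in> H1" "V n \<in> H1" "mass (U n) = a1" "mass (V n) = a2" "kinetic (U n) + kinetic (V n) \<le> K" "J (U n) (V n) = J (u n) (v n)" for n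
    unfolding U_def V_def using H1_shift[OF H1(1)] H1_shift[OF H1(2)] mass_shift[OF H1_L2[OF H1(1)]] mass_shift[OF H1_L2[OF H1(2)]] mass
      kinetic_shift[OF H1(1)] kinetic_shift[OF H1(2)] k J_shift[OF H1] by simp_all
  have sb: "shift_bounded K (U n)" "shift_bounded K (V n)" for n
    using shift_bounded_mono[OF H1_shift_bounded[OF UV(1)], of n K] shift_bounded_mono[OF H1_shift_bounded[OF UV(2)], of n K]
      UV(5)[of n] kinetic_nonneg[of "U n"] kinetic_nonneg[of "V n"] by linarith+
  have tight: "\<exists>R N. \<forall>n\<ge>N. mass_on (- ball 0 R) (U n) \<le> e \<and> mass_on (- ball 0 R) (V n) \<le> e" if e: "e > 0" for e
  proof -
    obtain R \<tau> where R: "R > 0" "\<tau> > 0" "\<And>u v y. u \<in> H1 \<Longrightarrow> v \<in> H1 \<Longrightarrow> mass u = a1 \<Longrightarrow> mass v = a2 \<Longrightarrow> kinetic u + kinetic v \<le> K \<Longrightarrow>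
      \<delta> \<le> mass_on (ball y 1) (combine u v) \<Longrightarrow> J u v \<le> m + \<tau> \<Longrightarrow> mass_on (- ball y R) (combine u v) < e"
      using tightness_step[OF \<delta> e K] by blast
    obtain N1 where N1: "\<And>n. n \<ge> N1 \<Longrightarrow> J (u n) (v n) \<le> m + \<tau>" using ev[of "m + \<tau>"] R by auto
    have "mass_on (- ball 0 R) (U n) \<le> e \<and> mass_on (- ball 0 R) (V n) \<le> e" if n: "n \<ge> max N0 N1" for n
    proof -
      have "mass_on (- ball (c n) R) (combine (u n) (v n)) < e"
        by (rule R(3)[OF H1 mass k c N1]) (use n in auto)
      then have "mass_on (- ball (c n) R) (u n) + mass_on (- ball (c n) R) (v n) < e"
        by (subst (asm) mass_on_combine[OF H1_L2[OF H1(1)] H1_L2[OF H1(2)]]) auto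
      moreover have "(\<lambda>x. x - c n) -` (- ball 0 R) = - ball (c n) R" by (auto simp: dist_norm norm_minus_commute)
      moreover have "mass_on (- ball 0 R) (U n) = mass_on ((\<lambda>x. x - c n) -` (- ball 0 R)) (u n)"
        "mass_on (- ball 0 R) (V n) = mass_on ((\<lambda>x. x - c n) -` (- ball 0 R)) (v n)"
        unfolding U_def V_def by (rule mass_on_shift[OF H1_L2[OF H1(1)]] mass_on_shift[OF H1_L2[OF H1(2)]]; simp)+
      moreover have "0 \<le> mass_on (- ball (c n) R) (u n)" "0 \<le> mass_on (- ball (c n) R) (v n)" by simp_all
      ultimately show ?thesis by (simp del: mass_on_nonneg)
    qed
    then show ?thesis by blast
  qed
  have main: "\<exists>s::nat \<Rightarrow> nat. strict_mono s \<and> (\<forall>e>0. \<exists>N. \<forall>i\<ge>N. \<forall>j\<ge>N.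
      H1_norm (\<lambda>x. U (r (s i)) x - U (r (s j)) x) < e \<and> H1_norm (\<lambda>x. V (r (s i)) x - V (r (s j)) x) < e)"
    if r: "strict_mono r" for r :: "nat \<Rightarrow> nat"
  proof -
    have tU: "\<exists>R N. \<forall>n\<ge>N. mass_on (- ball 0 R) (U (r n)) \<le> e" if pos: "e > 0" for e
    proof -
      obtain R N where "\<forall>n\<ge>N. mass_on (- ball 0 R) (U n) \<le> e" using tight[OF pos] by blast
      then show ?thesis using seq_suble[OF r] order_trans by blast
    qed
    obtain s1 :: "nat \<Rightarrow> nat" where s1: "strict_mono s1" "\<forall>e>0. \<exists>N. \<forall>i\<ge>N. \<forall>j\<ge>N. L2_norm (\<lambda>x. U (r (s1 i)) x - U (r (s1 j)) x) < e"
      using L2_compact_subsequence[OF sb(1) eq_refl[OF UV(3)] tU] by blast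
    have rs: "strict_mono (\<lambda>n. r (s1 n))" using strict_mono_o[OF r s1(1)] by (simp add: o_def)
    have tV: "\<exists>R N. \<forall>n\<ge>N. mass_on (- ball 0 R) (V (r (s1 n))) \<le> e" if pos: "e > 0" for e
    proof -
      obtain R N where "\<forall>n\<ge>N. mass_on (- ball 0 R) (V n) \<le> e" using tight[OF pos] by blast
      then show ?thesis using seq_suble[OF rs] order_trans by blast
    qed
    obtain s2 :: "nat \<Rightarrow> nat" where s2: "strict_mono s2" "\<forall>e>0. \<exists>N. \<forall>i\<ge>N. \<forall>j\<ge>N. L2_norm (\<lambda>x. V (r (s1 (s2 i))) x - V (r (s1 (s2 j))) x) < e"
      using L2_compact_subsequence[OF sb(2) eq_refl[OF UV(4)] tV] by blast
    define s where "s n = s1 (s2 n)" for n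
    have s: "strict_mono s" using strict_mono_o[OF s1(1) s2(1)] by (simp add: o_def s_def[abs_def])
    have rs2: "strict_mono (\<lambda>n. r (s n))" using strict_mono_o[OF r s] by (simp add: o_def)
    have small: "\<exists>N. \<forall>i\<ge>N. \<forall>j\<ge>N. mass (\<lambda>x. U (r (s i)) x - U (r (s j)) x) < e \<and> mass (\<lambda>x. V (r (s i)) x - V (r (s j)) x) < e" if e: "e > 0" for e
    proof -
      have "sqrt e > 0" using e by simp
      then obtain M1 M2 where M: "\<forall>i\<ge>M1. \<forall>j\<ge>M1. L2_norm (\<lambda>x. U (r (s1 i)) x - U (r (s1 j)) x) < sqrt e"
        "\<forall>i\<ge>M2. \<forall>j\<ge>M2. L2_norm (\<lambda>x. V (r (s1 (s2 i))) x - V (r (s1 (s2 j))) x) < sqrt e"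
        using s1(2)[rule_format, of "sqrt e"] s2(2)[rule_format, of "sqrt e"] by blast
      show ?thesis
      proof (intro exI[of _ "max M1 M2"] allI impI conjI)
        fix i j assume ij: "max M1 M2 \<le> i" "max M1 M2 \<le> j"
        then have "M1 \<le> s2 i" "M1 \<le> s2 j" "M2 \<le> i" "M2 \<le> j" using seq_suble[OF s2(1), of i] seq_suble[OF s2(1), of j] by auto
        then show "mass (\<lambda>x. U (r (s i)) x - U (r (s j)) x) < e" "mass (\<lambda>x. V (r (s i)) x - V (r (s j)) x) < e"
          using M unfolding L2_norm_mass real_sqrt_less_iff s_def by blast+
      qed
    qed
    show ?thesis
    proof (intro exI[of _ s] conjI allI impI s)
      fix e :: real assume e: "e > 0"
      then have e2: "e\<^sup>2 / 4 > 0" by simp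
      obtain \<sigma> \<tau> where st: "\<sigma> > 0" "\<tau> > 0" and close: "\<And>u1 u2 v1 v2. u1 \<in> H1 \<Longrightarrow> u2 \<in> H1 \<Longrightarrow> v1 \<in> H1 \<Longrightarrow> v2 \<in> H1 \<Longrightarrow>
        mass u1 = a1 \<Longrightarrow> mass u2 = a2 \<Longrightarrow> mass v1 = a1 \<Longrightarrow> mass v2 = a2 \<Longrightarrow>
        kinetic u1 + kinetic u2 \<le> K \<Longrightarrow> kinetic v1 + kinetic v2 \<le> K \<Longrightarrow> J u1 u2 \<le> m + \<tau> \<Longrightarrow> J v1 v2 \<le> m + \<tau> \<Longrightarrow>
        mass (\<lambda>x. u1 x - v1 x) + mass (\<lambda>x. u2 x - v2 x) \<le> \<sigma> \<Longrightarrow>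
        kinetic (\<lambda>x. u1 x - v1 x) + kinetic (\<lambda>x. u2 x - v2 x) \<le> e\<^sup>2 / 4"
        using almost_minimisers_close[OF K e2] by blast
      obtain N1 where N1: "\<And>n. n \<ge> N1 \<Longrightarrow> J (u n) (v n) \<le> m + \<tau>" using ev[of "m + \<tau>"] st by auto
      have "min (\<sigma> / 2) (e\<^sup>2 / 4) > 0" using st e2 by simp
      from small[OF this] obtain N2 where N2: "\<forall>i\<ge>N2. \<forall>j\<ge>N2. mass (\<lambda>x. U (r (s i)) x - U (r (s j)) x) < min (\<sigma> / 2) (e\<^sup>2 / 4) \<and>
         mass (\<lambda>x. V (r (s i)) x - V (r (s j)) x) < min (\<sigma> / 2) (e\<^sup>2 / 4)" ..
      have "H1_norm (\<lambda>x. U (r (s i)) x - U (r (s j)) x) < e \<and> H1_norm (\<lambda>x. V (r (s i)) x - V (r (s j)) x) < e"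
        if ij: "i \<ge> max N1 N2" "j \<ge> max N1 N2" for i j
      proof -
        let ?DU = "\<lambda>x. U (r (s i)) x - U (r (s j)) x" and ?DV = "\<lambda>x. V (r (s i)) x - V (r (s j)) x"
        have ms: "mass ?DU < \<sigma> / 2" "mass ?DU < e\<^sup>2 / 4" "mass ?DV < \<sigma> / 2" "mass ?DV < e\<^sup>2 / 4"
          using N2[rule_format, of i j] ij by auto
        have "J (U (r (s i))) (V (r (s i))) \<le> m + \<tau>" "J (U (r (s j))) (V (r (s j))) \<le> m + \<tau>"
          unfolding UV(6) using N1 seq_suble[OF rs2, of i] seq_suble[OF rs2, of j] ij by (auto intro: order_trans)
        then have "kinetic ?DU + kinetic ?DV \<le> e\<^sup>2 / 4"
          using ms by (intro close UV) auto
        then have kk: "kinetic ?DU \<le> e\<^sup>2 / 4" "kinetic ?DV \<le> e\<^sup>2 / 4" using kinetic_nonneg[of ?DU] kinetic_nonneg[of ?DV] by argo+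
        have "e\<^sup>2 > 0" using e by simp
        then have "kinetic ?DU + mass ?DU < e\<^sup>2" "kinetic ?DV + mass ?DV < e\<^sup>2" using ms kk by argo+
        then show ?thesis
          unfolding H1_norm_eq[OF H1_diff[OF UV(1) UV(1)]] H1_norm_eq[OF H1_diff[OF UV(2) UV(2)]]
          using e by (auto intro!: real_less_lsqrt)
      qed
      then show "\<exists>N. \<forall>i\<ge>N. \<forall>j\<ge>N. H1_norm (\<lambda>x. U (r (s i)) x - U (r (s j)) x) < e \<and> H1_norm (\<lambda>x. V (r (s i)) x - V (r (s j)) x) < e"
        by blast
    qed
  qed
  show ?thesis by (intro exI[of _ c] allI impI) (rule main[unfolded U_def V_def])
qed

end

section \<open>The topology of \<open>H1\<close> through a metric on representatives\<close>

text \<open>The value 0 off \<open>H1\<close> makes nonnegativity and symmetry hold for all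
  arguments, as the locale \<open>Metric_space\<close> demands.\<close>

definition H1_dist :: "('a::euclidean_space \<Rightarrow> complex) \<Rightarrow> ('a \<Rightarrow> complex) \<Rightarrow> real" where
  "H1_dist u v = (if u \<in> H1 \<and> v \<in> H1 then H1_norm (\<lambda>x. u x - v x) else 0)"

lemma H1_norm_nonneg [simp]: "0 \<le> H1_norm u"
  unfolding H1_norm_def by (intro real_sqrt_ge_zero integral_nonneg_AE AE_I2) (simp add: grad_sq_def sum_nonneg)

lemma H1_dist_nonneg: "0 \<le> H1_dist u v"
  by (simp add: H1_dist_def)

lemma H1_dist_commute: "H1_dist u v = H1_dist v u"
proof (cases "u \<in> H1 \<and> v \<in> H1")
  case True
  have "kinetic (\<lambda>x. v x - u x) = kinetic (\<lambda>x. u x - v x)"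
    using kinetic_cmult[OF H1_diff, of u v "-1"] True by simp
  then show ?thesis using True mass_diff_commute[of u v] by (simp add: H1_dist_def H1_norm_eq H1_diff)
qed (auto simp: H1_dist_def)

lemma H1_dist_triangle:
  assumes "u \<in> H1" "v \<in> H1" "w \<in> H1"
  shows "H1_dist u w \<le> H1_dist u v + H1_dist v w"
  using H1_norm_triangle[OF H1_diff[OF assms(1,2)] H1_diff[OF assms(2,3)]] assms by (simp add: H1_dist_def)

lemma H1_dist_self: "H1_dist u u = 0"
proof (cases "u \<in> H1")
  case True
  then have "(\<lambda>x. 0) \<in> (H1 :: ('a \<Rightarrow> complex) set)" using H1_cmult[of u 0] by simp
  moreover have "kinetic (\<lambda>x::'a. 0) = 0" using kinetic_cmult[OF True, of 0] by simp
  ultimately show ?thesis using True by (simp add: H1_dist_def H1_norm_eq mass_def)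
qed (simp add: H1_dist_def)

text \<open>The predicate under \<open>SOME\<close> depends only on the class of \<open>u\<close> at
  distance 0, so equivalent functions receive the same representative.\<close>

definition H1_rep :: "('a::euclidean_space \<Rightarrow> complex) \<Rightarrow> 'a \<Rightarrow> complex" where
  "H1_rep u = (SOME v. v \<in> H1 \<and> H1_dist u v = 0)"

lemma H1_rep:
  assumes "u \<in> H1" shows "H1_rep u \<in> H1" "H1_dist u (H1_rep u) = 0"
proof -
  have "\<exists>v. v \<in> H1 \<and> H1_dist u v = 0" using assms H1_dist_self by blast
  from someI_ex[OF this] show "H1_rep u \<in> H1" "H1_dist u (H1_rep u) = 0" by (auto simp: H1_rep_def)
qed

lemma H1_dist_cong:
  assumes "u \<in> H1" "v \<in> H1" "w \<in> H1" "H1_dist u v = 0"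
  shows "H1_dist u w = H1_dist v w"
  using H1_dist_triangle[OF assms(1,2,3)] H1_dist_triangle[OF assms(2,1,3)] H1_dist_commute[of u v] assms(4) by linarith

lemma H1_rep_eq:
  assumes "u \<in> H1" "v \<in> H1" "H1_dist u v = 0" shows "H1_rep u = H1_rep v"
  unfolding H1_rep_def using H1_dist_cong[OF assms(1,2) _ assms(3)] by metis

lemma H1_dist_rep:
  assumes "u \<in> H1" "v \<in> H1" shows "H1_dist (H1_rep u) (H1_rep v) = H1_dist u v"
  using H1_dist_cong[OF assms(1) H1_rep(1)[OF assms(1)] H1_rep(1)[OF assms(2)] H1_rep(2)[OF assms(1)]]
    H1_dist_cong[OF assms(2) H1_rep(1)[OF assms(2)] assms(1) H1_rep(2)[OF assms(2)]]
    H1_dist_commute[of u "H1_rep v"] H1_dist_commute[of u v] H1_dist_commute[of "H1_rep v" u] by argo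

interpretation H1_metric: Metric_space "H1_rep ` (H1 :: ('a::euclidean_space \<Rightarrow> complex) set)" H1_dist
proof
  show "0 \<le> H1_dist u v" for u v :: "'a \<Rightarrow> complex" by (rule H1_dist_nonneg)
  show "H1_dist u v = H1_dist v u" for u v :: "'a \<Rightarrow> complex" by (rule H1_dist_commute)
  fix u v :: "'a \<Rightarrow> complex" assume "u \<in> H1_rep ` H1" "v \<in> H1_rep ` H1"
  then obtain u' v' where uv: "u' \<in> H1" "v' \<in> H1" "u = H1_rep u'" "v = H1_rep v'" by blast
  show "(H1_dist u v = 0) = (u = v)"
    using H1_dist_self H1_rep_eq[OF uv(1,2)] H1_dist_rep[OF uv(1,2)] uv(3,4) by metis
next
  fix u v w :: "'a \<Rightarrow> complex" assume "u \<in> H1_rep ` H1" "v \<in> H1_rep ` H1" "w \<in> H1_rep ` H1"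
  then show "H1_dist u w \<le> H1_dist u v + H1_dist v w"
    using H1_rep(1) by (intro H1_dist_triangle) auto
qed

text \<open>The limit obtained in \<open>H1\<close> need not be a chosen representative; replacing
  it by its representative moves it by distance 0.\<close>

lemma H1_metric_mcomplete: "H1_metric.mcomplete TYPE('a::euclidean_space)"
  unfolding H1_metric.mcomplete_def
proof (intro allI impI)
  fix f :: "nat \<Rightarrow> 'a \<Rightarrow> complex" assume f: "H1_metric.MCauchy f"
  have fr: "f n \<in> H1_rep ` H1" for n
    using conjunct1[OF f[unfolded H1_metric.MCauchy_def]] by (rule subsetD) simp
  have H1: "f n \<in> H1" for n using fr[of n] by (auto simp: H1_rep(1))
  have "\<exists>N. \<forall>m\<ge>N. \<forall>n\<ge>N. H1_norm (\<lambda>x. f m x - f n x) < e" if pos: "e > 0" for e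
  proof -
    obtain N where N: "\<And>m n. N \<le> m \<Longrightarrow> N \<le> n \<Longrightarrow> H1_dist (f m) (f n) < e"
      using conjunct2[OF f[unfolded H1_metric.MCauchy_def], rule_format, OF pos] by metis
    have "H1_norm (\<lambda>x. f m x - f n x) < e" if "m \<ge> N" "n \<ge> N" for m n
      using N[OF that] by (simp add: H1_dist_def H1)
    then show ?thesis by metis
  qed
  then obtain g where g: "g \<in> H1" "(\<lambda>n. H1_norm (\<lambda>x. f n x - g x)) \<longlonglongrightarrow> 0"
    using H1_complete[of f, OF H1] by blast
  show "\<exists>x. limitin H1_metric.mtopology f x sequentially"
    unfolding H1_metric.limit_metric_sequentially
  proof (intro exI[of _ "H1_rep g"] conjI allI impI)
    show "H1_rep g \<in> H1_rep ` H1" using g by blast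
    fix e :: real assume "e > 0"
    then obtain N where N: "\<And>n. n \<ge> N \<Longrightarrow> H1_norm (\<lambda>x. f n x - g x) < e"
      using LIMSEQ_D[OF g(2)] by auto
    show "\<exists>N. \<forall>n\<ge>N. f n \<in> H1_rep ` H1 \<and> H1_dist (f n) (H1_rep g) < e"
    proof (intro exI[of _ N] allI impI conjI)
      fix n assume "n \<ge> N"
      show "f n \<in> H1_rep ` H1" by (rule fr)
      have "H1_dist (f n) (H1_rep g) = H1_dist g (f n)"
        using H1_dist_cong[OF g(1) H1_rep(1)[OF g(1)] H1 H1_rep(2)[OF g(1)], of n] H1_dist_commute[of "f n" "H1_rep g"] by argo
      then show "H1_dist (f n) (H1_rep g) < e"
        unfolding H1_dist_commute[of g "f n"] using N[OF \<open>n \<ge> N\<close>] g(1) H1[of n] by (simp add: H1_dist_def)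
    qed
  qed
qed

lemma openin_H1_topology_dist:
  "openin H1_topology W \<longleftrightarrow> W \<subseteq> H1 \<and> (\<forall>u\<in>W. \<exists>e>0. \<forall>v\<in>H1. H1_dist u v < e \<longrightarrow> v \<in> W)"
proof -
  have "H1_norm (\<lambda>x. v x - u x) = H1_dist u v" if "u \<in> H1" "v \<in> H1" for u v :: "'a \<Rightarrow> complex"
    unfolding H1_dist_commute[of u v] using that by (simp add: H1_dist_def)
  then show ?thesis unfolding openin_H1_topology by (metis subsetD)
qed

text \<open>
  The topology \<^const>\<open>H1_topology\<close> comes from a pseudometric; one representative of each
  class of functions at distance 0 gives a complete metric space, in which sequential
  compactness can be used.
\<close>

lemma relatively_compact_H1:
  assumes A: "A \<subseteq> H1"
    and seq: "\<And>f :: nat \<Rightarrow> 'a::euclidean_space \<Rightarrow> complex. range f \<subseteq> A \<Longrightarrow> \<exists>r::nat \<Rightarrow> nat. strict_mono r \<and>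
       (\<forall>e>0. \<exists>N. \<forall>i\<ge>N. \<forall>j\<ge>N. H1_norm (\<lambda>x. f (r i) x - f (r j) x) < e)"
  shows "relatively_compact_in H1_topology A"
proof -
  let ?M = "H1_rep ` (H1 :: ('a \<Rightarrow> complex) set)"
  have "H1_metric.mtotally_bounded (H1_rep ` A)"
    unfolding H1_metric.mtotally_bounded_sequentially
  proof (intro conjI allI impI)
    show "H1_rep ` A \<subseteq> ?M" using A by blast
    fix g :: "nat \<Rightarrow> 'a \<Rightarrow> complex" assume g: "range g \<subseteq> H1_rep ` A"
    then have "\<forall>n. \<exists>f. f \<in> A \<and> g n = H1_rep f" by blast
    then obtain f where f: "\<And>n. f n \<in> A" "\<And>n. g n = H1_rep (f n)" by metis
    then have "range f \<subseteq> A" by (intro image_subsetI)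
    from seq[OF this] obtain r :: "nat \<Rightarrow> nat" where r: "strict_mono r" "\<forall>e>0. \<exists>N. \<forall>i\<ge>N. \<forall>j\<ge>N. H1_norm (\<lambda>x. f (r i) x - f (r j) x) < e"
      by blast
    have fH: "f n \<in> H1" for n using f(1) A by blast
    have "H1_metric.MCauchy (g \<circ> r)"
      unfolding H1_metric.MCauchy_def
    proof (intro conjI allI impI)
      show "range (g \<circ> r) \<subseteq> ?M" using f(2) fH by auto
      fix e :: real assume "e > 0"
      then show "\<exists>N. \<forall>n n'. N \<le> n \<longrightarrow> N \<le> n' \<longrightarrow> H1_dist ((g \<circ> r) n) ((g \<circ> r) n') < e"
        using r(2)[rule_format, of e] by (simp add: f(2) H1_dist_rep fH) (simp add: H1_dist_def fH)
    qed
    then show "\<exists>r. strict_mono r \<and> H1_metric.MCauchy (g \<circ> r)" using r(1) by blast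
  qed
  then have comp: "compactin H1_metric.mtopology (H1_metric.mtopology closure_of (H1_rep ` A))"
    using H1_metric.mtotally_bounded_eq_compact_closure_of[OF H1_metric_mcomplete] by blast
  define C where "C = H1_metric.mtopology closure_of (H1_rep ` A)"
  have CM: "C \<subseteq> ?M" unfolding C_def using closure_of_subset_topspace[of H1_metric.mtopology] by simp
  \<comment> \<open>The union of all classes whose representative lies in \<open>C\<close>; it turns
    out to be compact, closed and to contain \<open>A\<close>.\<close>
  define C' where "C' = {u \<in> H1. H1_rep u \<in> C}"
  \<comment> \<open>Open sets of a pseudometric topology are unions of classes, so covers can be
    moved back and forth between \<open>C'\<close> and \<open>C\<close>.\<close>
  have sat: "H1_rep u \<in> W \<longleftrightarrow> u \<in> W" if "openin H1_topology W" "u \<in> H1" for W u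
    using that H1_rep[OF that(2)] H1_dist_commute[of u "H1_rep u"] unfolding openin_H1_topology_dist by (metis)
  have open_M: "openin H1_metric.mtopology (W \<inter> ?M)" if W: "openin H1_topology W" for W
    unfolding H1_metric.openin_mtopology
  proof (intro conjI allI impI)
    fix x assume x: "x \<in> W \<inter> ?M"
    then obtain e where e: "e > 0" "\<forall>v\<in>H1. H1_dist x v < e \<longrightarrow> v \<in> W" using W unfolding openin_H1_topology_dist by blast
    have "H1_metric.mball x e \<subseteq> W \<inter> ?M"
    proof
      fix z assume "z \<in> H1_metric.mball x e"
      then have z: "z \<in> ?M" "H1_dist x z < e" by (auto simp: H1_metric.in_mball)
      then have "z \<in> H1" using H1_rep(1) by blast
      then show "z \<in> W \<inter> ?M" using z e(2) by blast
    qed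
    then show "\<exists>r>0. H1_metric.mball x r \<subseteq> W \<inter> ?M" using e(1) by blast
  qed simp
  have compC': "compactin H1_topology C'"
    unfolding compactin_def topspace_H1_topology
  proof (intro conjI allI impI)
    show "C' \<subseteq> H1" by (auto simp: C'_def)
    fix \<U> assume U: "Ball \<U> (openin H1_topology) \<and> C' \<subseteq> \<Union>\<U>"
    have "C \<subseteq> \<Union>((\<lambda>W. W \<inter> ?M) ` \<U>)"
    proof
      fix x assume x: "x \<in> C"
      then obtain u where u: "u \<in> H1" "x = H1_rep u" using CM by blast
      then have "u \<in> C'" using x by (simp add: C'_def)
      then obtain W where "W \<in> \<U>" "u \<in> W" using U by blast
      then show "x \<in> \<Union>((\<lambda>W. W \<inter> ?M) ` \<U>)" using sat[of W u] U u by auto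
    qed
    moreover have "\<And>V. V \<in> (\<lambda>W. W \<inter> ?M) ` \<U> \<Longrightarrow> openin H1_metric.mtopology V" using U open_M by blast
    ultimately obtain \<F> where F: "finite \<F>" "\<F> \<subseteq> (\<lambda>W. W \<inter> ?M) ` \<U>" "C \<subseteq> \<Union>\<F>"
      using comp unfolding compactin_def C_def[symmetric] by (metis (no_types, lifting))
    then obtain \<G> where G: "finite \<G>" "\<G> \<subseteq> \<U>" "\<F> = (\<lambda>W. W \<inter> ?M) ` \<G>" by (meson finite_subset_image)
    have "C' \<subseteq> \<Union>\<G>"
    proof
      fix u assume u: "u \<in> C'"
      then have "H1_rep u \<in> C" "u \<in> H1" by (auto simp: C'_def)
      then obtain W where "W \<in> \<G>" "H1_rep u \<in> W" using F(3) G(3) by blast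
      then show "u \<in> \<Union>\<G>" using sat[of W u] U G(2) \<open>u \<in> H1\<close> by blast
    qed
    then show "\<exists>\<F>. finite \<F> \<and> \<F> \<subseteq> \<U> \<and> C' \<subseteq> \<Union>\<F>" using G by blast
  qed
  have closed: "closedin H1_topology C'"
    unfolding closedin_def topspace_H1_topology openin_H1_topology_dist
  proof (intro conjI ballI)
    fix u assume u: "u \<in> H1 - C'"
    then have x: "H1_rep u \<in> ?M - C" by (auto simp: C'_def)
    have "openin H1_metric.mtopology (?M - C)"
      using closedin_closure_of[of H1_metric.mtopology "H1_rep ` A"] unfolding C_def closedin_def by simp
    then obtain e where e: "e > 0" "H1_metric.mball (H1_rep u) e \<subseteq> ?M - C"
      using x unfolding H1_metric.openin_mtopology by blast
    have "v \<in> H1 - C'" if "v \<in> H1" "H1_dist u v < e" for v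
    proof -
      have "H1_dist (H1_rep u) (H1_rep v) < e" using H1_dist_rep[of u v] that u by simp
      then have "H1_rep v \<in> H1_metric.mball (H1_rep u) e" using that(1) u by (simp add: H1_metric.in_mball)
      from subsetD[OF e(2) this] show ?thesis using that(1) by (simp add: C'_def)
    qed
    then show "\<exists>e>0. \<forall>v\<in>H1. H1_dist u v < e \<longrightarrow> v \<in> H1 - C'" using e(1) by blast
  qed (auto simp: C'_def)
  have "A \<subseteq> C'"
    using A closure_of_subset[of "H1_rep ` A" H1_metric.mtopology] by (auto simp: C'_def C_def)
  then have "H1_topology closure_of A \<subseteq> C'" by (rule closure_of_minimal[OF _ closed])
  then have "compactin H1_topology (H1_topology closure_of A)"
    using closed_compactin[OF compC'] closedin_closure_of by blast
  then show ?thesis using A by (simp add: relatively_compact_in_def topspace_H1_topology)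
qed

section \<open>From sequences to ranges and products\<close>

text \<open>A sequence taken from the range of another may repeat indices or visit them out of
  order. With finitely many indices one recurs infinitely often; otherwise indices beyond every
  bound occur arbitrarily late and can be chosen recursively.\<close>

lemma nat_sequence_constant_or_increasing:
  fixes j :: "nat \<Rightarrow> nat"
  obtains r :: "nat \<Rightarrow> nat" where "strict_mono r" "(\<exists>c. \<forall>n. j (r n) = c) \<or> strict_mono (\<lambda>n. j (r n))"
proof (cases "finite (range j)")
  case True
  then obtain c where "infinite {n. j n = c}"
    using pigeonhole_infinite[of UNIV j] by auto
  then show ?thesis
    using that[of "enumerate {n. j n = c}"] enumerate_in_set[of "{n. j n = c}"] strict_mono_enumerate by blast
next
  case False
  have big: "\<exists>n>N. j n > b" for N b
  proof (rule ccontr)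
    assume "\<not> ?thesis"
    then have "range j \<subseteq> j ` {..N} \<union> {..b}" by (auto simp: not_less)
    then show False using False finite_subset by blast
  qed
  have "\<exists>r. \<forall>n. r n < r (Suc n) \<and> j (r n) < j (r (Suc n))"
    using dependent_nat_choice[of "\<lambda>n x. True" "\<lambda>n x y. x < y \<and> j x < j y"] big by auto
  then obtain r where "\<forall>n. r n < r (Suc n) \<and> j (r n) < j (r (Suc n))" ..
  then show ?thesis using that[of r] by (auto simp: strict_mono_Suc_iff)
qed

lemma relatively_compact_range_H1:
  fixes u :: "nat \<Rightarrow> 'a::euclidean_space \<Rightarrow> complex"
  assumes H1: "\<And>n. u n \<in> H1"
    and seq: "\<And>r. strict_mono r \<Longrightarrow> \<exists>s::nat \<Rightarrow> nat. strict_mono s \<and>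
       (\<forall>e>0. \<exists>N. \<forall>i\<ge>N. \<forall>j\<ge>N. H1_norm (\<lambda>x. u (r (s i)) x - u (r (s j)) x) < e)"
  shows "relatively_compact_in H1_topology (range u)"
proof (rule relatively_compact_H1)
  show "range u \<subseteq> H1" using H1 by blast
  fix f :: "nat \<Rightarrow> 'a \<Rightarrow> complex" assume "range f \<subseteq> range u"
  then have "\<forall>n. \<exists>j. f n = u j" by blast
  then obtain j where j: "\<And>n. f n = u (j n)" by metis
  obtain r :: "nat \<Rightarrow> nat" where r: "strict_mono r" "(\<exists>c. \<forall>n. j (r n) = c) \<or> strict_mono (\<lambda>n. j (r n))"
    by (rule nat_sequence_constant_or_increasing)
  from r(2) show "\<exists>r::nat \<Rightarrow> nat. strict_mono r \<and> (\<forall>e>0. \<exists>N. \<forall>i\<ge>N. \<forall>j\<ge>N. H1_norm (\<lambda>x. f (r i) x - f (r j) x) < e)"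
  proof
    assume "\<exists>c. \<forall>n. j (r n) = c"
    then obtain c where c: "\<And>n. j (r n) = c" by blast
    have "H1_norm (\<lambda>x. u c x - u c x) = 0" using H1_dist_self[of "u c"] H1 by (simp add: H1_dist_def)
    then show ?thesis using r(1) by (intro exI[of _ r]) (simp add: j c)
  next
    assume "strict_mono (\<lambda>n. j (r n))"
    from seq[OF this] obtain s :: "nat \<Rightarrow> nat" where s: "strict_mono s"
      "\<forall>e>0. \<exists>N. \<forall>i\<ge>N. \<forall>k\<ge>N. H1_norm (\<lambda>x. u (j (r (s i))) x - u (j (r (s k))) x) < e" by blast
    then show ?thesis using strict_mono_o[OF r(1) s(1)] by (intro exI[of _ "r \<circ> s"]) (simp add: j)
  qed
qed

text \<open>The closure is a closed subset of the product of the closures of the two projections,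
  and that product is compact.\<close>

lemma relatively_compact_in_prod:
  assumes "relatively_compact_in X (fst ` A)" "relatively_compact_in Y (snd ` A)"
  shows "relatively_compact_in (prod_topology X Y) A"
proof -
  have A: "A \<subseteq> fst ` A \<times> snd ` A" by force
  have "prod_topology X Y closure_of A \<subseteq> (X closure_of (fst ` A)) \<times> (Y closure_of (snd ` A))"
    using closure_of_mono[OF A, of "prod_topology X Y"] by (simp add: closure_of_Times)
  moreover have "compactin (prod_topology X Y) ((X closure_of (fst ` A)) \<times> (Y closure_of (snd ` A)))"
    using assms by (simp add: compactin_Times relatively_compact_in_def)
  ultimately have "compactin (prod_topology X Y) (prod_topology X Y closure_of A)"
    by (meson closed_compactin closedin_closure_of)
  moreover have "A \<subseteq> topspace (prod_topology X Y)" using assms A by (auto simp: relatively_compact_in_def)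
  ultimately show ?thesis by (simp add: relatively_compact_in_def)
qed

theorem theorem1p1:
  fixes \<mu>1 \<mu>2 p1 p2 r1 r2 \<beta> a1 a2 :: real
    and u1 u2 :: "nat \<Rightarrow> 'a::euclidean_space \<Rightarrow> complex"
  assumes "\<beta> > 0" and "\<mu>1 > 0" and "\<mu>2 > 0" and "r1 > 1" and "r2 > 1"
    and "2 < p1" and "p1 < 2 + 4 / real DIM('a)"
    and "2 < p2" and "p2 < 2 + 4 / real DIM('a)"
    and "r1 + r2 < 2 + 4 / real DIM('a)"
    and "a1 > 0" and "a2 > 0"
    and "\<And>n. (u1 n, u2 n) \<in> mass_constraint a1 a2"
    and "(\<lambda>n. ereal (energy \<mu>1 \<mu>2 p1 p2 r1 r2 \<beta> (u1 n) (u2 n)))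
           \<longlonglongrightarrow> min_energy TYPE('a) \<mu>1 \<mu>2 p1 p2 r1 r2 \<beta> a1 a2"
  shows "\<exists>y :: nat \<Rightarrow> 'a. relatively_compact_in (prod_topology H1_topology H1_topology)
           (range (\<lambda>n. (\<lambda>x. u1 n (x - y n), \<lambda>x. u2 n (x - y n))))"
proof -
  interpret sys: nls_system "TYPE('a)" \<mu>1 \<mu>2 p1 p2 r1 r2 \<beta>
    by unfold_locales (use assms in auto)
  let ?I = "min_energy TYPE('a) \<mu>1 \<mu>2 p1 p2 r1 r2 \<beta> a1 a2"
  have H1: "u1 n \<in> H1" "u2 n \<in> H1" "mass (u1 n) = a1" "mass (u2 n) = a2" for n
    using assms(13)[of n] by (auto simp: mass_constraint_def L2_norm_sq)
  have le: "?I \<le> ereal (sys.J u v)" if "u \<in> H1" "v \<in> H1" "mass u = a1" "mass v = a2" for u v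
  proof -
    have "(u, v) \<in> mass_constraint a1 a2" using that by (simp add: mass_constraint_def L2_norm_sq)
    then show ?thesis unfolding min_energy_def using INF_lower[of "(u, v)" "mass_constraint a1 a2" "\<lambda>(u1, u2). ereal (energy \<mu>1 \<mu>2 p1 p2 r1 r2 \<beta> u1 u2)"]
      sys.energy_eq_J[OF that(1,2)] by simp
  qed
  have s: "a1 + a2 > 0" using assms by simp
  obtain C where C: "\<And>u v. u \<in> H1 \<Longrightarrow> v \<in> H1 \<Longrightarrow> mass u = a1 \<Longrightarrow> mass v = a2 \<Longrightarrow> kinetic u + kinetic v \<le> 4 * sys.J u v + C"
    using sys.kinetic_coercive[OF s] by blast
  have C: "- (C / 4) \<le> sys.J u v" if "u \<in> H1" "v \<in> H1" "mass u = a1" "mass v = a2" for u v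
    using C[OF that] kinetic_nonneg[of u] kinetic_nonneg[of v] by argo
  \<comment> \<open>Coercivity bounds the extended real infimum from below and a member of the
    sequence bounds it from above, so it is a real number and \<open>nls_min\<close> can be
    instantiated.\<close>
  have "ereal (- (C / 4)) \<le> ?I"
    unfolding min_energy_def
    by (rule INF_greatest) (use C in \<open>auto simp: mass_constraint_def L2_norm_sq sys.energy_eq_J\<close>)
  moreover have "?I \<le> ereal (sys.J (u1 0) (u2 0))" by (rule le[OF H1])
  ultimately obtain m where m: "?I = ereal m" by (cases ?I) auto
  interpret nls_min "TYPE('a)" \<mu>1 \<mu>2 p1 p2 r1 r2 \<beta> a1 a2 m
    by unfold_locales (use assms le m in auto)
  have "(\<lambda>n. ereal (sys.J (u1 n) (u2 n))) \<longlonglongrightarrow> ereal m"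
    using assms(14) by (simp add: m sys.energy_eq_J H1)
  then have "(\<lambda>n. sys.J (u1 n) (u2 n)) \<longlonglongrightarrow> m" by simp
  from precompact_up_to_translation[OF H1 this]
  obtain c where c: "\<And>r::nat \<Rightarrow> nat. strict_mono r \<Longrightarrow> (\<exists>s::nat \<Rightarrow> nat. strict_mono s \<and>
    (\<forall>e>0. \<exists>N. \<forall>i\<ge>N. \<forall>j\<ge>N.
      H1_norm (\<lambda>x. u1 (r (s i)) (x + c (r (s i))) - u1 (r (s j)) (x + c (r (s j)))) < e \<and>
      H1_norm (\<lambda>x. u2 (r (s i)) (x + c (r (s i))) - u2 (r (s j)) (x + c (r (s j)))) < e))" by blast
  have "relatively_compact_in H1_topology (range (\<lambda>n x. u1 n (x + c n)))"
    by (rule relatively_compact_range_H1[OF H1_shift[OF H1(1)]]) (use c in meson)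
  moreover have "relatively_compact_in H1_topology (range (\<lambda>n x. u2 n (x + c n)))"
    by (rule relatively_compact_range_H1[OF H1_shift[OF H1(2)]]) (use c in meson)
  ultimately have "relatively_compact_in (prod_topology H1_topology H1_topology) (range (\<lambda>n. (\<lambda>x. u1 n (x + c n), \<lambda>x. u2 n (x + c n))))"
    by (intro relatively_compact_in_prod) (simp_all add: image_image)
  \<comment> \<open>The centres \<open>c\<close> recentre by \<open>x + c n\<close>, whereas the
    claim translates by \<open>x - y n\<close>; hence the sign.\<close>
  then show ?thesis by (intro exI[of _ "\<lambda>n. - c n"]) simp
qed

end
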